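(* Let $F_1$ and $F_2$ be compact, connected, oriented surfaces with $\partial F_1=-\partial F_2=S^1$, equipped with handle decompositions encoded by matched intervals $\mathcal Z_1=(Z_1,\mathbf a_1,M_1)$ and $\mathcal Z_2=(Z_2,\mathbf a_2,M_2)$ (so $F_i=F(\mathcal Z_i)$). Glue them to form the closed surface $F=F_1\cup F_2$, encoded by the pointed matched circle $\mathcal Z=\mathcal Z_1\cup\mathcal Z_2$. Then the matching algebra of $F$ is recovered as a tensor product over the nilCoxeter sequential 2-algebra: there is an isomorphism of differential algebras $$\mathcal A(F)\;\cong\;\mathcal T(F_1)\odot_{\mathfrak N}\mathcal B(F_2),$$ where $\mathcal A(F)=\mathcal A(\mathcal Z)$, $\mathcal T(F_1)=\mathcal T(\mathcal Z_1)$, $\mathcal B(F_2)=\mathcal B(\mathcal Z_2)$.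
   Context: $\mathbf k$ is a field of characteristic $2$; $[n]=\{1,\dots,n\}$. **NilCoxeter sequential 2-algebra $\mathfrak N$.** For $m\ge 0$, $\mathfrak N_m$ is the unital $\mathbf k$-algebra generated by $\sigma_1,\dots,\sigma_{m-1}$ with relations $\sigma_i^2=0$, $\sigma_i\sigma_j=\sigma_j\sigma_i$ for $|i-j|>1$, $\sigma_i\sigma_{i+1}\sigma_i=\sigma_{i+1}\sigma_i\sigma_{i+1}$, with product denoted $\cdot$. It has a $\mathbf k$-basis $\{\sigma_w: w\in S_m\}$ with $\sigma_w\cdot\sigma_{w'}=\sigma_{ww'}$ if $\ell(ww')=\ell(w)+\ell(w')$ and $0$ otherwise; here permutations are composed left to right, $(ww')(i)=w'(w(i))$, and $\ell$ is the number of inversions. The differential is determined by $\partial\sigma_i=1$ and the Leibniz rule. A second product $*:\mathfrak N_m\otimes\mathfrak N_n\to\mathfrak N_{m+n}$ is given by $\sigma_i*\sigma_j=\sigma_i\sigma_{m+j}$. **Strands algebra $\mathcal A(N)$.** Its $\mathbf k$-basis consists of bijections $f:S\to T$ with $S,T\subseteq[N]$ and $f(i)\ge i$ for all $i$. Let $\mathrm{inv}(f)$ be the number of inversions. The product is $f*g=g\circ f$ if the target of $f$ equals the source of $g$ and $\mathrm{inv}(g\circ f)=\mathrm{inv}(f)+\mathrm{inv}(g)$, and $0$ otherwise. The differential is $\partial f=\sum f'$ over all $f'$ obtained from $f$ by exchanging the two values at an inverted pair such that $\mathrm{inv}(f')=\mathrm{inv}(f)-1$. **Top strands algebra-module $\mathcal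 T(N)=\{\mathcal T(N)_m\}_{m\ge0}$.** $\mathcal T(N)_m$ has $\mathbf k$-basis the bijections $f:S\to T\sqcup\{t_1,\dots,t_m\}$, $S,T\subseteq[N]$, with $f(i)\ge i$ whenever $f(i)\in T$ ($t_1,\dots,t_m$ are points where strands leave at the top, listed left to right). Inversions are counted with the target ordered by: elements of $T$ in the usual order, all less than $t_m<t_{m-1}<\dots<t_1$. The differential is as for $\mathcal A(N)$. Vertical right action of $\mathfrak N_m$: $f\cdot\sigma_w$ is $f$ followed by $t_p\mapsto t_{w(p)}$ if the inversion number increases by exactly $\ell(w)$, and $0$ otherwise. Horizontal product $\mathcal T(N)_m\otimes\mathcal T(N)_n\to\mathcal T(N)_{m+n}$: for $f:S\to T\sqcup\{t_1,\dots,t_m\}$ and $g:T'\to U\sqcup\{t_1,\dots,t_n\}$, $f*g=0$ unless $T=T'$; if $T=T'$ let $h:S\to U\sqcup\{t_1,\dots,t_{m+n}\}$ be $h(s)=t_p$ if $f(s)=t_p$, $h(s)=g(f(s))$ if this lies in $U$, and $h(s)=t_{m+q}$ if $g(f(s))=t_q$; then $f*g=h$ if $\mathrm{inv}(h)=\mathrm{inv}(f)+\mathrm{inv}(g)$ and $0$ otherwise. **Bottom strands algebra-module $\mathcal B(N)=\{\mathcal B(N)_m\}_{m\ge0}$.** $\mathcal B(N)_m$ has $\mathbf k$-basis the bijections $g:S\sqcup\{b_1,\dots,b_m\}\to T$, $S,T\subseteq[N]$, with $g(i)\ge i$ for $i\in S$. Inversions are counted with the source ordered by $b_m<\dots<b_1$,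 all less than the elements of $S$. The differential is $\partial g=\sum g'$ over all $g'$ obtained from $g$ by exchanging the two values at an inverted pair such that $\mathrm{inv}(g')=\mathrm{inv}(g)-1$. Vertical left action of $\mathfrak N_m$: $\sigma_w\cdot g$ is $b_p\mapsto g(b_{w(p)})$, unchanged on $S$, if the inversion number increases by exactly $\ell(w)$, and $0$ otherwise. Horizontal product: for $g:S\sqcup\{b_1,\dots,b_m\}\to T$ and $h:T'\sqcup\{b_1,\dots,b_n\}\to U$, $g*h=0$ unless $T=T'$, in which case it is the map $s\mapsto h(g(s))$ ($s\in S$), $b_p\mapsto h(g(b_p))$ ($p\le m$), $b_{m+q}\mapsto h(b_q)$ if inversion numbers add, and $0$ otherwise. **Matched intervals and circles.** A matched interval $(Z,\mathbf a,M)$ is an oriented closed interval $Z$, $4k$ points $\mathbf a=\{a_1<\dots<a_{4k}\}$ in its interior (identified with $[4k]$ using the orientation), and a 2-to-1 map $M:\mathbf a\to[2k]$ such that surgery along the $2k$ matched pairs yields a single interval. Its surface $F(Z,\mathbf a,M)$ is the surgery cobordism from an interval to an interval, viewed as a surface with circle boundary. A matched circle is defined in the same way with an oriented circle in place of the interval, surgery being required to yield a single circle; its closed surface is the surgery cobordism capped off by two discs. A pointed matched circle has in addition a basepoint $z\in Z\setminus\mathbf a$; starting at $z$ and following the orientation identifies $\mathbf a$ with $[4k]$. Given matched intervals $\mathcal Z_1,\mathcal Z_2$ with $4k_1$ and $4k_2$ points, $\mathcal Z=\mathcal Z_1\cup\mathcal Z_2$ is the matched circle obtained by gluing them at their endpoints,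 where $Z_1$ is oriented from the basepoint $z$ to the other gluing point $w$ and $Z_2$ from $w$ to $z$; so $k=k_1+k_2$, and the points of $\mathcal Z_1$ precede those of $\mathcal Z_2$. **Matching algebra $\mathcal A(\mathcal Z)$.** A section over a set $h\subseteq[2k]$ of pairs is a set $S\subseteq[4k]$ mapped bijectively onto $h$ by $M$. $\mathcal A(\mathcal Z)\subseteq\mathcal A(4k)$ is the differential subalgebra with $\mathbf k$-basis the elements $\sum_S(\mathrm{id}_S\cup f_c: S\cup c\to S\cup f_c(c))$, the sum being over all sections $S$ over $h$. There is one such element for each choice of a subset $c\subseteq[4k]$, an injection $f_c:c\to[4k]$ with $f_c(i)>i$ for all $i\in c$, and $h\subseteq[2k]$, such that $M$ is injective on $c$ and on $f_c(c)$, and $h$ is disjoint from $M(c)$ and from $M(f_c(c))$. **Algebra-modules of matched intervals.** $\mathcal T(\mathcal Z_1)_m\subseteq\mathcal T(4k_1)_m$ has $\mathbf k$-basis the elements $\sum_S(\mathrm{id}_S\cup f_c)$, $S$ ranging over all sections (for $M_1$) over $h\subseteq[2k_1]$, where $f_c:c\to[4k_1]\sqcup\{t_1,\dots,t_m\}$ is injective with all $t_p$ in its image, $f_c(i)>i$ when $f_c(i)\in[4k_1]$, $M_1$ is injective on $c$ and on $f_c(c)\cap[4k_1]$, and $h$ is disjoint from $M_1(c)$ and $M_1(f_c(c)\cap[4k_1])$. $\mathcal B(\mathcal Z_2)_m\subseteq\mathcal B(4k_2)_m$ has $\mathbf k$-basis the elements $\sum_S(\mathrm{id}_S\cup g_c)$,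 $S$ ranging over all sections (for $M_2$) over $h\subseteq[2k_2]$, where $g_c:c\sqcup\{b_1,\dots,b_m\}\to[4k_2]$ is injective, $g_c(i)>i$ for $i\in c$, $M_2$ is injective on $c$ and on the image of $g_c$, and $h$ is disjoint from the $M_2$-images of both. The differentials, $*$-products and $\mathfrak N_m$-actions are restricted from $\mathcal T(4k_1)$ and $\mathcal B(4k_2)$. **Tensor product.** $\mathcal T\odot_{\mathfrak N}\mathcal B:=\prod_m\mathcal T_m\otimes_{\mathfrak N_m}\mathcal B_m$ with the tensor product differential and product $(\phi\odot\phi')*(\psi\odot\psi')=(\phi*\psi)\odot(\phi'*\psi')$ for $\phi\in\mathcal T_m$, $\psi\in\mathcal T_n$, $\phi'\in\mathcal B_m$, $\psi'\in\mathcal B_n$. *)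

theory Defs
  imports
    "HOL.Vector_Spaces"
    "HOL-Algebra.QuotRing"
    "HOL-Algebra.Module"
    "HOL-Combinatorics.Permutations"
    "HOL-Computational_Algebra.Primes"
    "HOL-Library.Function_Algebras"
    "HOL-Library.Set_Algebras"
begin

section \<open>Formal linear combinations\<close>

text \<open>
  The free vector space on \<^typ>\<open>'a\<close> is the space of finitely supported functions
  \<^typ>\<open>'a \<Rightarrow> 'k\<close>; every space below is a span of such functions.
\<close>

definition formal_scale :: "'k::field \<Rightarrow> ('a \<Rightarrow> 'k) \<Rightarrow> ('a \<Rightarrow> 'k)"  (infixr \<open>*\<^sub>k\<close> 75)
  where "c *\<^sub>k x = (\<lambda>a. c * x a)"

interpretation formal: vector_space formal_scale
  by standard (auto simp: formal_scale_def fun_eq_iff algebra_simps)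

definition single :: "'a \<Rightarrow> ('a \<Rightarrow> 'k::field)"
  where "single a = (\<lambda>b. if b = a then 1 else 0)"

definition linear_ext :: "('a \<Rightarrow> 'b \<Rightarrow> 'k::field) \<Rightarrow> ('a \<Rightarrow> 'k) \<Rightarrow> ('b \<Rightarrow> 'k)"
  where "linear_ext F x = (\<Sum>a | x a \<noteq> 0. x a *\<^sub>k F a)"

definition bilinear_ext ::
    "('a \<Rightarrow> 'b \<Rightarrow> 'c \<Rightarrow> 'k::field) \<Rightarrow> ('a \<Rightarrow> 'k) \<Rightarrow> ('b \<Rightarrow> 'k) \<Rightarrow> ('c \<Rightarrow> 'k)"
  where "bilinear_ext F x y = (\<Sum>a | x a \<noteq> 0. \<Sum>b | y b \<noteq> 0. (x a * y b) *\<^sub>k F a b)"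

section \<open>Differential algebras and algebra-modules\<close>

record ('k, 'v) dg_algebra = "('k, 'v) module" +
  differential :: "'v \<Rightarrow> 'v"

definition dg_isomorphic :: "('k, 'v) dg_algebra \<Rightarrow> ('k, 'w) dg_algebra \<Rightarrow> bool"
  where "dg_isomorphic A B \<longleftrightarrow>
    (\<exists>\<phi> \<in> ring_iso A B.
      (\<forall>c. \<forall>x \<in> carrier A. \<phi> (c \<odot>\<^bsub>A\<^esub> x) = c \<odot>\<^bsub>B\<^esub> \<phi> x) \<and>
      (\<forall>x \<in> carrier A. \<phi> (differential A x) = differential B (\<phi> x)))"

text \<open>
  The data of a (right or left) algebra-module over a sequence of algebras with elements in
  \<^typ>\<open>'r\<close>: \<open>vact a x\<close> is \<open>x \<cdot> a\<close> for a right and \<open>a \<cdot> x\<close> for a left action, \<open>hmult m n\<close> is the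
  product of the components \<open>m\<close> and \<open>n\<close>, and \<open>hone\<close> is its unit, which lies in component \<open>0\<close>.
\<close>

record ('r, 'v) algebra_module =
  component :: "nat \<Rightarrow> 'v set"
  vact :: "'r \<Rightarrow> 'v \<Rightarrow> 'v"
  hmult :: "nat \<Rightarrow> nat \<Rightarrow> 'v \<Rightarrow> 'v \<Rightarrow> 'v"
  hone :: "'v"
  hdiff :: "'v \<Rightarrow> 'v"

section \<open>The tensor product over a sequence of algebras\<close>

text \<open>
  \<open>X \<otimes>\<^sub>R Y\<close> is the free vector space on \<open>X \<times> Y\<close> modulo the subspace spanned by the usual
  relations; its elements are the cosets \<open>u +o tensor_relations \<dots>\<close>.
\<close>

definition free_on_pairs ::
    "('a \<Rightarrow> 'k::field) set \<Rightarrow> ('b \<Rightarrow> 'k) set \<Rightarrow> (('a \<Rightarrow> 'k) \<times> ('b \<Rightarrow> 'k) \<Rightarrow> 'k) set"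
  where "free_on_pairs X Y = formal.span (single ` (X \<times> Y))"

definition tensor_relations ::
    "('a \<Rightarrow> 'k::field) set \<Rightarrow> 'r set \<Rightarrow> ('b \<Rightarrow> 'k) set \<Rightarrow>
     ('r \<Rightarrow> ('a \<Rightarrow> 'k) \<Rightarrow> ('a \<Rightarrow> 'k)) \<Rightarrow> ('r \<Rightarrow> ('b \<Rightarrow> 'k) \<Rightarrow> ('b \<Rightarrow> 'k)) \<Rightarrow>
     (('a \<Rightarrow> 'k) \<times> ('b \<Rightarrow> 'k) \<Rightarrow> 'k) set"
  where "tensor_relations X R Y ract lact = formal.span (
      {single (x + x', y) - single (x, y) - single (x', y) | x x' y. x \<in> X \<and> x' \<in> X \<and> y \<in> Y} \<union>
      {single (x, y + y') - single (x, y) - single (x, y') | x y y'. x \<in> X \<and> y \<in> Y \<and> y' \<in> Y} \<union>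
      {single (c *\<^sub>k x, y) - c *\<^sub>k single (x, y) | c x y. x \<in> X \<and> y \<in> Y} \<union>
      {single (x, c *\<^sub>k y) - c *\<^sub>k single (x, y) | c x y. x \<in> X \<and> y \<in> Y} \<union>
      {single (ract a x, y) - single (x, lact a y) | a x y. a \<in> R \<and> x \<in> X \<and> y \<in> Y})"

text \<open>
  \<open>tensor_product N T B\<close> is the product over all \<open>m\<close> of \<open>T\<^sub>m \<otimes>\<^bsub>N m\<^esub> B\<^sub>m\<close>, for right modules \<open>T\<^sub>m\<close> and
  left modules \<open>B\<^sub>m\<close>.  An element assigns a coset to each \<open>m\<close>, and sums of cosets are sums of sets.
  In the definition of the differential and the products, the image of a coset under a map of
  representatives is saturated by adding the subspace of relations.
  In characteristic \<open>2\<close> no sign occurs in the differential of \<open>x \<otimes> y\<close>.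
\<close>

definition tensor_product ::
    "(nat \<Rightarrow> ('k::field, 'r) module) \<Rightarrow>
     ('r, 'a \<Rightarrow> 'k) algebra_module \<Rightarrow> ('r, 'b \<Rightarrow> 'k) algebra_module \<Rightarrow>
     ('k, nat \<Rightarrow> (('a \<Rightarrow> 'k) \<times> ('b \<Rightarrow> 'k) \<Rightarrow> 'k) set) dg_algebra"
  where "tensor_product N T B = (
    let R = (\<lambda>m. tensor_relations (component T m) (carrier (N m)) (component B m) (vact T) (vact B));
        \<mu> = (\<lambda>m n. bilinear_ext
               (\<lambda>(x, y) (x', y'). single (hmult T m n x x', hmult B m n y y')));
        D = linear_ext (\<lambda>(x, y). single (hdiff T x, y) + single (x, hdiff B y))
    in \<lparr>carrier = {\<Phi>. \<forall>m. \<exists>u \<in> free_on_pairs (component T m) (component B m). \<Phi> m = u +o R m},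
        monoid.mult = (\<lambda>\<Phi> \<Psi> l. \<Sum>m\<le>l. {\<mu> m (l - m) u v | u v. u \<in> \<Phi> m \<and> v \<in> \<Psi> (l - m)} + R l),
        one = (\<lambda>m. if m = 0 then single (hone T, hone B) +o R m else R m),
        zero = R,
        add = (\<lambda>\<Phi> \<Psi> m. \<Phi> m + \<Psi> m),
        smult = (\<lambda>c \<Phi> m. (*\<^sub>k) c ` \<Phi> m + R m),
        differential = (\<lambda>\<Phi> m. D ` \<Phi> m + R m)\<rparr>)"

section \<open>The nilCoxeter algebras\<close>

definition perm_length :: "(nat \<Rightarrow> nat) \<Rightarrow> nat"
  where "perm_length w = card {(i, j). i < j \<and> w j < w i}"

text \<open>
  \<open>\<sigma>\<^sub>w\<close> is \<^term>\<open>single w\<close>.  Permutations are composed from left to right.  The tensor product only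
  uses the algebras of the sequential 2-algebra and their actions, not its differential or its
  horizontal product.
\<close>

definition nilcoxeter :: "nat \<Rightarrow> ('k::field, (nat \<Rightarrow> nat) \<Rightarrow> 'k) module"
  where "nilcoxeter m =
    \<lparr>carrier = formal.span (single ` {w. w permutes {1..m}}),
     monoid.mult = bilinear_ext (\<lambda>w w'.
       if perm_length (w' \<circ> w) = perm_length w + perm_length w' then single (w' \<circ> w) else 0),
     one = single id,
     zero = 0,
     add = (+),
     smult = (*\<^sub>k)\<rparr>"

section \<open>Strands\<close>

text \<open>
  A bijection between finite subsets of two linear orders is a partial map, injective on its
  domain; source and target are \<^const>\<open>dom\<close> and \<^const>\<open>ran\<close>.
\<close>

definition inversions :: "('a::linorder \<rightharpoonup> 'b::linorder) \<Rightarrow> ('a \<times> 'a) set"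
  where "inversions f = {(x, y). x \<in> dom f \<and> y \<in> dom f \<and> x < y \<and> the (f y) < the (f x)}"

definition inv_num :: "('a::linorder \<rightharpoonup> 'b::linorder) \<Rightarrow> nat"
  where "inv_num f = card (inversions f)"

definition exchange :: "('a \<rightharpoonup> 'b) \<Rightarrow> 'a \<times> 'a \<Rightarrow> ('a \<rightharpoonup> 'b)"
  where "exchange f = (\<lambda>(x, y). f(x := f y, y := f x))"

definition strand_diff ::
    "(('a::linorder \<rightharpoonup> 'b::linorder) \<Rightarrow> 'k::field) \<Rightarrow> (('a \<rightharpoonup> 'b) \<Rightarrow> 'k)"
  where "strand_diff = linear_ext (\<lambda>f.
    \<Sum>p | p \<in> inversions f \<and> inv_num f = inv_num (exchange f p) + 1. single (exchange f p))"

definition single_if_inv :: "('a::linorder \<rightharpoonup> 'b::linorder) \<Rightarrow> nat \<Rightarrow> ('a \<rightharpoonup> 'b) \<Rightarrow> 'k::field"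
  where "single_if_inv f n = (if inv_num f = n then single f else 0)"

definition strands :: "nat \<Rightarrow> (nat \<rightharpoonup> nat) set"
  where "strands N = {f. dom f \<subseteq> {1..N} \<and> ran f \<subseteq> {1..N} \<and> inj_on f (dom f) \<and>
    (\<forall>i j. f i = Some j \<longrightarrow> i \<le> j)}"

definition strands_algebra :: "nat \<Rightarrow> ('k::field, (nat \<rightharpoonup> nat) \<Rightarrow> 'k) dg_algebra"
  where "strands_algebra N =
    \<lparr>carrier = formal.span (single ` strands N),
     monoid.mult = bilinear_ext (\<lambda>f g.
       if ran f = dom g then single_if_inv (g \<circ>\<^sub>m f) (inv_num f + inv_num g) else 0),
     one = (\<Sum>S \<in> Pow {1..N}. single (Some |` S)),
     zero = 0,
     add = (+),
     smult = (*\<^sub>k),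
     differential = strand_diff\<rparr>"

subsection \<open>Strands leaving at the top\<close>

text \<open>\<open>Top p\<close> is the point \<open>t\<^sub>p\<close>; the order is \<open>TPt 1 < TPt 2 < \<dots> < Top 2 < Top 1\<close>.\<close>

datatype top_target = TPt nat | Top nat

instantiation top_target :: linorder
begin

fun less_eq_top_target :: "top_target \<Rightarrow> top_target \<Rightarrow> bool" where
  "TPt i \<le> TPt j \<longleftrightarrow> i \<le> j"
| "TPt i \<le> Top q \<longleftrightarrow> True"
| "Top p \<le> TPt j \<longleftrightarrow> False"
| "Top p \<le> Top q \<longleftrightarrow> q \<le> p"

definition less_top_target :: "top_target \<Rightarrow> top_target \<Rightarrow> bool"
  where "x < y \<longleftrightarrow> x \<le> y \<and> \<not> y \<le> (x :: top_target)"

instance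
proof
  fix x y z :: top_target
  show "x < y \<longleftrightarrow> x \<le> y \<and> \<not> y \<le> x" by (rule less_top_target_def)
  show "x \<le> x" by (cases x) auto
  show "x \<le> y \<Longrightarrow> y \<le> z \<Longrightarrow> x \<le> z" by (cases x; cases y; cases z) auto
  show "x \<le> y \<Longrightarrow> y \<le> x \<Longrightarrow> x = y" by (cases x; cases y) auto
  show "x \<le> y \<or> y \<le> x" by (cases x; cases y) auto
qed

end

definition top_strands :: "nat \<Rightarrow> nat \<Rightarrow> (nat \<rightharpoonup> top_target) set"
  where "top_strands N m = {f. dom f \<subseteq> {1..N} \<and>
    Top ` {1..m} \<subseteq> ran f \<and> ran f \<subseteq> TPt ` {1..N} \<union> Top ` {1..m} \<and>
    inj_on f (dom f) \<and> (\<forall>i j. f i = Some (TPt j) \<longrightarrow> i \<le> j)}"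

definition relabel_tops :: "(nat \<Rightarrow> nat) \<Rightarrow> top_target \<Rightarrow> top_target"
  where "relabel_tops w = (\<lambda>y. case y of TPt j \<Rightarrow> TPt j | Top p \<Rightarrow> Top (w p))"

definition top_compose :: "nat \<Rightarrow> (nat \<rightharpoonup> top_target) \<Rightarrow> (nat \<rightharpoonup> top_target) \<Rightarrow> (nat \<rightharpoonup> top_target)"
  where "top_compose m f g = (\<lambda>s. case f s of
      None \<Rightarrow> None
    | Some (Top p) \<Rightarrow> Some (Top p)
    | Some (TPt j) \<Rightarrow> (case g j of
          None \<Rightarrow> None
        | Some (TPt u) \<Rightarrow> Some (TPt u)
        | Some (Top q) \<Rightarrow> Some (Top (m + q))))"

definition top_module ::
    "nat \<Rightarrow> ((nat \<Rightarrow> nat) \<Rightarrow> 'k::field, (nat \<rightharpoonup> top_target) \<Rightarrow> 'k) algebra_module"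
  where "top_module N =
    \<lparr>component = (\<lambda>m. formal.span (single ` top_strands N m)),
     vact = (\<lambda>a x. bilinear_ext (\<lambda>f w.
       single_if_inv (map_option (relabel_tops w) \<circ> f) (inv_num f + perm_length w)) x a),
     hmult = (\<lambda>m n. bilinear_ext (\<lambda>f g.
       if {j. TPt j \<in> ran f} = dom g
       then single_if_inv (top_compose m f g) (inv_num f + inv_num g) else 0)),
     hone = (\<Sum>S \<in> Pow {1..N}. single ((Some \<circ> TPt) |` S)),
     hdiff = strand_diff\<rparr>"

subsection \<open>Strands entering at the bottom\<close>

text \<open>\<open>Bot p\<close> is the point \<open>b\<^sub>p\<close>; the order is \<open>\<dots> < Bot 2 < Bot 1 < BPt 1 < BPt 2 < \<dots>\<close>.\<close>

datatype bottom_source = Bot nat | BPt nat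

instantiation bottom_source :: linorder
begin

fun less_eq_bottom_source :: "bottom_source \<Rightarrow> bottom_source \<Rightarrow> bool" where
  "BPt i \<le> BPt j \<longleftrightarrow> i \<le> j"
| "BPt i \<le> Bot q \<longleftrightarrow> False"
| "Bot p \<le> BPt j \<longleftrightarrow> True"
| "Bot p \<le> Bot q \<longleftrightarrow> q \<le> p"

definition less_bottom_source :: "bottom_source \<Rightarrow> bottom_source \<Rightarrow> bool"
  where "x < y \<longleftrightarrow> x \<le> y \<and> \<not> y \<le> (x :: bottom_source)"

instance
proof
  fix x y z :: bottom_source
  show "x < y \<longleftrightarrow> x \<le> y \<and> \<not> y \<le> x" by (rule less_bottom_source_def)
  show "x \<le> x" by (cases x) auto
  show "x \<le> y \<Longrightarrow> y \<le> z \<Longrightarrow> x \<le> z" by (cases x; cases y; cases z) auto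
  show "x \<le> y \<Longrightarrow> y \<le> x \<Longrightarrow> x = y" by (cases x; cases y) auto
  show "x \<le> y \<or> y \<le> x" by (cases x; cases y) auto
qed

end

definition bottom_strands :: "nat \<Rightarrow> nat \<Rightarrow> (bottom_source \<rightharpoonup> nat) set"
  where "bottom_strands N m = {g. Bot ` {1..m} \<subseteq> dom g \<and>
    dom g \<subseteq> BPt ` {1..N} \<union> Bot ` {1..m} \<and> ran g \<subseteq> {1..N} \<and>
    inj_on g (dom g) \<and> (\<forall>i j. g (BPt i) = Some j \<longrightarrow> i \<le> j)}"

definition relabel_bottoms :: "(nat \<Rightarrow> nat) \<Rightarrow> bottom_source \<Rightarrow> bottom_source"
  where "relabel_bottoms w = (\<lambda>x. case x of BPt i \<Rightarrow> BPt i | Bot p \<Rightarrow> Bot (w p))"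

definition bottom_compose ::
    "nat \<Rightarrow> (bottom_source \<rightharpoonup> nat) \<Rightarrow> (bottom_source \<rightharpoonup> nat) \<Rightarrow> (bottom_source \<rightharpoonup> nat)"
  where "bottom_compose m g h = (\<lambda>x. case x of
      BPt s \<Rightarrow> ((h \<circ> BPt) \<circ>\<^sub>m g) (BPt s)
    | Bot p \<Rightarrow> if p \<le> m then ((h \<circ> BPt) \<circ>\<^sub>m g) (Bot p) else h (Bot (p - m)))"

definition bottom_module ::
    "nat \<Rightarrow> ((nat \<Rightarrow> nat) \<Rightarrow> 'k::field, (bottom_source \<rightharpoonup> nat) \<Rightarrow> 'k) algebra_module"
  where "bottom_module N =
    \<lparr>component = (\<lambda>m. formal.span (single ` bottom_strands N m)),
     vact = bilinear_ext (\<lambda>w g.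
       single_if_inv (g \<circ> relabel_bottoms w) (inv_num g + perm_length w)),
     hmult = (\<lambda>m n. bilinear_ext (\<lambda>g h.
       if ran g = {i. BPt i \<in> dom h}
       then single_if_inv (bottom_compose m g h) (inv_num g + inv_num h) else 0)),
     hone = (\<Sum>S \<in> Pow {1..N}. single (\<lambda>x. case x of BPt i \<Rightarrow> (Some |` S) i | Bot p \<Rightarrow> None)),
     hdiff = strand_diff\<rparr>"

section \<open>Matched intervals and circles\<close>

text \<open>
  The marked points of a matched interval or pointed matched circle are identified with
  \<open>{1..4k}\<close>, where \<open>k\<close> is the genus of its surface.
\<close>

record matching =
  genus :: nat
  pair_of :: "nat \<Rightarrow> nat"

abbreviation points :: "matching \<Rightarrow> nat set"
  where "points Z \<equiv> {1..4 * genus Z}"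

abbreviation pairs :: "matching \<Rightarrow> nat set"
  where "pairs Z \<equiv> {1..2 * genus Z}"

definition two_to_one :: "matching \<Rightarrow> bool"
  where "two_to_one Z \<longleftrightarrow> pair_of Z ` points Z \<subseteq> pairs Z \<and>
    (\<forall>j \<in> pairs Z. card {i \<in> points Z. pair_of Z i = j} = 2)"

definition partner :: "matching \<Rightarrow> nat \<Rightarrow> nat"
  where "partner Z i = (THE j. j \<in> points Z \<and> j \<noteq> i \<and> pair_of Z j = pair_of Z i)"

text \<open>
  The points cut the oriented interval into the arcs \<open>0, \<dots>, 4k\<close>, arc \<open>i\<close> running from point \<open>i\<close> to
  point \<open>i + 1\<close>.  Oriented surgery on a pair joins the arc ending at either of its points to the
  arc starting at the other one.  So the result is a single interval iff all arcs become connected.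
  In the case of a circle cut open at the basepoint, the arcs \<open>0\<close> and \<open>4k\<close> are moreover
  two halves of the same arc.
\<close>

definition surgery_joins :: "matching \<Rightarrow> (nat \<times> nat) set"
  where "surgery_joins Z = {(i - 1, partner Z i) | i. i \<in> points Z}"

definition all_connected :: "nat set \<Rightarrow> (nat \<times> nat) set \<Rightarrow> bool"
  where "all_connected A r \<longleftrightarrow> (\<forall>a \<in> A. \<forall>b \<in> A. (a, b) \<in> (r \<union> r\<inverse>)\<^sup>*)"

definition matched_interval :: "matching \<Rightarrow> bool"
  where "matched_interval Z \<longleftrightarrow>
    two_to_one Z \<and> all_connected {0..4 * genus Z} (surgery_joins Z)"

definition pointed_matched_circle :: "matching \<Rightarrow> bool"
  where "pointed_matched_circle Z \<longleftrightarrow>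
    two_to_one Z \<and> all_connected {0..4 * genus Z} (insert (0, 4 * genus Z) (surgery_joins Z))"

definition glue :: "matching \<Rightarrow> matching \<Rightarrow> matching"
  where "glue Z1 Z2 = \<lparr>genus = genus Z1 + genus Z2,
    pair_of = (\<lambda>i. if i \<le> 4 * genus Z1 then pair_of Z1 i
                   else 2 * genus Z1 + pair_of Z2 (i - 4 * genus Z1))\<rparr>"

definition sections :: "matching \<Rightarrow> nat set \<Rightarrow> nat set set"
  where "sections Z h = {S. S \<subseteq> points Z \<and> bij_betw (pair_of Z) S h}"

section \<open>The matching algebra\<close>

text \<open>In each of the following, the moving strands \<open>f\<close> have source \<open>c = dom f\<close>.\<close>

definition matching_data :: "matching \<Rightarrow> ((nat \<rightharpoonup> nat) \<times> nat set) set"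
  where "matching_data Z = {(f, h). dom f \<subseteq> points Z \<and> ran f \<subseteq> points Z \<and> inj_on f (dom f) \<and>
    (\<forall>i j. f i = Some j \<longrightarrow> i < j) \<and>
    inj_on (pair_of Z) (dom f) \<and> inj_on (pair_of Z) (ran f) \<and>
    h \<subseteq> pairs Z \<and> h \<inter> pair_of Z ` dom f = {} \<and> h \<inter> pair_of Z ` ran f = {}}"

definition matching_basis :: "matching \<Rightarrow> (nat \<rightharpoonup> nat) \<times> nat set \<Rightarrow> (nat \<rightharpoonup> nat) \<Rightarrow> 'k::field"
  where "matching_basis Z = (\<lambda>(f, h). \<Sum>S \<in> sections Z h. single ((Some |` S) ++ f))"

definition matching_algebra :: "matching \<Rightarrow> ('k::field, (nat \<rightharpoonup> nat) \<Rightarrow> 'k) dg_algebra"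
  where "matching_algebra Z = strands_algebra (4 * genus Z)
    \<lparr>carrier := formal.span (matching_basis Z ` matching_data Z),
     one := (\<Sum>h \<in> Pow (pairs Z). matching_basis Z (Map.empty, h))\<rparr>"

section \<open>The algebra-modules of a matched interval\<close>

definition top_data :: "matching \<Rightarrow> nat \<Rightarrow> ((nat \<rightharpoonup> top_target) \<times> nat set) set"
  where "top_data Z m = {(f, h). dom f \<subseteq> points Z \<and>
    Top ` {1..m} \<subseteq> ran f \<and> ran f \<subseteq> TPt ` points Z \<union> Top ` {1..m} \<and> inj_on f (dom f) \<and>
    (\<forall>i j. f i = Some (TPt j) \<longrightarrow> i < j) \<and>
    inj_on (pair_of Z) (dom f) \<and> inj_on (pair_of Z) {j. TPt j \<in> ran f} \<and>
    h \<subseteq> pairs Z \<and> h \<inter> pair_of Z ` dom f = {} \<and> h \<inter> pair_of Z ` {j. TPt j \<in> ran f} = {}}"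

definition top_basis ::
    "matching \<Rightarrow> (nat \<rightharpoonup> top_target) \<times> nat set \<Rightarrow> (nat \<rightharpoonup> top_target) \<Rightarrow> 'k::field"
  where "top_basis Z = (\<lambda>(f, h). \<Sum>S \<in> sections Z h. single (((Some \<circ> TPt) |` S) ++ f))"

definition matched_top_module ::
    "matching \<Rightarrow> ((nat \<Rightarrow> nat) \<Rightarrow> 'k::field, (nat \<rightharpoonup> top_target) \<Rightarrow> 'k) algebra_module"
  where "matched_top_module Z = top_module (4 * genus Z)
    \<lparr>component := (\<lambda>m. formal.span (top_basis Z ` top_data Z m)),
     hone := (\<Sum>h \<in> Pow (pairs Z). top_basis Z (Map.empty, h))\<rparr>"

definition bottom_data :: "matching \<Rightarrow> nat \<Rightarrow> ((bottom_source \<rightharpoonup> nat) \<times> nat set) set"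
  where "bottom_data Z m = {(g, h). Bot ` {1..m} \<subseteq> dom g \<and>
    dom g \<subseteq> BPt ` points Z \<union> Bot ` {1..m} \<and> ran g \<subseteq> points Z \<and> inj_on g (dom g) \<and>
    (\<forall>i j. g (BPt i) = Some j \<longrightarrow> i < j) \<and>
    inj_on (pair_of Z) {i. BPt i \<in> dom g} \<and> inj_on (pair_of Z) (ran g) \<and>
    h \<subseteq> pairs Z \<and> h \<inter> pair_of Z ` {i. BPt i \<in> dom g} = {} \<and> h \<inter> pair_of Z ` ran g = {}}"

definition bottom_basis ::
    "matching \<Rightarrow> (bottom_source \<rightharpoonup> nat) \<times> nat set \<Rightarrow> (bottom_source \<rightharpoonup> nat) \<Rightarrow> 'k::field"
  where "bottom_basis Z = (\<lambda>(g, h). \<Sum>S \<in> sections Z h.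
    single ((\<lambda>x. case x of BPt i \<Rightarrow> (Some |` S) i | Bot p \<Rightarrow> None) ++ g))"

definition matched_bottom_module ::
    "matching \<Rightarrow> ((nat \<Rightarrow> nat) \<Rightarrow> 'k::field, (bottom_source \<rightharpoonup> nat) \<Rightarrow> 'k) algebra_module"
  where "matched_bottom_module Z = bottom_module (4 * genus Z)
    \<lparr>component := (\<lambda>m. formal.span (bottom_basis Z ` bottom_data Z m)),
     hone := (\<Sum>h \<in> Pow (pairs Z). bottom_basis Z (Map.empty, h))\<rparr>"

section \<open>The gluing of two matched intervals is a pointed matched circle\<close>

lemma glue_sel:
  "genus (glue Z1 Z2) = genus Z1 + genus Z2"
  "pair_of (glue Z1 Z2) i = (if i \<le> 4 * genus Z1 then pair_of Z1 i
     else 2 * genus Z1 + pair_of Z2 (i - 4 * genus Z1))"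
  by (simp_all add: glue_def)

lemma two_to_one_glue:
  assumes "two_to_one Z1" "two_to_one Z2"
  shows "two_to_one (glue Z1 Z2)"
  unfolding two_to_one_def
proof (intro conjI ballI)
  let ?Z = "glue Z1 Z2" and ?n = "4 * genus Z1" and ?m = "2 * genus Z1"
  have im1: "pair_of Z1 i \<in> pairs Z1" if "i \<in> points Z1" for i
    using assms(1) that unfolding two_to_one_def by blast
  have im2: "pair_of Z2 i \<in> pairs Z2" if "i \<in> points Z2" for i
    using assms(2) that unfolding two_to_one_def by blast
  show "pair_of ?Z ` points ?Z \<subseteq> pairs ?Z"
  proof
    fix j assume "j \<in> pair_of ?Z ` points ?Z"
    then obtain i where i: "i \<in> points ?Z" "j = pair_of ?Z i" by auto
    show "j \<in> pairs ?Z"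
    proof (cases "i \<le> ?n")
      case True
      then show ?thesis using im1[of i] i by (auto simp: glue_sel)
    next
      case False
      then have "i - ?n \<in> points Z2" using i by (auto simp: glue_sel)
      from im2[OF this] show ?thesis using False i by (auto simp: glue_sel)
    qed
  qed
  fix j assume j: "j \<in> pairs ?Z"
  show "card {i \<in> points ?Z. pair_of ?Z i = j} = 2"
  proof (cases "j \<le> ?m")
    case True
    have "{i \<in> points ?Z. pair_of ?Z i = j} = {i \<in> points Z1. pair_of Z1 i = j}"
    proof (intro Set.set_eqI iffI)
      fix i assume i: "i \<in> {i \<in> points ?Z. pair_of ?Z i = j}"
      have "i \<le> ?n"
      proof (rule ccontr)
        assume "\<not> i \<le> ?n"
        moreover from this have "i - ?n \<in> points Z2" using i by (auto simp: glue_sel)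
        from im2[OF this] have "1 \<le> pair_of Z2 (i - ?n)" by simp
        ultimately show False using i True by (auto simp: glue_sel)
      qed
      then show "i \<in> {i \<in> points Z1. pair_of Z1 i = j}" using i by (auto simp: glue_sel)
    qed (auto simp: glue_sel)
    moreover have "j \<in> pairs Z1" using True j by auto
    ultimately show ?thesis using assms(1) by (simp add: two_to_one_def)
  next
    case False
    have "{i \<in> points ?Z. pair_of ?Z i = j} = (+) ?n ` {i \<in> points Z2. pair_of Z2 i = j - ?m}"
    proof (intro Set.set_eqI iffI)
      fix i assume i: "i \<in> {i \<in> points ?Z. pair_of ?Z i = j}"
      have "\<not> i \<le> ?n" using i False im1[of i] by (auto simp: glue_sel)
      then have "i = ?n + (i - ?n)" "i - ?n \<in> {i \<in> points Z2. pair_of Z2 i = j - ?m}"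
        using i by (auto simp: glue_sel)
      then show "i \<in> (+) ?n ` {i \<in> points Z2. pair_of Z2 i = j - ?m}" by blast
    next
      fix i assume "i \<in> (+) ?n ` {i \<in> points Z2. pair_of Z2 i = j - ?m}"
      then show "i \<in> {i \<in> points ?Z. pair_of ?Z i = j}" using False by (auto simp: glue_sel)
    qed
    moreover have "j - ?m \<in> pairs Z2" using False j by (auto simp: glue_sel)
    ultimately show ?thesis using assms(2) by (simp add: two_to_one_def card_image)
  qed
qed

lemma pointed_matched_circle_glue:
  assumes "matched_interval Z1" "matched_interval Z2"
  shows "pointed_matched_circle (glue Z1 Z2)"
proof -
  let ?Z = "glue Z1 Z2" and ?n = "4 * genus Z1" and ?m = "2 * genus Z1"
  let ?n' = "4 * genus (glue Z1 Z2)"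
  have im1: "pair_of Z1 i \<in> pairs Z1" if "i \<in> points Z1" for i
    using assms(1) that unfolding matched_interval_def two_to_one_def by blast
  have im2: "pair_of Z2 i \<in> pairs Z2" if "i \<in> points Z2" for i
    using assms(2) that unfolding matched_interval_def two_to_one_def by blast
  have two: "two_to_one Z2" using assms(2) by (simp add: matched_interval_def)
  have p1: "partner ?Z i = partner Z1 i" if i: "i \<in> points Z1" for i
  proof -
    have "(j \<in> points ?Z \<and> j \<noteq> i \<and> pair_of ?Z j = pair_of ?Z i) \<longleftrightarrow>
          (j \<in> points Z1 \<and> j \<noteq> i \<and> pair_of Z1 j = pair_of Z1 i)" for j
    proof (cases "j \<in> points ?Z \<and> \<not> j \<le> ?n")
      case True
      then have "j - ?n \<in> points Z2" by (auto simp: glue_sel)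
      from im2[OF this] have "1 \<le> pair_of Z2 (j - ?n)" by simp
      then show ?thesis using True i im1[OF i] by (auto simp: glue_sel)
    next
      case False
      then show ?thesis using i by (auto simp: glue_sel)
    qed
    then show ?thesis unfolding partner_def by simp
  qed
  have p2: "partner ?Z (?n + i) = ?n + partner Z2 i" if i: "i \<in> points Z2" for i
  proof -
    have "card {j \<in> points Z2. pair_of Z2 j = pair_of Z2 i} = 2"
      using two im2[OF i] unfolding two_to_one_def by blast
    then obtain a b where ab: "{j \<in> points Z2. pair_of Z2 j = pair_of Z2 i} = {a, b}" "a \<noteq> b"
      by (meson card_2_iff)
    moreover have "i \<in> {j \<in> points Z2. pair_of Z2 j = pair_of Z2 i}" using i by simp
    ultimately obtain c where c: "{j \<in> points Z2. pair_of Z2 j = pair_of Z2 i} = {i, c}" "c \<noteq> i"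
      by (cases "i = a") (auto simp: insert_commute)
    have iff2: "(j \<in> points Z2 \<and> j \<noteq> i \<and> pair_of Z2 j = pair_of Z2 i) \<longleftrightarrow> j = c" for j
      using c by blast
    have "(j \<in> points ?Z \<and> j \<noteq> ?n + i \<and> pair_of ?Z j = pair_of ?Z (?n + i)) \<longleftrightarrow> j = ?n + c" for j
    proof (cases "j \<le> ?n")
      case True
      have "c \<in> points Z2" using c by blast
      then show ?thesis using True i im1[of j] im2[OF i] by (auto simp: glue_sel)
    next
      case False
      have "(j \<in> points ?Z \<and> j \<noteq> ?n + i \<and> pair_of ?Z j = pair_of ?Z (?n + i)) \<longleftrightarrow>
            (j - ?n \<in> points Z2 \<and> j - ?n \<noteq> i \<and> pair_of Z2 (j - ?n) = pair_of Z2 i)"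
        using False i by (auto simp: glue_sel)
      then show ?thesis using iff2[of "j - ?n"] False by auto
    qed
    then have "partner ?Z (?n + i) = ?n + c" unfolding partner_def by simp
    moreover have "partner Z2 i = c" unfolding partner_def by (simp only: iff2 the_eq_trivial)
    ultimately show ?thesis by simp
  qed
  define r where "r = insert (0, ?n') (surgery_joins ?Z)"
  have r1: "(a, b) \<in> r" if ab: "(a, b) \<in> surgery_joins Z1" for a b
  proof -
    obtain i where i: "i \<in> points Z1" "a = i - 1" "b = partner Z1 i"
      using ab unfolding surgery_joins_def mem_Collect_eq prod.inject by metis
    then have "i \<in> points ?Z" "b = partner ?Z i" using p1 by (auto simp: glue_sel)
    then show ?thesis using i(2) unfolding r_def surgery_joins_def by blast
  qed
  have r2: "(?n + a, ?n + b) \<in> r" if ab: "(a, b) \<in> surgery_joins Z2" for a b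
  proof -
    obtain i where i: "i \<in> points Z2" "a = i - 1" "b = partner Z2 i"
      using ab unfolding surgery_joins_def mem_Collect_eq prod.inject by metis
    then have "?n + i \<in> points ?Z" "?n + b = partner ?Z (?n + i)" "?n + a = (?n + i) - 1"
      using p2 by (auto simp: glue_sel)
    then show ?thesis unfolding r_def surgery_joins_def by blast
  qed
  have c1: "(a, b) \<in> (r \<union> r\<inverse>)\<^sup>*" if "a \<le> ?n" "b \<le> ?n" for a b
  proof -
    have "(a, b) \<in> (surgery_joins Z1 \<union> (surgery_joins Z1)\<inverse>)\<^sup>*"
      using assms(1) that unfolding matched_interval_def all_connected_def by simp
    moreover have "surgery_joins Z1 \<union> (surgery_joins Z1)\<inverse> \<subseteq> r \<union> r\<inverse>"
      using r1 by auto
    ultimately show ?thesis using rtrancl_mono by blast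
  qed
  have c2: "(?n + a, ?n + b) \<in> (r \<union> r\<inverse>)\<^sup>*" if "a \<le> 4 * genus Z2" "b \<le> 4 * genus Z2" for a b
  proof -
    have "(a, b) \<in> (surgery_joins Z2 \<union> (surgery_joins Z2)\<inverse>)\<^sup>*"
      using assms(2) that unfolding matched_interval_def all_connected_def by simp
    then show ?thesis
    proof (induction rule: rtrancl_induct)
      case (step y z)
      then have "(?n + y, ?n + z) \<in> r \<union> r\<inverse>" using r2 by auto
      then show ?case using step.IH by (rule rtrancl_into_rtrancl[rotated])
    qed simp
  qed
  have c0: "(?n, a) \<in> (r \<union> r\<inverse>)\<^sup>*" "(a, ?n) \<in> (r \<union> r\<inverse>)\<^sup>*" if "a \<le> ?n'" for a
    using that c1[of ?n a] c1[of a ?n] c2[of 0 "a - ?n"] c2[of "a - ?n" 0]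
    by (cases "a \<le> ?n"; simp add: glue_sel)+
  have "all_connected {0..?n'} r"
    unfolding all_connected_def using c0 by (meson atLeastAtMost_iff rtrancl_trans)
  then show ?thesis
    using assms two_to_one_glue unfolding pointed_matched_circle_def matched_interval_def r_def
    by blast
qed

section \<open>Consistency checks\<close>

lemma bilinear_ext_single: "bilinear_ext F (single a) (single b) = F a b"
proof -
  have "{c. single d c \<noteq> (0::'e::field)} = {d}" for d :: 'd
    by (auto simp: single_def)
  then show ?thesis
    unfolding bilinear_ext_def by (simp add: single_def formal_scale_def)
qed

lemma inversions_of_three:
  fixes w :: "nat \<Rightarrow> nat"
  assumes off: "\<And>x. x < i \<or> i + 2 < x \<Longrightarrow> w x = x"
    and v: "w i = i + a" "w (i + 1) = i + b" "w (i + 2) = i + c" and le: "a \<le> 2" "b \<le> 2" "c \<le> 2"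
  shows "perm_length w = (if b < a then 1 else 0) + (if c < a then 1 else 0) + (if c < b then 1 else 0)"
proof -
  define A where "A = (if b < a then {(i, i + 1)} else {})"
  define B where "B = (if c < a then {(i, i + 2)} else {})"
  define C where "C = (if c < b then {(i + 1, i + 2)} else {})"
  have cases3: "x < i \<or> i + 2 < x \<or> x = i \<or> x = i + 1 \<or> x = i + 2" for x by arith
  have range: "i \<le> w x \<and> w x \<le> i + 2" if "x = i \<or> x = i + 1 \<or> x = i + 2" for x
    using that v le by auto
  have "x < y \<and> w y < w x \<longleftrightarrow> (x, y) \<in> A \<union> (B \<union> C)" for x y
    using cases3[of x]
  proof (elim disjE)
    assume x: "x < i"
    have "w x \<le> w y" if "x < y"
      using cases3[of y] x off[of x] off[of y] range[of y] that by linarith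
    moreover have "(x, y) \<notin> A \<union> (B \<union> C)" using x by (simp add: A_def B_def C_def)
    ultimately show ?thesis by auto
  next
    assume x: "i + 2 < x"
    have "w x \<le> w y" if "x < y" using x off[of x] off[of y] that by linarith
    moreover have "(x, y) \<notin> A \<union> (B \<union> C)" using x by (simp add: A_def B_def C_def)
    ultimately show ?thesis by auto
  next
    assume x: "x = i"
    show ?thesis using cases3[of y] off[of y] v le x
      by (elim disjE) (simp_all add: A_def B_def C_def)
  next
    assume x: "x = i + 1"
    show ?thesis using cases3[of y] off[of y] v le x
      by (elim disjE) (simp_all add: A_def B_def C_def)
  next
    assume x: "x = i + 2"
    show ?thesis using cases3[of y] off[of y] v le x
      by (elim disjE) (simp_all add: A_def B_def C_def)
  qed
  then have "perm_length w = card (A \<union> (B \<union> C))"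
    by (simp only: perm_length_def case_prod_unfold prod.collapse Collect_mem_eq)
  also have "\<dots> = card A + (card B + card C)"
    by (subst card_Un_disjoint; (subst card_Un_disjoint)?) (auto simp: A_def B_def C_def)
  finally show ?thesis by (simp add: A_def B_def C_def)
qed

lemma perm_length_simple:
  defines "s \<equiv> \<lambda>i. transpose i (Suc i)"
  shows "perm_length id = 0"
    and "perm_length (s i) = 1"
    and "perm_length (s (Suc i) \<circ> s i) = 2"
    and "perm_length (s i \<circ> s (Suc i)) = 2"
    and "perm_length (s i \<circ> (s (Suc i) \<circ> s i)) = 3"
proof -
  show "perm_length id = 0"
    by (subst inversions_of_three[of i _ 0 1 2]) simp_all
  show "perm_length (s i) = 1"
    by (subst inversions_of_three[of i _ 1 0 2]) (auto simp: s_def transpose_def)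
  show "perm_length (s (Suc i) \<circ> s i) = 2"
    by (subst inversions_of_three[of i _ 2 0 1]) (auto simp: s_def transpose_def)
  show "perm_length (s i \<circ> s (Suc i)) = 2"
    by (subst inversions_of_three[of i _ 1 2 0]) (auto simp: s_def transpose_def)
  show "perm_length (s i \<circ> (s (Suc i) \<circ> s i)) = 3"
    by (subst inversions_of_three[of i _ 2 1 0]) (auto simp: s_def transpose_def)
qed

lemma nilcoxeter_relations:
  defines "\<sigma> \<equiv> \<lambda>i. single (transpose i (Suc i)) :: (nat \<Rightarrow> nat) \<Rightarrow> 'k::field"
  shows "\<sigma> i \<otimes>\<^bsub>nilcoxeter m\<^esub> \<sigma> i = 0"
    and "i + 1 < j \<Longrightarrow> \<sigma> i \<otimes>\<^bsub>nilcoxeter m\<^esub> \<sigma> j = \<sigma> j \<otimes>\<^bsub>nilcoxeter m\<^esub> \<sigma> i"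
    and "\<sigma> i \<otimes>\<^bsub>nilcoxeter m\<^esub> \<sigma> (i + 1) \<otimes>\<^bsub>nilcoxeter m\<^esub> \<sigma> i =
         \<sigma> (i + 1) \<otimes>\<^bsub>nilcoxeter m\<^esub> \<sigma> i \<otimes>\<^bsub>nilcoxeter m\<^esub> \<sigma> (i + 1)"
proof -
  let ?s = "\<lambda>i. transpose i (Suc i)"
  show "\<sigma> i \<otimes>\<^bsub>nilcoxeter m\<^esub> \<sigma> i = 0"
    using perm_length_simple(1,2)
    by (simp add: nilcoxeter_def \<sigma>_def bilinear_ext_single zero_fun_def)
  have "?s j \<circ> ?s i = ?s i \<circ> ?s j" if "i + 1 < j"
    using that by (auto simp: transpose_def fun_eq_iff)
  then show "\<sigma> i \<otimes>\<^bsub>nilcoxeter m\<^esub> \<sigma> j = \<sigma> j \<otimes>\<^bsub>nilcoxeter m\<^esub> \<sigma> i" if "i + 1 < j"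
    using that by (simp add: nilcoxeter_def \<sigma>_def bilinear_ext_single add.commute zero_fun_def)
  have "?s (Suc i) \<circ> (?s i \<circ> ?s (Suc i)) = ?s i \<circ> (?s (Suc i) \<circ> ?s i)"
    by (auto simp: transpose_def fun_eq_iff)
  then show "\<sigma> i \<otimes>\<^bsub>nilcoxeter m\<^esub> \<sigma> (i + 1) \<otimes>\<^bsub>nilcoxeter m\<^esub> \<sigma> i =
      \<sigma> (i + 1) \<otimes>\<^bsub>nilcoxeter m\<^esub> \<sigma> i \<otimes>\<^bsub>nilcoxeter m\<^esub> \<sigma> (i + 1)"
    by (simp add: nilcoxeter_def \<sigma>_def bilinear_ext_single perm_length_simple)
qed

lemma matching_algebra_subset:
  "carrier (matching_algebra Z :: ('k::field, _) dg_algebra)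
     \<subseteq> carrier (strands_algebra (4 * genus Z))"
proof -
  have "matching_basis Z d \<in> formal.span (single ` strands (4 * genus Z) :: (_ \<Rightarrow> 'k) set)"
    if "d \<in> matching_data Z" for d
  proof -
    obtain f h where d: "d = (f, h)" by (cases d)
    have "(Some |` S) ++ f \<in> strands (4 * genus Z)" if S: "S \<in> sections Z h" for S
    proof -
      have fh: "dom f \<subseteq> points Z" "ran f \<subseteq> points Z" "inj_on f (dom f)"
        "\<And>i j. f i = Some j \<Longrightarrow> i < j" "h \<inter> pair_of Z ` dom f = {}" "h \<inter> pair_of Z ` ran f = {}"
        using \<open>d \<in> matching_data Z\<close> by (auto simp: d matching_data_def)
      have SZ: "S \<subseteq> points Z" "pair_of Z ` S = h"
        using S by (auto simp: sections_def bij_betw_def)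
      have disj: "S \<inter> dom f = {}" "S \<inter> ran f = {}" using fh SZ by blast+
      have val: "((Some |` S) ++ f) i = Some j \<longleftrightarrow> f i = Some j \<or> i \<in> S \<and> j = i" for i j
        using disj(1) by (auto simp: map_add_def restrict_map_def split: option.splits)
      show ?thesis
        unfolding strands_def
      proof (intro CollectI conjI allI impI)
        show "dom ((Some |` S) ++ f) \<subseteq> points Z" using fh(1) SZ(1) by auto
        show "ran ((Some |` S) ++ f) \<subseteq> points Z"
          using fh(2) SZ(1) by (auto simp: ran_def val)
        show "inj_on ((Some |` S) ++ f) (dom ((Some |` S) ++ f))"
        proof (rule inj_onI)
          fix x y assume "x \<in> dom ((Some |` S) ++ f)"
            and eq: "((Some |` S) ++ f) x = ((Some |` S) ++ f) y"
          then obtain v where v: "((Some |` S) ++ f) x = Some v" "((Some |` S) ++ f) y = Some v"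
            by (metis domD)
          then show "x = y"
            using disj(2) inj_onD[OF fh(3), of x y] unfolding val by (auto simp: ran_def dom_def)
        qed
        show "i \<le> j" if "((Some |` S) ++ f) i = Some j" for i j
          using that fh(4)[of i j] unfolding val by auto
      qed
    qed
    then show ?thesis
      unfolding d matching_basis_def by (auto intro!: formal.span_sum intro: formal.span_base)
  qed
  then have "formal.span (matching_basis Z ` matching_data Z)
      \<subseteq> formal.span (single ` strands (4 * genus Z) :: (_ \<Rightarrow> 'k) set)"
    by (intro formal.span_minimal formal.subspace_span) auto
  then show ?thesis by (simp add: matching_algebra_def strands_algebra_def)
qed

end

theory Submission
  imports Defs
begin

text \<open>
  Cut every strand of the glued circle at the point \<open>w\<close> between the two intervals: a strand that
  passes \<open>w\<close> leaves the first interval at the top and enters the second one at the bottom.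
  Conversely, strands \<open>f\<close> and \<open>g\<close> glue to strands \<open>F\<close> whose crossings are the symmetric difference
  of those of \<open>f\<close> and \<open>g\<close>, so that \<open>inv F = inv f + inv g\<close> unless two strands cross twice.  The pairing
  that sends \<open>f \<otimes> g\<close> to \<open>F\<close>, or to \<open>0\<close> if there is a double crossing, is balanced and multiplicative
  because inversion numbers are subadditive.  It commutes with the differentials because the two
  resolutions of a double crossing cancel in characteristic \<open>2\<close>.

  A permutation moved across the tensor product straightens the strands on the left, so the tensor
  product is spanned by pairs in which no two strands leaving at the top cross.  These pairs
  correspond bijectively to the basis of the matching algebra.  So the kernel of the pairing is the
  space of tensor relations, and the pairing is an isomorphism.

  The modules of a matched interval are closed under all operations because a fixed strand never
  takes part in a double crossing: it can be replaced by the fixed strand at the paired point in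
  each summand of a product or differential.
\<close>

text \<open>Every operation here is truncated: it returns the composite only if inversion numbers
  add, and \<open>0\<close> otherwise. An identity between two chains of operations therefore
  compares two truncation conditions. By subadditivity, a chain survives exactly when its final
  strands have as many inversions as all its ingredients together, and this total does not depend on
  the order of the operations. This one remark handles the balancing of the pairing, its
  multiplicativity and, with the total lowered by one, the differentials.

  Basis elements of the matched modules are sums over sections, so closure cannot be seen summand by
  summand. The span is instead described by coefficients: they vanish off the strands compatible
  with the matching and are constant on strands that differ only by the position of fixed strands
  within their pairs. Closure then becomes a bijection between terms.

  The number of strands through the cut can be read off from glued strands and is bounded. It grades
  the matching algebra, and so the product over all \<open>m\<close> has only finitely many nonzero
  factors.\<close>

section \<open>Linear extensions\<close>

definition supp :: "('a \<Rightarrow> 'k::field) \<Rightarrow> 'a set"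
  where "supp x = {a. x a \<noteq> 0}"

lemma formal_scale_apply [simp]: "(c *\<^sub>k x) a = c * x a"
  by (simp add: formal_scale_def)

lemma single_apply: "single a b = (if b = a then 1 else (0::'k::field))"
  by (simp add: single_def)

lemma sum_fun_apply: "(\<Sum>i\<in>I. f i) a = (\<Sum>i\<in>I. f i a)"
  by (induction I rule: infinite_finite_induct) auto

lemma supp_single [simp]: "supp (single a :: 'a \<Rightarrow> 'k::field) = {a}"
  by (auto simp: supp_def single_apply)

lemma supp_zero [simp]: "supp 0 = {}"
  by (simp add: supp_def)

lemma supp_add: "supp (x + y) \<subseteq> supp x \<union> supp y"
  by (auto simp: supp_def)

lemma supp_scale: "supp (c *\<^sub>k x) \<subseteq> supp x"
  by (auto simp: supp_def)

lemma expand_single: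
  assumes "finite A" "supp x \<subseteq> A"
  shows "x = (\<Sum>a\<in>A. x a *\<^sub>k single a)"
proof
  fix b
  show "x b = (\<Sum>a\<in>A. x a *\<^sub>k single a) b"
    using assms by (auto simp: sum_fun_apply single_apply supp_def if_distrib cong: if_cong)
qed

lemma subspace_finite_supp:
  "formal.subspace {x :: 'a \<Rightarrow> 'b::field. finite (supp x) \<and> supp x \<subseteq> X}"
proof (rule formal.subspaceI)
  show "0 \<in> {x :: 'a \<Rightarrow> 'b. finite (supp x) \<and> supp x \<subseteq> X}" by simp
  show "x + y \<in> {x. finite (supp x) \<and> supp x \<subseteq> X}"
    if "x \<in> {x. finite (supp x) \<and> supp x \<subseteq> X}" "y \<in> {x. finite (supp x) \<and> supp x \<subseteq> X}"
    for x y :: "'a \<Rightarrow> 'b"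
    using that supp_add[of x y] finite_subset[OF supp_add[of x y]] by blast
  show "c *\<^sub>k x \<in> {x. finite (supp x) \<and> supp x \<subseteq> X}"
    if "x \<in> {x. finite (supp x) \<and> supp x \<subseteq> X}" for x :: "'a \<Rightarrow> 'b" and c
    using that supp_scale[of c x] finite_subset[OF supp_scale[of c x]] by blast
qed

lemma span_single: "formal.span (single ` X) = {x :: 'a \<Rightarrow> 'k::field. finite (supp x) \<and> supp x \<subseteq> X}"
proof
  show "formal.span (single ` X) \<subseteq> {x :: 'a \<Rightarrow> 'k. finite (supp x) \<and> supp x \<subseteq> X}"
    by (rule formal.span_minimal[OF _ subspace_finite_supp]) auto
next
  show "{x :: 'a \<Rightarrow> 'k. finite (supp x) \<and> supp x \<subseteq> X} \<subseteq> formal.span (single ` X)"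
  proof clarify
    fix x :: "'a \<Rightarrow> 'k" assume x: "finite (supp x)" "supp x \<subseteq> X"
    have "(\<Sum>a\<in>supp x. x a *\<^sub>k single a) \<in> formal.span (single ` X)"
      using x(2) by (auto intro!: formal.span_sum formal.span_scale intro: formal.span_base)
    then show "x \<in> formal.span (single ` X)"
      using expand_single[OF x(1) subset_refl] by simp
  qed
qed

text \<open>A sum over an infinite index set is \<open>0\<close> by convention, so
  \<open>linear_ext\<close> is additive in general only on functions of finite support. This
  subspace carries that side condition through the later rules.\<close>

definition finitary :: "('a \<Rightarrow> 'k::field) set"
  where "finitary = {x. finite (supp x)}"

lemma subspace_finitary: "formal.subspace finitary"
  using subspace_finite_supp[of UNIV] by (simp add: finitary_def)

lemma finitary_single [simp]: "single a \<in> finitary"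
  by (simp add: finitary_def)

lemmas finitary_zero [simp] = formal.subspace_0[OF subspace_finitary]
lemmas finitary_add = formal.subspace_add[OF subspace_finitary]
lemmas finitary_diff = formal.subspace_diff[OF subspace_finitary]
lemmas finitary_scale = formal.subspace_scale[OF subspace_finitary]
lemmas finitary_sum = formal.subspace_sum[OF subspace_finitary]

lemma linear_ext_supp: "linear_ext F x = (\<Sum>a\<in>supp x. x a *\<^sub>k F a)"
  by (simp add: linear_ext_def supp_def)

lemma linear_ext_superset:
  assumes "finite A" "supp x \<subseteq> A"
  shows "linear_ext F x = (\<Sum>a\<in>A. x a *\<^sub>k F a)"
  unfolding linear_ext_supp
  by (rule sum.mono_neutral_left[OF assms]) (auto simp: supp_def)

lemma linear_ext_single [simp]: "linear_ext F (single a) = F a"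
  by (simp add: linear_ext_supp single_apply)

lemma linear_ext_zero [simp]: "linear_ext F 0 = 0"
  by (simp add: linear_ext_supp)

lemma linear_ext_add:
  assumes "x \<in> finitary" "y \<in> finitary"
  shows "linear_ext F (x + y) = linear_ext F x + linear_ext F y"
proof -
  let ?A = "supp x \<union> supp y"
  have A: "finite ?A" using assms by (simp add: finitary_def)
  show ?thesis
    using linear_ext_superset[OF A supp_add, of F] linear_ext_superset[OF A, of x F]
      linear_ext_superset[OF A, of y F]
    by (simp add: formal.scale_left_distrib sum.distrib)
qed

lemma linear_ext_scale:
  assumes "x \<in> finitary"
  shows "linear_ext F (c *\<^sub>k x) = c *\<^sub>k linear_ext F x"
proof -
  have A: "finite (supp x)" using assms by (simp add: finitary_def)
  show ?thesis
    using linear_ext_superset[OF A supp_scale, of F c] linear_ext_superset[OF A, of x F]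
    by (simp add: formal.scale_sum_right)
qed

lemma linear_ext_diff:
  assumes "x \<in> finitary" "y \<in> finitary"
  shows "linear_ext F (x - y) = linear_ext F x - linear_ext F y"
  using linear_ext_add[OF finitary_diff[OF assms] assms(2), of F] by simp

lemma linear_ext_sum:
  assumes "\<And>i. i \<in> I \<Longrightarrow> x i \<in> finitary"
  shows "linear_ext F (\<Sum>i\<in>I. x i) = (\<Sum>i\<in>I. linear_ext F (x i))"
  using assms
  by (induction I rule: infinite_finite_induct) (auto simp: linear_ext_add finitary_sum)

lemma linear_ext_in_subspace:
  assumes "formal.subspace V" "\<And>a. a \<in> supp x \<Longrightarrow> F a \<in> V"
  shows "linear_ext F x \<in> V"
  unfolding linear_ext_supp
  using assms by (auto intro!: formal.subspace_sum formal.subspace_scale)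

lemma linear_ext_cong:
  "(\<And>a. a \<in> supp x \<Longrightarrow> F a = G a) \<Longrightarrow> linear_ext F x = linear_ext G x"
  unfolding linear_ext_supp by (rule sum.cong) auto

lemma linear_ext_linear_ext:
  assumes "\<And>a. a \<in> supp x \<Longrightarrow> F a \<in> finitary"
  shows "linear_ext G (linear_ext F x) = linear_ext (\<lambda>a. linear_ext G (F a)) x"
  unfolding linear_ext_supp[of F] linear_ext_supp[of "\<lambda>a. linear_ext G (F a)"]
  using assms by (subst linear_ext_sum) (auto simp: linear_ext_scale finitary_scale)

lemma bilinear_ext_linear_ext:
  "bilinear_ext F x y = linear_ext (\<lambda>a. linear_ext (F a) y) x"
  by (simp add: bilinear_ext_def linear_ext_def formal.scale_sum_right)

text \<open>Valid for arbitrary \<open>x\<close> and \<open>y\<close>: if one support is infinite,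
  both sides are \<open>0\<close>. Exchanging the sums lets each rule for the left argument be
  repeated for the right one.\<close>

lemma bilinear_ext_flip:
  "bilinear_ext F x y = linear_ext (\<lambda>b. linear_ext (\<lambda>a. F a b) x) y"
  by (simp add: bilinear_ext_def linear_ext_def formal.scale_sum_right)
     (subst sum.swap, simp add: mult.commute)

lemma bilinear_ext_add_left:
  "x \<in> finitary \<Longrightarrow> x' \<in> finitary \<Longrightarrow>
   bilinear_ext F (x + x') y = bilinear_ext F x y + bilinear_ext F x' y"
  by (simp add: bilinear_ext_linear_ext linear_ext_add)

lemma bilinear_ext_add_right:
  "y \<in> finitary \<Longrightarrow> y' \<in> finitary \<Longrightarrow>
   bilinear_ext F x (y + y') = bilinear_ext F x y + bilinear_ext F x y'"
  by (simp add: bilinear_ext_flip linear_ext_add)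

lemma bilinear_ext_scale_left:
  "x \<in> finitary \<Longrightarrow> bilinear_ext F (c *\<^sub>k x) y = c *\<^sub>k bilinear_ext F x y"
  by (simp add: bilinear_ext_linear_ext linear_ext_scale)

lemma bilinear_ext_scale_right:
  "y \<in> finitary \<Longrightarrow> bilinear_ext F x (c *\<^sub>k y) = c *\<^sub>k bilinear_ext F x y"
  by (simp add: bilinear_ext_flip linear_ext_scale)

lemma bilinear_ext_sum_left:
  "(\<And>i. i \<in> I \<Longrightarrow> x i \<in> finitary) \<Longrightarrow>
   bilinear_ext F (\<Sum>i\<in>I. x i) y = (\<Sum>i\<in>I. bilinear_ext F (x i) y)"
  by (simp add: bilinear_ext_linear_ext linear_ext_sum)

lemma bilinear_ext_sum_right:
  "(\<And>i. i \<in> I \<Longrightarrow> y i \<in> finitary) \<Longrightarrow>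
   bilinear_ext F x (\<Sum>i\<in>I. y i) = (\<Sum>i\<in>I. bilinear_ext F x (y i))"
  by (simp add: bilinear_ext_flip linear_ext_sum)

lemma bilinear_ext_zero [simp]: "bilinear_ext F 0 y = 0" "bilinear_ext F x 0 = 0"
  using bilinear_ext_linear_ext[of F 0 y] bilinear_ext_flip[of F x 0] by simp_all

lemma bilinear_ext_single_left [simp]: "bilinear_ext F (single a) y = linear_ext (F a) y"
  by (simp add: bilinear_ext_linear_ext)

lemma bilinear_ext_single_right [simp]: "bilinear_ext F x (single b) = linear_ext (\<lambda>a. F a b) x"
  by (simp add: bilinear_ext_flip)

lemma bilinear_ext_in_subspace:
  assumes "formal.subspace V" "\<And>a b. a \<in> supp x \<Longrightarrow> b \<in> supp y \<Longrightarrow> F a b \<in> V"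
  shows "bilinear_ext F x y \<in> V"
  unfolding bilinear_ext_linear_ext
  by (intro linear_ext_in_subspace assms)

lemma bilinear_ext_cong:
  "(\<And>a b. a \<in> supp x \<Longrightarrow> b \<in> supp y \<Longrightarrow> F a b = G a b) \<Longrightarrow>
   bilinear_ext F x y = bilinear_ext G x y"
  unfolding bilinear_ext_linear_ext by (intro linear_ext_cong) auto

lemma bilinear_ext_apply:
  "bilinear_ext F x y c = (\<Sum>(a, b)\<in>supp x \<times> supp y. x a * y b * F a b c)"
  by (simp add: bilinear_ext_def sum_fun_apply supp_def sum.cartesian_product case_prod_unfold)

lemma linear_ext_bilinear_ext:
  assumes "\<And>a b. a \<in> supp x \<Longrightarrow> b \<in> supp y \<Longrightarrow> F a b \<in> finitary"
  shows "linear_ext G (bilinear_ext F x y) = bilinear_ext (\<lambda>a b. linear_ext G (F a b)) x y"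
  unfolding bilinear_ext_linear_ext
  using assms by (subst linear_ext_linear_ext)
    (auto intro!: linear_ext_cong linear_ext_in_subspace[OF subspace_finitary] linear_ext_linear_ext)

text \<open>Both sides are the quadrilinear extension of the same function of basis elements.\<close>

lemma bilinear_ext_bilinear_ext:
  assumes "\<And>a b. a \<in> supp x \<Longrightarrow> b \<in> supp y \<Longrightarrow> F a b \<in> finitary"
    and "\<And>a b. a \<in> supp x' \<Longrightarrow> b \<in> supp y' \<Longrightarrow> F' a b \<in> finitary"
  shows "bilinear_ext G (bilinear_ext F x y) (bilinear_ext F' x' y') =
    bilinear_ext (\<lambda>a b. bilinear_ext (\<lambda>a' b'. bilinear_ext G (F a b) (F' a' b')) x' y') x y"
proof -
  have "bilinear_ext G (bilinear_ext F x y) (bilinear_ext F' x' y') =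
    bilinear_ext (\<lambda>a b. linear_ext (\<lambda>c. linear_ext (G c) (bilinear_ext F' x' y')) (F a b)) x y"
    unfolding bilinear_ext_linear_ext[of G]
    by (rule linear_ext_bilinear_ext[OF assms(1)])
  also have "\<dots> = bilinear_ext (\<lambda>a b. bilinear_ext (\<lambda>a' b'. bilinear_ext G (F a b) (F' a' b')) x' y') x y"
  proof (rule bilinear_ext_cong)
    fix a b
    show "linear_ext (\<lambda>c. linear_ext (G c) (bilinear_ext F' x' y')) (F a b) =
      bilinear_ext (\<lambda>a' b'. bilinear_ext G (F a b) (F' a' b')) x' y'"
      unfolding bilinear_ext_linear_ext[of G, symmetric] unfolding bilinear_ext_flip[of G]
      by (rule linear_ext_bilinear_ext[OF assms(2)])
  qed
  finally show ?thesis .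
qed

text \<open>The middle interchange in a fourfold sum. Products of tensors group the factors as
  \<open>(x, x')\<close> and \<open>(y, y')\<close>, while products of glued strands group them as
  \<open>(x, y)\<close> and \<open>(x', y')\<close>.\<close>

lemma bilinear_ext_swap_args:
  "bilinear_ext (\<lambda>a b. bilinear_ext (\<lambda>a' b'. H a b a' b') x' y') x y =
    bilinear_ext (\<lambda>a a'. bilinear_ext (\<lambda>b b'. H a b a' b') y y') x x'"
  unfolding bilinear_ext_def formal.scale_sum_right formal.scale_scale
  by (rule sum.cong[OF refl], subst sum.swap) (simp add: mult_ac)

section \<open>Crossings\<close>

text \<open>Strands are abstracted to an index set \<open>I\<close>, with positions \<alpha> and
  \<beta> at two heights. The inversions of two factors and of their composite then become crossings
  of one family of strands between three heights, and can be compared as sets.\<close>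

definition crossings :: "'i set \<Rightarrow> ('i \<Rightarrow> 'a::linorder) \<Rightarrow> ('i \<Rightarrow> 'b::linorder) \<Rightarrow> ('i \<times> 'i) set"
  where "crossings I \<alpha> \<beta> = {(i, j). i \<in> I \<and> j \<in> I \<and> \<alpha> i < \<alpha> j \<and> \<beta> j < \<beta> i}"

text \<open>Pairs that cross between \<alpha> and \<beta> and cross back between \<beta> and
  \<gamma>: the obstruction to additivity of inversion numbers.\<close>

definition double_crossings ::
    "'i set \<Rightarrow> ('i \<Rightarrow> 'a::linorder) \<Rightarrow> ('i \<Rightarrow> 'b::linorder) \<Rightarrow> ('i \<Rightarrow> 'c::linorder) \<Rightarrow> ('i \<times> 'i) set"
  where "double_crossings I \<alpha> \<beta> \<gamma> =
    {(i, j). i \<in> I \<and> j \<in> I \<and> \<alpha> i < \<alpha> j \<and> \<beta> j < \<beta> i \<and> \<gamma> i < \<gamma> j}"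

text \<open>The crossings between the last two positions, as pairs that are sorted by the first position.\<close>

definition sorted_crossings ::
    "'i set \<Rightarrow> ('i \<Rightarrow> 'a::linorder) \<Rightarrow> ('i \<Rightarrow> 'b::linorder) \<Rightarrow> ('i \<Rightarrow> 'c::linorder) \<Rightarrow> ('i \<times> 'i) set"
  where "sorted_crossings I \<alpha> \<beta> \<gamma> =
    {(i, j). i \<in> I \<and> j \<in> I \<and> \<alpha> i < \<alpha> j \<and> (\<beta> i < \<beta> j \<longleftrightarrow> \<gamma> j < \<gamma> i)}"

lemma inversions_eq_crossings: "inversions f = crossings (dom f) id (\<lambda>x. the (f x))"
  by (simp add: inversions_def crossings_def)

lemma inv_num_eq_card: "inv_num f = card (crossings (dom f) id (\<lambda>x. the (f x)))"
  by (simp add: inv_num_def inversions_eq_crossings)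

lemma finite_crossings: "finite I \<Longrightarrow> finite (crossings I \<alpha> \<beta>)"
  by (rule finite_subset[of _ "I \<times> I"]) (auto simp: crossings_def)

lemma finite_inversions: "finite (dom f) \<Longrightarrow> finite (inversions f)"
  unfolding inversions_eq_crossings by (rule finite_crossings)

definition sort_pair :: "('i \<Rightarrow> 'a::linorder) \<Rightarrow> 'i \<times> 'i \<Rightarrow> 'i \<times> 'i"
  where "sort_pair \<alpha> = (\<lambda>(i, j). if \<alpha> i < \<alpha> j then (i, j) else (j, i))"

text \<open>A crossing between \<beta> and \<gamma> is recorded in the order of \<beta>. Sorting by
  \<alpha> loses nothing, because sorting by \<beta> restores the pair. Injectivity makes distinct
  strands comparable at all three heights.\<close>

lemma bij_betw_sort_pair:
  assumes "inj_on \<alpha> I" "inj_on \<beta> I" "inj_on \<gamma> I"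
  shows "bij_betw (sort_pair \<alpha>) (crossings I \<beta> \<gamma>) (sorted_crossings I \<alpha> \<beta> \<gamma>)"
proof -
  have lt: "\<alpha> i < \<alpha> j \<or> \<alpha> j < \<alpha> i" "\<beta> i < \<beta> j \<or> \<beta> j < \<beta> i" "\<gamma> i < \<gamma> j \<or> \<gamma> j < \<gamma> i"
    if "i \<in> I" "j \<in> I" "i \<noteq> j" for i j
    using assms that by (meson inj_on_eq_iff linorder_neqE)+
  have 1: "sort_pair \<beta> (sort_pair \<alpha> p) = p \<and> sort_pair \<alpha> p \<in> sorted_crossings I \<alpha> \<beta> \<gamma>"
    if p: "p \<in> crossings I \<beta> \<gamma>" for p
  proof -
    obtain i j where ij: "p = (i, j)" "i \<in> I" "j \<in> I" "\<beta> i < \<beta> j" "\<gamma> j < \<gamma> i"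
      using p by (cases p) (auto simp: crossings_def)
    then have "i \<noteq> j" by auto
    then show ?thesis
      using ij lt(1)[of i j] by (auto simp: sort_pair_def sorted_crossings_def)
  qed
  have 2: "sort_pair \<alpha> (sort_pair \<beta> p) = p \<and> sort_pair \<beta> p \<in> crossings I \<beta> \<gamma>"
    if p: "p \<in> sorted_crossings I \<alpha> \<beta> \<gamma>" for p
  proof -
    obtain i j where ij: "p = (i, j)" "i \<in> I" "j \<in> I" "\<alpha> i < \<alpha> j" "\<beta> i < \<beta> j \<longleftrightarrow> \<gamma> j < \<gamma> i"
      using p by (cases p) (auto simp: sorted_crossings_def)
    then have "i \<noteq> j" by auto
    then show ?thesis
      using ij lt(2,3)[of i j] by (auto simp: sort_pair_def crossings_def)
  qed
  show ?thesis
    by (rule bij_betw_byWitness[where f' = "sort_pair \<beta>"]) (use 1 2 in blast)+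
qed

text \<open>The order of two strands differs at \<alpha> and \<gamma> iff it changes exactly once on
  the way through \<beta>. If it changes twice, the pair is a double crossing.\<close>

lemma crossings_symmetric_difference:
  assumes "inj_on \<alpha> I" "inj_on \<beta> I" "inj_on \<gamma> I"
  shows "p \<in> crossings I \<alpha> \<gamma> \<longleftrightarrow> (p \<in> crossings I \<alpha> \<beta> \<longleftrightarrow> p \<notin> sorted_crossings I \<alpha> \<beta> \<gamma>)"
    and "crossings I \<alpha> \<beta> \<inter> sorted_crossings I \<alpha> \<beta> \<gamma> = double_crossings I \<alpha> \<beta> \<gamma>"
proof -
  obtain i j where p: "p = (i, j)" by (cases p)
  have "\<beta> i \<noteq> \<beta> j" "\<gamma> i \<noteq> \<gamma> j" if "i \<in> I" "j \<in> I" "\<alpha> i < \<alpha> j"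
    using assms(2,3) that by (auto dest: inj_onD)
  then show "p \<in> crossings I \<alpha> \<gamma> \<longleftrightarrow> (p \<in> crossings I \<alpha> \<beta> \<longleftrightarrow> p \<notin> sorted_crossings I \<alpha> \<beta> \<gamma>)"
    unfolding p crossings_def sorted_crossings_def by auto
next
  have "\<beta> i \<noteq> \<beta> j" "\<gamma> i \<noteq> \<gamma> j" if "i \<in> I" "j \<in> I" "\<alpha> i < \<alpha> j" for i j
    using assms(2,3) that by (auto dest: inj_onD)
  then have "\<not> \<gamma> j < \<gamma> i \<longleftrightarrow> \<gamma> i < \<gamma> j" if "i \<in> I" "j \<in> I" "\<alpha> i < \<alpha> j" for i j
    using that by (meson linorder_neqE order_less_asym)
  then show "crossings I \<alpha> \<beta> \<inter> sorted_crossings I \<alpha> \<beta> \<gamma> = double_crossings I \<alpha> \<beta> \<gamma>"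
    unfolding crossings_def sorted_crossings_def double_crossings_def
    by (auto dest: order_less_asym)
qed

text \<open>With A and B the crossings of the two halves and D their common part, |A - D| + |B - D|
  + 2|D| = |A| + |B|. The subadditivity of inversion numbers under actions, products and gluing, and
  each criterion for equality, are instances of this count.\<close>

lemma card_crossings:
  assumes "finite I" "inj_on \<alpha> I" "inj_on \<beta> I" "inj_on \<gamma> I"
  shows "card (crossings I \<alpha> \<gamma>) + 2 * card (double_crossings I \<alpha> \<beta> \<gamma>) =
    card (crossings I \<alpha> \<beta>) + card (crossings I \<beta> \<gamma>)"
proof -
  let ?ab = "crossings I \<alpha> \<beta>" and ?ac = "crossings I \<alpha> \<gamma>"
    and ?bc = "sorted_crossings I \<alpha> \<beta> \<gamma>" and ?d = "double_crossings I \<alpha> \<beta> \<gamma>"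
  have fin: "finite ?ab" "finite ?bc" "finite ?d" "finite ?ac"
    by (rule finite_subset[of _ "I \<times> I"];
        use assms(1) in \<open>force simp: crossings_def sorted_crossings_def double_crossings_def\<close>)+
  have d: "?d = ?ab \<inter> ?bc"
    by (rule crossings_symmetric_difference(2)[OF assms(2-4), symmetric])
  have ac: "?ac = (?ab - ?d) \<union> (?bc - ?d)"
    unfolding d using crossings_symmetric_difference(1)[OF assms(2-4)] by blast
  have "card ?ac = card (?ab - ?d) + card (?bc - ?d)"
    unfolding ac using fin d by (intro card_Un_disjoint) auto
  moreover have "card (?ab - ?d) + card ?d = card ?ab" "card (?bc - ?d) + card ?d = card ?bc"
    using fin d card_mono[of ?ab ?d] card_mono[of ?bc ?d] by (auto simp: card_Diff_subset)
  moreover have "card ?bc = card (crossings I \<beta> \<gamma>)"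
    using bij_betw_same_card[OF bij_betw_sort_pair[OF assms(2-4)]] by simp
  ultimately show ?thesis by simp
qed

text \<open>Used to recognise the crossings between two heights as the inversions of a smaller map:
  strands outside \<open>J\<close> take no part in a crossing, and \<open>e\<close> carries those in
  \<open>J\<close> to positions of that map.\<close>

lemma bij_betw_crossings:
  assumes "J \<subseteq> I" "bij_betw e J D"
    and "\<And>i j. i \<in> I \<Longrightarrow> j \<in> I \<Longrightarrow> \<alpha> i < \<alpha> j \<Longrightarrow> \<beta> j < \<beta> i \<Longrightarrow> i \<in> J \<and> j \<in> J"
    and "\<And>i j. i \<in> J \<Longrightarrow> j \<in> J \<Longrightarrow>
      \<alpha> i < \<alpha> j \<and> \<beta> j < \<beta> i \<longleftrightarrow> \<alpha>' (e i) < \<alpha>' (e j) \<and> \<beta>' (e j) < \<beta>' (e i)"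
  shows "bij_betw (map_prod e e) (crossings I \<alpha> \<beta>) (crossings D \<alpha>' \<beta>')"
proof -
  have "crossings I \<alpha> \<beta> \<subseteq> J \<times> J" using assms(3) by (auto simp: crossings_def)
  moreover have "inj_on (map_prod e e) (J \<times> J)"
    using assms(2) by (auto simp: bij_betw_def intro!: map_prod_inj_on)
  moreover have "map_prod e e ` crossings I \<alpha> \<beta> = crossings D \<alpha>' \<beta>'"
  proof
    show "map_prod e e ` crossings I \<alpha> \<beta> \<subseteq> crossings D \<alpha>' \<beta>'"
    proof
      fix q assume "q \<in> map_prod e e ` crossings I \<alpha> \<beta>"
      then obtain i j where ij: "q = (e i, e j)" "i \<in> I" "j \<in> I" "\<alpha> i < \<alpha> j" "\<beta> j < \<beta> i"
        by (auto simp: crossings_def)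
      then have "i \<in> J" "j \<in> J" using assms(3) by blast+
      then show "q \<in> crossings D \<alpha>' \<beta>'"
        using ij assms(4)[of i j] bij_betwE[OF assms(2)] by (simp add: crossings_def)
    qed
    show "crossings D \<alpha>' \<beta>' \<subseteq> map_prod e e ` crossings I \<alpha> \<beta>"
    proof
      fix q assume q: "q \<in> crossings D \<alpha>' \<beta>'"
      then obtain i j where ij: "q = (e i, e j)" "i \<in> J" "j \<in> J"
        using assms(2) by (auto simp: crossings_def bij_betw_def)
      then have "(i, j) \<in> crossings I \<alpha> \<beta>"
        using q assms(1) assms(4)[of i j] by (auto simp: crossings_def)
      then show "q \<in> map_prod e e ` crossings I \<alpha> \<beta>" using ij by force
    qed
  qed
  ultimately show ?thesis unfolding bij_betw_def by (meson inj_on_subset)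
qed

text \<open>The signs reverse both orders, as the points t_p and b_p are ordered by decreasing
  label, and \<open>prod.swap\<close> compensates for this in the pairs. A label outside
  \<open>{1..m}\<close> is fixed by \<open>w\<close> and takes part in no inversion.\<close>

lemma perm_length_eq_card:
  assumes "w permutes {1..m}"
  shows "perm_length w = card (crossings {1..m} (\<lambda>p. - int p) (\<lambda>p. - int (w p)))"
proof -
  have "bij_betw prod.swap {(i, j). i < j \<and> w j < w i}
      (crossings {1..m} (\<lambda>p. - int p) (\<lambda>p. - int (w p)))"
  proof (rule bij_betw_byWitness[where f' = prod.swap])
    have "i \<in> {1..m} \<and> j \<in> {1..m}" if ij: "i < j" "w j < w i" for i j
    proof -
      have m: "w p \<in> {1..m} \<longleftrightarrow> p \<in> {1..m}" for p using permutes_in_image[OF assms] .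
      have n: "p \<notin> {1..m} \<Longrightarrow> w p = p" for p using assms by (simp add: permutes_def)
      show ?thesis
        using ij m[of i] m[of j] n[of i] n[of j] by (cases "i \<in> {1..m}"; cases "j \<in> {1..m}") auto
    qed
    then show "prod.swap ` {(i, j). i < j \<and> w j < w i} \<subseteq> crossings {1..m} (\<lambda>p. - int p) (\<lambda>p. - int (w p))"
      by (force simp: crossings_def)
  qed (auto simp: crossings_def)
  then show ?thesis unfolding perm_length_def by (rule bij_betw_same_card)
qed

section \<open>Exchanging the values at an inverted pair\<close>

lemma exchange_eq_comp: "exchange f (x, y) = f \<circ> transpose x y"
  by (auto simp: exchange_def transpose_def fun_eq_iff)

lemma exchange_commute: "exchange f (x, y) = exchange f (y, x)"
  by (simp add: exchange_eq_comp transpose_commute)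

lemma dom_exchange [simp]: "x \<in> dom f \<Longrightarrow> y \<in> dom f \<Longrightarrow> dom (exchange f (x, y)) = dom f"
  by (auto simp: exchange_def)

lemma ran_exchange [simp]: "ran (exchange f (x, y)) = ran f"
proof -
  have "f a = (f \<circ> transpose x y) (transpose x y a)" for a by simp
  then show ?thesis unfolding exchange_eq_comp ran_def by (metis (no_types, lifting) comp_apply)
qed

lemma inj_on_exchange:
  assumes "inj_on f (dom f)" "x \<in> dom f" "y \<in> dom f"
  shows "inj_on (exchange f (x, y)) (dom (exchange f (x, y)))"
proof (rule inj_onI)
  fix a b
  let ?t = "transpose x y"
  assume "a \<in> dom (exchange f (x, y))" "b \<in> dom (exchange f (x, y))"
    "exchange f (x, y) a = exchange f (x, y) b"
  then have "?t a \<in> dom f" "?t b \<in> dom f" "f (?t a) = f (?t b)"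
    by (auto simp: exchange_eq_comp)
  then show "a = b" using assms(1) by (metis inj_onD transpose_involutory)
qed

lemma inj_on_the: "inj_on f (dom f) \<Longrightarrow> inj_on (\<lambda>x. the (f x)) (dom f)"
  by (rule inj_onI) (metis domIff inj_onD option.expand)

text \<open>There is an injection \<phi> from the crossings of the exchanged map to those of
  \<open>F\<close>: it swaps the names \<open>x\<close> and \<open>y\<close> in a pair whenever the
  pair stays sorted. It misses \<open>(x, y)\<close>. Each \<open>z\<close> in \<open>R\<close>
  crosses both \<open>x\<close> and \<open>y\<close>, and the exchange removes these crossings as
  well.\<close>

lemma card_crossings_transpose:
  fixes F :: "'a::linorder \<Rightarrow> 'b::linorder"
  assumes fin: "finite D" and inj: "inj_on F D" and xy: "x \<in> D" "y \<in> D" "x < y" "F y < F x"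
  defines "G \<equiv> \<lambda>a. F (transpose x y a)"
  defines "R \<equiv> {z \<in> D. x < z \<and> z < y \<and> F y < F z \<and> F z < F x}"
  shows "card (crossings D id G) < card (crossings D id F)"
    and "card (crossings D id F) = card (crossings D id G) + 1 \<longleftrightarrow> R = {}"
proof -
  define \<phi> where "\<phi> = (\<lambda>(a, b). let a' = transpose x y a; b' = transpose x y b in
    if a' < b' then (a', b') else (a, b))"
  let ?f = "crossings D id F" and ?g = "crossings D id G"
  have ne: "F a \<noteq> F b" if "a \<in> D" "b \<in> D" "a \<noteq> b" for a b
    using inj that by (auto dest: inj_onD)
  have D: "transpose x y a \<in> D \<longleftrightarrow> a \<in> D" for a
    using xy by (auto simp: transpose_def)
  have inj\<phi>: "inj_on \<phi> ?g"
  proof (rule inj_onI)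
    fix p q assume "p \<in> ?g" "q \<in> ?g" "\<phi> p = \<phi> q"
    moreover obtain a b c d where "p = (a, b)" "q = (c, d)" by (cases p; cases q)
    ultimately show "p = q"
      by (auto simp: \<phi>_def crossings_def Let_def split: if_splits) (metis transpose_involutory)+
  qed
  have into: "\<phi> p \<in> ?f - {(x, y)}" if p: "p \<in> ?g" for p
  proof -
    obtain a b where ab: "p = (a, b)" "a < b" "a \<in> D" "b \<in> D" "G b < G a"
      using p by (cases p) (auto simp: crossings_def)
    consider "a = x" "b = y" | "a = x" "b \<noteq> y" "b \<noteq> x" | "a = y" "b \<noteq> x" "b \<noteq> y"
      | "b = x" "a \<noteq> y" "a \<noteq> x" | "b = y" "a \<noteq> x" "a \<noteq> y"
      | "a \<noteq> x" "a \<noteq> y" "b \<noteq> x" "b \<noteq> y"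
      using ab(2) xy(3) by (metis order_less_asym order_less_irrefl)
    then show ?thesis using xy ab
      by cases (auto simp: \<phi>_def crossings_def Let_def G_def)
  qed
  have fin': "finite ?f" "finite ?g" using fin by (auto intro: finite_crossings)
  have xyf: "(x, y) \<in> ?f" using xy by (simp add: crossings_def)
  have "card ?g = card (\<phi> ` ?g)" using inj\<phi> by (simp add: card_image)
  also have "\<dots> \<le> card (?f - {(x, y)})" using into fin' by (intro card_mono image_subsetI) auto
  also have "\<dots> < card ?f" using xyf fin' by (intro psubset_card_mono) auto
  finally show "card ?g < card ?f" .
  have "\<phi> ` ?g = ?f - {(x, y)}" if "R = {}"
  proof -
    have "p \<in> \<phi> ` ?g" if p: "p \<in> ?f - {(x, y)}" for p
    proof -
      obtain a b where ab: "p = (a, b)" "a < b" "a \<in> D" "b \<in> D" "F b < F a" "a = x \<longrightarrow> b \<noteq> y"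
        using p by (cases p) (auto simp: crossings_def)
      have r: "\<not> (x < z \<and> z < y \<and> F y < F z \<and> F z < F x)" if "z \<in> D" for z
        using \<open>R = {}\<close> that by (auto simp: R_def)
      consider "a = x" "b \<noteq> y" "b \<noteq> x" | "a = y" "b \<noteq> x" "b \<noteq> y"
        | "b = x" "a \<noteq> y" "a \<noteq> x" | "b = y" "a \<noteq> x" "a \<noteq> y"
        | "a \<noteq> x" "a \<noteq> y" "b \<noteq> x" "b \<noteq> y"
        using ab(2,6) xy(3) by (metis order_less_asym order_less_irrefl)
      \<comment> \<open>Without an intermediate strand \<phi> undoes itself, so it reaches every
        crossing of \<open>F\<close> other than \<open>(x, y)\<close>.\<close>
      then have "\<phi> (\<phi> p) = p \<and> \<phi> p \<in> ?g"
        using ab(1-5) xy r[of a] r[of b] ne[of a x] ne[of a y] ne[of b x] ne[of b y]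
        by cases (auto simp: \<phi>_def crossings_def Let_def G_def)
      then show ?thesis by (metis image_eqI)
    qed
    moreover have "\<phi> ` ?g \<subseteq> ?f - {(x, y)}" using into by (rule image_subsetI)
    ultimately show ?thesis by (meson subset_antisym subsetI)
  qed
  then have "card ?f = card ?g + 1" if "R = {}"
    using that xyf fin' card_image[OF inj\<phi>] card_Suc_Diff1[of ?f "(x, y)"] by simp
  \<comment> \<open>An intermediate strand \<open>z\<close> provides a second crossing
    \<open>(x, z)\<close> that \<phi> misses.\<close>
  moreover have "card ?g + 1 < card ?f" if "z \<in> R" for z
  proof -
    have z: "(x, z) \<in> ?f" "z \<noteq> y" "x \<noteq> z" using that xy by (auto simp: R_def crossings_def)
    have "\<phi> p \<noteq> (x, z)" if "p \<in> ?g" for p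
    proof
      assume p: "\<phi> p = (x, z)"
      obtain a b where "p = (a, b)" by (cases p)
      with p that \<open>z \<in> R\<close> have "a = x \<and> b = z \<or> transpose x y a = x \<and> transpose x y b = z"
        by (auto simp: \<phi>_def Let_def split: if_splits)
      then have "a = x \<and> b = z \<or> a = y \<and> b = z"
        using z(2,3) by (metis transpose_apply_other transpose_apply_second transpose_involutory)
      then show False
        using that \<open>z \<in> R\<close> \<open>p = (a, b)\<close> z(2,3) by (auto simp: crossings_def R_def G_def)
    qed
    then have "\<phi> ` ?g \<subseteq> ?f - {(x, y), (x, z)}" using into by (intro image_subsetI) simp
    then have "card ?g \<le> card (?f - {(x, y), (x, z)})"
      using fin' card_image[OF inj\<phi>] card_mono[of "?f - {(x, y), (x, z)}" "\<phi> ` ?g"] by auto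
    moreover have "card (?f - {(x, y), (x, z)}) = card ?f - 2"
      using z xyf fin' by (subst card_Diff_subset) auto
    moreover have "2 \<le> card ?f"
      using z xyf fin' card_mono[of ?f "{(x, y), (x, z)}"] by auto
    ultimately show ?thesis by linarith
  qed
  ultimately show "card ?f = card ?g + 1 \<longleftrightarrow> R = {}" by (metis all_not_in_conv less_irrefl)
qed

text \<open>No strand may pass between the two exchanged ones. This is the familiar criterion for
  covering relations in the Bruhat order.\<close>

lemma inversions_exchange:
  assumes "finite (dom f)" "inj_on f (dom f)" "(x, y) \<in> inversions f"
  shows "inv_num (exchange f (x, y)) < inv_num f"
    and "inv_num f = inv_num (exchange f (x, y)) + 1 \<longleftrightarrow>
      \<not> (\<exists>z \<in> dom f. x < z \<and> z < y \<and> the (f y) < the (f z) \<and> the (f z) < the (f x))"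
proof -
  have xy: "x \<in> dom f" "y \<in> dom f" "x < y" "the (f y) < the (f x)"
    using assms(3) by (auto simp: inversions_def)
  note * = card_crossings_transpose[OF assms(1) inj_on_the[OF assms(2)] xy]
  have "dom (exchange f (x, y)) = dom f" using xy(1,2) by simp
  then have e: "inv_num (exchange f (x, y)) =
      card (crossings (dom f) id (\<lambda>a. the (f (transpose x y a))))"
    by (simp add: inv_num_eq_card exchange_eq_comp)
  show "inv_num (exchange f (x, y)) < inv_num f"
    using *(1) unfolding e inv_num_eq_card[of f] .
  show "inv_num f = inv_num (exchange f (x, y)) + 1 \<longleftrightarrow>
      \<not> (\<exists>z \<in> dom f. x < z \<and> z < y \<and> the (f y) < the (f z) \<and> the (f z) < the (f x))"
    using *(2) unfolding e inv_num_eq_card[of f] by auto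
qed

section \<open>Fixed strands in a matching\<close>

text \<open>The maps \<open>ia\<close> and \<open>ib\<close> embed the marked points into the
  ordered source and target. They are \<open>id\<close> and \<open>TPt\<close> for tops,
  \<open>BPt\<close> and \<open>id\<close> for bottoms, and \<open>id\<close> twice for the matching
  algebra, so that one development covers all three.\<close>

definition fixed_points :: "(nat \<Rightarrow> 'a) \<Rightarrow> (nat \<Rightarrow> 'b) \<Rightarrow> ('a \<rightharpoonup> 'b) \<Rightarrow> nat set"
  where "fixed_points ia ib f = {s. f (ia s) = Some (ib s)}"

definition fixed_strands :: "(nat \<Rightarrow> 'a) \<Rightarrow> (nat \<Rightarrow> 'b) \<Rightarrow> nat set \<Rightarrow> ('a \<rightharpoonup> 'b)"
  where "fixed_strands ia ib S = (\<lambda>x. if x \<in> ia ` S then Some (ib (the_inv ia x)) else None)"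

definition moving :: "(nat \<Rightarrow> 'a) \<Rightarrow> (nat \<Rightarrow> 'b) \<Rightarrow> ('a \<rightharpoonup> 'b) \<Rightarrow> ('a \<rightharpoonup> 'b)"
  where "moving ia ib f = f |` (- ia ` fixed_points ia ib f)"

definition replace_fixed ::
    "(nat \<Rightarrow> 'a) \<Rightarrow> (nat \<Rightarrow> 'b) \<Rightarrow> nat set \<Rightarrow> nat set \<Rightarrow> ('a \<rightharpoonup> 'b) \<Rightarrow> ('a \<rightharpoonup> 'b)"
  where "replace_fixed ia ib S S' f =
    fixed_strands ia ib (fixed_points ia ib f - S \<union> S') ++ moving ia ib f"

lemma fixed_strands_apply:
  assumes "inj ia"
  shows "fixed_strands ia ib S (ia i) = (if i \<in> S then Some (ib i) else None)"
  using assms by (auto simp: fixed_strands_def the_inv_f_f inj_image_mem_iff)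

lemma fixed_strands_eq_None: "x \<notin> ia ` S \<Longrightarrow> fixed_strands ia ib S x = None"
  by (simp add: fixed_strands_def)

lemma finite_sections: "finite (sections Z h)"
  by (rule finite_subset[of _ "Pow (points Z)"]) (auto simp: sections_def)

text \<open>Each pair contains a point, so a section can be chosen pair by pair. Hence no basis
  element is an empty sum.\<close>

lemma sections_nonempty:
  assumes "two_to_one Z" "h \<subseteq> pairs Z"
  shows "sections Z h \<noteq> {}"
proof -
  have "\<exists>i. i \<in> points Z \<and> pair_of Z i = j" if "j \<in> h" for j
  proof -
    have "card {i \<in> points Z. pair_of Z i = j} = 2"
      using assms that unfolding two_to_one_def by blast
    then show ?thesis by (metis (mono_tags, lifting) card.empty empty_Collect_eq zero_neq_numeral)
  qed
  then obtain e where e: "\<And>j. j \<in> h \<Longrightarrow> e j \<in> points Z \<and> pair_of Z (e j) = j" by metis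
  then have "e ` h \<in> sections Z h"
    unfolding sections_def by (auto intro!: bij_betw_byWitness[where f' = e])
  then show ?thesis by blast
qed

text \<open>\<open>A\<close> holds the entries b_p at the bottom and \<open>B\<close> the exits t_p
  at the top; each is empty where it does not occur. The order assumptions put entries below and
  exits above all marked points, so a strand that uses one of them goes upward like the
  others.\<close>

locale matched_strands =
  fixes ia :: "nat \<Rightarrow> 'a::linorder" and ib :: "nat \<Rightarrow> 'b::linorder"
    and Z :: matching and A :: "'a set" and B :: "'b set"
  assumes mono: "strict_mono ia" "strict_mono ib"
    and finite_ends: "finite A" "finite B"
    and below: "\<And>a s. a \<in> A \<Longrightarrow> a < ia s"
    and above: "\<And>b s. b \<in> B \<Longrightarrow> ib s < b"
    and two: "two_to_one Z"
begin

abbreviation "M \<equiv> pair_of Z"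
abbreviation "fp \<equiv> fixed_points ia ib"
abbreviation "fs \<equiv> fixed_strands ia ib"
abbreviation "mv \<equiv> moving ia ib"
abbreviation "rp \<equiv> replace_fixed ia ib"
abbreviation "src f \<equiv> {i. ia i \<in> dom f}"
abbreviation "tgt f \<equiv> {j. ib j \<in> ran f}"

definition strs :: "('a \<rightharpoonup> 'b) set"
  where "strs = {f. A \<subseteq> dom f \<and> dom f \<subseteq> ia ` points Z \<union> A \<and>
    B \<subseteq> ran f \<and> ran f \<subseteq> ib ` points Z \<union> B \<and>
    inj_on f (dom f) \<and> (\<forall>i j. f (ia i) = Some (ib j) \<longrightarrow> i \<le> j)}"

text \<open>These are the strands that occur as summands of basis elements: by
  \<open>combine\<close> and \<open>cls_mem\<close> each consists of moving strands and of fixed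
  strands over a section.\<close>

definition mstrs :: "('a \<rightharpoonup> 'b) set"
  where "mstrs = {f \<in> strs. inj_on M (src f) \<and> inj_on M (tgt f)}"

definition data :: "(('a \<rightharpoonup> 'b) \<times> nat set) set"
  where "data = {(f, h). A \<subseteq> dom f \<and> dom f \<subseteq> ia ` points Z \<union> A \<and>
    B \<subseteq> ran f \<and> ran f \<subseteq> ib ` points Z \<union> B \<and> inj_on f (dom f) \<and>
    (\<forall>i j. f (ia i) = Some (ib j) \<longrightarrow> i < j) \<and>
    inj_on M (src f) \<and> inj_on M (tgt f) \<and>
    h \<subseteq> pairs Z \<and> h \<inter> M ` src f = {} \<and> h \<inter> M ` tgt f = {}}"

definition basis :: "('a \<rightharpoonup> 'b) \<times> nat set \<Rightarrow> ('a \<rightharpoonup> 'b) \<Rightarrow> 'k::field"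
  where "basis = (\<lambda>(f, h). \<Sum>S\<in>sections Z h. single (fs S ++ f))"

text \<open>Two strands of \<open>mstrs\<close> are summands of the same basis element iff they have
  the same moving part and fixed strands over the same pairs.\<close>

definition cls :: "('a \<rightharpoonup> 'b) \<Rightarrow> ('a \<rightharpoonup> 'b) \<times> nat set"
  where "cls f = (mv f, M ` fp f)"

lemma inj: "inj ia" "inj ib"
  using mono strict_mono_imp_inj_on by blast+

lemma eq_iff [simp]: "ia i = ia j \<longleftrightarrow> i = j" "ib i = ib j \<longleftrightarrow> i = j"
  using inj by (auto dest: injD)

lemma less_iff [simp]: "ia i < ia j \<longleftrightarrow> i < j" "ib i < ib j \<longleftrightarrow> i < j"
  "ia i \<le> ia j \<longleftrightarrow> i \<le> j" "ib i \<le> ib j \<longleftrightarrow> i \<le> j"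
  using mono by (simp_all add: strict_mono_less strict_mono_less_eq)

lemma not_end: "ia i \<notin> A" "ib i \<notin> B"
  using below above by blast+

lemma fs_apply [simp]: "fs S (ia i) = (if i \<in> S then Some (ib i) else None)"
  by (rule fixed_strands_apply[OF inj(1)])

lemma fs_end: "x \<notin> range ia \<Longrightarrow> fs S x = None"
  by (rule fixed_strands_eq_None) auto

lemma finite_dom: "f \<in> strs \<Longrightarrow> finite (dom f)"
  using finite_ends(1) by (auto simp: strs_def intro: finite_subset)

lemma strs_cases:
  assumes "f \<in> strs" "f x = Some y"
  obtains i j where "x = ia i" "y = ib j" "i \<le> j" "i \<in> points Z" "j \<in> points Z"
  | i where "x = ia i" "y \<in> B" "i \<in> points Z"
  | j where "x \<in> A" "y = ib j" "j \<in> points Z"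
  | "x \<in> A" "y \<in> B"
proof -
  have "x \<in> ia ` points Z \<union> A" "y \<in> ib ` points Z \<union> B"
    using assms by (auto simp: strs_def ran_def)
  then show thesis using that assms by (force simp: strs_def)
qed

text \<open>Entries and exits cause no exception, since they lie below and above all marked points.
  As a consequence, what is to the right of a fixed strand stays to its right, which rules out
  double crossings with fixed strands.\<close>

lemma upward:
  assumes "f \<in> strs" "f x = Some y"
  shows "ia s \<le> x \<Longrightarrow> ib s \<le> y" "ia s < x \<Longrightarrow> ib s < y"
proof -
  have A: False if "ia s \<le> x" "x \<in> A" using below[OF that(2), of s] that(1) by simp
  from strs_cases[OF assms] show "ib s \<le> y" if "ia s \<le> x"
  proof cases
    case (2 i)
    then show ?thesis using above[of y s] by simp
  qed (use A that in auto)
  from strs_cases[OF assms] show "ib s < y" if "ia s < x"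
  proof cases
    case (2 i)
    then show ?thesis using above[of y s] by simp
  qed (use A less_imp_le[OF that] that in auto)
qed

lemma finite_strs: "finite strs"
proof -
  have "strs \<subseteq> (\<Union>D\<in>Pow (ia ` points Z \<union> A). {f. dom f = D \<and> ran f \<subseteq> ib ` points Z \<union> B})"
    by (auto simp: strs_def)
  moreover have "finite \<dots>"
    using finite_ends by (intro finite_UN_I finite_set_of_finite_maps) (auto intro: finite_subset)
  ultimately show ?thesis by (rule finite_subset)
qed

lemma mv_apply: "mv f (ia i) = (if i \<in> fp f then None else f (ia i))"
  by (auto simp: moving_def restrict_map_def)

lemma mv_end: "x \<notin> range ia \<Longrightarrow> mv f x = f x"
  by (auto simp: moving_def restrict_map_def)

lemma fp_mem: "s \<in> fp f \<longleftrightarrow> f (ia s) = Some (ib s)"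
  by (simp add: fixed_points_def)

lemma fs_mv: "fs (fp f) ++ mv f = f"
proof
  fix x show "(fs (fp f) ++ mv f) x = f x"
    by (cases "x \<in> range ia") (auto simp: map_add_def mv_apply fp_mem mv_end fs_end split: option.splits if_splits)
qed

lemma dataD:
  assumes "(f, h) \<in> data"
  shows "f \<in> strs" "\<And>i j. f (ia i) = Some (ib j) \<Longrightarrow> i < j"
    "inj_on M (src f)" "inj_on M (tgt f)" "h \<subseteq> pairs Z" "h \<inter> M ` src f = {}" "h \<inter> M ` tgt f = {}"
  using assms by (auto simp: data_def strs_def intro: less_imp_le)

lemma dataI:
  assumes "f \<in> strs" "\<And>i j. f (ia i) = Some (ib j) \<Longrightarrow> i < j"
    "inj_on M (src f)" "inj_on M (tgt f)" "h \<subseteq> pairs Z" "h \<inter> M ` src f = {}" "h \<inter> M ` tgt f = {}"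
  shows "(f, h) \<in> data"
  using assms by (auto simp: data_def strs_def)

lemma src_subset: "f \<in> strs \<Longrightarrow> src f \<subseteq> points Z"
  unfolding strs_def using not_end by fastforce

lemma strs_inj: "f \<in> strs \<Longrightarrow> f x = Some y \<Longrightarrow> f x' = Some y \<Longrightarrow> x = x'"
  unfolding strs_def inj_on_def by (metis (mono_tags, lifting) domI mem_Collect_eq)

text \<open>Since \<open>h\<close> avoids the pairs of the moving ends, a section over
  \<open>h\<close> shares no point with them and its fixed strands can be added freely. The strict
  inequality in \<open>data\<close> ensures that no moving strand counts as fixed.\<close>

lemma combine:
  assumes d: "(f, h) \<in> data" and S: "S \<in> sections Z h"
  shows "fs S ++ f \<in> mstrs" "fp (fs S ++ f) = S" "mv (fs S ++ f) = f"
    "src (fs S ++ f) = src f \<union> S" "tgt (fs S ++ f) = tgt f \<union> S"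
proof -
  let ?F = "fs S ++ f"
  note D = dataD[OF d]
  have S': "S \<subseteq> points Z" "inj_on M S" "M ` S = h"
    using S by (auto simp: sections_def bij_betw_def)
  have S1: "S \<inter> src f = {}" "S \<inter> tgt f = {}" using D(6,7) S'(3) by blast+
  have val: "?F (ia i) = (if i \<in> S then Some (ib i) else f (ia i))" for i
    using S1(1) by (auto simp: map_add_def split: option.splits)
  have vend: "?F x = f x" if "x \<notin> range ia" for x
    using that by (auto simp: map_add_def fs_end split: option.splits)
  have vf: "?F x = Some y" if "f x = Some y" for x y
    using that by (simp add: map_add_def)
  have vF: "(\<exists>i\<in>S. x = ia i \<and> y = ib i) \<or> f x = Some y" if "?F x = Some y" for x y
    using that val vend by (cases "x \<in> range ia") (auto split: if_splits)
  show fpF: "fp ?F = S"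
    using D(2) by (fastforce simp: fp_mem val split: if_splits)
  show "mv ?F = f"
  proof
    fix x show "mv ?F x = f x"
      using S1(1) by (cases "x \<in> range ia") (auto simp: mv_apply fpF val mv_end vend disjoint_iff domIff)
  qed
  show src: "src ?F = src f \<union> S" by (auto simp: val dom_def split: if_splits)
  have ran: "ran ?F = ran f \<union> ib ` S"
  proof
    show "ran ?F \<subseteq> ran f \<union> ib ` S"
    proof
      fix y assume "y \<in> ran ?F"
      then obtain x where "?F x = Some y" unfolding ran_def mem_Collect_eq by (elim exE)
      from vF[OF this] show "y \<in> ran f \<union> ib ` S" by (auto intro: ranI)
    qed
    show "ran f \<union> ib ` S \<subseteq> ran ?F"
    proof -
      have "ib s \<in> ran ?F" if "s \<in> S" for s
        using val[of s] that by (intro ranI[of _ "ia s"]) simp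
      moreover have "y \<in> ran ?F" if "y \<in> ran f" for y
        using that by (auto simp: ran_def[of f] intro: ranI vf)
      ultimately show ?thesis by blast
    qed
  qed
  then show tgt: "tgt ?F = tgt f \<union> S" by auto
  have dom: "dom ?F = dom f \<union> ia ` S"
    by (auto simp: map_add_def fixed_strands_def split: option.splits if_splits)
  have "inj_on ?F (dom ?F)"
  proof (rule inj_onI)
    fix x x' assume "x \<in> dom ?F" "?F x = ?F x'"
    then obtain y where y: "?F x = Some y" "?F x' = Some y" by (metis domD)
    have no: False if "f x = Some (ib i)" "i \<in> S" for x i
      using that S1(2) by (auto simp: ran_def)
    show "x = x'"
      using vF[OF y(1)] vF[OF y(2)] no strs_inj[OF D(1)] by auto
  qed
  moreover have "i \<le> j" if "?F (ia i) = Some (ib j)" for i j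
    using that D(2) by (auto simp: val less_imp_le split: if_splits)
  ultimately have "?F \<in> strs"
    using D(1) S'(1) dom ran unfolding strs_def by auto
  moreover have "inj_on M (src f \<union> S)" "inj_on M (tgt f \<union> S)"
    using D(3,4,6,7) S'(2,3) by (auto simp: inj_on_Un)
  ultimately show "?F \<in> mstrs" by (simp only: mstrs_def mem_Collect_eq src tgt)
qed

text \<open>The converse splitting. Without its fixed strands \<open>F\<close> is strictly
  increasing, and injectivity on pairs keeps the pairs of the removed strands apart from those of
  the remaining ends.\<close>

lemma cls_mem:
  assumes "F \<in> mstrs"
  shows "cls F \<in> data" "fp F \<in> sections Z (M ` fp F)"
proof -
  have F: "F \<in> strs" "inj_on M (src F)" "inj_on M (tgt F)" using assms by (auto simp: mstrs_def)
  have fp: "fp F \<subseteq> src F" "fp F \<subseteq> tgt F" by (auto simp: fp_mem ran_def)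
  then have pts: "fp F \<subseteq> points Z" using src_subset[OF F(1)] by blast
  then show "fp F \<in> sections Z (M ` fp F)"
    using F(2) fp by (auto simp: sections_def bij_betw_def intro: inj_on_subset)
  have sub: "F x = Some y" if "mv F x = Some y" for x y
    using that by (auto simp: moving_def restrict_map_def split: if_splits)
  have s: "src (mv F) = src F - fp F" by (auto simp: mv_apply dom_def)
  have dom: "dom (mv F) = dom F - ia ` fp F" by (auto simp: moving_def)
  have ran: "ran (mv F) = ran F - ib ` fp F"
  proof
    show "ran (mv F) \<subseteq> ran F - ib ` fp F"
    proof
      fix y assume "y \<in> ran (mv F)"
      then obtain x where x: "mv F x = Some y" by (auto simp: ran_def)
      have "y \<noteq> ib i" if "i \<in> fp F" for i
        using x sub[OF x] that strs_inj[OF F(1), of x y "ia i"] by (auto simp: fp_mem mv_apply)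
      then show "y \<in> ran F - ib ` fp F" using sub[OF x] by (auto simp: ran_def)
    qed
    show "ran F - ib ` fp F \<subseteq> ran (mv F)"
    proof
      fix y assume "y \<in> ran F - ib ` fp F"
      then obtain x where x: "F x = Some y" and y: "y \<notin> ib ` fp F" by (auto simp: ran_def)
      then have "i \<notin> fp F" if "x = ia i" for i using that by (auto simp: fp_mem)
      then have "mv F x = Some y" using x by (auto simp: moving_def restrict_map_def)
      then show "y \<in> ran (mv F)" by (rule ranI)
    qed
  qed
  then have t: "tgt (mv F) = tgt F - fp F" by auto
  have "inj_on (mv F) (dom (mv F))"
    by (rule inj_onI) (metis domD strs_inj[OF F(1)] sub)
  moreover have less: "i < j" if "mv F (ia i) = Some (ib j)" for i j
    using F(1) that sub[OF that] by (fastforce simp: strs_def mv_apply fp_mem split: if_splits)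
  moreover have "A \<subseteq> dom (mv F)" "B \<subseteq> ran (mv F)"
    using F(1) not_end unfolding dom ran by (auto simp: strs_def)
  moreover have "dom (mv F) \<subseteq> ia ` points Z \<union> A" "ran (mv F) \<subseteq> ib ` points Z \<union> B"
    using F(1) unfolding dom ran by (auto simp: strs_def)
  ultimately have "mv F \<in> strs" by (auto simp: strs_def intro: less_imp_le)
  moreover have "inj_on M (src (mv F))" "inj_on M (tgt (mv F))"
    unfolding s t using F(2,3) by (auto intro: inj_on_subset)
  moreover have "M ` fp F \<inter> M ` src (mv F) = {}" "M ` fp F \<inter> M ` tgt (mv F) = {}"
    unfolding s t using F(2,3) fp by (auto dest!: inj_onD)
  moreover have "M ` fp F \<subseteq> pairs Z" using pts two unfolding two_to_one_def by blast
  ultimately show "cls F \<in> data" unfolding cls_def using less by (intro dataI)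
qed

text \<open>The section that contributes \<open>F\<close> can only be the set of its fixed points.
  So a basis element is the indicator function of one class of \<open>cls\<close>, and different
  basis elements have disjoint supports.\<close>

lemma basis_apply:
  assumes "d \<in> data"
  shows "basis d F = (if F \<in> mstrs \<and> cls F = d then 1 else 0)"
proof -
  obtain f h where d: "d = (f, h)" by (cases d)
  have *: "F = fs S ++ f \<longleftrightarrow> F \<in> mstrs \<and> cls F = d \<and> S = fp F" if "S \<in> sections Z h" for S
  proof
    assume "F = fs S ++ f"
    then show "F \<in> mstrs \<and> cls F = d \<and> S = fp F"
      using combine[OF assms[unfolded d] that] that
      by (auto simp: cls_def d sections_def bij_betw_def)
  next
    assume "F \<in> mstrs \<and> cls F = d \<and> S = fp F"
    then show "F = fs S ++ f" using fs_mv[of F] by (simp add: cls_def d)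
  qed
  have "basis d F = (\<Sum>S\<in>sections Z h. if F \<in> mstrs \<and> cls F = d \<and> S = fp F then 1 else 0)"
  proof -
    have "basis d F = (\<Sum>S\<in>sections Z h. if F = fs S ++ f then 1 else 0)"
      by (simp add: d basis_def sum_fun_apply single_apply)
    also have "\<dots> = (\<Sum>S\<in>sections Z h. if F \<in> mstrs \<and> cls F = d \<and> S = fp F then 1 else 0)"
      by (intro sum.cong refl) (simp only: *)
    finally show ?thesis .
  qed
  also have "\<dots> = (if F \<in> mstrs \<and> cls F = d then 1 else 0)"
  proof (cases "F \<in> mstrs \<and> cls F = d")
    case True
    then have "fp F \<in> sections Z h" using cls_mem(2)[of F] by (simp add: cls_def d)
    then show ?thesis using True finite_sections[of Z h] by simp
  qed auto
  finally show ?thesis .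
qed

lemma mstrs_of_data:
  assumes "d \<in> data"
  obtains F where "F \<in> mstrs" "cls F = d"
proof -
  obtain f h where d: "d = (f, h)" by (cases d)
  have "sections Z h \<noteq> {}"
    using dataD(5)[OF assms[unfolded d]] by (rule sections_nonempty[OF two])
  then obtain S where "S \<in> sections Z h" by blast
  then show thesis using that[of "fs S ++ f"] combine[of f h S] assms
    by (auto simp: cls_def d sections_def bij_betw_def)
qed

text \<open>Evaluation at \<open>rep d\<close> is the coordinate function of the basis element with
  datum \<open>d\<close>.\<close>

definition rep :: "('a \<rightharpoonup> 'b) \<times> nat set \<Rightarrow> ('a \<rightharpoonup> 'b)"
  where "rep d = (SOME F. F \<in> mstrs \<and> cls F = d)"

lemma rep: "d \<in> data \<Longrightarrow> rep d \<in> mstrs \<and> cls (rep d) = d"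
  unfolding rep_def
  by (elim mstrs_of_data, rule someI_ex[of "\<lambda>F. F \<in> mstrs \<and> cls F = d"]) blast

lemma basis_rep: "d \<in> data \<Longrightarrow> d' \<in> data \<Longrightarrow> basis d (rep d') = (if d = d' then 1 else 0)"
  using rep[of d'] by (auto simp: basis_apply)

lemma finite_mstrs: "finite mstrs"
  using finite_strs by (simp add: mstrs_def)

lemma finite_data: "finite data"
proof -
  have "data \<subseteq> cls ` mstrs" by (metis image_eqI mstrs_of_data subsetI)
  then show ?thesis using finite_mstrs by (rule finite_surj[rotated])
qed

text \<open>The span of the basis, described by coefficients instead of expansions. Closure under an
  operation becomes a comparison of the terms that contribute to the coefficients at two strands of
  one class.\<close>

definition matched :: "(('a \<rightharpoonup> 'b) \<Rightarrow> 'k::field) set"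
  where "matched = {x. supp x \<subseteq> mstrs \<and>
    (\<forall>F G. F \<in> mstrs \<longrightarrow> G \<in> mstrs \<longrightarrow> cls F = cls G \<longrightarrow> x F = x G)}"

lemma matchedI:
  assumes "\<And>F. x F \<noteq> 0 \<Longrightarrow> F \<in> mstrs"
    and "\<And>F G. F \<in> mstrs \<Longrightarrow> G \<in> mstrs \<Longrightarrow> cls F = cls G \<Longrightarrow> x F = x G"
  shows "x \<in> matched"
  unfolding matched_def mem_Collect_eq
proof (intro conjI allI impI)
  show "supp x \<subseteq> mstrs" using assms(1) by (auto simp: supp_def)
qed (rule assms(2))

lemma matchedD:
  assumes "x \<in> matched"
  shows "x F \<noteq> 0 \<Longrightarrow> F \<in> mstrs"
    and "F \<in> mstrs \<Longrightarrow> G \<in> mstrs \<Longrightarrow> cls F = cls G \<Longrightarrow> x F = x G"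
proof -
  have x: "supp x \<subseteq> mstrs" "\<forall>F G. F \<in> mstrs \<longrightarrow> G \<in> mstrs \<longrightarrow> cls F = cls G \<longrightarrow> x F = x G"
    using assms unfolding matched_def by blast+
  show "x F \<noteq> 0 \<Longrightarrow> F \<in> mstrs" using x(1) by (auto simp: supp_def)
  show "F \<in> mstrs \<Longrightarrow> G \<in> mstrs \<Longrightarrow> cls F = cls G \<Longrightarrow> x F = x G" using x(2) by blast
qed

lemma matched_expand:
  assumes "x \<in> matched"
  shows "x = (\<Sum>d\<in>data. x (rep d) *\<^sub>k basis d)"
proof
  fix F
  have "(\<Sum>d\<in>data. x (rep d) *\<^sub>k basis d) F =
      (\<Sum>d\<in>data. if F \<in> mstrs \<and> cls F = d then x (rep d) else 0)"
    by (auto simp: sum_fun_apply basis_apply intro!: sum.cong)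
  also have "\<dots> = (if F \<in> mstrs then x (rep (cls F)) else 0)"
    using finite_data cls_mem(1)[of F] by auto
  also have "\<dots> = x F"
  proof (cases "F \<in> mstrs")
    case True
    have "x (rep (cls F)) = x F"
      using matchedD(2)[OF assms _ True] rep[OF cls_mem(1)[OF True]] by blast
    then show ?thesis using True by simp
  next
    case False
    then show ?thesis using matchedD(1)[OF assms] by auto
  qed
  finally show "x F = (\<Sum>d\<in>data. x (rep d) *\<^sub>k basis d) F" by simp
qed

lemma basis_matched:
  assumes "d \<in> data"
  shows "basis d \<in> matched"
  by (rule matchedI) (simp_all add: basis_apply[OF assms] split: if_splits)

lemma span_basis: "formal.span (basis ` data) = (matched :: (('a \<rightharpoonup> 'b) \<Rightarrow> 'k::field) set)"
proof
  have "formal.subspace (matched :: (('a \<rightharpoonup> 'b) \<Rightarrow> 'k) set)"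
  proof (rule formal.subspaceI)
    show "0 \<in> (matched :: (('a \<rightharpoonup> 'b) \<Rightarrow> 'k) set)" by (rule matchedI) auto
    fix x y :: "('a \<rightharpoonup> 'b) \<Rightarrow> 'k" and c assume x: "x \<in> matched"
    show "c *\<^sub>k x \<in> matched"
    proof (rule matchedI)
      show "F \<in> mstrs" if "(c *\<^sub>k x) F \<noteq> 0" for F
        using that by (intro matchedD(1)[OF x]) auto
      show "(c *\<^sub>k x) F = (c *\<^sub>k x) G" if "F \<in> mstrs" "G \<in> mstrs" "cls F = cls G" for F G
        using matchedD(2)[OF x that] by simp
    qed
    assume y: "y \<in> matched"
    show "x + y \<in> matched"
    proof (rule matchedI)
      show "F \<in> mstrs" if "(x + y) F \<noteq> 0" for F
        using that matchedD(1)[OF x] matchedD(1)[OF y] by (cases "x F = 0") auto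
      show "(x + y) F = (x + y) G" if "F \<in> mstrs" "G \<in> mstrs" "cls F = cls G" for F G
        using matchedD(2)[OF x that] matchedD(2)[OF y that] by simp
    qed
  qed
  moreover have "basis ` data \<subseteq> (matched :: (('a \<rightharpoonup> 'b) \<Rightarrow> 'k) set)"
    using basis_matched by blast
  ultimately show "formal.span (basis ` data) \<subseteq> (matched :: (('a \<rightharpoonup> 'b) \<Rightarrow> 'k) set)"
    by (rule formal.span_minimal[rotated])
  show "matched \<subseteq> formal.span (basis ` data :: (('a \<rightharpoonup> 'b) \<Rightarrow> 'k) set)"
  proof
    fix x :: "('a \<rightharpoonup> 'b) \<Rightarrow> 'k" assume "x \<in> matched"
    then have x: "x = (\<Sum>d\<in>data. x (rep d) *\<^sub>k basis d)" by (rule matched_expand)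
    show "x \<in> formal.span (basis ` data)"
      by (subst x) (auto intro!: formal.span_sum formal.span_scale intro: formal.span_base)
  qed
qed

lemma matched_finitary: "x \<in> matched \<Longrightarrow> x \<in> finitary"
  using finite_subset[OF _ finite_mstrs] unfolding matched_def finitary_def by blast

text \<open>Strands of one class have the same moving part, so one arises from the other by shifting
  fixed strands within their pairs.\<close>

lemma same_pairs:
  assumes "F \<in> mstrs" "G \<in> mstrs" "cls F = cls G"
  shows "fp G \<subseteq> points Z" "inj_on M (fp G)" "M ` fp F = M ` fp G" "rp (fp F) (fp G) F = G"
  using cls_mem(2)[OF assms(2)] assms(3) fs_mv[of G]
  by (auto simp: sections_def bij_betw_def cls_def replace_fixed_def)

text \<open>All other ends lie in pairs different from those of \<open>S\<close>, hence from those
  of \<open>S'\<close>. The fixed strands shifted to \<open>S'\<close> therefore meet no other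
  end.\<close>

lemma replace_fixed:
  assumes f: "f \<in> mstrs" and S: "S \<subseteq> fp f"
    and S': "S' \<subseteq> points Z" "inj_on M S'" "M ` S = M ` S'"
  shows "rp S S' f \<in> mstrs" "cls (rp S S' f) = cls f" "fp (rp S S' f) = fp f - S \<union> S'"
    "rp S' S (rp S S' f) = f"
    "src (rp S S' f) = src f - S \<union> S'" "tgt (rp S S' f) = tgt f - S \<union> S'"
    "S' \<inter> (src f - S) = {}" "S' \<inter> (tgt f - S) = {}"
    "rp S S' f (ia i) = (if i \<in> S' then Some (ib i) else if i \<in> S then None else f (ia i))"
    "x \<notin> range ia \<Longrightarrow> rp S S' f x = f x"
proof -
  have inj: "inj_on M (src f)" "inj_on M (tgt f)" and fstrs: "f \<in> strs" using f by (auto simp: mstrs_def)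
  have fp: "fp f \<subseteq> src f" "fp f \<subseteq> tgt f" by (auto simp: fp_mem ran_def)
  have disj: "S' \<inter> (X - S) = {}" if "inj_on M X" "S \<subseteq> X" for X
  proof (rule ccontr)
    assume "S' \<inter> (X - S) \<noteq> {}"
    then obtain s' where s': "s' \<in> S'" "s' \<in> X" "s' \<notin> S" by blast
    then obtain s where "s \<in> S" "M s = M s'" using S'(3) by (metis imageE imageI)
    then show False using that s' by (metis inj_onD subsetD)
  qed
  show d1: "S' \<inter> (src f - S) = {}" using disj[OF inj(1)] S fp by blast
  show "S' \<inter> (tgt f - S) = {}" using disj[OF inj(2)] S fp by blast
  have sec: "fp f \<in> sections Z (M ` fp f)" by (rule cls_mem(2)[OF f])
  then have fpi: "fp f \<subseteq> points Z" "inj_on M (fp f)" by (auto simp: sections_def bij_betw_def)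
  have d2: "S' \<inter> (fp f - S) = {}" using d1 fp(1) by blast
  let ?T = "fp f - S \<union> S'"
  have img: "M ` ?T = M ` fp f"
    using S S'(3) by (metis Diff_partition Un_commute image_Un)
  moreover have "inj_on M ?T"
  proof -
    have "M ` (fp f - S) \<inter> M ` S' = {}"
      unfolding S'(3)[symmetric] using fpi(2) S by (auto dest!: inj_onD)
    then show ?thesis using fpi(2) S'(2) by (auto simp: inj_on_Un intro: inj_on_subset)
  qed
  ultimately have T: "?T \<in> sections Z (M ` fp f)"
    using fpi(1) S'(1) by (auto simp: sections_def bij_betw_def)
  have d: "(mv f, M ` fp f) \<in> data" using cls_mem(1)[OF f] by (simp add: cls_def)
  note c = combine[OF d T, folded replace_fixed_def]
  show "rp S S' f \<in> mstrs" by (rule c(1))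
  show fp': "fp (rp S S' f) = ?T" by (rule c(2))
  show "cls (rp S S' f) = cls f" using c(2,3) img by (simp add: cls_def)
  have "?T - S' \<union> S = fp f" using d2 S by blast
  then show "rp S' S (rp S S' f) = f"
    unfolding replace_fixed_def[of _ _ S' S] c(3) fp' by (simp add: fs_mv)
  note c0 = combine[OF d sec, unfolded fs_mv]
  have "src (mv f) \<inter> fp f = {}" "tgt (mv f) \<inter> fp f = {}"
    using dataD(6,7)[OF d] by blast+
  then show "src (rp S S' f) = src f - S \<union> S'" "tgt (rp S S' f) = tgt f - S \<union> S'"
    unfolding c(4,5) c0(4,5) using S by blast+
  show "rp S S' f (ia i) = (if i \<in> S' then Some (ib i) else if i \<in> S then None else f (ia i))"
    using S d1 by (auto simp: replace_fixed_def map_add_def mv_apply fp_mem split: option.splits)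
  show "rp S S' f x = f x" if "x \<notin> range ia"
    using that by (simp add: replace_fixed_def map_add_def mv_end fs_end split: option.splits if_splits)
qed

end

section \<open>The differential preserves the span of the matched basis\<close>

context matched_strands begin

text \<open>If \<open>x\<close> goes to \<open>u\<close> and \<open>y\<close> to \<open>v\<close> in
  an inverted pair of marked points, then x < y \<le> v < u, so that \<open>x\<close> may go to
  \<open>v\<close> and \<open>y\<close> to \<open>u\<close>. The lemma \<open>upward\<close> covers
  entries and exits.\<close>

lemma strs_exchange:
  assumes f: "f \<in> strs" and p: "p \<in> inversions f"
  shows "exchange f p \<in> strs" "src (exchange f p) = src f" "tgt (exchange f p) = tgt f"
proof -
  obtain x y where xy: "p = (x, y)" "x \<in> dom f" "y \<in> dom f" "x < y" "the (f y) < the (f x)"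
    using p by (auto simp: inversions_def)
  then obtain u v where uv: "f x = Some u" "f y = Some v" "v < u" by auto
  have dom: "dom (exchange f p) = dom f" and ran: "ran (exchange f p) = ran f"
    using xy by simp_all
  have "i \<le> j" if e: "exchange f p (ia i) = Some (ib j)" for i j
  proof -
    consider "ia i = x" "ib j = v" | "ia i = y" "ib j = u" | "f (ia i) = Some (ib j)"
    proof -
      have "exchange f p (ia i) = (if ia i = y then Some u else if ia i = x then Some v else f (ia i))"
        using uv by (simp add: xy(1) exchange_def)
      then show thesis using e that by (metis option.inject)
    qed
    then show ?thesis
    proof cases
      case 1
      then show ?thesis using upward(1)[OF f uv(2), of i] xy(4) by (metis less_iff(4) less_imp_le)
    next
      case 2
      then show ?thesis using upward(1)[OF f uv(2), of i] uv(3)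
        by (metis less_iff(4) order.refl order.strict_implies_order order.trans)
    next
      case 3
      then show ?thesis using f by (simp add: strs_def)
    qed
  qed
  moreover have "inj_on (exchange f p) (dom (exchange f p))"
    unfolding xy(1) using f xy(2,3) by (intro inj_on_exchange) (auto simp: strs_def)
  ultimately show "exchange f p \<in> strs"
    using f unfolding strs_def mem_Collect_eq dom ran by blast
  show "src (exchange f p) = src f" "tgt (exchange f p) = tgt f"
    unfolding dom ran by auto
qed

text \<open>In the chain x < y \<le> v < u both new strands, from \<open>x\<close> to
  \<open>v\<close> and from \<open>y\<close> to \<open>u\<close>, pass a strict inequality. A strand
  created by an exchange is therefore never fixed.\<close>

lemma fixed_not_exchanged:
  assumes f: "f \<in> strs" and p: "(x, y) \<in> inversions f"
    and s: "exchange f (x, y) (ia s) = Some (ib s)"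
  shows "ia s \<noteq> x" "ia s \<noteq> y" "f (ia s) = Some (ib s)"
proof -
  obtain u v where uv: "f x = Some u" "f y = Some v" "v < u" "x < y"
    using p by (auto simp: inversions_def)
  show 1: "ia s \<noteq> x"
  proof
    assume "ia s = x"
    then have "v = ib s" using s uv by (auto simp: exchange_def split: if_splits)
    then show False using upward(2)[OF f uv(2), of s] uv(4) \<open>ia s = x\<close> by simp
  qed
  show 2: "ia s \<noteq> y"
  proof
    assume "ia s = y"
    then have "u = ib s" using s uv by (auto simp: exchange_def split: if_splits)
    then show False using upward(1)[OF f uv(2), of s] uv(3) \<open>ia s = y\<close> by simp
  qed
  show "f (ia s) = Some (ib s)" using s 1 2 by (simp add: exchange_def)
qed

definition diff_terms :: "('a \<rightharpoonup> 'b) \<Rightarrow> (('a \<rightharpoonup> 'b) \<times> ('a \<times> 'a)) set"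
  where "diff_terms F = {(f, p). f \<in> mstrs \<and> p \<in> inversions f \<and>
    inv_num f = inv_num (exchange f p) + 1 \<and> exchange f p = F}"

text \<open>A fixed strand takes no part in an exchange of lowering degree one, so that it can be moved.\<close>

lemma diff_terms_replace:
  assumes F: "F \<in> mstrs" and G: "G \<in> mstrs" and FG: "cls F = cls G" and fp: "(f, p) \<in> diff_terms F"
  shows "(rp (fp F) (fp G) f, p) \<in> diff_terms G" "cls (rp (fp F) (fp G) f) = cls f"
    "rp (fp G) (fp F) (rp (fp F) (fp G) f) = f"
proof -
  let ?S = "fp F" and ?S' = "fp G" and ?f = "rp (fp F) (fp G) f"
  note SS = same_pairs[OF F G FG]
  obtain x y where p: "p = (x, y)" by (cases p)
  have f: "f \<in> mstrs" "f \<in> strs" "(x, y) \<in> inversions f" "inv_num f = inv_num (exchange f (x, y)) + 1"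
    "exchange f (x, y) = F"
    using fp by (auto simp: diff_terms_def mstrs_def p)
  obtain u v where uv: "f x = Some u" "f y = Some v" "v < u" "x < y"
    using f(3) by (auto simp: inversions_def)
  have fix1: "ia s \<noteq> x" "ia s \<noteq> y" "f (ia s) = Some (ib s)" if "s \<in> ?S" for s
    using fixed_not_exchanged[OF f(2,3), of s] that by (auto simp: f(5) fp_mem)
  then have S: "?S \<subseteq> fp f" by (auto simp: fp_mem)
  note r = replace_fixed[OF f(1) S SS(1-3)]
  note rF = replace_fixed[OF F subset_refl SS(1-3), unfolded SS(4)]
  show "cls ?f = cls f" "rp ?S' ?S ?f = f" by (rule r(2), rule r(4))
  have fstrs: "?f \<in> strs" using r(1) by (simp add: mstrs_def)
  have src: "i \<in> src f - ?S \<longleftrightarrow> i \<in> src f \<and> i \<notin> ?S" for i by blast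
  have fix2: "ia s \<noteq> x" "ia s \<noteq> y" if "s \<in> ?S'" for s
    using r(7) fix1(1,2)[of s] that uv(1,2) by blast+
  have same: "?f z = f z" if "z \<notin> ia ` ?S" "z \<notin> ia ` ?S'" for z
    using that r(9,10) by (cases "z \<in> range ia") auto
  have sameF: "G z = F z" if "z \<notin> ia ` ?S" "z \<notin> ia ` ?S'" for z
    using that rF(9,10) by (cases "z \<in> range ia") auto
  have same': "?f x = f x" "?f y = f y"
    using fix1(1,2) fix2 by (intro same; blast)+
  have inv: "(x, y) \<in> inversions ?f"
    using uv same' by (auto simp: inversions_def)
  have "exchange ?f (x, y) z = G z" for z
  proof (cases "z = x \<or> z = y")
    case True
    have "F z = G z" using True fix1(1,2) fix2 by (intro sameF[symmetric]; blast)
    moreover have "exchange ?f (x, y) z = F z"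
      using True same' unfolding f(5)[symmetric] by (auto simp: exchange_def)
    ultimately show ?thesis by simp
  next
    case False
    have "F z = f z" using False unfolding f(5)[symmetric] by (auto simp: exchange_def)
    moreover have "exchange ?f (x, y) z = ?f z" using False by (auto simp: exchange_def)
    moreover have "G z = ?f z" if "z \<in> ia ` ?S \<union> ia ` ?S'"
      using that rF(9) r(9) by auto
    ultimately show ?thesis using same[of z] sameF[of z]
      by (cases "z \<in> ia ` ?S \<union> ia ` ?S'") simp_all
  qed
  then have exch: "exchange ?f (x, y) = G" by blast
  have fin: "finite (dom g)" "inj_on g (dom g)" if "g \<in> strs" for g
    using that finite_dom by (auto simp: strs_def)
  \<comment> \<open>The exchange must still lower the inversion number by exactly one. A fixed
    strand shifted to a point \<open>s\<close> cannot come to lie between the exchanged strands: if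
    \<open>y\<close> is to the right of \<open>s\<close>, then so is its end
    \<open>v\<close>.\<close>
  have "\<not> (\<exists>z \<in> dom ?f. x < z \<and> z < y \<and> the (?f y) < the (?f z) \<and> the (?f z) < the (?f x))"
  proof clarify
    fix z w assume z: "?f z = Some w" "x < z" "z < y" "the (?f y) < the (?f z)" "the (?f z) < the (?f x)"
    then have vw: "v < w" "w < u" using same' uv by auto
    have "z \<notin> ia ` ?S'"
    proof
      assume "z \<in> ia ` ?S'"
      then obtain s where s: "s \<in> ?S'" "z = ia s" by blast
      then have "w = ib s" using z(1) r(9)[of s] by simp
      then show False using upward(2)[OF f(2) uv(2), of s] vw(1) z(3) s(2) by simp
    qed
    moreover from this have "z \<notin> ia ` ?S"
      using z(1) r(9) by (auto split: if_splits)
    ultimately have "f z = Some w" using same z(1) by simp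
    then have "z \<in> dom f" "the (f y) < the (f z)" "the (f z) < the (f x)" using uv vw by auto
    then show False
      using f(4) inversions_exchange(2)[OF fin[OF f(2)] f(3)] z(2,3) by blast
  qed
  then have "inv_num ?f = inv_num (exchange ?f (x, y)) + 1"
    using inversions_exchange(2)[OF fin[OF fstrs] inv] by blast
  then show "(?f, p) \<in> diff_terms G"
    using r(1) inv exch by (simp add: diff_terms_def p)
qed

text \<open>Collects a coefficient of the differential into a single sum, so that two coefficients
  can be compared by reindexing.\<close>

lemma strand_diff_apply:
  assumes "x \<in> matched"
  shows "strand_diff x F = (\<Sum>(f, p)\<in>diff_terms F. x f)"
proof -
  have fin: "finite (inversions f)" if "f \<in> mstrs" for f
    using that finite_dom by (auto simp: mstrs_def intro: finite_inversions)
  let ?C = "\<lambda>f. {p. p \<in> inversions f \<and> inv_num f = inv_num (exchange f p) + 1}"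
  have finC: "finite (?C f)" if "f \<in> mstrs" for f
    using fin[OF that] by (rule finite_subset[rotated]) auto
  have "strand_diff x F = (\<Sum>f\<in>mstrs. x f * (\<Sum>p\<in>?C f. if exchange f p = F then 1 else 0))"
    unfolding strand_diff_def
    using matchedD(1)[OF assms] finite_mstrs by (subst linear_ext_superset[of mstrs])
      (simp_all add: supp_def subset_iff sum_fun_apply single_apply eq_commute[of F])
  also have "\<dots> = (\<Sum>f\<in>mstrs. \<Sum>p\<in>?C f. if exchange f p = F then x f else 0)"
    by (simp add: sum_distrib_left if_distrib cong: if_cong)
  also have "\<dots> = (\<Sum>f\<in>mstrs. \<Sum>p\<in>{p \<in> ?C f. exchange f p = F}. x f)"
    using finC by (intro sum.cong refl sum.inter_filter[symmetric]) auto
  also have "\<dots> = (\<Sum>(f, p)\<in>(SIGMA f:mstrs. {p \<in> ?C f. exchange f p = F}). x f)"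
    using finite_mstrs by (intro sum.Sigma ballI finite_subset[OF _ finC]) auto
  also have "(SIGMA f:mstrs. {p \<in> ?C f. exchange f p = F}) = diff_terms F"
    by (auto simp: diff_terms_def)
  finally show ?thesis .
qed

text \<open>Shifting fixed strands matches the terms of the coefficients at \<open>F\<close> and
  \<open>G\<close>. Matched terms agree because \<open>x\<close> is constant on classes.\<close>

lemma strand_diff_matched:
  assumes x: "x \<in> matched"
  shows "strand_diff x \<in> matched"
proof (rule matchedI)
  fix F assume "strand_diff x F \<noteq> 0"
  then obtain f p where "(f, p) \<in> diff_terms F"
    unfolding strand_diff_apply[OF x] by (metis (no_types, lifting) sum.neutral surj_pair)
  then have f: "f \<in> mstrs" "f \<in> strs" "p \<in> inversions f" "F = exchange f p"
    by (auto simp: diff_terms_def mstrs_def)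
  show "F \<in> mstrs"
    using f(1) strs_exchange[OF f(2,3)] unfolding f(4) mstrs_def mem_Collect_eq by simp
next
  fix F G assume FG: "F \<in> mstrs" "G \<in> mstrs" "cls F = cls G"
  show "strand_diff x F = strand_diff x G"
    unfolding strand_diff_apply[OF x]
  proof (rule sum.reindex_bij_witness[where j = "\<lambda>(f, p). (rp (fp F) (fp G) f, p)"
        and i = "\<lambda>(f, p). (rp (fp G) (fp F) f, p)"])
    note 1 = diff_terms_replace[OF FG] and 2 = diff_terms_replace[OF FG(2,1) FG(3)[symmetric]]
    show "(case case a of (f, p) \<Rightarrow> (rp (fp F) (fp G) f, p) of (f, p) \<Rightarrow> (rp (fp G) (fp F) f, p)) = a"
      if "a \<in> diff_terms F" for a using that 1 by (cases a) simp
    show "(case a of (f, p) \<Rightarrow> (rp (fp F) (fp G) f, p)) \<in> diff_terms G"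
      if "a \<in> diff_terms F" for a using that 1 by (cases a) simp
    show "(case case a of (f, p) \<Rightarrow> (rp (fp G) (fp F) f, p) of (f, p) \<Rightarrow> (rp (fp F) (fp G) f, p)) = a"
      if "a \<in> diff_terms G" for a using that 2 by (cases a) simp
    show "(case a of (f, p) \<Rightarrow> (rp (fp G) (fp F) f, p)) \<in> diff_terms F"
      if "a \<in> diff_terms G" for a using that 2 by (cases a) simp
    show "(case case a of (f, p) \<Rightarrow> (rp (fp F) (fp G) f, p) of (f, p) \<Rightarrow> x f) = (case a of (f, p) \<Rightarrow> x f)"
      if "a \<in> diff_terms F" for a
    proof -
      obtain f p where a: "a = (f, p)" by (cases a)
      have "rp (fp F) (fp G) f \<in> mstrs" "f \<in> mstrs"
        using 1(1)[OF that[unfolded a]] that by (auto simp: diff_terms_def a)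
      then show ?thesis using matchedD(2)[OF x _ _ 1(2)[OF that[unfolded a]]] by (simp add: a)
    qed
  qed
qed

end

section \<open>Permutations and products of strands\<close>

lemma top_less_simps [simp]:
  "TPt i < TPt j \<longleftrightarrow> i < j" "TPt i < Top q" "\<not> Top p < TPt j" "Top p < Top q \<longleftrightarrow> q < p"
  by (auto simp: less_top_target_def)

lemma bottom_less_simps [simp]:
  "BPt i < BPt j \<longleftrightarrow> i < j" "\<not> BPt i < Bot q" "Bot p < BPt j" "Bot p < Bot q \<longleftrightarrow> q < p"
  by (auto simp: less_bottom_source_def)

lemma relabel_tops_simps [simp]:
  "relabel_tops w (TPt j) = TPt j" "relabel_tops w (Top p) = Top (w p)"
  by (simp_all add: relabel_tops_def)

lemma relabel_bottoms_simps [simp]: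
  "relabel_bottoms w (BPt j) = BPt j" "relabel_bottoms w (Bot p) = Bot (w p)"
  by (simp_all add: relabel_bottoms_def)

lemma inj_the_dom:
  "inj_on f (dom f) \<Longrightarrow> f x = Some y \<Longrightarrow> f x' = Some y \<Longrightarrow> x = x'"
  by (metis domI inj_onD)

definition top_point :: "top_target \<Rightarrow> nat"
  where "top_point y = (case y of TPt j \<Rightarrow> j | Top p \<Rightarrow> 0)"

definition top_label :: "top_target \<Rightarrow> nat"
  where "top_label y = (case y of TPt j \<Rightarrow> 0 | Top p \<Rightarrow> p)"

lemma top_point_label_simps [simp]:
  "top_point (TPt j) = j" "top_label (Top p) = p"
  by (simp_all add: top_point_def top_label_def)

lemma top_strandsD:
  assumes "f \<in> top_strands N m"
  shows "finite (dom f)" "inj_on f (dom f)"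
    and "f x = Some (TPt j) \<Longrightarrow> x \<in> {1..N} \<and> j \<in> {1..N} \<and> x \<le> j"
    and "f x = Some (Top p) \<Longrightarrow> x \<in> {1..N} \<and> p \<in> {1..m}"
    and "p \<in> {1..m} \<Longrightarrow> \<exists>x. f x = Some (Top p)"
proof -
  have f: "dom f \<subseteq> {1..N}" "Top ` {1..m} \<subseteq> ran f" "ran f \<subseteq> TPt ` {1..N} \<union> Top ` {1..m}"
    "inj_on f (dom f)" "\<And>i j. f i = Some (TPt j) \<Longrightarrow> i \<le> j"
    using assms by (auto simp: top_strands_def)
  show "finite (dom f)" using f(1) by (rule finite_subset) simp
  show "inj_on f (dom f)" by (rule f(4))
  show "x \<in> {1..N} \<and> j \<in> {1..N} \<and> x \<le> j" if "f x = Some (TPt j)"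
    using that domI[of f x, OF that] ranI[of f x "TPt j", OF that] f(1,3) f(5)[OF that] by auto
  show "x \<in> {1..N} \<and> p \<in> {1..m}" if "f x = Some (Top p)"
    using that domI[of f x, OF that] ranI[of f x "Top p", OF that] f(1,3) by auto
  show "\<exists>x. f x = Some (Top p)" if "p \<in> {1..m}"
    using subsetD[OF f(2) imageI[OF that]] by (simp add: ran_def)
qed

lemma top_strandsI:
  assumes "inj_on f (dom f)"
    and "\<And>x j. f x = Some (TPt j) \<Longrightarrow> x \<in> {1..N} \<and> j \<in> {1..N} \<and> x \<le> j"
    and "\<And>x p. f x = Some (Top p) \<Longrightarrow> x \<in> {1..N} \<and> p \<in> {1..m}"
    and "\<And>p. p \<in> {1..m} \<Longrightarrow> \<exists>x. f x = Some (Top p)"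
  shows "f \<in> top_strands N m"
proof -
  have *: "x \<in> {1..N} \<and> y \<in> TPt ` {1..N} \<union> Top ` {1..m}" if "f x = Some y" for x y
    using that assms(2,3) by (cases y) auto
  then have "dom f \<subseteq> {1..N}" "ran f \<subseteq> TPt ` {1..N} \<union> Top ` {1..m}"
    by (fastforce simp: ran_def)+
  moreover have "Top ` {1..m} \<subseteq> ran f" using assms(4) by (fastforce intro: ranI)
  ultimately show ?thesis using assms(1,2) by (simp add: top_strands_def)
qed

lemma bottom_strandsD:
  assumes "g \<in> bottom_strands N m"
  shows "finite (dom g)" "inj_on g (dom g)"
    and "g (BPt i) = Some j \<Longrightarrow> i \<in> {1..N} \<and> j \<in> {1..N} \<and> i \<le> j"
    and "g (Bot p) = Some j \<Longrightarrow> p \<in> {1..m} \<and> j \<in> {1..N}"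
    and "p \<in> {1..m} \<Longrightarrow> \<exists>j. g (Bot p) = Some j"
proof -
  have g: "Bot ` {1..m} \<subseteq> dom g" "dom g \<subseteq> BPt ` {1..N} \<union> Bot ` {1..m}" "ran g \<subseteq> {1..N}"
    "inj_on g (dom g)" "\<And>i j. g (BPt i) = Some j \<Longrightarrow> i \<le> j"
    using assms by (auto simp: bottom_strands_def)
  show "finite (dom g)" using g(2) by (rule finite_subset) simp
  show "inj_on g (dom g)" by (rule g(4))
  show "i \<in> {1..N} \<and> j \<in> {1..N} \<and> i \<le> j" if "g (BPt i) = Some j"
    using that domI[of g "BPt i", OF that] ranI[of g "BPt i", OF that] g(2,3) g(5)[OF that] by auto
  show "p \<in> {1..m} \<and> j \<in> {1..N}" if "g (Bot p) = Some j"
    using that domI[of g "Bot p", OF that] ranI[of g "Bot p", OF that] g(2,3) by auto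
  show "\<exists>j. g (Bot p) = Some j" if "p \<in> {1..m}"
    using subsetD[OF g(1) imageI[OF that]] by auto
qed

lemma bottom_strandsI:
  assumes "inj_on g (dom g)"
    and "\<And>i j. g (BPt i) = Some j \<Longrightarrow> i \<in> {1..N} \<and> j \<in> {1..N} \<and> i \<le> j"
    and "\<And>p j. g (Bot p) = Some j \<Longrightarrow> p \<in> {1..m} \<and> j \<in> {1..N}"
    and "\<And>p. p \<in> {1..m} \<Longrightarrow> \<exists>j. g (Bot p) = Some j"
  shows "g \<in> bottom_strands N m"
proof -
  have *: "x \<in> BPt ` {1..N} \<union> Bot ` {1..m} \<and> y \<in> {1..N}" if "g x = Some y" for x y
    using that assms(2,3) by (cases x) auto
  then have "dom g \<subseteq> BPt ` {1..N} \<union> Bot ` {1..m}" "ran g \<subseteq> {1..N}"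
    by (fastforce simp: ran_def)+
  moreover have "Bot ` {1..m} \<subseteq> dom g" using assms(4) by fastforce
  ultimately show ?thesis using assms(1,2) by (simp add: bottom_strands_def)
qed

lemma additive_iff:
  assumes "inv_num F + 2 * card (double_crossings I \<alpha> \<beta> \<gamma>) = n" "finite I"
  shows "inv_num F \<le> n" "inv_num F = n \<longleftrightarrow> double_crossings I \<alpha> \<beta> \<gamma> = {}"
proof -
  have "finite (double_crossings I \<alpha> \<beta> \<gamma>)"
    by (rule finite_subset[of _ "I \<times> I"]) (use assms(2) in \<open>auto simp: double_crossings_def\<close>)
  then show "inv_num F \<le> n" "inv_num F = n \<longleftrightarrow> double_crossings I \<alpha> \<beta> \<gamma> = {}"
    using assms(1) by auto
qed

lemma bij_betw_top_label:
  assumes "f \<in> top_strands N m"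
  shows "bij_betw (\<lambda>s. top_label (the (f s))) {s. \<exists>p. f s = Some (Top p)} {1..m}"
proof -
  note fD = top_strandsD[OF assms]
  have "inj_on (\<lambda>s. top_label (the (f s))) {s. \<exists>p. f s = Some (Top p)}"
    by (rule inj_onI) (auto dest: inj_the_dom[OF fD(2)])
  moreover have "(\<lambda>s. top_label (the (f s))) ` {s. \<exists>p. f s = Some (Top p)} = {1..m}"
  proof
    show "(\<lambda>s. top_label (the (f s))) ` {s. \<exists>p. f s = Some (Top p)} \<subseteq> {1..m}" using fD(4) by fastforce
    show "{1..m} \<subseteq> (\<lambda>s. top_label (the (f s))) ` {s. \<exists>p. f s = Some (Top p)}"
    proof
      fix p assume "p \<in> {1..m}"
      then obtain x where "f x = Some (Top p)" using fD(5) by blast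
      then show "p \<in> (\<lambda>s. top_label (the (f s))) ` {s. \<exists>p. f s = Some (Top p)}"
        by (intro image_eqI[of _ _ x]) auto
    qed
  qed
  ultimately show ?thesis by (simp add: bij_betw_def)
qed

text \<open>The three heights are the source, the target and the relabelled target. Only exits move
  between the last two, so the crossings there are the inversions of \<open>w\<close>.\<close>

lemma relabel_tops_strands:
  assumes f: "f \<in> top_strands N m" and w: "w permutes {1..m}"
  defines "f' \<equiv> map_option (relabel_tops w) \<circ> f"
  shows "f' \<in> top_strands N m"
    and "inv_num f' + 2 * card (double_crossings (dom f) id (\<lambda>s. the (f s)) (\<lambda>s. the (f' s))) =
      inv_num f + perm_length w"
proof -
  note F = top_strandsD[OF f]
  have wm: "w p \<in> {1..m} \<longleftrightarrow> p \<in> {1..m}" for p using permutes_in_image[OF w] .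
  have inj_w: "inj w" using w by (rule permutes_inj)
  have inj_r: "relabel_tops w y = relabel_tops w y' \<Longrightarrow> y = y'" for y y'
    by (cases y; cases y') (auto dest: injD[OF inj_w])
  have eq: "f' x = Some y \<longleftrightarrow> (\<exists>y'. f x = Some y' \<and> y = relabel_tops w y')" for x y
    by (auto simp: f'_def)
  have eqT: "f' x = Some (TPt j) \<longleftrightarrow> f x = Some (TPt j)" for x j
    unfolding eq by (metis relabel_tops_simps top_target.distinct(1) top_target.exhaust top_target.inject(1))
  have eqP: "f' x = Some (Top q) \<longleftrightarrow> (\<exists>p. f x = Some (Top p) \<and> q = w p)" for x q
    unfolding eq by (metis relabel_tops_simps top_target.distinct(1) top_target.exhaust top_target.inject(2))
  have dom: "dom f' = dom f" by (auto simp: f'_def)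
  have inj: "inj_on f' (dom f')"
    by (rule inj_onI) (metis domD eq inj_r inj_the_dom[OF F(2)])
  show "f' \<in> top_strands N m"
  proof (rule top_strandsI[OF inj])
    show "\<exists>x. f' x = Some (Top p)" if "p \<in> {1..m}" for p
    proof -
      obtain p' where p': "w p' = p" using permutes_surj[OF w] by (metis surjD)
      then have "\<exists>x. f x = Some (Top p')" using that wm[of p'] by (intro F(5)) simp
      then obtain x where "f x = Some (Top p')" by (elim exE)
      then show ?thesis using p' eqP by blast
    qed
    show "x \<in> {1..N} \<and> p \<in> {1..m}" if f': "f' x = Some (Top p)" for x p
    proof -
      obtain p' where "f x = Some (Top p')" "p = w p'" using f' eqP by blast
      then show ?thesis using F(4)[of x p'] wm[of p'] by (simp del: atLeastAtMost_iff)
    qed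
  qed (use F(3) eqT in blast)
  have injs: "inj_on (\<lambda>s. the (f s)) (dom f)" "inj_on (\<lambda>s. the (f' s)) (dom f)"
    using inj_on_the[OF F(2)] inj_on_the[OF inj] by (simp_all add: dom)
  let ?J = "{s. \<exists>p. f s = Some (Top p)}"
  have "bij_betw (map_prod (\<lambda>s. top_label (the (f s))) (\<lambda>s. top_label (the (f s))))
    (crossings (dom f) (\<lambda>s. the (f s)) (\<lambda>s. the (f' s)))
    (crossings {1..m} (\<lambda>p. - int p) (\<lambda>p. - int (w p)))"
  proof (rule bij_betw_crossings)
    show "?J \<subseteq> dom f" by auto
    show "bij_betw (\<lambda>s. top_label (the (f s))) ?J {1..m}" by (rule bij_betw_top_label[OF f])
    show "i \<in> ?J \<and> j \<in> ?J"
      if ij: "i \<in> dom f" "j \<in> dom f" "the (f i) < the (f j)" "the (f' j) < the (f' i)" for i j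
    proof -
      obtain u v where "f i = Some u" "f j = Some v" using ij by blast
      then show ?thesis using ij(3,4) by (cases u; cases v) (auto simp: f'_def)
    qed
    show "the (f i) < the (f j) \<and> the (f' j) < the (f' i) \<longleftrightarrow>
      - int (top_label (the (f i))) < - int (top_label (the (f j))) \<and>
      - int (w (top_label (the (f j)))) < - int (w (top_label (the (f i))))"
      if "i \<in> ?J" "j \<in> ?J" for i j
      using that by (auto simp: f'_def)
  qed
  from bij_betw_same_card[OF this]
  show "inv_num f' + 2 * card (double_crossings (dom f) id (\<lambda>s. the (f s)) (\<lambda>s. the (f' s))) =
      inv_num f + perm_length w"
    using card_crossings[OF F(1) inj_on_id injs]
    by (simp add: inv_num_eq_card dom perm_length_eq_card[OF w])
qed

text \<open>Here the permutation acts first, and \<open>relabel_bottoms w\<close> is the middle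
  height. The inversions of \<open>w\<close> occur before it and those of \<open>g\<close> after
  it.\<close>

lemma relabel_bottoms_strands:
  assumes g: "g \<in> bottom_strands N m" and w: "w permutes {1..m}"
  defines "g' \<equiv> g \<circ> relabel_bottoms w"
  shows "g' \<in> bottom_strands N m" "dom g' = dom g"
    and "inv_num g' + 2 * card (double_crossings (dom g) id (relabel_bottoms w) (\<lambda>s. the (g' s))) =
      inv_num g + perm_length w"
proof -
  note G = bottom_strandsD[OF g]
  have wm: "w p \<in> {1..m} \<longleftrightarrow> p \<in> {1..m}" for p using permutes_in_image[OF w] .
  have inj_w: "inj w" using w by (rule permutes_inj)
  have inj_r: "inj (relabel_bottoms w)"
  proof (rule injI)
    show "x = y" if "relabel_bottoms w x = relabel_bottoms w y" for x y
      using that by (cases x; cases y) (auto dest: injD[OF inj_w])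
  qed
  have val: "g' (BPt i) = g (BPt i)" "g' (Bot p) = g (Bot (w p))" for i p
    by (simp_all add: g'_def)
  have rdom: "relabel_bottoms w x \<in> dom g \<longleftrightarrow> x \<in> dom g" for x
  proof (cases x)
    case (Bot p)
    have "Bot p \<in> dom g \<longleftrightarrow> p \<in> {1..m}" for p using G(4,5) by blast
    then show ?thesis using wm Bot by simp
  qed simp
  show dom: "dom g' = dom g"
    using rdom by (auto simp: g'_def dom_def)
  have inj: "inj_on g' (dom g')"
    unfolding dom unfolding g'_def
    by (rule inj_onI) (metis comp_apply inj_onD[OF G(2)] injD[OF inj_r] rdom)
  show "g' \<in> bottom_strands N m"
  proof (rule bottom_strandsI[OF inj])
    show "i \<in> {1..N} \<and> j \<in> {1..N} \<and> i \<le> j" if "g' (BPt i) = Some j" for i j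
      using G(3)[of i j] that by (simp add: val)
    show "p \<in> {1..m} \<and> j \<in> {1..N}" if "g' (Bot p) = Some j" for p j
      using G(4)[of "w p" j] that wm[of p] by (simp add: val del: atLeastAtMost_iff)
    show "\<exists>j. g' (Bot p) = Some j" if "p \<in> {1..m}" for p
      using G(5)[of "w p"] that wm[of p] by (simp add: val del: atLeastAtMost_iff)
  qed
  have injs: "inj_on (relabel_bottoms w) (dom g)" "inj_on (\<lambda>s. the (g' s)) (dom g)"
    using inj_on_subset[OF inj_r subset_UNIV] inj_on_the[OF inj] by (simp_all add: dom)
  have surj_r: "relabel_bottoms w ` dom g = dom g"
  proof
    show "relabel_bottoms w ` dom g \<subseteq> dom g" using rdom by blast
    have "card (relabel_bottoms w ` dom g) = card (dom g)"
      using injs(1) by (rule card_image)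
    then show "dom g \<subseteq> relabel_bottoms w ` dom g"
      using \<open>relabel_bottoms w ` dom g \<subseteq> dom g\<close> G(1) by (metis card_subset_eq order_refl)
  qed
  let ?e = "\<lambda>x. case x of Bot p \<Rightarrow> p | BPt i \<Rightarrow> i"
  have "bij_betw (map_prod ?e ?e) (crossings (dom g) id (relabel_bottoms w))
    (crossings {1..m} (\<lambda>p. - int p) (\<lambda>p. - int (w p)))"
  proof (rule bij_betw_crossings)
    show "Bot ` {1..m} \<subseteq> dom g" using G(5) by blast
    show "bij_betw ?e (Bot ` {1..m}) {1..m}"
      by (rule bij_betw_byWitness[where f' = Bot]) auto
    show "i \<in> Bot ` {1..m} \<and> j \<in> Bot ` {1..m}"
      if "i \<in> dom g" "j \<in> dom g" "id i < id j" "relabel_bottoms w j < relabel_bottoms w i" for i j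
      using that G(4) by (cases i; cases j) force+
  qed auto
  from bij_betw_same_card[OF this]
  have "card (crossings (dom g) id (relabel_bottoms w)) = perm_length w"
    by (simp add: perm_length_eq_card[OF w])
  moreover have "bij_betw (map_prod (relabel_bottoms w) (relabel_bottoms w))
    (crossings (dom g) (relabel_bottoms w) (\<lambda>s. the (g' s))) (crossings (dom g) id (\<lambda>s. the (g s)))"
    by (rule bij_betw_crossings[OF subset_refl bij_betw_imageI[OF injs(1) surj_r]])
      (auto simp: g'_def)
  from bij_betw_same_card[OF this]
  have "card (crossings (dom g) (relabel_bottoms w) (\<lambda>s. the (g' s))) = inv_num g"
    by (simp add: inv_num_eq_card)
  ultimately show "inv_num g' + 2 * card (double_crossings (dom g) id (relabel_bottoms w) (\<lambda>s. the (g' s))) =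
      inv_num g + perm_length w"
    using card_crossings[OF G(1) inj_on_id injs] by (simp add: inv_num_eq_card dom)
qed

section \<open>Horizontal products of strands\<close>

definition shift_tops :: "nat \<Rightarrow> top_target \<Rightarrow> top_target"
  where "shift_tops m y = (case y of TPt u \<Rightarrow> TPt u | Top q \<Rightarrow> Top (m + q))"

lemma shift_tops_simps [simp]: "shift_tops m (TPt u) = TPt u" "shift_tops m (Top q) = Top (m + q)"
  by (simp_all add: shift_tops_def)

lemma shift_tops_less [simp]: "shift_tops m y < shift_tops m y' \<longleftrightarrow> y < y'"
  by (cases y; cases y') auto

lemma shift_tops_inj [simp]: "shift_tops m y = shift_tops m y' \<longleftrightarrow> y = y'"
  by (cases y; cases y') auto

lemma top_compose_simps:
  "f s = None \<Longrightarrow> top_compose m f g s = None"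
  "f s = Some (Top p) \<Longrightarrow> top_compose m f g s = Some (Top p)"
  "f s = Some (TPt j) \<Longrightarrow> top_compose m f g s = map_option (shift_tops m) (g j)"
  by (auto simp: top_compose_def shift_tops_def split: option.splits top_target.splits)

text \<open>The middle height is the value of \<open>f\<close>. A strand that leaves at the top in
  \<open>f\<close> crosses nothing afterwards, since the exits contributed by \<open>g\<close> have
  labels above \<open>m\<close> and so lie below those of \<open>f\<close>. The remaining crossings
  are the inversions of \<open>g\<close>.\<close>

lemma top_compose_strands:
  assumes f: "f \<in> top_strands N m" and g: "g \<in> top_strands N n" and K: "{j. TPt j \<in> ran f} = dom g"
  defines "C \<equiv> top_compose m f g"
  shows "C \<in> top_strands N (m + n)" "dom C = dom f" "{j. TPt j \<in> ran C} = {j. TPt j \<in> ran g}"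
    and "inv_num C + 2 * card (double_crossings (dom f) id (\<lambda>s. the (f s)) (\<lambda>s. the (C s))) =
      inv_num f + inv_num g"
proof -
  note F = top_strandsD[OF f] and G = top_strandsD[OF g]
  have K': "\<exists>y. g j = Some y" if "f s = Some (TPt j)" for s j
    using K ranI[of f s, OF that] by blast
  have C1: "C s = Some (Top p)" if "f s = Some (Top p)" for s p
    using top_compose_simps(2)[of f s p m g] that by (simp add: C_def)
  have C2: "C s = Some (shift_tops m y)" if "f s = Some (TPt j)" "g j = Some y" for s j y
    using top_compose_simps(3)[of f s j m g] that by (simp add: C_def)
  have cases: "(\<exists>p. f s = Some (Top p) \<and> y = Top p) \<or>
      (\<exists>j y'. f s = Some (TPt j) \<and> g j = Some y' \<and> y = shift_tops m y')" if "C s = Some y" for s y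
  proof (cases "f s")
    case None
    then show ?thesis using that top_compose_simps(1)[of f s m g] by (simp add: C_def)
  next
    case (Some z)
    show ?thesis
    proof (cases z)
      case (TPt j)
      then obtain y' where "g j = Some y'" using K' Some by blast
      then show ?thesis using C2[of s j y'] that Some TPt by simp
    next
      case (Top p)
      then show ?thesis using C1[of s p] that Some by simp
    qed
  qed
  show dom: "dom C = dom f"
  proof
    show "dom C \<subseteq> dom f" using cases by blast
    show "dom f \<subseteq> dom C"
    proof
      fix s assume "s \<in> dom f"
      then obtain y where "f s = Some y" by blast
      then show "s \<in> dom C" using C1[of s] C2[of s] K'[of s] by (cases y) auto
    qed
  qed
  have ne: "Top p \<noteq> shift_tops m y" if "f s = Some (Top p)" "g j = Some y" for s j p y
    using F(4)[OF that(1)] G(4)[of j] that(2) by (cases y) auto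
  have inj: "inj_on C (dom C)"
  proof (rule inj_onI)
    fix s s' assume "s \<in> dom C" "C s = C s'"
    then obtain y where y: "C s = Some y" "C s' = Some y" by (metis domD)
    show "s = s'"
      using cases[OF y(1)] cases[OF y(2)]
      by (metis ne shift_tops_inj inj_the_dom[OF F(2)] inj_the_dom[OF G(2)])
  qed
  have T: "\<exists>j. f s = Some (TPt j) \<and> g j = Some (TPt u)" if "C s = Some (TPt u)" for s u
    using cases[OF that] by (metis shift_tops_simps top_target.distinct(1) top_target.exhaust top_target.inject(1))
  have P: "f s = Some (Top q) \<or> (\<exists>j p. f s = Some (TPt j) \<and> g j = Some (Top p) \<and> q = m + p)"
    if "C s = Some (Top q)" for s q
    using cases[OF that] by (metis shift_tops_simps top_target.distinct(1) top_target.exhaust top_target.inject(2))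
  show "C \<in> top_strands N (m + n)"
  proof (rule top_strandsI[OF inj])
    show "x \<in> {1..N} \<and> j \<in> {1..N} \<and> x \<le> j" if "C x = Some (TPt j)" for x j
      using T[OF that] F(3) G(3) by (metis order_trans)
    show "x \<in> {1..N} \<and> p \<in> {1..m + n}" if "C x = Some (Top p)" for x p
      using P[OF that] F(3)[of x] F(4)[of x] G(4) by fastforce
    show "\<exists>x. C x = Some (Top p)" if p: "p \<in> {1..m + n}" for p
    proof (cases "p \<le> m")
      case True
      then show ?thesis using p F(5)[of p] C1 by fastforce
    next
      case False
      then have "p - m \<in> {1..n}" using p unfolding atLeastAtMost_iff by linarith
      then obtain j where j: "g j = Some (Top (p - m))" using G(5) by blast
      then obtain s where "f s = Some (TPt j)" using K by (fastforce simp: ran_def)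
      then have "C s = Some (Top p)" using C2[OF _ j] False by simp
      then show ?thesis by blast
    qed
  qed
  show "{j. TPt j \<in> ran C} = {j. TPt j \<in> ran g}"
  proof (intro Set.set_eqI iffI; unfold mem_Collect_eq)
    show "TPt u \<in> ran g" if "TPt u \<in> ran C" for u
      using that T by (fastforce simp: ran_def)
    fix u assume "TPt u \<in> ran g"
    then obtain j where j: "g j = Some (TPt u)" by (auto simp: ran_def)
    then obtain s where "f s = Some (TPt j)" using K by (fastforce simp: ran_def)
    then show "TPt u \<in> ran C" using C2[OF _ j] by (auto intro: ranI)
  qed
  have injs: "inj_on (\<lambda>s. the (f s)) (dom f)" "inj_on (\<lambda>s. the (C s)) (dom f)"
    using inj_on_the[OF F(2)] inj_on_the[OF inj] by (simp_all add: dom)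
  let ?J = "{s. \<exists>j. f s = Some (TPt j)}"
  let ?e = "\<lambda>s. top_point (the (f s))"
  have "bij_betw (map_prod ?e ?e) (crossings (dom f) (\<lambda>s. the (f s)) (\<lambda>s. the (C s)))
    (crossings (dom g) id (\<lambda>j. the (g j)))"
  proof (rule bij_betw_crossings)
    show "?J \<subseteq> dom f" by auto
    show "bij_betw ?e ?J (dom g)"
      unfolding bij_betw_def K[symmetric]
      by (auto intro!: inj_onI ranI dest: inj_the_dom[OF F(2)] simp: ran_def image_iff) force
    show "i \<in> ?J \<and> j \<in> ?J"
      if ij: "i \<in> dom f" "j \<in> dom f" "the (f i) < the (f j)" "the (C j) < the (C i)" for i j
    proof -
      obtain u v where uv: "f i = Some u" "f j = Some v" using ij by blast
      have False if v: "v = Top q" for q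
      proof (cases u)
        case (Top p)
        then show ?thesis using ij(3,4) uv v C1 by auto
      next
        case (TPt l)
        then obtain y where y: "g l = Some y" using K' uv by blast
        have Ci: "C i = Some (shift_tops m y)" using C2[OF _ y] uv TPt by simp
        show ?thesis
        proof (cases y)
          case (Top r)
          then have "1 \<le> r" "q \<le> m" using y G(4)[of l r] uv F(4)[of j q] v by auto
          then show ?thesis using ij(4) Ci C1[of j q] uv v Top by simp
        qed (use ij(4) Ci C1[of j q] uv v in simp)
      qed
      moreover have "u \<noteq> Top p" if "v = TPt l" for p l using ij(3) uv that by auto
      ultimately show ?thesis using uv by (cases u; cases v) auto
    qed
    show "the (f i) < the (f j) \<and> the (C j) < the (C i) \<longleftrightarrow>
        id (?e i) < id (?e j) \<and> the (g (?e j)) < the (g (?e i))"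
      if ij: "i \<in> ?J" "j \<in> ?J" for i j
    proof -
      obtain a b where ab: "f i = Some (TPt a)" "f j = Some (TPt b)" using ij by blast
      obtain y z where yz: "g a = Some y" "g b = Some z" using K' ab by metis
      show ?thesis using ab yz C2[OF ab(1) yz(1)] C2[OF ab(2) yz(2)] by simp
    qed
  qed
  from bij_betw_same_card[OF this]
  show "inv_num C + 2 * card (double_crossings (dom f) id (\<lambda>s. the (f s)) (\<lambda>s. the (C s))) =
      inv_num f + inv_num g"
    using card_crossings[OF F(1) inj_on_id injs] by (simp add: inv_num_eq_card dom)
qed

lemma bottom_compose_simps:
  "bottom_compose m g h (BPt s) = (case g (BPt s) of None \<Rightarrow> None | Some j \<Rightarrow> h (BPt j))"
  "p \<le> m \<Longrightarrow> bottom_compose m g h (Bot p) = (case g (Bot p) of None \<Rightarrow> None | Some j \<Rightarrow> h (BPt j))"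
  "m < p \<Longrightarrow> bottom_compose m g h (Bot p) = h (Bot (p - m))"
  by (auto simp: bottom_compose_def map_comp_def split: option.splits)

text \<open>The middle height \<beta> puts the strands of \<open>g\<close> at their values and
  leaves the entries that belong to \<open>h\<close> waiting at the bottom, with labels above
  \<open>m\<close>. Such an entry is below every strand of \<open>g\<close> both at the source and
  at \<beta>, so it crosses none of them before \<beta>.\<close>

lemma bottom_compose_strands:
  assumes g: "g \<in> bottom_strands N m" and h: "h \<in> bottom_strands N n"
    and K: "ran g = {i. BPt i \<in> dom h}"
  defines "C \<equiv> bottom_compose m g h"
  defines "\<beta> \<equiv> \<lambda>x. if x \<in> dom g then BPt (the (g x)) else x"
  shows "C \<in> bottom_strands N (m + n)" "ran C = ran h" "{i. BPt i \<in> dom C} = {i. BPt i \<in> dom g}"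
    and "inv_num C + 2 * card (double_crossings (dom C) id \<beta> (\<lambda>s. the (C s))) =
      inv_num g + inv_num h"
proof -
  note G = bottom_strandsD[OF g] and H = bottom_strandsD[OF h]
  have K': "\<exists>y. h (BPt j) = Some y" if "g x = Some j" for x j
    using K ranI[of g x, OF that] by blast
  have K'': "\<exists>x. g x = Some j" if "h (BPt j) = Some y" for j y
    using K that by (fastforce simp: ran_def)
  have C1: "C x = h (BPt j)" if "g x = Some j" for x j
    using that G(4)[of _ j] unfolding C_def
    by (cases x) (fastforce simp: bottom_compose_simps)+
  have C2: "C (Bot (m + q)) = h (Bot q)" if "1 \<le> q" for q
    using that by (simp add: C_def bottom_compose_simps)
  have cases: "(\<exists>j. g x = Some j \<and> h (BPt j) = Some y) \<or>
      (\<exists>q\<in>{1..n}. x = Bot (m + q) \<and> g x = None \<and> h (Bot q) = Some y)" if C: "C x = Some y" for x y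
  proof (cases x)
    case (BPt s)
    then show ?thesis using C unfolding C_def by (auto simp: bottom_compose_simps split: option.splits)
  next
    case (Bot p)
    show ?thesis
    proof (cases "p \<le> m")
      case True
      then show ?thesis using C Bot unfolding C_def
        by (auto simp: bottom_compose_simps split: option.splits)
    next
      case False
      then have q: "h (Bot (p - m)) = Some y" "p = m + (p - m)"
        using C Bot unfolding C_def by (auto simp: bottom_compose_simps)
      have "g (Bot p) = None" using G(4)[of p] False by (cases "g (Bot p)") auto
      then show ?thesis using q H(4)[OF q(1)] Bot by (metis)
    qed
  qed
  have eq: "\<exists>j. g (BPt s) = Some j \<and> h (BPt j) = Some y" if "C (BPt s) = Some y" for s y
    using cases[OF that] by auto
  have inj: "inj_on C (dom C)"
  proof (rule inj_onI)
    fix s s' assume "s \<in> dom C" "C s = C s'"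
    then obtain y where y: "C s = Some y" "C s' = Some y" by (metis domD)
    show "s = s'"
      using cases[OF y(1)] cases[OF y(2)]
      by (metis bottom_source.distinct(1) bottom_source.inject(1) bottom_source.inject(2)
          inj_the_dom[OF G(2)] inj_the_dom[OF H(2)])
  qed
  show "C \<in> bottom_strands N (m + n)"
  proof (rule bottom_strandsI[OF inj])
    show "i \<in> {1..N} \<and> j \<in> {1..N} \<and> i \<le> j" if "C (BPt i) = Some j" for i j
      using eq[OF that] G(3) H(3) by (metis order_trans)
    show "p \<in> {1..m + n} \<and> j \<in> {1..N}" if "C (Bot p) = Some j" for p j
      using cases[OF that] G(4)[of p] H(3,4) by fastforce
    show "\<exists>j. C (Bot p) = Some j" if p: "p \<in> {1..m + n}" for p
    proof (cases "p \<le> m")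
      case True
      then show ?thesis using p G(5)[of p] C1[of "Bot p"] K'[of "Bot p"] by auto
    next
      case False
      then have "p - m \<in> {1..n}" using p unfolding atLeastAtMost_iff by linarith
      then show ?thesis using H(5)[of "p - m"] C2[of "p - m"] False by auto
    qed
  qed
  show "ran C = ran h"
  proof (intro Set.set_eqI iffI)
    show "y \<in> ran h" if "y \<in> ran C" for y
      using that cases by (auto simp: ran_def)
    fix y assume "y \<in> ran h"
    then obtain x where x: "h x = Some y" by (auto simp: ran_def)
    show "y \<in> ran C"
    proof (cases x)
      case (BPt j)
      then obtain x' where "g x' = Some j" using K'' x by blast
      then show ?thesis using C1[of x' j] x BPt by (auto intro: ranI)
    next
      case (Bot q)
      then have "1 \<le> q" using H(4) x by fastforce
      then show ?thesis using C2[of q] x Bot by (auto intro: ranI)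
    qed
  qed
  show "{i. BPt i \<in> dom C} = {i. BPt i \<in> dom g}"
    using eq C1 K' by fastforce
  let ?I = "dom C"
  have I: "x \<in> dom g \<or> (\<exists>q\<in>{1..n}. x = Bot (m + q) \<and> g x = None)" if "x \<in> ?I" for x
    using that cases by (fastforce simp: domIff)
  have gI: "dom g \<subseteq> ?I" using C1 K' by fastforce
  have \<beta>1: "\<beta> x = BPt j" if "g x = Some j" for x j using that by (auto simp: \<beta>_def)
  have \<beta>2: "\<beta> x = x" if "g x = None" for x using that by (simp add: \<beta>_def domIff)
  have finI: "finite ?I"
  proof (rule finite_subset)
    show "?I \<subseteq> dom g \<union> Bot ` {..m + n}" using I by fastforce
    show "finite (dom g \<union> Bot ` {..m + n})" using G(1) by simp
  qed
  have inj\<beta>: "inj_on \<beta> ?I"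
  proof (rule inj_onI)
    fix x y assume "x \<in> ?I" "y \<in> ?I" "\<beta> x = \<beta> y"
    then show "x = y"
      using I[of x] I[of y] by (auto simp: \<beta>1 \<beta>2 dest: inj_the_dom[OF G(2)])
  qed
  have "bij_betw (map_prod id id) (crossings ?I id \<beta>) (crossings (dom g) id (\<lambda>x. the (g x)))"
  proof (rule bij_betw_crossings[OF gI bij_betw_id])
    show "x \<in> dom g \<and> y \<in> dom g"
      if xy: "x \<in> ?I" "y \<in> ?I" "id x < id y" "\<beta> y < \<beta> x" for x y
    proof -
      have "y \<in> dom g"
      proof (rule ccontr)
        assume y: "y \<notin> dom g"
        then obtain q where q: "y = Bot (m + q)" "q \<in> {1..n}" using I[OF xy(2)] by blast
        show False
        proof (cases "x \<in> dom g")
          case True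
          then show ?thesis using xy(3) q G(4)[of _ "the (g x)"] by (cases x) fastforce+
        next
          case False
          then show ?thesis using xy(3,4) y by (simp add: \<beta>2 domIff)
        qed
      qed
      moreover have "x \<in> dom g"
      proof (rule ccontr)
        assume x: "x \<notin> dom g"
        then obtain q where q: "x = Bot (m + q)" using I[OF xy(1)] by blast
        obtain j where "g y = Some j" using \<open>y \<in> dom g\<close> by blast
        then show False using xy(4) q x by (simp add: \<beta>1 \<beta>2 domIff)
      qed
      ultimately show ?thesis by simp
    qed
  qed (auto simp: \<beta>1)
  from bij_betw_same_card[OF this]
  have c1: "card (crossings ?I id \<beta>) = inv_num g" by (simp add: inv_num_eq_card)
  \<comment> \<open>Lowering the labels of the waiting entries by \<open>m\<close> turns the middle
    height into the source of \<open>h\<close> without changing the order.\<close>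
  define e where "e = (\<lambda>x. if x \<in> dom g then BPt (the (g x)) else
    case x of Bot p \<Rightarrow> Bot (p - m) | BPt i \<Rightarrow> BPt i)"
  have e1: "e x = BPt j" if "g x = Some j" for x j using that by (auto simp: e_def)
  have e2: "e (Bot (m + q)) = Bot q" if "g (Bot (m + q)) = None" for q
    using that by (simp add: e_def domIff)
  have less: "\<beta> x < \<beta> y \<longleftrightarrow> e x < e y" if "x \<in> ?I" "y \<in> ?I" for x y
    using I[OF that(1)] I[OF that(2)] by (auto simp: \<beta>1 \<beta>2 e1 e2)
  have Ce: "C x = h (e x)" if "x \<in> ?I" for x
    using I[OF that] C1[of x] C2 by (auto simp: e1 e2)
  have "bij_betw (map_prod e e) (crossings ?I \<beta> (\<lambda>s. the (C s))) (crossings (dom h) id (\<lambda>s. the (h s)))"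
  proof (rule bij_betw_crossings[OF subset_refl])
    show "bij_betw e ?I (dom h)"
      unfolding bij_betw_def
    proof
      show "inj_on e ?I"
        by (rule inj_onI) (metis Ce inj_onD[OF inj])
      show "e ` ?I = dom h"
      proof
        show "e ` ?I \<subseteq> dom h" using Ce by (metis domIff image_subsetI)
        show "dom h \<subseteq> e ` ?I"
        proof
          fix x assume "x \<in> dom h"
          then obtain y where x: "h x = Some y" by blast
          show "x \<in> e ` ?I"
          proof (cases x)
            case (BPt j)
            then obtain x' where x': "g x' = Some j" using K'' x by blast
            then have "x' \<in> ?I" "e x' = x" using gI BPt by (auto simp: e1)
            then show ?thesis by blast
          next
            case (Bot q)
            then have q: "q \<in> {1..n}" using H(4) x by blast
            have "g (Bot (m + q)) = None"
              using G(4)[of "m + q"] q by (cases "g (Bot (m + q))") auto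
            then have "Bot (m + q) \<in> ?I" "e (Bot (m + q)) = x"
              using C2[of q] q x Bot by (auto simp: e2)
            then show ?thesis by blast
          qed
        qed
      qed
    qed
  qed (auto simp: less Ce)
  from bij_betw_same_card[OF this]
  have "card (crossings ?I \<beta> (\<lambda>s. the (C s))) = inv_num h" by (simp add: inv_num_eq_card)
  then show "inv_num C + 2 * card (double_crossings ?I id \<beta> (\<lambda>s. the (C s))) =
      inv_num g + inv_num h"
    using card_crossings[OF finI inj_on_id inj\<beta> inj_on_the[OF inj]] c1
    by (simp add: inv_num_eq_card)
qed

section \<open>The modules of a matched interval\<close>

text \<open>The counterpart of \<open>strand_diff_apply\<close> for products: a coefficient becomes
  one sum over the pairs of factors that produce \<open>F\<close>, ready for reindexing.\<close>

lemma additive_product_apply: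
  assumes "finite X" "finite Y" "supp x \<subseteq> X" "supp y \<subseteq> Y"
  shows "bilinear_ext (\<lambda>f g. if K f g then single_if_inv (C f g) (inv_num f + inv_num g) else 0) x y F =
    (\<Sum>(f, g)\<in>{(f, g). f \<in> X \<and> g \<in> Y \<and> K f g \<and> C f g = F \<and>
        inv_num (C f g) = inv_num f + inv_num g}. x f * y g)"
proof -
  let ?G = "\<lambda>f g. if K f g then single_if_inv (C f g) (inv_num f + inv_num g) else 0"
  let ?P = "{(f, g). f \<in> X \<and> g \<in> Y \<and> K f g \<and> C f g = F \<and> inv_num (C f g) = inv_num f + inv_num g}"
  have XY: "finite (X \<times> Y)" "supp x \<times> supp y \<subseteq> X \<times> Y" using assms by auto
  have "bilinear_ext ?G x y F = (\<Sum>(f, g)\<in>X \<times> Y. x f * y g * ?G f g F)"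
    unfolding bilinear_ext_apply
    by (rule sum.mono_neutral_left[OF XY]) (auto simp: supp_def)
  also have "\<dots> = (\<Sum>(f, g)\<in>?P. x f * y g)"
    by (rule sum.mono_neutral_cong_right[OF XY(1)])
      (auto simp: single_if_inv_def single_apply split: if_splits)
  finally show ?thesis .
qed

text \<open>Both module products have this form. The substance is the assumption
  \<open>step\<close>: fixed strands of a composite are fixed in both factors, and shifting them in
  the factors shifts them in the composite without destroying additivity.\<close>

lemma product_in_matched:
  fixes x y :: "('a::linorder \<rightharpoonup> 'b::linorder) \<Rightarrow> 'k::field"
  assumes L: "matched_strands ia ib Z A1 B1" and R: "matched_strands ia ib Z A2 B2"
    and W: "matched_strands ia ib Z A3 B3"
    and x: "x \<in> matched_strands.matched ia ib Z A1 B1"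
    and y: "y \<in> matched_strands.matched ia ib Z A2 B2"
    and closed: "\<And>f g. f \<in> matched_strands.mstrs ia ib Z A1 B1 \<Longrightarrow>
      g \<in> matched_strands.mstrs ia ib Z A2 B2 \<Longrightarrow> K f g \<Longrightarrow>
      C f g \<in> matched_strands.mstrs ia ib Z A3 B3"
    and step: "\<And>f g S S'. f \<in> matched_strands.mstrs ia ib Z A1 B1 \<Longrightarrow>
      g \<in> matched_strands.mstrs ia ib Z A2 B2 \<Longrightarrow> K f g \<Longrightarrow>
      inv_num (C f g) = inv_num f + inv_num g \<Longrightarrow>
      S \<subseteq> fixed_points ia ib (C f g) \<Longrightarrow> S' \<subseteq> points Z \<Longrightarrow> inj_on (pair_of Z) S' \<Longrightarrow>
      pair_of Z ` S = pair_of Z ` S' \<Longrightarrow>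
      S \<subseteq> fixed_points ia ib f \<and> S \<subseteq> fixed_points ia ib g \<and>
      K (replace_fixed ia ib S S' f) (replace_fixed ia ib S S' g) \<and>
      C (replace_fixed ia ib S S' f) (replace_fixed ia ib S S' g) = replace_fixed ia ib S S' (C f g) \<and>
      inv_num (C (replace_fixed ia ib S S' f) (replace_fixed ia ib S S' g)) =
        inv_num (replace_fixed ia ib S S' f) + inv_num (replace_fixed ia ib S S' g)"
  shows "bilinear_ext (\<lambda>f g. if K f g then single_if_inv (C f g) (inv_num f + inv_num g) else 0) x y
    \<in> matched_strands.matched ia ib Z A3 B3"
proof -
  interpret L: matched_strands ia ib Z A1 B1 by (rule L)
  interpret R: matched_strands ia ib Z A2 B2 by (rule R)
  interpret W: matched_strands ia ib Z A3 B3 by (rule W)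
  let ?fp = "fixed_points ia ib" and ?rp = "replace_fixed ia ib"
  let ?P = "\<lambda>F. {(f, g). f \<in> L.mstrs \<and> g \<in> R.mstrs \<and> K f g \<and> C f g = F \<and>
    inv_num (C f g) = inv_num f + inv_num g}"
  have sx: "supp x \<subseteq> L.mstrs" using L.matchedD(1)[OF x] by (auto simp: supp_def)
  have sy: "supp y \<subseteq> R.mstrs" using R.matchedD(1)[OF y] by (auto simp: supp_def)
  note coeff = additive_product_apply[OF L.finite_mstrs R.finite_mstrs sx sy, of K C]
  have move: "(?rp (?fp F) (?fp G) f, ?rp (?fp F) (?fp G) g) \<in> ?P G"
    "L.cls (?rp (?fp F) (?fp G) f) = L.cls f" "R.cls (?rp (?fp F) (?fp G) g) = R.cls g"
    "?rp (?fp G) (?fp F) (?rp (?fp F) (?fp G) f) = f" "?rp (?fp G) (?fp F) (?rp (?fp F) (?fp G) g) = g"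
    if FG: "F \<in> W.mstrs" "G \<in> W.mstrs" "W.cls F = W.cls G" and fg: "(f, g) \<in> ?P F" for F G f g
  proof -
    have fg': "f \<in> L.mstrs" "g \<in> R.mstrs" "K f g" "C f g = F" "inv_num (C f g) = inv_num f + inv_num g"
      using fg by auto
    note SS = W.same_pairs[OF FG]
    note st = step[OF fg'(1-3,5), of "?fp F" "?fp G", unfolded fg'(4), OF subset_refl SS(1-3), unfolded SS(4)]
    note rf = L.replace_fixed[OF fg'(1) st[THEN conjunct1] SS(1-3)]
    note rg = R.replace_fixed[OF fg'(2) st[THEN conjunct2, THEN conjunct1] SS(1-3)]
    show "L.cls (?rp (?fp F) (?fp G) f) = L.cls f" "R.cls (?rp (?fp F) (?fp G) g) = R.cls g"
      "?rp (?fp G) (?fp F) (?rp (?fp F) (?fp G) f) = f" "?rp (?fp G) (?fp F) (?rp (?fp F) (?fp G) g) = g"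
      by (rule rf(2) rg(2) rf(4) rg(4))+
    show "(?rp (?fp F) (?fp G) f, ?rp (?fp F) (?fp G) g) \<in> ?P G"
      unfolding mem_Collect_eq case_prod_conv using rf(1) rg(1) st by blast
  qed
  show ?thesis
  proof (rule W.matchedI)
    fix F assume nz: "bilinear_ext (\<lambda>f g. if K f g then single_if_inv (C f g) (inv_num f + inv_num g) else 0) x y F \<noteq> 0"
    have "?P F \<noteq> {}"
    proof
      assume "?P F = {}"
      then show False using nz unfolding coeff by (simp only: sum.empty refl not_True_eq_False)
    qed
    then show "F \<in> W.mstrs" using closed by blast
  next
    fix F G assume FG: "F \<in> W.mstrs" "G \<in> W.mstrs" "W.cls F = W.cls G"
    note 1 = move[OF FG] and 2 = move[OF FG(2,1) FG(3)[symmetric]]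
    show "bilinear_ext (\<lambda>f g. if K f g then single_if_inv (C f g) (inv_num f + inv_num g) else 0) x y F =
      bilinear_ext (\<lambda>f g. if K f g then single_if_inv (C f g) (inv_num f + inv_num g) else 0) x y G"
      unfolding coeff
    proof (rule sum.reindex_bij_witness[where j = "map_prod (?rp (?fp F) (?fp G)) (?rp (?fp F) (?fp G))"
          and i = "map_prod (?rp (?fp G) (?fp F)) (?rp (?fp G) (?fp F))"])
      fix a assume a: "a \<in> ?P F"
      obtain f g where fg: "a = (f, g)" by (cases a)
      note m = 1[OF a[unfolded fg]]
      show "map_prod (?rp (?fp G) (?fp F)) (?rp (?fp G) (?fp F))
          (map_prod (?rp (?fp F) (?fp G)) (?rp (?fp F) (?fp G)) a) = a"
        unfolding fg map_prod_simp m(4,5) ..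
      show "map_prod (?rp (?fp F) (?fp G)) (?rp (?fp F) (?fp G)) a \<in> ?P G"
        unfolding fg map_prod_simp by (rule m(1))
      have "x (?rp (?fp F) (?fp G) f) = x f"
        using a m(1) by (intro L.matchedD(2)[OF x _ _ m(2)]) (simp_all add: fg)
      moreover have "y (?rp (?fp F) (?fp G) g) = y g"
        using a m(1) by (intro R.matchedD(2)[OF y _ _ m(3)]) (simp_all add: fg)
      ultimately show "(case map_prod (?rp (?fp F) (?fp G)) (?rp (?fp F) (?fp G)) a of (f, g) \<Rightarrow> x f * y g) =
          (case a of (f, g) \<Rightarrow> x f * y g)"
        by (simp add: fg)
    next
      fix a assume a: "a \<in> ?P G"
      obtain f g where fg: "a = (f, g)" by (cases a)
      note m = 2[OF a[unfolded fg]]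
      show "map_prod (?rp (?fp F) (?fp G)) (?rp (?fp F) (?fp G))
          (map_prod (?rp (?fp G) (?fp F)) (?rp (?fp G) (?fp F)) a) = a"
        unfolding fg map_prod_simp m(4,5) ..
      show "map_prod (?rp (?fp G) (?fp F)) (?rp (?fp G) (?fp F)) a \<in> ?P F"
        unfolding fg map_prod_simp by (rule m(1))
    qed
  qed
qed

lemma matched_strands_top: "two_to_one Z \<Longrightarrow> matched_strands id TPt Z {} (Top ` {1..m})"
  by unfold_locales (auto simp: strict_mono_def)

lemma matched_strands_bottom: "two_to_one Z \<Longrightarrow> matched_strands BPt id Z (Bot ` {1..m}) {}"
  by unfold_locales (auto simp: strict_mono_def)

lemma matched_strands_plain: "two_to_one Z \<Longrightarrow> matched_strands id id Z {} {}"
  by unfold_locales (auto simp: strict_mono_def)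

lemma the_inv_id: "the_inv id = id"
  by (rule ext) (simp add: the_inv_f_f[of id, simplified])

lemma fixed_strands_top: "fixed_strands id TPt S = (Some \<circ> TPt) |` S"
  by (auto simp: fixed_strands_def restrict_map_def the_inv_id fun_eq_iff)

lemma fixed_strands_plain: "fixed_strands id id S = Some |` S"
  by (auto simp: fixed_strands_def restrict_map_def the_inv_id fun_eq_iff)

lemma fixed_strands_bottom:
  "fixed_strands BPt id S = (\<lambda>x. case x of BPt i \<Rightarrow> (Some |` S) i | Bot p \<Rightarrow> None)"
proof
  fix x
  have "inj BPt" by (auto simp: inj_def)
  then show "fixed_strands BPt id S x = (case x of BPt i \<Rightarrow> (Some |` S) i | Bot p \<Rightarrow> None)"
    by (cases x) (auto simp: the_inv_f_f restrict_map_def fixed_strands_def)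
qed

section \<open>Closure of the modules of a matched interval under products and differentials\<close>

context
  fixes Z :: matching
  assumes two: "two_to_one Z"
begin

lemma top_strs: "matched_strands.strs id TPt Z {} (Top ` {1..m}) = top_strands (4 * genus Z) m"
  unfolding matched_strands.strs_def[OF matched_strands_top[OF two]] top_strands_def by simp

lemma bottom_strs: "matched_strands.strs BPt id Z (Bot ` {1..m}) {} = bottom_strands (4 * genus Z) m"
  unfolding matched_strands.strs_def[OF matched_strands_bottom[OF two]] bottom_strands_def by simp

lemma data_top: "matched_strands.data id TPt Z {} (Top ` {1..m}) = top_data Z m"
  unfolding matched_strands.data_def[OF matched_strands_top[OF two]] top_data_def by simp

lemma data_bottom: "matched_strands.data BPt id Z (Bot ` {1..m}) {} = bottom_data Z m"
  unfolding matched_strands.data_def[OF matched_strands_bottom[OF two]] bottom_data_def by simp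

lemma data_plain: "matched_strands.data id id Z {} {} = matching_data Z"
  unfolding matched_strands.data_def[OF matched_strands_plain[OF two]] matching_data_def by simp

lemma basis_top: "matched_strands.basis id TPt Z = top_basis Z"
  unfolding matched_strands.basis_def[OF matched_strands_top[OF two]] top_basis_def fixed_strands_top ..

lemma basis_bottom: "matched_strands.basis BPt id Z = bottom_basis Z"
  unfolding matched_strands.basis_def[OF matched_strands_bottom[OF two]] bottom_basis_def fixed_strands_bottom ..

lemma basis_plain: "matched_strands.basis id id Z = matching_basis Z"
  unfolding matched_strands.basis_def[OF matched_strands_plain[OF two]] matching_basis_def fixed_strands_plain ..

lemmas span_top_basis = matched_strands.span_basis[OF matched_strands_top[OF two], unfolded basis_top data_top]
lemmas span_bottom_basis = matched_strands.span_basis[OF matched_strands_bottom[OF two], unfolded basis_bottom data_bottom]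

text \<open>A strand fixed in the composite is fixed in both factors, as neither factor moves a
  point to a smaller one. After the shift, a new double crossing would have to involve a shifted
  strand, and \<open>upward\<close> in the two factors excludes this.\<close>

lemma top_product_matched:
  assumes x: "x \<in> formal.span (top_basis Z ` top_data Z m)" and y: "y \<in> formal.span (top_basis Z ` top_data Z n)"
  shows "hmult (top_module (4 * genus Z)) m n x y \<in> formal.span (top_basis Z ` top_data Z (m + n))"
proof -
  interpret L: matched_strands id TPt Z "{}" "Top ` {1..m}" by (rule matched_strands_top[OF two])
  interpret R: matched_strands id TPt Z "{}" "Top ` {1..n}" by (rule matched_strands_top[OF two])
  interpret W: matched_strands id TPt Z "{}" "Top ` {1..m + n}" by (rule matched_strands_top[OF two])
  let ?K = "\<lambda>f g. {j. TPt j \<in> ran f} = dom g" and ?C = "top_compose m"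
  have closed: "?C f g \<in> W.mstrs" if fg: "f \<in> L.mstrs" "g \<in> R.mstrs" "?K f g" for f g
  proof -
    have "f \<in> top_strands (4 * genus Z) m" "g \<in> top_strands (4 * genus Z) n"
      using fg unfolding L.mstrs_def R.mstrs_def top_strs by simp_all
    note c = top_compose_strands[OF this fg(3)]
    show ?thesis
      using fg(1,2) c(1) unfolding W.mstrs_def L.mstrs_def R.mstrs_def top_strs mem_Collect_eq c(2,3) by simp
  qed
  show ?thesis
    unfolding top_module_def algebra_module.simps span_top_basis
  proof (rule product_in_matched[OF L.matched_strands_axioms R.matched_strands_axioms W.matched_strands_axioms])
    show "x \<in> L.matched" "y \<in> R.matched" using x y unfolding span_top_basis .
    fix f g assume fg: "f \<in> L.mstrs" "g \<in> R.mstrs" "?K f g"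
    then show C: "?C f g \<in> W.mstrs" by (rule closed)
    fix S S' assume add: "inv_num (?C f g) = inv_num f + inv_num g"
      and S: "S \<subseteq> fixed_points id TPt (?C f g)"
      and S': "S' \<subseteq> points Z" "inj_on (pair_of Z) S'" "pair_of Z ` S = pair_of Z ` S'"
    have f: "f \<in> top_strands (4 * genus Z) m" and g: "g \<in> top_strands (4 * genus Z) n"
      using fg unfolding L.mstrs_def R.mstrs_def top_strs by simp_all
    note F = top_strandsD[OF f] and G = top_strandsD[OF g]
    note c = top_compose_strands[OF f g fg(3)]
    have K': "\<exists>y. g j = Some y" if "f s = Some (TPt j)" for s j
      using fg(3) ranI[of f s, OF that] by blast
    have still: "f s = Some (TPt s) \<and> g s = Some (TPt s)" if "s \<in> S" for s
    proof -
      have Cs: "?C f g s = Some (TPt s)" using S that by (auto simp: fixed_points_def)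
      show ?thesis
      proof (cases "f s")
        case None
        then show ?thesis using Cs by (simp add: top_compose_simps)
      next
        case (Some z)
        show ?thesis
        proof (cases z)
          case (Top p)
          then show ?thesis using Cs Some by (simp add: top_compose_simps)
        next
          case (TPt j)
          then obtain y where y: "g j = Some y" using K' Some by blast
          then have "y = TPt s" using Cs Some TPt
            by (cases y) (auto simp: top_compose_simps)
          moreover have "j = s" using F(3)[of s j] G(3)[of j s] y Some TPt calculation by simp
          ultimately show ?thesis using Some TPt y by simp
        qed
      qed
    qed
    have Sf: "S \<subseteq> fixed_points id TPt f" and Sg: "S \<subseteq> fixed_points id TPt g"
      using still by (auto simp: fixed_points_def)
    let ?f = "replace_fixed id TPt S S' f" and ?g = "replace_fixed id TPt S S' g"
    note rf = L.replace_fixed[OF fg(1) Sf S'] and rg = R.replace_fixed[OF fg(2) Sg S']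
      and rC = W.replace_fixed[OF C S S']
    have K2: "?K ?f ?g"
      using rf(6) rg(5) fg(3) by simp
    have f': "?f \<in> top_strands (4 * genus Z) m" and g': "?g \<in> top_strands (4 * genus Z) n"
      using rf(1) rg(1) unfolding L.mstrs_def R.mstrs_def top_strs by simp_all
    note F' = top_strandsD[OF f'] and c' = top_compose_strands[OF f' g' K2]
    have C2: "?C ?f ?g = replace_fixed id TPt S S' (?C f g)"
    proof
      fix i
      note vf = rf(9)[of i] and vC = rC(9)[of i]
      show "?C ?f ?g i = replace_fixed id TPt S S' (?C f g) i"
      proof (cases "i \<in> S'")
        case True
        then show ?thesis
          using vC rg(9)[of i] top_compose_simps(3)[of ?f i i m ?g] vf by simp
      next
        case i: False
        show ?thesis
        proof (cases "i \<in> S")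
          case True
          then show ?thesis using i vf vC by (simp add: top_compose_simps)
        next
          case False
          then have e: "?f i = f i" "replace_fixed id TPt S S' (?C f g) i = ?C f g i"
            using i vf vC by simp_all
          show ?thesis
          proof (cases "\<exists>j. f i = Some (TPt j)")
            case True
            then obtain j where j: "f i = Some (TPt j)" by blast
            have "j \<notin> S" using still[of j] j inj_the_dom[OF F(2)] False by blast
            moreover have "j \<notin> S'" using rf(8) ranI[of f i, OF j] calculation by blast
            ultimately have "?g j = g j" using rg(9)[of j] by simp
            then show ?thesis unfolding e(2) using e(1) j by (simp add: top_compose_simps)
          next
            case no: False
            then show ?thesis
              unfolding e(2) using e(1)
              by (cases "f i"; cases "the (f i)") (auto simp: top_compose_simps)
          qed
        qed
      qed
    qed
    have "inv_num (?C ?f ?g) = inv_num ?f + inv_num ?g"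
    proof -
      have none: "double_crossings (dom f) id (\<lambda>s. the (f s)) (\<lambda>s. the (?C f g s)) = {}"
        using additive_iff(2)[OF c(4) F(1)] add by simp
      \<comment> \<open>A double crossing of two strands off \<open>S'\<close> would already exist
        before the shift. It remains to keep both strands off \<open>S'\<close>.\<close>
      have "double_crossings (dom ?f) id (\<lambda>s. the (?f s)) (\<lambda>s. the (?C ?f ?g s)) = {}"
      proof (rule ccontr)
        assume "\<not> ?thesis"
        then obtain s t where st: "s \<in> dom ?f" "t \<in> dom ?f" "s < t" "the (?f t) < the (?f s)"
          "the (?C ?f ?g s) < the (?C ?f ?g t)"
          unfolding double_crossings_def by auto
        have fx: "?f i = Some (TPt i)" "?C ?f ?g i = Some (TPt i)" if "i \<in> S'" for i
          using that rf(9)[of i] rC(9)[of i] unfolding C2 by simp_all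
        have W': "?C ?f ?g \<in> W.strs" using c'(1) unfolding top_strs .
        obtain u v where uv: "?f s = Some u" "?f t = Some v" using st by blast
        obtain u' v' where uv': "?C ?f ?g s = Some u'" "?C ?f ?g t = Some v'"
          using st(1,2) c'(2) by blast
        have "s \<notin> S'"
        proof
          assume s: "s \<in> S'"
          have L': "?f \<in> L.strs" using f' unfolding top_strs .
          show False
            using L.upward(2)[OF L' uv(2), of s] st(3,4) fx(1)[OF s] uv by simp
        qed
        moreover have "t \<notin> S'"
        proof
          assume t: "t \<in> S'"
          then have u: "TPt t < u" using fx(1) st(4) uv by simp
          have "TPt t < u'"
          proof (cases u)
            case (Top p)
            then show ?thesis using uv uv' u by (simp add: top_compose_simps)
          next
            case (TPt j)
            then obtain y where y: "?g j = Some y"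
              using K2 ranI[of ?f s, OF uv(1)] by blast
            have R': "?g \<in> R.strs" using g' unfolding top_strs .
            have "TPt t < y" using R.upward(2)[OF R' y, of t] u TPt by simp
            moreover have "u' = shift_tops m y"
              using uv uv' y TPt by (simp add: top_compose_simps)
            ultimately show ?thesis by (cases y) auto
          qed
          then show False using st(5) uv' fx(2)[OF t] by simp
        qed
        ultimately have e: "s \<notin> S" "t \<notin> S" "?f s = f s" "?f t = f t"
          using st(1,2) rf(9)[of s] rf(9)[of t] by (auto split: if_splits)
        then have "?C ?f ?g s = ?C f g s" "?C ?f ?g t = ?C f g t"
          unfolding C2 using rC(9)[of s] rC(9)[of t] \<open>s \<notin> S'\<close> \<open>t \<notin> S'\<close> by simp_all
        then have "(s, t) \<in> double_crossings (dom f) id (\<lambda>s. the (f s)) (\<lambda>s. the (?C f g s))"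
          using st e by (simp add: double_crossings_def domIff)
        then show False using none by blast
      qed
      then show ?thesis using additive_iff(2)[OF c'(4) F'(1)] by simp
    qed
    then show "S \<subseteq> fixed_points id TPt f \<and> S \<subseteq> fixed_points id TPt g \<and> ?K ?f ?g \<and>
        ?C ?f ?g = replace_fixed id TPt S S' (?C f g) \<and> inv_num (?C ?f ?g) = inv_num ?f + inv_num ?g"
      using Sf Sg K2 C2 by blast
  qed
qed

text \<open>As for tops, with the middle height of \<open>bottom_compose_strands\<close>. An entry
  waiting at the bottom is below every fixed strand at the source and at the middle height, so the
  pairs to be excluded consist of strands of the first factor, where \<open>upward\<close>
  applies.\<close>

lemma bottom_product_matched:
  assumes x: "x \<in> formal.span (bottom_basis Z ` bottom_data Z m)"
    and y: "y \<in> formal.span (bottom_basis Z ` bottom_data Z n)"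
  shows "hmult (bottom_module (4 * genus Z)) m n x y \<in> formal.span (bottom_basis Z ` bottom_data Z (m + n))"
proof -
  interpret L: matched_strands BPt id Z "Bot ` {1..m}" "{}" by (rule matched_strands_bottom[OF two])
  interpret R: matched_strands BPt id Z "Bot ` {1..n}" "{}" by (rule matched_strands_bottom[OF two])
  interpret W: matched_strands BPt id Z "Bot ` {1..m + n}" "{}" by (rule matched_strands_bottom[OF two])
  let ?K = "\<lambda>f g. ran f = {i. BPt i \<in> dom g}" and ?C = "bottom_compose m"
  have closed: "?C f g \<in> W.mstrs" if fg: "f \<in> L.mstrs" "g \<in> R.mstrs" "?K f g" for f g
  proof -
    have "f \<in> bottom_strands (4 * genus Z) m" "g \<in> bottom_strands (4 * genus Z) n"
      using fg unfolding L.mstrs_def R.mstrs_def bottom_strs by simp_all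
    note c = bottom_compose_strands[OF this fg(3)]
    show ?thesis
      using fg(1,2) c(1) unfolding W.mstrs_def L.mstrs_def R.mstrs_def bottom_strs mem_Collect_eq c(2,3) by simp
  qed
  show ?thesis
    unfolding bottom_module_def algebra_module.simps span_bottom_basis
  proof (rule product_in_matched[OF L.matched_strands_axioms R.matched_strands_axioms W.matched_strands_axioms])
    show "x \<in> L.matched" "y \<in> R.matched" using x y unfolding span_bottom_basis .
    fix f g assume fg: "f \<in> L.mstrs" "g \<in> R.mstrs" "?K f g"
    then show C: "?C f g \<in> W.mstrs" by (rule closed)
    fix S S' assume add: "inv_num (?C f g) = inv_num f + inv_num g"
      and S: "S \<subseteq> fixed_points BPt id (?C f g)"
      and S': "S' \<subseteq> points Z" "inj_on (pair_of Z) S'" "pair_of Z ` S = pair_of Z ` S'"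
    have f: "f \<in> bottom_strands (4 * genus Z) m" and g: "g \<in> bottom_strands (4 * genus Z) n"
      using fg unfolding L.mstrs_def R.mstrs_def bottom_strs by simp_all
    note F = bottom_strandsD[OF f] and G = bottom_strandsD[OF g]
    note c = bottom_compose_strands[OF f g fg(3)]
    have still: "f (BPt s) = Some s \<and> g (BPt s) = Some s" if "s \<in> S" for s
    proof -
      have Cs: "?C f g (BPt s) = Some s" using S that by (auto simp: fixed_points_def)
      then obtain j where j: "f (BPt s) = Some j" "g (BPt j) = Some s"
        by (auto simp: bottom_compose_simps split: option.splits)
      then have "j = s" using F(3)[of s j] G(3)[of j s] by simp
      then show ?thesis using j by simp
    qed
    have Sf: "S \<subseteq> fixed_points BPt id f" and Sg: "S \<subseteq> fixed_points BPt id g"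
      using still by (auto simp: fixed_points_def)
    let ?f = "replace_fixed BPt id S S' f" and ?g = "replace_fixed BPt id S S' g"
    note rf = L.replace_fixed[OF fg(1) Sf S'] and rg = R.replace_fixed[OF fg(2) Sg S']
      and rC = W.replace_fixed[OF C S S']
    have K2: "?K ?f ?g"
      using rf(6) rg(5) fg(3) by simp
    have f': "?f \<in> bottom_strands (4 * genus Z) m" and g': "?g \<in> bottom_strands (4 * genus Z) n"
      using rf(1) rg(1) unfolding L.mstrs_def R.mstrs_def bottom_strs by simp_all
    note F' = bottom_strandsD[OF f'] and c' = bottom_compose_strands[OF f' g' K2]
    have gsame: "?g (BPt j) = g (BPt j)" if "f z = Some j" "\<And>s. z = BPt s \<Longrightarrow> s \<notin> S" for z j
    proof -
      have "j \<notin> S" using still[of j] that inj_the_dom[OF F(2)] by blast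
      moreover have "j \<notin> S'" using rf(8) ranI[of f z, OF that(1)] calculation by auto
      ultimately show ?thesis using rg(9)[of j] by simp
    qed
    have C2: "?C ?f ?g = replace_fixed BPt id S S' (?C f g)"
    proof
      fix z
      show "?C ?f ?g z = replace_fixed BPt id S S' (?C f g) z"
      proof (cases z)
        case (BPt i)
        then show ?thesis
          using rf(9)[of i] rC(9)[of i] rg(9)[of i] gsame[of z]
          by (auto simp: bottom_compose_simps split: option.splits)
      next
        case (Bot p)
        then have z: "?f z = f z" "replace_fixed BPt id S S' (?C f g) z = ?C f g z"
          by (auto intro!: rf(10) rC(10))
        show ?thesis
        proof (cases "p \<le> m")
          case True
          then show ?thesis unfolding z(2) using z(1) gsame[of z] Bot
            by (auto simp: bottom_compose_simps split: option.splits)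
        next
          case False
          have "?g (Bot (p - m)) = g (Bot (p - m))" by (rule rg(10)) auto
          then show ?thesis unfolding z(2) using Bot False by (simp add: bottom_compose_simps)
        qed
      qed
    qed
    have "inv_num (?C ?f ?g) = inv_num ?f + inv_num ?g"
    proof -
      let ?b = "\<lambda>f x. if x \<in> dom f then BPt (the (f x)) else x"
      have fin: "finite (dom (?C f g))" "finite (dom (?C ?f ?g))"
        using bottom_strandsD(1)[OF c(1)] bottom_strandsD(1)[OF c'(1)] by auto
      have none: "double_crossings (dom (?C f g)) id (?b f) (\<lambda>s. the (?C f g s)) = {}"
        using additive_iff(2)[OF c(4) fin(1)] add by simp
      have "double_crossings (dom (?C ?f ?g)) id (?b ?f) (\<lambda>s. the (?C ?f ?g s)) = {}"
      proof (rule ccontr)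
        assume "\<not> ?thesis"
        then obtain s t where st: "s \<in> dom (?C ?f ?g)" "t \<in> dom (?C ?f ?g)" "s < t" "?b ?f t < ?b ?f s"
          "the (?C ?f ?g s) < the (?C ?f ?g t)"
          unfolding double_crossings_def by auto
        have fx: "?f (BPt i) = Some i" "?C ?f ?g (BPt i) = Some i" if "i \<in> S'" for i
          using that rf(9)[of i] rC(9)[of i] unfolding C2 by simp_all
        have bfx: "?b ?f (BPt i) = BPt i" if "i \<in> S'" for i
          using fx(1)[OF that] by auto
        have L': "?f \<in> L.strs" and R': "?g \<in> R.strs" using f' g' unfolding bottom_strs .
        obtain u' v' where uv': "?C ?f ?g s = Some u'" "?C ?f ?g t = Some v'"
          using st(1,2) by blast
        have s: "s \<noteq> BPt i" if "i \<in> S'" for i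
        proof
          assume s: "s = BPt i"
          then obtain k where k: "t = BPt k" "i < k" using st(3) by (cases t) auto
          then obtain j where j: "?f t = Some j" using uv'(2)
            by (auto simp: bottom_compose_simps split: option.splits)
          then have "i < j" using F'(3)[of k j] k by auto
          moreover have "?b ?f t < BPt i" using st(4) unfolding s bfx[OF that] .
          ultimately show False using domI[of ?f t, OF j] j by simp
        qed
        moreover have t: "t \<noteq> BPt i" if "i \<in> S'" for i
        proof
          assume t: "t = BPt i"
          have "BPt i < ?b ?f s" using st(4) unfolding t bfx[OF that] .
          moreover have "s < BPt i" using st(3) t by simp
          ultimately obtain j where j: "?f s = Some j" "i < j"
            by (cases "?f s") (auto simp: dom_def split: if_splits)
          obtain y where y: "?g (BPt j) = Some y"
            using K2 ranI[of ?f s, OF j(1)] by blast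
          have "?C ?f ?g s = Some y"
          proof (cases s)
            case (BPt a)
            then show ?thesis using j y by (simp add: bottom_compose_simps)
          next
            case (Bot p)
            then have "p \<le> m" using F'(4)[of p j] j by simp
            then show ?thesis using j y Bot by (simp add: bottom_compose_simps)
          qed
          moreover have "i < y" using R.upward(2)[OF R' y, of i] j(2) by simp
          ultimately show False using st(5) t fx(2)[OF that] by simp
        qed
        have e: "?f z = f z \<and> ?C ?f ?g z = ?C f g z"
          if z: "z \<in> dom (?C ?f ?g)" "\<And>i. i \<in> S' \<Longrightarrow> z \<noteq> BPt i" for z
        proof (cases z)
          case (BPt i)
          then show ?thesis using z rf(9)[of i] rC(9)[of i] unfolding C2 by (auto split: if_splits)
        next
          case (Bot p)
          then show ?thesis unfolding C2 by (auto intro!: rf(10) rC(10))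
        qed
        have "(s, t) \<in> double_crossings (dom (?C f g)) id (?b f) (\<lambda>s. the (?C f g s))"
        proof -
          note es = e[OF st(1) s] and et = e[OF st(2) t]
          have "?b ?f s = ?b f s" "?b ?f t = ?b f t" using es et by (simp_all add: domIff)
          then have "?b f t < ?b f s" using st(4) by (simp only:)
          moreover have "s \<in> dom (?C f g)" "t \<in> dom (?C f g)" "the (?C f g s) < the (?C f g t)"
            using st(1,2,5) es et by (simp_all add: domIff)
          ultimately show ?thesis
            using st(3) unfolding double_crossings_def mem_Collect_eq case_prod_conv id_apply by blast
        qed
        then show False using none by blast
      qed
      then show ?thesis using additive_iff(2)[OF c'(4) fin(2)] by simp
    qed
    then show "S \<subseteq> fixed_points BPt id f \<and> S \<subseteq> fixed_points BPt id g \<and> ?K ?f ?g \<and>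
        ?C ?f ?g = replace_fixed BPt id S S' (?C f g) \<and> inv_num (?C ?f ?g) = inv_num ?f + inv_num ?g"
      using Sf Sg K2 C2 by blast
  qed
qed

lemma top_diff_matched:
  "x \<in> formal.span (top_basis Z ` top_data Z m) \<Longrightarrow>
   strand_diff x \<in> formal.span (top_basis Z ` top_data Z m)"
  unfolding span_top_basis by (rule matched_strands.strand_diff_matched[OF matched_strands_top[OF two]])

lemma bottom_diff_matched:
  "x \<in> formal.span (bottom_basis Z ` bottom_data Z m) \<Longrightarrow>
   strand_diff x \<in> formal.span (bottom_basis Z ` bottom_data Z m)"
  unfolding span_bottom_basis
  by (rule matched_strands.strand_diff_matched[OF matched_strands_bottom[OF two]])

end

section \<open>Gluing strands\<close>

text \<open>The points of the second interval follow those of the first, hence the shift by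
  \<open>n\<close>. A strand that leaves at t_p continues as the one that enters at b_p.\<close>

definition glue_strands :: "nat \<Rightarrow> (nat \<rightharpoonup> top_target) \<Rightarrow> (bottom_source \<rightharpoonup> nat) \<Rightarrow> (nat \<rightharpoonup> nat)"
  where "glue_strands n f g = (\<lambda>s. if s \<le> n then (case f s of
      None \<Rightarrow> None
    | Some (TPt j) \<Rightarrow> Some j
    | Some (Top p) \<Rightarrow> map_option ((+) n) (g (Bot p)))
    else map_option ((+) n) (g (BPt (s - n))))"

lemma glue_strands_simps:
  "s \<le> n \<Longrightarrow> f s = None \<Longrightarrow> glue_strands n f g s = None"
  "s \<le> n \<Longrightarrow> f s = Some (TPt j) \<Longrightarrow> glue_strands n f g s = Some j"
  "s \<le> n \<Longrightarrow> f s = Some (Top p) \<Longrightarrow> glue_strands n f g s = map_option ((+) n) (g (Bot p))"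
  "n < s \<Longrightarrow> glue_strands n f g s = map_option ((+) n) (g (BPt (s - n)))"
  by (auto simp: glue_strands_def)

text \<open>The same count at three heights, for the product of glued strands. The inequality
  suffices, because \<open>glue_term_mult\<close> recognises the additive case from the total number
  of inversions.\<close>

lemma inv_num_comp_le:
  assumes f: "finite (dom f)" "inj_on f (dom f)" and g: "inj_on g (dom g)" and K: "ran f = dom g"
  shows "inv_num (g \<circ>\<^sub>m f) \<le> inv_num f + inv_num g"
proof -
  let ?C = "g \<circ>\<^sub>m f"
  have K': "\<exists>y. g j = Some y" if "f s = Some j" for s j
    using K ranI[of f s, OF that] by blast
  have C: "?C s = g j" if "f s = Some j" for s j using that by simp
  have dom: "dom ?C = dom f" using K' by (fastforce simp: map_comp_def split: option.splits)
  have inj: "inj_on ?C (dom ?C)"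
  proof (rule inj_onI)
    fix s s' assume "s \<in> dom ?C" "?C s = ?C s'"
    then obtain y where y: "?C s = Some y" "?C s' = Some y" by (metis domD)
    then obtain j j' where "f s = Some j" "g j = Some y" "f s' = Some j'" "g j' = Some y"
      by (auto simp: map_comp_Some_iff)
    then show "s = s'" by (metis inj_the_dom f(2) g)
  qed
  have injs: "inj_on (\<lambda>s. the (f s)) (dom f)" "inj_on (\<lambda>s. the (?C s)) (dom f)"
    using inj_on_the[OF f(2)] inj_on_the[OF inj] by (simp_all only: dom)
  let ?e = "\<lambda>s. the (f s)"
  have "bij_betw (map_prod ?e ?e) (crossings (dom f) ?e (\<lambda>s. the (?C s)))
    (crossings (dom g) id (\<lambda>j. the (g j)))"
  proof (rule bij_betw_crossings[OF subset_refl])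
    show "bij_betw ?e (dom f) (dom g)"
      using injs(1) unfolding bij_betw_def K[symmetric] by (force simp: ran_def image_iff)
  qed (auto simp: C)
  from bij_betw_same_card[OF this] show ?thesis
    using card_crossings[OF f(1) inj_on_id injs] by (simp add: inv_num_eq_card dom)
qed

section \<open>Inversions of glued strands\<close>

context
  fixes n n' m :: nat and f :: "nat \<rightharpoonup> top_target" and g :: "bottom_source \<rightharpoonup> nat"
  assumes f: "f \<in> top_strands n m" and g: "g \<in> bottom_strands n' m"
begin

private abbreviation "F \<equiv> glue_strands n f g"

text \<open>Positions at the cut. Strands ending in the first interval get values at most -m - 1, a
  strand leaving at t_p gets -p, and strands starting in the second interval get positive values.
  The order is thus that of the targets of \<open>f\<close>, followed by the points of the second
  interval.\<close>

private definition \<beta> :: "nat \<Rightarrow> int"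
  where "\<beta> s = (if s \<le> n then (case the (f s) of TPt j \<Rightarrow> int j - int n - int m - 1 | Top p \<Rightarrow> - int p)
    else int (s - n))"

private definition below :: "nat \<Rightarrow> bottom_source"
  where "below s = (if s \<le> n then Bot (top_label (the (f s))) else BPt (s - n))"

text \<open>The strands with a part in the second interval, whether they pass the cut or start
  beyond it; \<open>below\<close> identifies them with the strands of \<open>g\<close>.\<close>

private definition crossing :: "nat set"
  where "crossing = {s. (\<exists>p. f s = Some (Top p)) \<or> n < s \<and> BPt (s - n) \<in> dom g}"

private lemmas fD = top_strandsD[OF f]
private lemmas gD = bottom_strandsD[OF g]

lemma glue_strands_cases:
  assumes "F s = Some y"
  obtains "f s = Some (TPt y)" "s \<le> n" "y \<in> {1..n}" "s \<le> y"
  | p v where "f s = Some (Top p)" "s \<le> n" "g (Bot p) = Some v" "y = n + v" "p \<in> {1..m}"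
  | v where "n < s" "f s = None" "g (BPt (s - n)) = Some v" "y = n + v"
proof (cases "s \<le> n")
  case True
  show thesis
  proof (cases "f s")
    case None
    then show thesis using assms True by (simp add: glue_strands_simps)
  next
    case (Some z)
    show thesis
    proof (cases z)
      case (TPt j)
      then show thesis using assms True Some that(1) fD(3)[of s j] by (simp add: glue_strands_simps)
    next
      case (Top p)
      then obtain v where "g (Bot p) = Some v" using Some fD(4)[of s p] gD(5)[of p] by blast
      then show thesis using assms True Some Top that(2) fD(4)[of s p] by (simp add: glue_strands_simps)
    qed
  qed
next
  case False
  moreover have "f s = None"
  proof (cases "f s")
    case (Some z)
    then show ?thesis using False fD(3,4)[of s] by (cases z) auto
  qed
  ultimately show thesis using assms that(3) by (auto simp: glue_strands_simps)
qed

lemma glue_top_val: "f s = Some (Top p) \<Longrightarrow> \<exists>v. g (Bot p) = Some v \<and> F s = Some (n + v)"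
  using fD(4)[of s p] gD(5)[of p] by (auto simp: glue_strands_simps)

lemma glue_point_val: "f s = Some (TPt j) \<Longrightarrow> F s = Some j"
  using fD(3)[of s j] by (auto simp: glue_strands_simps)

lemma glue_bottom_val: "g (BPt i) = Some v \<Longrightarrow> F (n + i) = Some (n + v)"
  using gD(3)[of i v] by (auto simp: glue_strands_simps)

lemma dom_glue: "dom F = dom f \<union> (+) n ` {i. BPt i \<in> dom g}"
proof
  show "dom F \<subseteq> dom f \<union> (+) n ` {i. BPt i \<in> dom g}"
  proof
    fix s assume "s \<in> dom F"
    then obtain y where "F s = Some y" by blast
    then show "s \<in> dom f \<union> (+) n ` {i. BPt i \<in> dom g}"
    proof (cases rule: glue_strands_cases)
      case (3 v)
      then show ?thesis by (auto intro!: image_eqI[of _ _ "s - n"])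
    qed auto
  qed
  show "dom f \<union> (+) n ` {i. BPt i \<in> dom g} \<subseteq> dom F"
  proof (intro Un_least subsetI)
    fix s assume "s \<in> dom f"
    then obtain y where "f s = Some y" by blast
    then show "s \<in> dom F" using glue_top_val[of s] glue_point_val[of s] by (cases y) auto
  next
    fix s assume "s \<in> (+) n ` {i. BPt i \<in> dom g}"
    then show "s \<in> dom F" using glue_bottom_val by auto
  qed
qed

lemma ran_glue: "ran F = {j. TPt j \<in> ran f} \<union> (+) n ` ran g"
proof
  show "ran F \<subseteq> {j. TPt j \<in> ran f} \<union> (+) n ` ran g"
  proof
    fix y assume "y \<in> ran F"
    then obtain s where "F s = Some y" by (auto simp: ran_def)
    then show "y \<in> {j. TPt j \<in> ran f} \<union> (+) n ` ran g"
      by (cases rule: glue_strands_cases) (auto intro: ranI)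
  qed
  show "{j. TPt j \<in> ran f} \<union> (+) n ` ran g \<subseteq> ran F"
  proof (intro Un_least subsetI)
    fix y assume "y \<in> {j. TPt j \<in> ran f}"
    then obtain s where "f s = Some (TPt y)" by (auto simp: ran_def)
    then show "y \<in> ran F" using glue_point_val by (auto intro: ranI)
  next
    fix y assume "y \<in> (+) n ` ran g"
    then obtain x v where x: "g x = Some v" "y = n + v" by (auto simp: ran_def)
    show "y \<in> ran F"
    proof (cases x)
      case (BPt i)
      then show ?thesis using glue_bottom_val[of i v] x by (auto intro: ranI)
    next
      case (Bot p)
      then obtain s where "f s = Some (Top p)" using gD(4)[of p v] fD(5)[of p] x by blast
      then show ?thesis using glue_top_val[of s p] x Bot by (auto intro: ranI)
    qed
  qed
qed

lemma inj_on_glue: "inj_on F (dom F)"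
proof (rule inj_onI)
  fix s s' assume "s \<in> dom F" "F s = F s'"
  then obtain y where y: "F s = Some y" "F s' = Some y" by (metis domD)
  have pos: "1 \<le> v" if "g x = Some v" for x v
    using that gD(3,4) by (cases x) fastforce+
  show "s = s'"
    using y(1)
  proof (cases rule: glue_strands_cases)
    case 1
    show ?thesis using y(2)
      by (cases rule: glue_strands_cases) (use 1 pos inj_the_dom[OF fD(2)] in fastforce)+
  next
    case s: (2 p v)
    show ?thesis using y(2)
    proof (cases rule: glue_strands_cases)
      case 1
      then show ?thesis using s pos by fastforce
    next
      case (2 q u)
      then have "Bot p = Bot q" using s by (intro inj_the_dom[OF gD(2)]) auto
      then show ?thesis using s 2 inj_the_dom[OF fD(2)] by auto
    next
      case (3 u)
      then have "Bot p = BPt (s' - n)" using s by (intro inj_the_dom[OF gD(2)]) auto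
      then show ?thesis by simp
    qed
  next
    case s: (3 v)
    show ?thesis using y(2)
    proof (cases rule: glue_strands_cases)
      case 1
      then show ?thesis using s pos by fastforce
    next
      case (2 q u)
      then have "Bot q = BPt (s - n)" using s by (intro inj_the_dom[OF gD(2)]) auto
      then show ?thesis by simp
    next
      case (3 u)
      then have "BPt (s - n) = BPt (s' - n)" using s by (intro inj_the_dom[OF gD(2)]) auto
      then show ?thesis using s 3 by simp
    qed
  qed
qed

lemma finite_dom_glue: "finite (dom F)"
proof -
  have "{i. BPt i \<in> dom g} \<subseteq> {1..n'}" using gD(3) by blast
  then show ?thesis unfolding dom_glue using fD(1) by (auto intro: finite_subset)
qed

private lemma crossing_dom: "crossing \<subseteq> dom F"
  using glue_top_val unfolding dom_glue crossing_def by (auto intro!: image_eqI[of _ _ "_ - n"])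

private lemma dom_cases:
  assumes "s \<in> dom F"
  obtains j where "f s = Some (TPt j)" "s \<le> n" "j \<le> n" "F s = Some j" "\<beta> s = int j - int n - int m - 1" "s \<notin> crossing"
  | p v where "f s = Some (Top p)" "s \<le> n" "p \<in> {1..m}" "g (Bot p) = Some v" "F s = Some (n + v)"
    "\<beta> s = - int p" "s \<in> crossing" "below s = Bot p"
  | v where "n < s" "f s = None" "g (BPt (s - n)) = Some v" "F s = Some (n + v)" "\<beta> s = int (s - n)"
    "s \<in> crossing" "below s = BPt (s - n)"
proof -
  obtain y where y: "F s = Some y" using assms by blast
  then show thesis
  proof (cases rule: glue_strands_cases)
    case 1
    then show thesis using that(1)[of y] y by (simp add: \<beta>_def crossing_def)
  next
    case (2 p v)
    then show thesis using that(2)[of p v] y by (auto simp: \<beta>_def crossing_def below_def)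
  next
    case (3 v)
    then show thesis using that(3)[of v] y by (auto simp: \<beta>_def crossing_def below_def)
  qed
qed

private lemma inj_\<beta>: "inj_on \<beta> (dom F)"
proof (rule inj_onI)
  fix s t assume s: "s \<in> dom F" and t: "t \<in> dom F" and e: "\<beta> s = \<beta> t"
  from s show "s = t"
  proof (cases rule: dom_cases)
    case s: (1 j)
    from t show ?thesis
    proof (cases rule: dom_cases)
      case (1 k)
      then have "f t = Some (TPt j)" using s e by simp
      then show ?thesis using inj_the_dom[OF fD(2) s(1)] by simp
    qed (use s e in auto)
  next
    case s: (2 p v)
    from t show ?thesis
    proof (cases rule: dom_cases)
      case (2 q u)
      then have "f t = Some (Top p)" using s e by simp
      then show ?thesis using inj_the_dom[OF fD(2) s(1)] by simp
    qed (use s e in auto)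
  next
    case s: (3 v)
    from t show ?thesis
      by (cases rule: dom_cases) (use s e in auto)
  qed
qed

text \<open>Strands that start in the second interval keep their order and lie to the right of all
  others, at the source as well as at the cut. So only strands of \<open>f\<close> cross before the
  cut.\<close>

private lemma crossings_\<beta>: "crossings (dom F) id \<beta> = inversions f"
proof -
  have "(s, t) \<in> crossings (dom F) id \<beta> \<longleftrightarrow> (s, t) \<in> inversions f" for s t
  proof (cases "s \<in> dom F \<and> t \<in> dom F")
    case True
    then show ?thesis
      by (elim conjE dom_cases) (auto simp: crossings_def inversions_def)
  next
    case False
    then show ?thesis by (auto simp: crossings_def inversions_def dom_glue)
  qed
  then show ?thesis by auto
qed

private lemma bij_below: "bij_betw below crossing (dom g)"
  unfolding bij_betw_def
proof
  show "inj_on below crossing"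
  proof (rule inj_onI)
    fix s t assume s: "s \<in> crossing" and t: "t \<in> crossing" and e: "below s = below t"
    have "s \<in> dom F" "t \<in> dom F" using s t crossing_dom by auto
    then show "s = t"
      by (elim dom_cases) (use s t e inj_the_dom[OF fD(2)] in auto)
  qed
  show "below ` crossing = dom g"
  proof
    show "below ` crossing \<subseteq> dom g"
    proof
      fix x assume "x \<in> below ` crossing"
      then obtain s where s: "s \<in> crossing" "x = below s" by blast
      then have "s \<in> dom F" using crossing_dom by blast
      then show "x \<in> dom g" by (cases rule: dom_cases) (use s in auto)
    qed
    show "dom g \<subseteq> below ` crossing"
    proof
      fix x assume "x \<in> dom g"
      then obtain v where x: "g x = Some v" by blast
      show "x \<in> below ` crossing"
      proof (cases x)
        case (BPt i)
        then have "1 \<le> i" using gD(3)[of i v] x by simp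
        then show ?thesis using x BPt
          by (intro image_eqI[of _ _ "n + i"]) (auto simp: below_def crossing_def)
      next
        case (Bot p)
        then obtain s where s: "f s = Some (Top p)" using gD(4)[of p v] fD(5)[of p] x by blast
        then show ?thesis using Bot fD(4)[OF s]
          by (intro image_eqI[of _ _ s]) (auto simp: below_def crossing_def)
      qed
    qed
  qed
qed

text \<open>Strands that end in the first interval keep their order and lie to the left of all
  others, at the cut as well as at the target. So only strands with a part in the second interval
  cross after the cut.\<close>

private lemma bij_crossings_below:
  "bij_betw (map_prod below below) (crossings (dom F) \<beta> (\<lambda>s. the (F s))) (inversions g)"
  unfolding inversions_eq_crossings
proof (rule bij_betw_crossings[OF crossing_dom bij_below])
  fix s t assume st: "s \<in> dom F" "t \<in> dom F" "\<beta> s < \<beta> t" "the (F t) < the (F s)"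
  then show "s \<in> crossing \<and> t \<in> crossing"
    by (elim dom_cases) auto
next
  fix s t assume st: "s \<in> crossing" "t \<in> crossing"
  then have "s \<in> dom F" "t \<in> dom F" using crossing_dom by auto
  then show "\<beta> s < \<beta> t \<and> the (F t) < the (F s) \<longleftrightarrow>
      id (below s) < id (below t) \<and> the (g (below t)) < the (g (below s))"
    by (elim dom_cases) (use st in auto)
qed

lemma inv_num_glue:
  "inv_num F + 2 * card (double_crossings (dom F) id \<beta> (\<lambda>s. the (F s))) = inv_num f + inv_num g"
  using card_crossings[OF finite_dom_glue inj_on_id inj_\<beta> inj_on_the[OF inj_on_glue]]
    bij_betw_same_card[OF bij_crossings_below]
  by (simp add: inv_num_def crossings_\<beta> inversions_eq_crossings[of F])

lemma inv_num_glue_le: "inv_num F \<le> inv_num f + inv_num g"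
  using inv_num_glue by simp

text \<open>A strand contained in one of the intervals crosses others on one side of the cut only.
  Two strands that cross twice therefore both pass the cut.\<close>

lemma inv_num_glue_eq_iff:
  "inv_num F = inv_num f + inv_num g \<longleftrightarrow>
    \<not> (\<exists>s t p q. s < t \<and> f s = Some (Top p) \<and> f t = Some (Top q) \<and> p < q \<and> the (g (Bot p)) < the (g (Bot q)))"
proof -
  have "(s, t) \<in> double_crossings (dom F) id \<beta> (\<lambda>s. the (F s)) \<longleftrightarrow>
    s < t \<and> (\<exists>p q. f s = Some (Top p) \<and> f t = Some (Top q) \<and> p < q \<and> the (g (Bot p)) < the (g (Bot q)))"
    for s t
  proof (cases "s \<in> dom F \<and> t \<in> dom F")
    case True
    then show ?thesis by (elim conjE dom_cases) (auto simp: double_crossings_def)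
  next
    case False
    then show ?thesis by (auto simp: double_crossings_def dom_glue)
  qed
  then have "double_crossings (dom F) id \<beta> (\<lambda>s. the (F s)) = {} \<longleftrightarrow>
    \<not> (\<exists>s t p q. s < t \<and> f s = Some (Top p) \<and> f t = Some (Top q) \<and> p < q \<and> the (g (Bot p)) < the (g (Bot q)))"
    by (simp only: set_eq_iff split_paired_all empty_iff not_ex split_paired_All simp_thms) blast
  then show ?thesis using additive_iff(2)[OF inv_num_glue finite_dom_glue] by simp
qed

lemma glue_exchange_top:
  assumes "p \<in> inversions f"
  shows "exchange F p = glue_strands n (exchange f p) g"
proof
  fix s
  obtain x y where p: "p = (x, y)" by (cases p)
  then obtain u v where "f x = Some u" "f y = Some v" using assms by (auto simp: inversions_def)
  then have xy: "x \<le> n" "y \<le> n" using fD(3,4)[of x] fD(3,4)[of y] by (cases u; cases v; auto)+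
  have t: "transpose x y s \<le> n \<longleftrightarrow> s \<le> n" using xy by (auto simp: transpose_def)
  have "transpose x y s = s" if "\<not> s \<le> n" using xy that by (auto simp: transpose_def)
  then show "exchange F p s = glue_strands n (exchange f p) g s"
    using t by (auto simp: p exchange_eq_comp glue_strands_def)
qed

text \<open>As \<open>below\<close> is a bijection onto the source of \<open>g\<close>, it carries
  the transposition of \<open>a\<close> and \<open>b\<close> to the transposition of their positions
  there.\<close>

private lemma glue_exchange_below:
  assumes "a \<in> crossing" "b \<in> crossing"
  shows "exchange F (a, b) = glue_strands n f (exchange g (below a, below b))"
proof
  fix s
  have val: "glue_strands n f h s = map_option ((+) n) (h (below s))" if "s \<in> crossing" for s h
  proof -
    have "s \<in> dom F" using that crossing_dom by auto
    then show ?thesis by (cases rule: dom_cases) (use that in \<open>auto simp: glue_strands_simps\<close>)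
  qed
  have inj: "below s = below t \<longleftrightarrow> s = t" if "s \<in> crossing" "t \<in> crossing" for s t
    using bij_below that by (auto simp: bij_betw_def dest: inj_onD)
  show "exchange F (a, b) s = glue_strands n f (exchange g (below a, below b)) s"
  proof (cases "s \<in> crossing")
    case True
    have t: "transpose a b s \<in> crossing" "transpose (below a) (below b) (below s) = below (transpose a b s)"
      using True assms inj by (auto simp: transpose_def)
    show ?thesis using val[OF t(1), of g] val[OF True] t(2) by (simp add: exchange_eq_comp)
  next
    case False
    then have "s \<noteq> a" "s \<noteq> b" using assms by auto
    then have e: "exchange F (a, b) s = F s" by (simp add: exchange_eq_comp)
    show ?thesis
    proof (cases "s \<le> n")
      case True
      have "F s = glue_strands n f h s" for h
        using True False by (auto simp: crossing_def glue_strands_def split: option.splits top_target.splits)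
      then show ?thesis using e by simp
    next
      case s: False
      have "below a \<in> dom g" "below b \<in> dom g"
        using assms bij_betwE[OF bij_below] by blast+
      moreover have "BPt (s - n) \<notin> dom g" using False s by (auto simp: crossing_def)
      ultimately have "BPt (s - n) \<noteq> below a" "BPt (s - n) \<noteq> below b" by metis+
      then show ?thesis unfolding e using s by (simp add: glue_strands_def exchange_eq_comp)
    qed
  qed
qed

text \<open>
  The crossings of \<open>F\<close> are those of \<open>f\<close> or \<open>g\<close>, but not both; this symmetric difference turns into
  a sum in characteristic \<open>2\<close>.
\<close>

lemma sum_inversions_glue:
  fixes \<phi> :: "(nat \<rightharpoonup> nat) \<Rightarrow> 'x \<Rightarrow> 'k::field"
  assumes char: "CHAR('k) = 2"
  shows "(\<Sum>p\<in>inversions f. \<phi> (glue_strands n (exchange f p) g)) +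
      (\<Sum>q\<in>inversions g. \<phi> (glue_strands n f (exchange g q))) =
    (\<Sum>p\<in>inversions F. \<phi> (exchange F p))"
proof -
  let ?B = "sorted_crossings (dom F) id \<beta> (\<lambda>s. the (F s))"
  let ?C = "crossings (dom F) \<beta> (\<lambda>s. the (F s))"
  note inj = inj_on_id[of "dom F"] inj_\<beta> inj_on_the[OF inj_on_glue]
  have fin: "finite (inversions f)" "finite ?B" "finite (inversions F)"
    using finite_crossings[OF finite_dom_glue, of id \<beta>] finite_crossings[OF finite_dom_glue, of \<beta>]
      bij_betw_finite[OF bij_betw_sort_pair[OF inj]] finite_crossings[OF finite_dom_glue]
    by (auto simp: crossings_\<beta> inversions_eq_crossings[of F])
  have sub: "a \<in> crossing \<and> b \<in> crossing" if ab: "(a, b) \<in> ?C" for a b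
  proof -
    have "a \<in> dom F" "b \<in> dom F" "\<beta> a < \<beta> b" "the (F b) < the (F a)"
      using ab by (auto simp: crossings_def)
    then show ?thesis by (elim dom_cases) auto
  qed
  have "(\<Sum>q\<in>inversions g. \<phi> (glue_strands n f (exchange g q))) =
      (\<Sum>q\<in>?C. \<phi> (glue_strands n f (exchange g (map_prod below below q))))"
    by (rule sum.reindex_bij_betw[OF bij_crossings_below, symmetric])
  also have "\<dots> = (\<Sum>q\<in>?C. \<phi> (exchange F (sort_pair id q)))"
  proof (rule sum.cong[OF refl])
    fix q assume q: "q \<in> ?C"
    obtain a b where ab: "q = (a, b)" by (cases q)
    \<comment> \<open>An exchange does not depend on the order of the two strands, so sorting the
      pair is harmless.\<close>
    have "exchange F (sort_pair id q) = exchange F (a, b)"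
      by (simp add: ab sort_pair_def exchange_commute[of F b a])
    also have "\<dots> = glue_strands n f (exchange g (map_prod below below q))"
      using glue_exchange_below sub q by (simp add: ab)
    finally show "\<phi> (glue_strands n f (exchange g (map_prod below below q))) =
        \<phi> (exchange F (sort_pair id q))" by simp
  qed
  also have "\<dots> = (\<Sum>p\<in>?B. \<phi> (exchange F p))"
    by (rule sum.reindex_bij_betw[OF bij_betw_sort_pair[OF inj]])
  finally have g_sum: "(\<Sum>q\<in>inversions g. \<phi> (glue_strands n f (exchange g q))) =
      (\<Sum>p\<in>?B. \<phi> (exchange F p))" .
  let ?A = "inversions f"
  have f_sum: "(\<Sum>p\<in>?A. \<phi> (glue_strands n (exchange f p) g)) = (\<Sum>p\<in>?A. \<phi> (exchange F p))"
    by (intro sum.cong refl) (simp add: glue_exchange_top)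
  have F: "inversions F = (?A - ?B) \<union> (?B - ?A)"
    using crossings_symmetric_difference(1)[OF inj, unfolded crossings_\<beta>]
    by (auto simp: inversions_eq_crossings[of F])
  have two: "x + x = 0" for x :: "'x \<Rightarrow> 'k"
  proof
    fix a
    have "(2::'k) = 0" using char of_nat_CHAR[where ?'a = 'k] by simp
    then have "2 * x a = 0" by simp
    then show "(x + x) a = 0 a" by (simp only: plus_fun_def zero_fun_def mult_2)
  qed
  have "(\<Sum>p\<in>inversions F. \<phi> (exchange F p)) =
      (\<Sum>p\<in>?A - ?B. \<phi> (exchange F p)) + (\<Sum>p\<in>?B - ?A. \<phi> (exchange F p))"
    unfolding F using fin by (intro sum.union_disjoint) auto
  moreover have "(\<Sum>p\<in>?A. \<phi> (exchange F p)) =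
      (\<Sum>p\<in>?A - ?B. \<phi> (exchange F p)) + (\<Sum>p\<in>?A \<inter> ?B. \<phi> (exchange F p))"
    using sum.Int_Diff[OF fin(1), of "\<lambda>p. \<phi> (exchange F p)" ?B] by (simp add: add.commute)
  moreover have "(\<Sum>p\<in>?B. \<phi> (exchange F p)) =
      (\<Sum>p\<in>?B - ?A. \<phi> (exchange F p)) + (\<Sum>p\<in>?A \<inter> ?B. \<phi> (exchange F p))"
    using sum.Int_Diff[OF fin(2), of "\<lambda>p. \<phi> (exchange F p)" ?A] by (simp add: add.commute Int_commute)
  ultimately show ?thesis
    unfolding f_sum g_sum using two[of "\<Sum>p\<in>?A \<inter> ?B. \<phi> (exchange F p)"] by (simp add: algebra_simps)
qed

end

section \<open>The pairing on single strands\<close>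

definition glue_term :: "nat \<Rightarrow> (nat \<rightharpoonup> top_target) \<Rightarrow> (bottom_source \<rightharpoonup> nat) \<Rightarrow> (nat \<rightharpoonup> nat) \<Rightarrow> 'k::field"
  where "glue_term n f g = single_if_inv (glue_strands n f g) (inv_num f + inv_num g)"

lemma linear_ext_single_if_inv [simp]:
  "linear_ext G (single_if_inv f k) = (if inv_num f = k then G f else 0)"
  by (simp add: single_if_inv_def)

lemma bilinear_ext_single_if_inv:
  "bilinear_ext G (single_if_inv f k) (single_if_inv g l) =
    (if inv_num f = k \<and> inv_num g = l then G f g else 0)"
  by (simp add: single_if_inv_def)

text \<open>Gluing joins t_p to b_p, so permuting the labels on either side yields the same strands.
  By subadditivity each side is nonzero iff these strands have
  \<open>inv_num f + inv_num g + perm_length w\<close> inversions.\<close>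

lemma glue_term_balanced:
  assumes f: "f \<in> top_strands n m" and g: "g \<in> bottom_strands n' m" and w: "w permutes {1..m}"
  shows "linear_ext (\<lambda>f. glue_term n f g)
      (single_if_inv (map_option (relabel_tops w) \<circ> f) (inv_num f + perm_length w)) =
    linear_ext (glue_term n f) (single_if_inv (g \<circ> relabel_bottoms w) (inv_num g + perm_length w))"
proof -
  let ?f = "map_option (relabel_tops w) \<circ> f" and ?g = "g \<circ> relabel_bottoms w"
  have e: "glue_strands n ?f g = glue_strands n f ?g"
    by (rule ext) (auto simp: glue_strands_def split: option.splits top_target.splits)
  have f': "?f \<in> top_strands n m" "inv_num ?f \<le> inv_num f + perm_length w"
    using relabel_tops_strands[OF f w] by linarith+
  have g': "?g \<in> bottom_strands n' m" "inv_num ?g \<le> inv_num g + perm_length w"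
    using relabel_bottoms_strands[OF g w] by linarith+
  show ?thesis
    using inv_num_glue_le[OF f'(1) g] inv_num_glue_le[OF f g'(1)] f'(2) g'(2)
    by (auto simp: glue_term_def single_if_inv_def e)
qed

text \<open>Gluing commutes with composition. Both sides equal \<open>?r\<close>, since along either
  route subadditivity makes every step additive exactly when the final strands have
  \<open>?N\<close> inversions.\<close>

lemma glue_term_mult:
  assumes f: "f \<in> top_strands n m" and g: "g \<in> bottom_strands n' m"
    and f': "f' \<in> top_strands n k" and g': "g' \<in> bottom_strands n' k"
  shows "bilinear_ext (glue_term n)
      (if {j. TPt j \<in> ran f} = dom f' then single_if_inv (top_compose m f f') (inv_num f + inv_num f') else 0)
      (if ran g = {i. BPt i \<in> dom g'} then single_if_inv (bottom_compose m g g') (inv_num g + inv_num g') else 0) =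
    bilinear_ext (\<lambda>f g. if ran f = dom g then single_if_inv (g \<circ>\<^sub>m f) (inv_num f + inv_num g) else 0)
      (glue_term n f g) (glue_term n f' g')" (is "?lhs = ?rhs")
proof -
  let ?K = "{j. TPt j \<in> ran f} = dom f'" and ?K' = "ran g = {i. BPt i \<in> dom g'}"
  let ?F = "glue_strands n f g" and ?F' = "glue_strands n f' g'"
  let ?C = "top_compose m f f'" and ?D = "bottom_compose m g g'"
  note fD = top_strandsD[OF f] and gD = bottom_strandsD[OF g]
    and fD' = top_strandsD[OF f'] and gD' = bottom_strandsD[OF g']
  \<comment> \<open>A set of points of the glued circle determines its parts in the two intervals,
    so glued strands are composable iff the factors are composable in both intervals.\<close>
  have K: "ran ?F = dom ?F' \<longleftrightarrow> ?K \<and> ?K'"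
  proof -
    have "{j. TPt j \<in> ran f} \<subseteq> {1..n}" "dom f' \<subseteq> {1..n}"
      using f f' by (auto simp: top_strands_def)
    moreover have "ran g \<subseteq> {1..n'}" "{i. BPt i \<in> dom g'} \<subseteq> {1..n'}"
      using g g' by (auto simp: bottom_strands_def)
    ultimately have "{j. TPt j \<in> ran f} = ran ?F \<inter> {..n}" "dom f' = dom ?F' \<inter> {..n}"
      "ran g = {i. n + i \<in> ran ?F \<and> 1 \<le> i}" "{i. BPt i \<in> dom g'} = {i. n + i \<in> dom ?F' \<and> 1 \<le> i}"
      unfolding ran_glue[OF f g] dom_glue[OF f' g'] by fastforce+
    moreover have "?K \<and> ?K' \<Longrightarrow> ran ?F = dom ?F'"
      unfolding ran_glue[OF f g] dom_glue[OF f' g'] by simp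
    ultimately show ?thesis by metis
  qed
  let ?N = "inv_num f + inv_num f' + inv_num g + inv_num g'"
  let ?r = "if ?K \<and> ?K' then single_if_inv (?F' \<circ>\<^sub>m ?F) ?N else 0"
  have e: "glue_strands n ?C ?D = ?F' \<circ>\<^sub>m ?F" if KK: "?K" "?K'"
  proof
    fix s
    have k: "\<exists>y. f' j = Some y" if "f s = Some (TPt j)" for j
      using KK(1) ranI[of f s, OF that] by blast
    show "glue_strands n ?C ?D s = (?F' \<circ>\<^sub>m ?F) s"
    proof (cases "s \<le> n")
      case False
      then have s: "glue_strands n ?C ?D s = map_option ((+) n) (?D (BPt (s - n)))"
        "?F s = map_option ((+) n) (g (BPt (s - n)))"
        by (simp_all add: glue_strands_simps)
      show ?thesis
      proof (cases "g (BPt (s - n))")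
        case None
        then show ?thesis unfolding map_comp_def s by (simp add: bottom_compose_simps)
      next
        case (Some j)
        then have "1 \<le> j" using gD(3)[of "s - n" j] by simp
        then show ?thesis unfolding map_comp_def s using Some
          by (simp add: bottom_compose_simps glue_strands_simps)
      qed
    next
      case True
      show ?thesis
      proof (cases "f s")
        case None
        then show ?thesis using True by (simp add: map_comp_def glue_strands_simps top_compose_simps)
      next
        case (Some z)
        show ?thesis
        proof (cases z)
          case (Top p)
          then have p: "p \<in> {1..m}" using Some fD(4) by blast
          then obtain v where v: "g (Bot p) = Some v" using gD(5) by blast
          then have "1 \<le> v" using gD(4) by fastforce
          then show ?thesis using True Some Top p v
            by (simp add: map_comp_def glue_strands_simps top_compose_simps bottom_compose_simps)
        next
          case (TPt j)
          then have j: "j \<le> n" using Some fD(3) by fastforce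
          obtain y where y: "f' j = Some y" using k Some TPt by blast
          show ?thesis
          proof (cases y)
            case (TPt u)
            then show ?thesis using True Some \<open>z = TPt j\<close> j y
              by (simp add: map_comp_def glue_strands_simps top_compose_simps)
          next
            case (Top q)
            then have "1 \<le> q" using y fD'(4) by fastforce
            then show ?thesis using True Some \<open>z = TPt j\<close> j y Top
              by (simp add: map_comp_def glue_strands_simps top_compose_simps bottom_compose_simps)
          qed
        qed
      qed
    qed
  qed
  have "?lhs = ?r"
  proof (cases "?K \<and> ?K'")
    case True
    then have KK: ?K ?K' by auto
    note c = top_compose_strands[OF f f' KK(1)] and d = bottom_compose_strands[OF g g' KK(2)]
    have "inv_num ?C \<le> inv_num f + inv_num f'" "inv_num ?D \<le> inv_num g + inv_num g'"
      using c(4) d(4) by linarith+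
    then show ?thesis
      using inv_num_glue_le[OF c(1) d(1)] KK
      by (auto simp: bilinear_ext_single_if_inv glue_term_def single_if_inv_def e)
  qed auto
  moreover have "?rhs = ?r"
  proof (cases "?K \<and> ?K'")
    case True
    have "inv_num (?F' \<circ>\<^sub>m ?F) \<le> inv_num ?F + inv_num ?F'"
      using True K by (intro inv_num_comp_le finite_dom_glue[OF f g] inj_on_glue[OF f g] inj_on_glue[OF f' g']) simp
    then show ?thesis
      using inv_num_glue_le[OF f g] inv_num_glue_le[OF f' g'] True
      by (auto simp: glue_term_def bilinear_ext_single_if_inv K single_if_inv_def)
  next
    case False
    then show ?thesis by (auto simp: glue_term_def bilinear_ext_single_if_inv K)
  qed
  ultimately show ?thesis by simp
qed

section \<open>Sorted strands\<close>

text \<open>The labels decrease from left to right. Since the exits are ordered by decreasing label,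
  this says that no two strands leaving at the top cross.\<close>

definition sorted_tops :: "(nat \<rightharpoonup> top_target) \<Rightarrow> bool"
  where "sorted_tops f \<longleftrightarrow>
    (\<forall>s t p q. s < t \<longrightarrow> f s = Some (Top p) \<longrightarrow> f t = Some (Top q) \<longrightarrow> q < p)"

lemma relabel_tops_additive_iff:
  assumes f: "f \<in> top_strands N m" and w: "w permutes {1..m}"
  shows "inv_num (map_option (relabel_tops w) \<circ> f) = inv_num f + perm_length w \<longleftrightarrow>
    \<not> (\<exists>s t p q. s < t \<and> f s = Some (Top p) \<and> f t = Some (Top q) \<and> p < q \<and> w q < w p)"
proof -
  let ?D = "double_crossings (dom f) id (\<lambda>s. the (f s)) (\<lambda>s. the ((map_option (relabel_tops w) \<circ> f) s))"
  have "(s, t) \<in> ?D \<longleftrightarrow>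
      s < t \<and> (\<exists>p q. f s = Some (Top p) \<and> f t = Some (Top q) \<and> p < q \<and> w q < w p)" for s t
  proof (cases "s \<in> dom f \<and> t \<in> dom f")
    case True
    then obtain u v where "f s = Some u" "f t = Some v" by blast
    then show ?thesis by (cases u; cases v) (auto simp: double_crossings_def)
  next
    case False
    then show ?thesis by (auto simp: double_crossings_def)
  qed
  then have "?D = {} \<longleftrightarrow>
      \<not> (\<exists>s t p q. s < t \<and> f s = Some (Top p) \<and> f t = Some (Top q) \<and> p < q \<and> w q < w p)"
    by (simp only: set_eq_iff split_paired_all empty_iff not_ex split_paired_All simp_thms) blast
  then show ?thesis
    using additive_iff(2)[OF relabel_tops_strands(2)[OF f w] top_strandsD(1)[OF f]] by simp
qed

text \<open>The permutation moves entries only, so a double crossing consists of two entries;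
  \<open>b < a\<close> is their order in the source.\<close>

lemma relabel_bottoms_additive_iff:
  assumes g: "g \<in> bottom_strands N m" and w: "w permutes {1..m}"
  shows "inv_num (g \<circ> relabel_bottoms w) = inv_num g + perm_length w \<longleftrightarrow>
    \<not> (\<exists>a b. a \<in> {1..m} \<and> b \<in> {1..m} \<and> b < a \<and> w a < w b \<and>
      the (g (Bot (w a))) < the (g (Bot (w b))))"
proof -
  note gD = bottom_strandsD[OF g]
  let ?D = "double_crossings (dom g) id (relabel_bottoms w) (\<lambda>s. the ((g \<circ> relabel_bottoms w) s))"
  have "(x, y) \<in> ?D \<longleftrightarrow> (\<exists>a b. x = Bot a \<and> y = Bot b \<and> a \<in> {1..m} \<and> b \<in> {1..m} \<and> b < a \<and> w a < w b \<and>
      the (g (Bot (w a))) < the (g (Bot (w b))))" for x y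
  proof -
    have "Bot a \<in> dom g \<longleftrightarrow> a \<in> {1..m}" for a using gD(4,5) by blast
    then show ?thesis
      by (cases x; cases y) (auto simp: double_crossings_def simp del: atLeastAtMost_iff not_None_eq)
  qed
  then have "?D = {} \<longleftrightarrow> \<not> (\<exists>a b. a \<in> {1..m} \<and> b \<in> {1..m} \<and> b < a \<and> w a < w b \<and>
      the (g (Bot (w a))) < the (g (Bot (w b))))"
    by (simp only: set_eq_iff split_paired_all empty_iff not_ex split_paired_All simp_thms) blast
  then show ?thesis
    using additive_iff(2)[OF relabel_bottoms_strands(3)[OF g w] gD(1)] by simp
qed

section \<open>The nilCoxeter action on basis elements\<close>

lemma top_data_iff:
  "(f, h) \<in> top_data Z m \<longleftrightarrow> f \<in> top_strands (4 * genus Z) m \<and> (\<forall>i j. f i = Some (TPt j) \<longrightarrow> i < j) \<and>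
    inj_on (pair_of Z) (dom f) \<and> inj_on (pair_of Z) {j. TPt j \<in> ran f} \<and>
    h \<subseteq> pairs Z \<and> h \<inter> pair_of Z ` dom f = {} \<and> h \<inter> pair_of Z ` {j. TPt j \<in> ran f} = {}"
  by (auto simp: top_data_def top_strands_def intro: less_imp_le)

lemma bottom_data_iff:
  "(g, h) \<in> bottom_data Z m \<longleftrightarrow> g \<in> bottom_strands (4 * genus Z) m \<and>
    (\<forall>i j. g (BPt i) = Some j \<longrightarrow> i < j) \<and>
    inj_on (pair_of Z) {i. BPt i \<in> dom g} \<and> inj_on (pair_of Z) (ran g) \<and>
    h \<subseteq> pairs Z \<and> h \<inter> pair_of Z ` {i. BPt i \<in> dom g} = {} \<and> h \<inter> pair_of Z ` ran g = {}"
  by (auto simp: bottom_data_def bottom_strands_def intro: less_imp_le)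

lemma top_combine:
  assumes two: "two_to_one Z" and d: "(f, h) \<in> top_data Z m" and S: "S \<in> sections Z h"
  defines "G \<equiv> (Some \<circ> TPt) |` S ++ f"
  shows "G \<in> top_strands (4 * genus Z) m" "S \<inter> dom f = {}"
    "G s = (if s \<in> S then Some (TPt s) else f s)"
    "G s = Some (Top p) \<longleftrightarrow> f s = Some (Top p)"
proof -
  interpret matched_strands id TPt Z "{}" "Top ` {1..m}" by (rule matched_strands_top[OF two])
  show "G \<in> top_strands (4 * genus Z) m"
    using combine(1)[unfolded fixed_strands_top data_top[OF two], OF d S]
    unfolding mstrs_def top_strs[OF two] G_def by blast
  have "S \<inter> dom f = {}" using S d unfolding top_data_iff sections_def bij_betw_def by blast
  then show "S \<inter> dom f = {}" .
  then have "s \<in> S \<Longrightarrow> f s = None" by (auto simp: domIff disjoint_iff)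
  then show "G s = (if s \<in> S then Some (TPt s) else f s)"
    by (auto simp: G_def map_add_def split: option.splits)
  with \<open>s \<in> S \<Longrightarrow> f s = None\<close> show "G s = Some (Top p) \<longleftrightarrow> f s = Some (Top p)" by auto
qed

lemma bottom_combine:
  assumes two: "two_to_one Z" and d: "(g, h) \<in> bottom_data Z m" and S: "S \<in> sections Z h"
  defines "G \<equiv> (\<lambda>x. case x of BPt i \<Rightarrow> (Some |` S) i | Bot p \<Rightarrow> None) ++ g"
  shows "G \<in> bottom_strands (4 * genus Z) m" "S \<inter> {i. BPt i \<in> dom g} = {}"
    "G (BPt i) = (if i \<in> S then Some i else g (BPt i))" "G (Bot p) = g (Bot p)"
proof -
  interpret matched_strands BPt id Z "Bot ` {1..m}" "{}" by (rule matched_strands_bottom[OF two])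
  show "G \<in> bottom_strands (4 * genus Z) m"
    using combine(1)[unfolded fixed_strands_bottom data_bottom[OF two], OF d S]
    unfolding mstrs_def bottom_strs[OF two] G_def by blast
  have "S \<inter> {i. BPt i \<in> dom g} = {}"
    using S d unfolding bottom_data_iff sections_def bij_betw_def by blast
  then show "S \<inter> {i. BPt i \<in> dom g} = {}" .
  then have "i \<in> S \<Longrightarrow> g (BPt i) = None" by (auto simp: domIff disjoint_iff)
  then show "G (BPt i) = (if i \<in> S then Some i else g (BPt i))"
    by (auto simp: G_def map_add_def split: option.splits)
  show "G (Bot p) = g (Bot p)" by (auto simp: G_def map_add_def split: option.splits)
qed

text \<open>The criterion for additivity sees only strands that leave at the top, and these are
  never fixed. It is the same for all sections, so a basis element goes to a basis element or to
  \<open>0\<close>.\<close>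

lemma top_action_basis:
  assumes two: "two_to_one Z" and d: "(f, h) \<in> top_data Z m" and w: "w permutes {1..m}"
  defines "f' \<equiv> map_option (relabel_tops w) \<circ> f"
  shows "(f', h) \<in> top_data Z m"
    and "vact (top_module N) (single w) (top_basis Z (f, h)) =
      (if \<exists>s t p q. s < t \<and> f s = Some (Top p) \<and> f t = Some (Top q) \<and> p < q \<and> w q < w p
       then 0 else top_basis Z (f', h) :: _ \<Rightarrow> 'k::field)"
proof -
  have f: "f \<in> top_strands (4 * genus Z) m" using d by (simp add: top_data_iff)
  have eqT: "f' x = Some (TPt j) \<longleftrightarrow> f x = Some (TPt j)" for x j
    unfolding f'_def by (cases "f x"; cases "the (f x)") auto
  then have "{j. TPt j \<in> ran f'} = {j. TPt j \<in> ran f}" by (simp add: ran_def)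
  moreover have "dom f' = dom f" by (auto simp: f'_def)
  ultimately show "(f', h) \<in> top_data Z m"
    using d relabel_tops_strands(1)[OF f w] unfolding top_data_iff f'_def[symmetric] by (simp add: eqT)
  define crossed where "crossed \<longleftrightarrow> (\<exists>s t p q. s < t \<and> f s = Some (Top p) \<and> f t = Some (Top q) \<and> p < q \<and> w q < w p)"
  have "vact (top_module N) (single w) (top_basis Z (f, h)) =
      (\<Sum>S\<in>sections Z h. single_if_inv (map_option (relabel_tops w) \<circ> ((Some \<circ> TPt) |` S ++ f))
        (inv_num ((Some \<circ> TPt) |` S ++ f) + perm_length w) :: _ \<Rightarrow> 'k)"
    unfolding top_module_def top_basis_def algebra_module.simps prod.case bilinear_ext_single_right
    by (subst linear_ext_sum) simp_all
  also have "\<dots> = (\<Sum>S\<in>sections Z h. if crossed then 0 else single ((Some \<circ> TPt) |` S ++ f'))"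
  proof (rule sum.cong[OF refl])
    fix S assume S: "S \<in> sections Z h"
    note c = top_combine[OF two d S]
    have "map_option (relabel_tops w) \<circ> ((Some \<circ> TPt) |` S ++ f) = (Some \<circ> TPt) |` S ++ f'"
    proof
      fix s
      have "s \<in> S \<Longrightarrow> f' s = None" using c(2) by (auto simp: f'_def domIff disjoint_iff)
      then have "((Some \<circ> TPt) |` S ++ f') s = (if s \<in> S then Some (TPt s) else f' s)"
        by (auto simp: map_add_def split: option.splits)
      then show "(map_option (relabel_tops w) \<circ> ((Some \<circ> TPt) |` S ++ f)) s = ((Some \<circ> TPt) |` S ++ f') s"
        using c(3)[of s] by (simp add: f'_def)
    qed
    moreover have "inv_num (map_option (relabel_tops w) \<circ> ((Some \<circ> TPt) |` S ++ f)) =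
        inv_num ((Some \<circ> TPt) |` S ++ f) + perm_length w \<longleftrightarrow> \<not> crossed"
      unfolding relabel_tops_additive_iff[OF c(1) w] c(4) crossed_def ..
    ultimately show "single_if_inv (map_option (relabel_tops w) \<circ> ((Some \<circ> TPt) |` S ++ f))
        (inv_num ((Some \<circ> TPt) |` S ++ f) + perm_length w) =
        (if crossed then 0 else single ((Some \<circ> TPt) |` S ++ f') :: _ \<Rightarrow> 'k)"
      by (simp add: single_if_inv_def)
  qed
  finally have "vact (top_module N) (single w) (top_basis Z (f, h)) =
      (if crossed then 0 else top_basis Z (f', h) :: _ \<Rightarrow> 'k)"
    by (simp add: top_basis_def)
  then show "vact (top_module N) (single w) (top_basis Z (f, h)) =
      (if \<exists>s t p q. s < t \<and> f s = Some (Top p) \<and> f t = Some (Top q) \<and> p < q \<and> w q < w p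
       then 0 else top_basis Z (f', h) :: _ \<Rightarrow> 'k)"
    unfolding crossed_def .
qed

text \<open>Fixed strands do not start at an entry and have no influence on the criterion, so all
  summands of a basis element survive or vanish together.\<close>

lemma bottom_action_basis:
  assumes two: "two_to_one Z" and d: "(g, h) \<in> bottom_data Z m" and w: "w permutes {1..m}"
  defines "g' \<equiv> g \<circ> relabel_bottoms w"
  shows "(g', h) \<in> bottom_data Z m"
    and "vact (bottom_module N) (single w) (bottom_basis Z (g, h)) =
      (if \<exists>a b. a \<in> {1..m} \<and> b \<in> {1..m} \<and> b < a \<and> w a < w b \<and>
        the (g (Bot (w a))) < the (g (Bot (w b)))
       then 0 else bottom_basis Z (g', h) :: _ \<Rightarrow> 'k::field)"
proof -
  let ?fix = "\<lambda>S x. case x of BPt i \<Rightarrow> (Some |` S) i | Bot p \<Rightarrow> None"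
  have g: "g \<in> bottom_strands (4 * genus Z) m" using d by (simp add: bottom_data_iff)
  note gD = bottom_strandsD[OF g]
  have val: "g' (BPt i) = g (BPt i)" "g' (Bot p) = g (Bot (w p))" for i p by (simp_all add: g'_def)
  have "ran g' = ran g"
  proof
    show "ran g' \<subseteq> ran g" by (auto simp: g'_def ran_def)
    show "ran g \<subseteq> ran g'"
    proof
      fix y assume "y \<in> ran g"
      then obtain x where x: "g x = Some y" by (auto simp: ran_def)
      show "y \<in> ran g'"
      proof (cases x)
        case (BPt i)
        then show ?thesis using x val(1)[of i] by (auto intro: ranI)
      next
        case (Bot p)
        obtain p' where "w p' = p" using permutes_surj[OF w] by (metis surjD)
        then show ?thesis using x Bot val(2)[of p'] by (auto intro: ranI)
      qed
    qed
  qed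
  moreover have "dom g' = dom g" unfolding g'_def by (rule relabel_bottoms_strands(2)[OF g w])
  ultimately show "(g', h) \<in> bottom_data Z m"
    using d relabel_bottoms_strands(1)[OF g w] unfolding bottom_data_iff g'_def[symmetric] by (simp add: val)
  define crossed where "crossed \<longleftrightarrow> (\<exists>a b. a \<in> {1..m} \<and> b \<in> {1..m} \<and> b < a \<and> w a < w b \<and>
        the (g (Bot (w a))) < the (g (Bot (w b))))"
  have "vact (bottom_module N) (single w) (bottom_basis Z (g, h)) =
      (\<Sum>S\<in>sections Z h. single_if_inv ((?fix S ++ g) \<circ> relabel_bottoms w)
        (inv_num (?fix S ++ g) + perm_length w) :: _ \<Rightarrow> 'k)"
    unfolding bottom_module_def bottom_basis_def algebra_module.simps prod.case bilinear_ext_single_left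
    by (subst linear_ext_sum) simp_all
  also have "\<dots> = (\<Sum>S\<in>sections Z h. if crossed then 0 else single (?fix S ++ g'))"
  proof (rule sum.cong[OF refl])
    fix S assume S: "S \<in> sections Z h"
    note c = bottom_combine[OF two d S]
    have "(?fix S ++ g) \<circ> relabel_bottoms w = ?fix S ++ g'"
    proof
      fix x show "((?fix S ++ g) \<circ> relabel_bottoms w) x = (?fix S ++ g') x"
        by (cases x) (auto simp: map_add_def val split: option.splits)
    qed
    moreover have "inv_num ((?fix S ++ g) \<circ> relabel_bottoms w) =
        inv_num (?fix S ++ g) + perm_length w \<longleftrightarrow> \<not> crossed"
      unfolding relabel_bottoms_additive_iff[OF c(1) w] c(4) crossed_def ..
    ultimately show "single_if_inv ((?fix S ++ g) \<circ> relabel_bottoms w)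
        (inv_num (?fix S ++ g) + perm_length w) =
        (if crossed then 0 else single (?fix S ++ g') :: _ \<Rightarrow> 'k)"
      by (simp add: single_if_inv_def)
  qed
  finally have "vact (bottom_module N) (single w) (bottom_basis Z (g, h)) =
      (if crossed then 0 else bottom_basis Z (g', h) :: _ \<Rightarrow> 'k)"
    by (simp add: bottom_basis_def)
  then show "vact (bottom_module N) (single w) (bottom_basis Z (g, h)) =
      (if \<exists>a b. a \<in> {1..m} \<and> b \<in> {1..m} \<and> b < a \<and> w a < w b \<and>
        the (g (Bot (w a))) < the (g (Bot (w b)))
       then 0 else bottom_basis Z (g', h) :: _ \<Rightarrow> 'k)"
    unfolding crossed_def .
qed

section \<open>Sorting the strands that leave at the top\<close>

text \<open>The rank counts from the top, since the points \<open>t\<^sub>p\<close> are ordered decreasingly.\<close>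

definition rank_in :: "nat set \<Rightarrow> nat \<Rightarrow> nat"
  where "rank_in C s = card {t \<in> C. s \<le> t}"

lemma rank_in_less:
  assumes C: "finite C" and s: "s \<in> C" and st: "s < t"
  shows "rank_in C t < rank_in C s"
proof -
  have "s \<in> {x \<in> C. s \<le> x}" "s \<notin> {x \<in> C. t \<le> x}" using s st by simp_all
  moreover have "{x \<in> C. t \<le> x} \<subseteq> {x \<in> C. s \<le> x}" using st by force
  ultimately show ?thesis unfolding rank_in_def using C by (intro psubset_card_mono) auto
qed

lemma bij_betw_rank_in:
  assumes "finite C"
  shows "bij_betw (rank_in C) C {1..card C}"
proof -
  have inj: "inj_on (rank_in C) C"
    by (rule inj_onI) (metis assms linorder_neqE rank_in_less less_irrefl)
  moreover have "rank_in C ` C \<subseteq> {1..card C}"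
  proof
    fix r assume "r \<in> rank_in C ` C"
    then obtain s where s: "s \<in> C" "r = card {t \<in> C. s \<le> t}" by (auto simp: rank_in_def)
    have "card {t \<in> C. s \<le> t} \<le> card C" using assms by (intro card_mono) auto
    moreover have "card {t \<in> C. s \<le> t} \<noteq> 0" using assms s by auto
    ultimately show "r \<in> {1..card C}" using s by simp
  qed
  ultimately have "rank_in C ` C = {1..card C}"
    by (intro card_subset_eq) (simp_all add: card_image)
  then show ?thesis using inj by (simp add: bij_betw_def)
qed

text \<open>The strands leaving at the top that start at \<open>s\<close> or to its right carry
  exactly the labels from 1 to \<open>p\<close>, so counting them yields \<open>p\<close>. In a
  sorted map the labels are thus determined by the set of strands that leave.\<close>

lemma sorted_tops_label:
  assumes f: "f \<in> top_strands N m" and sorted: "sorted_tops f" and s: "f s = Some (Top p)"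
  shows "p = rank_in {s. \<exists>p. f s = Some (Top p)} s"
proof -
  let ?C = "{s. \<exists>p. f s = Some (Top p)}" and ?l = "\<lambda>s. top_label (the (f s))"
  note b = bij_betw_top_label[OF f]
  have p: "p \<in> {1..m}" using top_strandsD(4)[OF f s] by simp
  have "?l ` {t \<in> ?C. s \<le> t} = {1..p}"
  proof
    show "?l ` {t \<in> ?C. s \<le> t} \<subseteq> {1..p}"
    proof
      fix q assume "q \<in> ?l ` {t \<in> ?C. s \<le> t}"
      then obtain t where t: "f t = Some (Top q)" "s \<le> t" by auto
      have "q < p" if "s < t" using sorted s t(1) that unfolding sorted_tops_def by blast
      then have "q \<le> p" using s t by (cases "s = t") auto
      then show "q \<in> {1..p}" using top_strandsD(4)[OF f t(1)] by simp
    qed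
    show "{1..p} \<subseteq> ?l ` {t \<in> ?C. s \<le> t}"
    proof
      fix q assume q: "q \<in> {1..p}"
      then have "q \<in> {1..m}" using p by simp
      then obtain t where t: "f t = Some (Top q)" using top_strandsD(5)[OF f] by blast
      have "s \<le> t"
      proof (rule ccontr)
        assume "\<not> s \<le> t"
        then have "p < q" using sorted t s unfolding sorted_tops_def by (metis not_le)
        then show False using q by simp
      qed
      then show "q \<in> ?l ` {t \<in> ?C. s \<le> t}" using t by (intro image_eqI[of _ _ t]) auto
    qed
  qed
  moreover have "inj_on ?l {t \<in> ?C. s \<le> t}"
    using b unfolding bij_betw_def by (auto intro: inj_on_subset)
  ultimately have "card {t \<in> ?C. s \<le> t} = card {1..p}"
    using card_image[of ?l "{t \<in> ?C. s \<le> t}"] by simp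
  then show ?thesis by (simp add: rank_in_def)
qed

text \<open>The permutation replaces the label of a strand by the rank of its starting
  point.\<close>

lemma sorting_permutation:
  assumes f: "f \<in> top_strands N m"
  obtains u where "u permutes {1..m}" "sorted_tops (map_option (relabel_tops u) \<circ> f)"
proof -
  let ?C = "{s. \<exists>p. f s = Some (Top p)}" and ?l = "\<lambda>s. top_label (the (f s))"
  note b = bij_betw_top_label[OF f]
  have fin: "finite ?C" using top_strandsD(1)[OF f] by (rule finite_subset[rotated]) auto
  have "card ?C = m" using bij_betw_same_card[OF b] by simp
  then have r: "bij_betw (rank_in ?C) ?C {1..m}" using bij_betw_rank_in[OF fin] by simp
  define u where "u = (\<lambda>p. if p \<in> {1..m} then rank_in ?C (inv_into ?C ?l p) else p)"
  have "bij_betw (rank_in ?C \<circ> inv_into ?C ?l) {1..m} {1..m}"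
    by (rule bij_betw_trans[OF bij_betw_inv_into[OF b] r])
  then have "bij_betw u {1..m} {1..m}"
    by (rule bij_betw_cong[THEN iffD1, rotated]) (simp add: u_def)
  then have u: "u permutes {1..m}"
    by (rule bij_imp_permutes) (auto simp: u_def)
  have ul: "u p = rank_in ?C s" if "f s = Some (Top p)" for s p
  proof -
    have "inv_into ?C ?l p = s"
      using bij_betw_inv_into_left[OF b, of s] that by auto
    then show ?thesis using top_strandsD(4)[OF f that] by (simp add: u_def)
  qed
  have "sorted_tops (map_option (relabel_tops u) \<circ> f)"
    unfolding sorted_tops_def
  proof (intro allI impI)
    fix s t p q
    assume st: "s < t" and s: "(map_option (relabel_tops u) \<circ> f) s = Some (Top p)"
      and t: "(map_option (relabel_tops u) \<circ> f) t = Some (Top q)"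
    have *: "\<exists>p'. f x = Some (Top p') \<and> p = u p'"
      if x: "(map_option (relabel_tops u) \<circ> f) x = Some (Top p)" for x p
    proof -
      obtain y where "f x = Some y" "relabel_tops u y = Top p" using x by auto
      then show ?thesis by (cases y) auto
    qed
    obtain p' q' where "f s = Some (Top p')" "p = u p'" "f t = Some (Top q')" "q = u q'"
      using *[OF s] *[OF t] by blast
    then show "q < p" using ul rank_in_less[OF fin, of s t] st by auto
  qed
  then show thesis using that u by blast
qed

text \<open>The map \<open>f\<close> is its sorted form followed by the inverse of the sorting
  permutation. In the sorted form no two strands leaving at the top cross, so undoing the sorting
  makes no double crossing and the action does not vanish.\<close>

lemma sort_top_basis:
  assumes two: "two_to_one Z" and d: "(f, h) \<in> top_data Z m"
  obtains f' w where "(f', h) \<in> top_data Z m" "sorted_tops f'" "w permutes {1..m}"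
    "top_basis Z (f, h) = (vact (top_module N) (single w) (top_basis Z (f', h)) :: _ \<Rightarrow> 'k::field)"
proof -
  have f: "f \<in> top_strands (4 * genus Z) m" using d by (simp add: top_data_iff)
  obtain u where u: "u permutes {1..m}" "sorted_tops (map_option (relabel_tops u) \<circ> f)"
    by (rule sorting_permutation[OF f])
  let ?f = "map_option (relabel_tops u) \<circ> f" and ?w = "inv_into UNIV u"
  have d': "(?f, h) \<in> top_data Z m" by (rule top_action_basis(1)[OF two d u(1)])
  have w: "?w permutes {1..m}" by (rule permutes_inv[OF u(1)])
  have "relabel_tops ?w (relabel_tops u y) = y" for y
    using permutes_inverses(2)[OF u(1)] by (cases y) auto
  then have "map_option (relabel_tops ?w) \<circ> ?f = f"
    by (auto simp: fun_eq_iff option.map_comp comp_def option.map_ident)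
  moreover have "\<not> (\<exists>s t p q. s < t \<and> ?f s = Some (Top p) \<and> ?f t = Some (Top q) \<and> p < q \<and> ?w q < ?w p)"
    using u(2) unfolding sorted_tops_def by (metis order_less_asym)
  ultimately have "vact (top_module N) (single ?w) (top_basis Z (?f, h)) = (top_basis Z (f, h) :: _ \<Rightarrow> 'k)"
    using top_action_basis(2)[OF two d' w, of N] by (simp only: if_False)
  then show thesis using that[OF d' u(2) w] by simp
qed

section \<open>Gluing matched intervals\<close>

text \<open>The disjoint union of subsets of two consecutive blocks, the first of length
  \<open>k\<close>. It serves for points, with \<open>k = 4 * genus Z1\<close>, and for pairs, with
  \<open>k = 2 * genus Z1\<close>.\<close>

definition join_sets :: "nat \<Rightarrow> nat set \<Rightarrow> nat set \<Rightarrow> nat set"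
  where "join_sets k A B = A \<union> (+) k ` B"

lemma join_sets_inject:
  assumes "A \<subseteq> {1..k}" "A' \<subseteq> {1..k}" "B \<subseteq> {1..l}" "B' \<subseteq> {1..l}" "join_sets k A B = join_sets k A' B'"
  shows "A = A' \<and> B = B'"
proof -
  have *: "A = join_sets k A B \<inter> {1..k} \<and> B = {i. 1 \<le> i \<and> k + i \<in> join_sets k A B}"
    if "A \<subseteq> {1..k}" "B \<subseteq> {1..l}" for A B
    using that by (auto simp: join_sets_def)
  show ?thesis using *[OF assms(1,3)] *[OF assms(2,4)] assms(5) by metis
qed

lemma split_join_sets:
  assumes "A \<subseteq> {1..k} \<union> (+) k ` {1..l}"
  obtains B C where "A = join_sets k B C" "B \<subseteq> {1..k}" "C \<subseteq> {1..l}"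
proof -
  have "A = join_sets k (A \<inter> {1..k}) {i \<in> {1..l}. k + i \<in> A}"
    using assms unfolding join_sets_def by blast
  then show thesis using that[of "A \<inter> {1..k}" "{i \<in> {1..l}. k + i \<in> A}"] by blast
qed

lemma join_sets_disjoint:
  assumes "A \<subseteq> {1..k}" "A' \<subseteq> {1..k}" "B \<subseteq> {1..l}" "B' \<subseteq> {1..l}"
  shows "join_sets k A B \<inter> join_sets k A' B' = {} \<longleftrightarrow> A \<inter> A' = {} \<and> B \<inter> B' = {}"
proof -
  have "join_sets k A B \<inter> join_sets k A' B' = join_sets k (A \<inter> A') (B \<inter> B')"
    using assms by (fastforce simp: join_sets_def)
  then show ?thesis by (auto simp: join_sets_def)
qed

lemma matching_data_iff:
  "(F, h) \<in> matching_data Z \<longleftrightarrow> F \<in> strands (4 * genus Z) \<and> (\<forall>i j. F i = Some j \<longrightarrow> i < j) \<and>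
    inj_on (pair_of Z) (dom F) \<and> inj_on (pair_of Z) (ran F) \<and>
    h \<subseteq> pairs Z \<and> h \<inter> pair_of Z ` dom F = {} \<and> h \<inter> pair_of Z ` ran F = {}"
  by (auto simp: matching_data_def strands_def intro: less_imp_le)

locale glued_intervals =
  fixes Z1 Z2 :: matching
  assumes two1: "two_to_one Z1" and two2: "two_to_one Z2"
begin

abbreviation "n \<equiv> 4 * genus Z1"
abbreviation "n' \<equiv> 4 * genus Z2"
abbreviation "Z \<equiv> glue Z1 Z2"

lemma two: "two_to_one Z"
  using two1 two2 by (rule two_to_one_glue)

lemma pair_of_Z [simp]:
  "i \<le> n \<Longrightarrow> pair_of Z i = pair_of Z1 i"
  "1 \<le> i \<Longrightarrow> pair_of Z (n + i) = 2 * genus Z1 + pair_of Z2 i"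
  by (simp_all add: glue_sel)

lemma pair_of_bounds:
  "i \<in> points Z1 \<Longrightarrow> pair_of Z1 i \<in> pairs Z1" "i \<in> points Z2 \<Longrightarrow> pair_of Z2 i \<in> pairs Z2"
  using two1 two2 unfolding two_to_one_def by blast+

lemma points_Z: "points Z = points Z1 \<union> (+) n ` points Z2"
proof
  show "points Z \<subseteq> points Z1 \<union> (+) n ` points Z2"
  proof
    fix i assume "i \<in> points Z"
    then show "i \<in> points Z1 \<union> (+) n ` points Z2"
      by (cases "i \<le> n") (auto simp: glue_sel intro!: image_eqI[of _ _ "i - n"])
  qed
qed (auto simp: glue_sel)

lemma pairs_Z: "pairs Z = pairs Z1 \<union> (+) (2 * genus Z1) ` pairs Z2"
proof
  show "pairs Z \<subseteq> pairs Z1 \<union> (+) (2 * genus Z1) ` pairs Z2"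
  proof
    fix i assume "i \<in> pairs Z"
    then show "i \<in> pairs Z1 \<union> (+) (2 * genus Z1) ` pairs Z2"
      by (cases "i \<le> 2 * genus Z1") (auto simp: glue_sel intro!: image_eqI[of _ _ "i - 2 * genus Z1"])
  qed
qed (auto simp: glue_sel)

lemma image_pair_of_join:
  assumes "A \<subseteq> points Z1" "B \<subseteq> points Z2"
  shows "pair_of Z ` join_sets n A B = join_sets (2 * genus Z1) (pair_of Z1 ` A) (pair_of Z2 ` B)"
proof -
  have "pair_of Z ` A = pair_of Z1 ` A" using assms(1) by (intro image_cong) auto
  moreover have "pair_of Z ` (+) n ` B = (+) (2 * genus Z1) ` pair_of Z2 ` B"
    unfolding image_image using assms(2) by (intro image_cong) auto
  ultimately show ?thesis by (simp only: join_sets_def image_Un)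
qed

text \<open>Pairs of the first interval have numbers up to \<open>2 * genus Z1\<close> and those of
  the second have larger ones, so points of different intervals never share a pair.\<close>

lemma inj_on_pair_of_join:
  assumes "A \<subseteq> points Z1" "B \<subseteq> points Z2"
  shows "inj_on (pair_of Z) (join_sets n A B) \<longleftrightarrow> inj_on (pair_of Z1) A \<and> inj_on (pair_of Z2) B"
proof -
  have 1: "inj_on (pair_of Z) A \<longleftrightarrow> inj_on (pair_of Z1) A"
    using assms(1) by (intro inj_on_cong) auto
  have 2: "inj_on (pair_of Z) ((+) n ` B) \<longleftrightarrow> inj_on (pair_of Z2) B"
  proof -
    have "inj_on (pair_of Z) ((+) n ` B) \<longleftrightarrow> inj_on (pair_of Z \<circ> (+) n) B"
      by (rule comp_inj_on_iff) simp
    also have "\<dots> \<longleftrightarrow> inj_on (\<lambda>i. 2 * genus Z1 + pair_of Z2 i) B"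
      using assms(2) by (intro inj_on_cong) auto
    also have "\<dots> \<longleftrightarrow> inj_on (pair_of Z2) B" by (simp add: inj_on_def)
    finally show ?thesis .
  qed
  have "pair_of Z i \<noteq> pair_of Z j" if iA: "i \<in> A" and jB: "j \<in> (+) n ` B" for i j
  proof -
    obtain b where b: "j = n + b" "b \<in> points Z2" using jB assms(2) by auto
    have i: "i \<in> points Z1" using iA assms(1) by auto
    have "pair_of Z i \<le> 2 * genus Z1" using pair_of_bounds(1)[OF i] i by simp
    moreover have "2 * genus Z1 < pair_of Z j" using pair_of_bounds(2)[OF b(2)] b by simp
    ultimately show ?thesis by simp
  qed
  then have "pair_of Z ` (A - (+) n ` B) \<inter> pair_of Z ` ((+) n ` B - A) = {}" by fast
  then show ?thesis unfolding join_sets_def inj_on_Un 1 2 by blast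
qed

text \<open>No pair contains points of both intervals, so a section of the glued matching amounts to
  two independent choices.\<close>

lemma sections_join:
  assumes "h1 \<subseteq> pairs Z1" "h2 \<subseteq> pairs Z2"
  shows "bij_betw (\<lambda>(S, S'). join_sets n S S') (sections Z1 h1 \<times> sections Z2 h2)
    (sections Z (join_sets (2 * genus Z1) h1 h2))"
proof -
  have inj: "inj_on (\<lambda>(S, S'). join_sets n S S') (sections Z1 h1 \<times> sections Z2 h2)"
    by (rule inj_onI) (auto simp: sections_def dest!: join_sets_inject[rotated 4])
  have iff: "join_sets n A B \<in> sections Z (join_sets (2 * genus Z1) h1 h2) \<longleftrightarrow>
      A \<in> sections Z1 h1 \<and> B \<in> sections Z2 h2"
    if AB: "A \<subseteq> points Z1" "B \<subseteq> points Z2" for A B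
  proof -
    have "pair_of Z1 ` A \<subseteq> pairs Z1" "pair_of Z2 ` B \<subseteq> pairs Z2"
      using AB pair_of_bounds by blast+
    then have "pair_of Z ` join_sets n A B = join_sets (2 * genus Z1) h1 h2 \<longleftrightarrow>
        pair_of Z1 ` A = h1 \<and> pair_of Z2 ` B = h2"
      unfolding image_pair_of_join[OF AB] using assms join_sets_inject by metis
    moreover have "join_sets n A B \<subseteq> points Z" using AB unfolding points_Z join_sets_def by blast
    ultimately show ?thesis
      using AB inj_on_pair_of_join[OF AB] by (simp add: sections_def bij_betw_def) blast
  qed
  have "(\<lambda>(S, S'). join_sets n S S') ` (sections Z1 h1 \<times> sections Z2 h2) =
      sections Z (join_sets (2 * genus Z1) h1 h2)"
  proof
    show "(\<lambda>(S, S'). join_sets n S S') ` (sections Z1 h1 \<times> sections Z2 h2) \<subseteq>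
        sections Z (join_sets (2 * genus Z1) h1 h2)"
      using iff by (auto simp: sections_def)
    show "sections Z (join_sets (2 * genus Z1) h1 h2) \<subseteq>
        (\<lambda>(S, S'). join_sets n S S') ` (sections Z1 h1 \<times> sections Z2 h2)"
    proof
      fix S assume S: "S \<in> sections Z (join_sets (2 * genus Z1) h1 h2)"
      then have "S \<subseteq> points Z1 \<union> (+) n ` points Z2" unfolding sections_def points_Z[symmetric] by blast
      then obtain A B where AB: "S = join_sets n A B" "A \<subseteq> points Z1" "B \<subseteq> points Z2"
        by (rule split_join_sets)
      then show "S \<in> (\<lambda>(S, S'). join_sets n S S') ` (sections Z1 h1 \<times> sections Z2 h2)"
        using iff[OF AB(2,3)] S by auto
    qed
  qed
  then show ?thesis using inj by (simp add: bij_betw_def)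
qed

definition join_data ::
    "((nat \<rightharpoonup> top_target) \<times> nat set) \<times> ((bottom_source \<rightharpoonup> nat) \<times> nat set) \<Rightarrow> (nat \<rightharpoonup> nat) \<times> nat set"
  where "join_data = (\<lambda>((f, h), (g, h')). (glue_strands n f g, join_sets (2 * genus Z1) h h'))"

lemma dom_ran_glue:
  assumes "f \<in> top_strands n m" "g \<in> bottom_strands n' m"
  shows "dom (glue_strands n f g) = join_sets n (dom f) {i. BPt i \<in> dom g}"
    and "ran (glue_strands n f g) = join_sets n {j. TPt j \<in> ran f} (ran g)"
    and "dom f \<subseteq> points Z1" "{i. BPt i \<in> dom g} \<subseteq> points Z2"
    and "{j. TPt j \<in> ran f} \<subseteq> points Z1" "ran g \<subseteq> points Z2"
  using dom_glue[OF assms] ran_glue[OF assms] assms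
  by (auto simp: join_sets_def top_strands_def bottom_strands_def)

text \<open>The conditions of \<open>matching_data\<close> split into conditions on the two
  intervals. A strand through the cut adds none: it starts at most at \<open>n\<close> and ends
  beyond \<open>n\<close>, so it goes strictly upward.\<close>

lemma join_data_iff:
  assumes f: "f \<in> top_strands n m" and g: "g \<in> bottom_strands n' m"
    and h: "h1 \<subseteq> pairs Z1" "h2 \<subseteq> pairs Z2"
  shows "join_data ((f, h1), (g, h2)) \<in> matching_data Z \<longleftrightarrow>
    (f, h1) \<in> top_data Z1 m \<and> (g, h2) \<in> bottom_data Z2 m"
proof -
  let ?F = "glue_strands n f g"
  note fD = top_strandsD[OF f] and gD = bottom_strandsD[OF g]
  note dr = dom_ran_glue[OF f g]
  have up: "(\<forall>i j. ?F i = Some j \<longrightarrow> i < j) \<longleftrightarrow>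
      (\<forall>i j. f i = Some (TPt j) \<longrightarrow> i < j) \<and> (\<forall>i j. g (BPt i) = Some j \<longrightarrow> i < j)"
  proof (intro iffI conjI allI impI)
    show "i < j" if "\<forall>i j. ?F i = Some j \<longrightarrow> i < j" "f i = Some (TPt j)" for i j
      using that glue_point_val[OF f g] by blast
    show "i < j" if "\<forall>i j. ?F i = Some j \<longrightarrow> i < j" "g (BPt i) = Some j" for i j
      using that(1) glue_bottom_val[OF f g that(2)] by fastforce
    fix s j assume fg: "(\<forall>i j. f i = Some (TPt j) \<longrightarrow> i < j) \<and> (\<forall>i j. g (BPt i) = Some j \<longrightarrow> i < j)"
      and Fs: "?F s = Some j"
    from Fs show "s < j"
    proof (cases rule: glue_strands_cases[OF f g, consumes 1, case_names point top bottom])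
      case point
      then show ?thesis using fg by blast
    next
      case (top p v)
      then show ?thesis using gD(4)[of p v] by simp
    next
      case (bottom v)
      then have "s - n < v" using fg by blast
      then show ?thesis using bottom by simp
    qed
  qed
  have "dom ?F \<subseteq> points Z" "ran ?F \<subseteq> points Z"
    unfolding dr(1,2) points_Z using dr(3-6) by (auto simp: join_sets_def)
  then have F: "(\<forall>i j. ?F i = Some j \<longrightarrow> i < j) \<Longrightarrow> ?F \<in> strands (4 * genus Z)"
    using inj_on_glue[OF f g] by (auto simp: strands_def intro: less_imp_le)
  have img: "pair_of Z1 ` dom f \<subseteq> pairs Z1" "pair_of Z2 ` {i. BPt i \<in> dom g} \<subseteq> pairs Z2"
    "pair_of Z1 ` {j. TPt j \<in> ran f} \<subseteq> pairs Z1" "pair_of Z2 ` ran g \<subseteq> pairs Z2"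
    using dr(3-6) pair_of_bounds by blast+
  have hZ: "join_sets (2 * genus Z1) h1 h2 \<subseteq> pairs Z"
    unfolding pairs_Z using h by (auto simp: join_sets_def)
  show ?thesis
    unfolding join_data_def prod.case matching_data_iff dr(1,2)
      inj_on_pair_of_join[OF dr(3,4)] inj_on_pair_of_join[OF dr(5,6)]
      image_pair_of_join[OF dr(3,4)] image_pair_of_join[OF dr(5,6)]
      join_sets_disjoint[OF h(1) img(1) h(2) img(2)] join_sets_disjoint[OF h(1) img(3) h(2) img(4)]
      top_data_iff bottom_data_iff up
    by (rule iffI; elim conjE; intro conjI;
      (assumption | rule f g h hZ | (rule F[unfolded up]; intro conjI; assumption)))
qed

text \<open>A fixed strand lies in a single interval, so it can be added before or after
  gluing.\<close>

lemma glue_combine: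
  assumes d: "(f, h1) \<in> top_data Z1 m" and d': "(g, h2) \<in> bottom_data Z2 m"
    and S: "S \<in> sections Z1 h1" "S' \<in> sections Z2 h2"
  shows "glue_strands n ((Some \<circ> TPt) |` S ++ f)
      ((\<lambda>x. case x of BPt i \<Rightarrow> (Some |` S') i | Bot p \<Rightarrow> None) ++ g) =
    Some |` join_sets n S S' ++ glue_strands n f g"
proof
  fix s
  note c = top_combine[OF two1 d S(1)] and b = bottom_combine[OF two2 d' S(2)]
  let ?f = "(Some \<circ> TPt) |` S ++ f"
  let ?g = "(\<lambda>x. case x of BPt i \<Rightarrow> (Some |` S') i | Bot p \<Rightarrow> None) ++ g"
  have SS: "S \<subseteq> points Z1" "S' \<subseteq> points Z2" using S by (auto simp: sections_def)
  have fg: "f \<in> top_strands n m" "g \<in> bottom_strands n' m"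
    using d d' by (simp_all add: top_data_iff bottom_data_iff)
  have none: "glue_strands n f g s = None" if "s \<in> join_sets n S S'"
  proof -
    have "s \<notin> dom (glue_strands n f g)"
      using that c(2) b(2) SS dom_ran_glue[OF fg] join_sets_disjoint[of S n "dom f" S' n' "{i. BPt i \<in> dom g}"]
      by blast
    then show ?thesis by (simp add: domIff)
  qed
  then have r: "(Some |` join_sets n S S' ++ glue_strands n f g) s =
      (if s \<in> join_sets n S S' then Some s else glue_strands n f g s)"
    by (auto simp: map_add_def restrict_map_def split: option.splits)
  show "glue_strands n ?f ?g s = (Some |` join_sets n S S' ++ glue_strands n f g) s"
  proof (cases "s \<le> n")
    case True
    then have "s \<in> join_sets n S S' \<longleftrightarrow> s \<in> S" using SS by (auto simp: join_sets_def)
    then have "glue_strands n ?f ?g s = (if s \<in> join_sets n S S' then Some s else glue_strands n f g s)"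
      using True c(3)[of s] b(4) by (auto simp: glue_strands_def split: option.splits top_target.splits)
    then show ?thesis unfolding r .
  next
    case False
    then have "s \<in> join_sets n S S' \<longleftrightarrow> s - n \<in> S'"
      using SS by (force simp: join_sets_def image_iff)
    then have "glue_strands n ?f ?g s = (if s \<in> join_sets n S S' then Some s else glue_strands n f g s)"
      using False b(3)[of "s - n"] by (auto simp: glue_strands_def)
    then show ?thesis unfolding r .
  qed
qed

section \<open>The pairing on basis elements\<close>

definition pairing :: "((nat \<rightharpoonup> top_target) \<Rightarrow> 'k::field) \<Rightarrow> ((bottom_source \<rightharpoonup> nat) \<Rightarrow> 'k) \<Rightarrow> (nat \<rightharpoonup> nat) \<Rightarrow> 'k"
  where "pairing = bilinear_ext (glue_term n)"

definition doubly_crossed :: "(nat \<rightharpoonup> top_target) \<Rightarrow> (bottom_source \<rightharpoonup> nat) \<Rightarrow> bool"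
  where "doubly_crossed f g \<longleftrightarrow> (\<exists>s t p q. s < t \<and> f s = Some (Top p) \<and> f t = Some (Top q) \<and> p < q \<and>
    the (g (Bot p)) < the (g (Bot q)))"

text \<open>Fixed strands do not pass the cut, so whether a double crossing occurs depends on the
  moving strands alone. The double sum over sections either vanishes or, by
  \<open>sections_join\<close>, becomes the sum over the sections of the glued matching.\<close>

lemma pairing_basis:
  assumes d: "(f, h1) \<in> top_data Z1 m" and d': "(g, h2) \<in> bottom_data Z2 m"
  shows "pairing (top_basis Z1 (f, h1)) (bottom_basis Z2 (g, h2)) =
    (if doubly_crossed f g then 0 else matching_basis Z (join_data ((f, h1), (g, h2))))"
proof -
  let ?f = "\<lambda>S. (Some \<circ> TPt) |` S ++ f"
  let ?g = "\<lambda>S'. (\<lambda>x. case x of BPt i \<Rightarrow> (Some |` S') i | Bot p \<Rightarrow> None) ++ g"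
  have h: "h1 \<subseteq> pairs Z1" "h2 \<subseteq> pairs Z2"
    using d d' by (simp_all add: top_data_iff bottom_data_iff)
  have "pairing (top_basis Z1 (f, h1)) (bottom_basis Z2 (g, h2)) =
      (\<Sum>S\<in>sections Z1 h1. \<Sum>S'\<in>sections Z2 h2. glue_term n (?f S) (?g S'))"
    unfolding pairing_def top_basis_def bottom_basis_def prod.case
    by (subst bilinear_ext_sum_left, simp, subst bilinear_ext_sum_right) simp_all
  also have "\<dots> = (\<Sum>S\<in>sections Z1 h1. \<Sum>S'\<in>sections Z2 h2.
      if doubly_crossed f g then 0 else single (Some |` join_sets n S S' ++ glue_strands n f g))"
  proof (intro sum.cong refl)
    fix S S' assume S: "S \<in> sections Z1 h1" "S' \<in> sections Z2 h2"
    note c = top_combine[OF two1 d S(1)] and b = bottom_combine[OF two2 d' S(2)]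
    have "inv_num (glue_strands n (?f S) (?g S')) = inv_num (?f S) + inv_num (?g S') \<longleftrightarrow>
        \<not> doubly_crossed f g"
      unfolding inv_num_glue_eq_iff[OF c(1) b(1)] c(4) b(4) doubly_crossed_def ..
    then show "glue_term n (?f S) (?g S') =
        (if doubly_crossed f g then 0 else single (Some |` join_sets n S S' ++ glue_strands n f g))"
      by (simp add: glue_term_def single_if_inv_def glue_combine[OF d d' S])
  qed
  also have "\<dots> = (if doubly_crossed f g then 0 else
      (\<Sum>(S, S')\<in>sections Z1 h1 \<times> sections Z2 h2. single (Some |` join_sets n S S' ++ glue_strands n f g)))"
    by (simp add: sum.cartesian_product)
  also have "(\<Sum>(S, S')\<in>sections Z1 h1 \<times> sections Z2 h2. single (Some |` join_sets n S S' ++ glue_strands n f g)) =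
      (\<Sum>S\<in>sections Z (join_sets (2 * genus Z1) h1 h2). single (Some |` S ++ glue_strands n f g) :: _ \<Rightarrow> 'a)"
    by (subst sum.reindex_bij_betw[OF sections_join[OF h], symmetric]) (simp add: case_prod_unfold)
  finally show ?thesis by (simp add: join_data_def matching_basis_def zero_fun_def)
qed

text \<open>Recovers from glued strands the component \<open>m\<close> from which they came. This
  keeps the components of the tensor product apart in the matching algebra.\<close>

definition crossing_number :: "(nat \<rightharpoonup> nat) \<Rightarrow> nat"
  where "crossing_number F = card {s. s \<le> n \<and> (\<exists>j > n. F s = Some j)}"

lemma crossing_iff:
  assumes f: "f \<in> top_strands n m" and g: "g \<in> bottom_strands n' m"
  shows "s \<le> n \<and> (\<exists>j > n. glue_strands n f g s = Some j) \<longleftrightarrow> (\<exists>p. f s = Some (Top p))"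
proof
  assume "s \<le> n \<and> (\<exists>j > n. glue_strands n f g s = Some j)"
  then obtain j where s: "s \<le> n" "n < j" "glue_strands n f g s = Some j" by blast
  from s(3) show "\<exists>p. f s = Some (Top p)"
    by (cases rule: glue_strands_cases[OF f g, consumes 1]) (use s in auto)
next
  assume "\<exists>p. f s = Some (Top p)"
  then obtain p where p: "f s = Some (Top p)" by blast
  obtain v where v: "g (Bot p) = Some v" "glue_strands n f g s = Some (n + v)"
    using glue_top_val[OF f g p] by blast
  then have "1 \<le> v" using bottom_strandsD(4)[OF g, of p v] by simp
  moreover have "s \<le> n" using top_strandsD(4)[OF f p] by simp
  ultimately show "s \<le> n \<and> (\<exists>j > n. glue_strands n f g s = Some j)" using v by auto
qed

lemma crossing_number_glue:
  assumes f: "f \<in> top_strands n m" and g: "g \<in> bottom_strands n' m"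
  shows "crossing_number (glue_strands n f g) = m"
  unfolding crossing_number_def crossing_iff[OF f g]
  using bij_betw_same_card[OF bij_betw_top_label[OF f]] by simp

lemma crossing_number_le: "crossing_number F \<le> n + 1"
proof -
  \<comment> \<open>The set \<open>{..n}\<close> contains \<open>0\<close>, which explains the bound
    \<open>n + 1\<close>. What matters is that it does not depend on \<open>F\<close>.\<close>
  have "card {s. s \<le> n \<and> (\<exists>j > n. F s = Some j)} \<le> card {..n}" by (intro card_mono) auto
  then show ?thesis by (simp add: crossing_number_def)
qed

definition standard_pairs ::
    "nat \<Rightarrow> (((nat \<rightharpoonup> top_target) \<times> nat set) \<times> ((bottom_source \<rightharpoonup> nat) \<times> nat set)) set"
  where "standard_pairs m = {d \<in> top_data Z1 m. sorted_tops (fst d)} \<times> bottom_data Z2 m"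

lemma not_doubly_crossed: "sorted_tops f \<Longrightarrow> \<not> doubly_crossed f g"
  unfolding sorted_tops_def doubly_crossed_def by (metis order_less_asym)

lemma standard_pairs_strands:
  assumes "((f, h1), (g, h2)) \<in> standard_pairs m"
  shows "f \<in> top_strands n m" "g \<in> bottom_strands n' m" "h1 \<subseteq> pairs Z1" "h2 \<subseteq> pairs Z2" "sorted_tops f"
  using assms unfolding standard_pairs_def by (auto simp: top_data_iff bottom_data_iff)

text \<open>Gluing forgets only the labels of the strands through the cut. In a sorted map these are
  the ranks of the starting points, which the glued strands determine.\<close>

lemma inj_on_join_data: "inj_on join_data (standard_pairs m)"
proof (rule inj_onI)
  fix a b assume ab: "a \<in> standard_pairs m" "b \<in> standard_pairs m" "join_data a = join_data b"
  obtain f h1 g h2 where a: "a = ((f, h1), (g, h2))" by (metis surj_pair)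
  obtain f' h1' g' h2' where b: "b = ((f', h1'), (g', h2'))" by (metis surj_pair)
  note A = standard_pairs_strands[OF ab(1)[unfolded a]] and B = standard_pairs_strands[OF ab(2)[unfolded b]]
  have F: "glue_strands n f g = glue_strands n f' g'"
    and h: "join_sets (2 * genus Z1) h1 h2 = join_sets (2 * genus Z1) h1' h2'"
    using ab(3) by (simp_all add: a b join_data_def)
  have hh: "h1 = h1'" "h2 = h2'" using join_sets_inject[OF A(3) B(3) A(4) B(4) h] by auto
  let ?C = "\<lambda>f. {s. \<exists>p. f s = Some (Top p)}"
  have C: "(\<exists>p. f s = Some (Top p)) \<longleftrightarrow> (\<exists>p. f' s = Some (Top p))" for s
    using crossing_iff[OF A(1,2), of s] crossing_iff[OF B(1,2), of s] F by simp
  have ff: "f s = f' s" for s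
  proof (cases "\<exists>p. f s = Some (Top p)")
    case True
    then obtain p q where "f s = Some (Top p)" "f' s = Some (Top q)" using C by blast
    moreover from this have "p = q"
      using sorted_tops_label[OF A(1,5), of s p] sorted_tops_label[OF B(1,5), of s q] C by simp
    ultimately show ?thesis by simp
  next
    case False
    then have no: "f s \<noteq> Some (Top p)" "f' s \<noteq> Some (Top p)" for p using C by blast+
    have "f s = Some (TPt j) \<longleftrightarrow> s \<le> n \<and> glue_strands n f g s = Some j"
      if f: "f \<in> top_strands n m" and no: "\<And>p. f s \<noteq> Some (Top p)" for f g j
    proof (cases "f s")
      case None
      then show ?thesis by (auto simp: glue_strands_def)
    next
      case (Some y)
      then show ?thesis using no top_strandsD(3)[OF f, of s]
        by (cases y) (auto simp: glue_strands_def)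
    qed
    then have "f s = Some (TPt j) \<longleftrightarrow> f' s = Some (TPt j)" for j
      using A(1) B(1) no F by metis
    then show ?thesis using no by (metis option.exhaust top_target.exhaust)
  qed
  have "g x = g' x" for x
  proof (cases x)
    case (BPt i)
    show ?thesis
    proof (cases "1 \<le> i")
      case True
      have "glue_strands n f g (n + i) = glue_strands n f' g' (n + i)" by (simp add: F)
      then have "map_option ((+) n) (g (BPt i)) = map_option ((+) n) (g' (BPt i))"
        using True by (simp add: glue_strands_def)
      then show ?thesis using BPt by (metis add_left_imp_eq inj_def option.inj_map_strong)
    next
      case False
      then have "g (BPt i) = None" "g' (BPt i) = None"
        using bottom_strandsD(3)[OF A(2), of i] bottom_strandsD(3)[OF B(2), of i]
        by (cases "g (BPt i)"; cases "g' (BPt i)"; auto)+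
      then show ?thesis using BPt by simp
    qed
  next
    case (Bot p)
    show ?thesis
    proof (cases "p \<in> {1..m}")
      case True
      then obtain s where s: "f s = Some (Top p)" using top_strandsD(5)[OF A(1)] by blast
      then have s': "f' s = Some (Top p)" using ff by simp
      show ?thesis
        using glue_top_val[OF A(1,2) s] glue_top_val[OF B(1,2) s'] F Bot by auto
    next
      case False
      then have "g (Bot p) = None" "g' (Bot p) = None"
        using bottom_strandsD(4)[OF A(2), of p] bottom_strandsD(4)[OF B(2), of p]
        by (cases "g (Bot p)"; cases "g' (Bot p)"; blast)+
      then show ?thesis using Bot by simp
    qed
  qed
  then have "f = f'" "g = g'" using ff by auto
  then show "a = b" using hh by (simp add: a b)
qed

text \<open>Cut \<open>F\<close> at the end of the first interval and label the strands through the
  cut by the ranks of their starting points, which makes the first part sorted. As \<open>F\<close>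
  is increasing, a strand that starts in the second interval stays there.\<close>

lemma join_data_surj:
  assumes Fh: "(F, h) \<in> matching_data Z" and m: "crossing_number F = m"
  obtains d where "d \<in> standard_pairs m" "join_data d = (F, h)"
proof -
  have F: "dom F \<subseteq> points Z" "ran F \<subseteq> points Z" "inj_on F (dom F)"
    "\<And>i j. F i = Some j \<Longrightarrow> i < j" "h \<subseteq> pairs Z"
    using Fh by (auto simp: matching_data_def)
  have val: "1 \<le> i \<and> i \<le> n + n' \<and> 1 \<le> j \<and> j \<le> n + n' \<and> i < j" if "F i = Some j" for i j
    using domI[of F i, OF that] ranI[of F i, OF that] F(1,2) F(4)[OF that] by (auto simp: glue_sel)
  let ?C = "{s. s \<le> n \<and> (\<exists>j > n. F s = Some j)}"
  have finC: "finite ?C" by (rule finite_subset[of _ "{..n}"]) auto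
  have r: "bij_betw (rank_in ?C) ?C {1..m}"
    using bij_betw_rank_in[OF finC] m by (simp add: crossing_number_def)
  define f where "f = (\<lambda>s. if s \<le> n then
    (case F s of None \<Rightarrow> None | Some j \<Rightarrow> Some (if j \<le> n then TPt j else Top (rank_in ?C s))) else None)"
  define g where "g = (\<lambda>x. case x of
      BPt i \<Rightarrow> if 1 \<le> i then map_option (\<lambda>j. j - n) (F (n + i)) else None
    | Bot p \<Rightarrow> if p \<in> {1..m} then map_option (\<lambda>j. j - n) (F (inv_into ?C (rank_in ?C) p)) else None)"
  have fT: "f s = Some (TPt j) \<longleftrightarrow> s \<le> n \<and> F s = Some j \<and> j \<le> n" for s j
    by (auto simp: f_def split: option.splits)
  have fP: "f s = Some (Top p) \<longleftrightarrow> s \<in> ?C \<and> p = rank_in ?C s" for s p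
    by (auto simp: f_def split: option.splits)
  \<comment> \<open>Here \<open>n < n + v\<close> says that \<open>v\<close> is positive. The
    truncated subtraction in \<open>g\<close> is exact, because a strand starting beyond
    \<open>n\<close> ends beyond \<open>n\<close>.\<close>
  have gB: "g (BPt i) = Some v \<longleftrightarrow> 1 \<le> i \<and> n < n + v \<and> F (n + i) = Some (n + v)" for i v
  proof -
    show ?thesis
    proof (cases "F (n + i)")
      case (Some j)
      then show ?thesis using val[OF Some] by (auto simp: g_def)
    qed (auto simp: g_def)
  qed
  have gP: "g (Bot (rank_in ?C s)) = Some v \<longleftrightarrow> n < n + v \<and> F s = Some (n + v)" if s: "s \<in> ?C" for s v
  proof -
    have "rank_in ?C s \<in> {1..m}" using r s by (auto simp: bij_betw_def)
    moreover have "inv_into ?C (rank_in ?C) (rank_in ?C s) = s"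
      using bij_betw_inv_into_left[OF r s] .
    moreover obtain j where "F s = Some j" "n < j" using s by blast
    ultimately show ?thesis by (auto simp: g_def)
  qed
  have Bot_rank: "\<exists>s\<in>?C. p = rank_in ?C s" if "p \<in> {1..m}" for p
  proof -
    have "p \<in> rank_in ?C ` ?C" using r that unfolding bij_betw_def by blast
    then show ?thesis by blast
  qed
  have gN: "g (Bot p) = None" if "p \<notin> {1..m}" for p using that by (auto simp: g_def)
  have injF: "i = i'" if "F i = Some j" "F i' = Some j" for i i' j
    using inj_the_dom[OF F(3) that] .
  have f_strands: "f \<in> top_strands n m"
  proof (rule top_strandsI)
    show "inj_on f (dom f)"
    proof (rule inj_onI)
      fix s t assume s: "s \<in> dom f" "f s = f t"
      then obtain y where y: "f s = Some y" "f t = Some y" by (metis domD)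
      show "s = t"
      proof (cases y)
        case (TPt j)
        then show ?thesis using y injF unfolding TPt fT by blast
      next
        case (Top p)
        then have "s \<in> ?C" "t \<in> ?C" "rank_in ?C s = rank_in ?C t" using y fP by auto
        then show ?thesis using r unfolding bij_betw_def by (meson inj_onD)
      qed
    qed
    show "x \<in> {1..n} \<and> j \<in> {1..n} \<and> x \<le> j" if "f x = Some (TPt j)" for x j
      using that val[of x j] unfolding fT by auto
    show "x \<in> {1..n} \<and> p \<in> {1..m}" if "f x = Some (Top p)" for x p
    proof -
      have x: "x \<in> ?C" "p = rank_in ?C x" using that fP by blast+
      then have "p \<in> {1..m}" using r by (auto simp: bij_betw_def)
      moreover have "x \<in> {1..n}" using x(1) val[of x] by auto
      ultimately show ?thesis by simp
    qed
    show "\<exists>x. f x = Some (Top p)" if "p \<in> {1..m}" for p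
      using Bot_rank[OF that] fP by blast
  qed
  have g_strands: "g \<in> bottom_strands n' m"
  proof (rule bottom_strandsI)
    have *: "\<exists>s. F s = Some (n + v) \<and> x = (if s \<le> n then Bot (rank_in ?C s) else BPt (s - n))"
      if x: "g x = Some v" for x v
    proof (cases x)
      case (BPt i)
      then have "1 \<le> i" "F (n + i) = Some (n + v)" using x gB by auto
      then show ?thesis using BPt by (intro exI[of _ "n + i"]) auto
    next
      case (Bot p)
      then have "p \<in> {1..m}" using gN[of p] x by (cases "p \<in> {1..m}") auto
      then obtain s where s: "s \<in> ?C" "p = rank_in ?C s" using Bot_rank by blast
      then have "F s = Some (n + v)" using gP x Bot by blast
      then show ?thesis using s Bot by (intro exI[of _ s]) simp
    qed
    show "inj_on g (dom g)"
    proof (rule inj_onI)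
      fix x y assume "x \<in> dom g" "g x = g y"
      then obtain v where v: "g x = Some v" "g y = Some v" by (metis domD)
      from *[OF v(1)] obtain s
        where s: "F s = Some (n + v)" "x = (if s \<le> n then Bot (rank_in ?C s) else BPt (s - n))"
        by (elim exE conjE)
      from *[OF v(2)] obtain t
        where t: "F t = Some (n + v)" "y = (if t \<le> n then Bot (rank_in ?C t) else BPt (t - n))"
        by (elim exE conjE)
      have "s = t" using s(1) t(1) by (rule injF)
      then show "x = y" using s(2) t(2) by simp
    qed
    show "i \<in> {1..n'} \<and> j \<in> {1..n'} \<and> i \<le> j" if "g (BPt i) = Some j" for i j
      using that val[of "n + i" "n + j"] unfolding gB by auto
    show "p \<in> {1..m} \<and> j \<in> {1..n'}" if "g (Bot p) = Some j" for p j
    proof -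
      have p: "p \<in> {1..m}" using gN[of p] that by (cases "p \<in> {1..m}") auto
      then obtain s where "s \<in> ?C" "p = rank_in ?C s" using Bot_rank by blast
      then have "n < n + j" "F s = Some (n + j)" using gP that by auto
      then show ?thesis using p val[of s "n + j"] by auto
    qed
    show "\<exists>j. g (Bot p) = Some j" if p: "p \<in> {1..m}" for p
    proof -
      obtain s where s: "s \<in> ?C" "p = rank_in ?C s" using Bot_rank[OF p] by blast
      then obtain j where "F s = Some j" "n < j" by blast
      then have "g (Bot (rank_in ?C s)) = Some (j - n)" using gP[OF s(1)] by simp
      then show ?thesis using s by blast
    qed
  qed
  have glue: "glue_strands n f g = F"
  proof
    fix s
    show "glue_strands n f g s = F s"
    proof (cases "s \<le> n")
      case True
      show ?thesis
      proof (cases "F s")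
        case None
        then have "f s = None" by (simp add: f_def)
        then show ?thesis using True None by (simp add: glue_strands_def)
      next
        case (Some j)
        show ?thesis
        proof (cases "j \<le> n")
          case j: True
          then have "f s = Some (TPt j)" using True Some fT by blast
          then show ?thesis using True Some by (simp add: glue_strands_def)
        next
          case False
          then have s: "s \<in> ?C" using True Some by auto
          then have "f s = Some (Top (rank_in ?C s))" using fP by blast
          moreover have "g (Bot (rank_in ?C s)) = Some (j - n)" using gP[OF s] Some False by simp
          ultimately show ?thesis using True Some False by (simp add: glue_strands_def)
        qed
      qed
    next
      case False
      show ?thesis
      proof (cases "F s")
        case None
        then show ?thesis using False by (simp add: glue_strands_def g_def)
      next
        case (Some j)
        then have "s < j" using val by blast
        then have "g (BPt (s - n)) = Some (j - n)" using False Some gB[of "s - n" "j - n"] by simp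
        then show ?thesis using False Some \<open>s < j\<close> by (simp add: glue_strands_def)
      qed
    qed
  qed
  obtain h1 h2 where h: "h = join_sets (2 * genus Z1) h1 h2" "h1 \<subseteq> pairs Z1" "h2 \<subseteq> pairs Z2"
    using split_join_sets[OF F(5)[unfolded pairs_Z]] .
  have j: "join_data ((f, h1), (g, h2)) = (F, h)" by (simp add: join_data_def glue h)
  have "(f, h1) \<in> top_data Z1 m \<and> (g, h2) \<in> bottom_data Z2 m"
    using join_data_iff[OF f_strands g_strands h(2,3)] Fh unfolding j by simp
  moreover have "sorted_tops f"
    unfolding sorted_tops_def fP using rank_in_less[OF finC] by blast
  ultimately have "((f, h1), (g, h2)) \<in> standard_pairs m" by (simp add: standard_pairs_def)
  then show thesis using j by (rule that)
qed

end

section \<open>The pairing respects actions, products and differentials\<close>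

lemma linear_ext_plus:
  "linear_ext (\<lambda>a. F a + G a) x = linear_ext F x + linear_ext G x"
  by (simp add: linear_ext_supp formal.scale_right_distrib sum.distrib)

lemma bilinear_ext_plus:
  "bilinear_ext (\<lambda>a b. F a b + G a b) x y = bilinear_ext F x y + bilinear_ext G x y"
  by (simp add: bilinear_ext_linear_ext linear_ext_plus)

lemma linear_ext_swap:
  "linear_ext (\<lambda>a. linear_ext (F a) y) x = linear_ext (\<lambda>b. linear_ext (\<lambda>a. F a b) x) y"
  using bilinear_ext_linear_ext[of F x y] bilinear_ext_flip[of F x y] by simp

lemma bilinear_ext_linear_ext_args:
  assumes "\<And>a. a \<in> supp u \<Longrightarrow> P a \<in> finitary" "\<And>b. b \<in> supp v \<Longrightarrow> Q b \<in> finitary"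
  shows "bilinear_ext M (linear_ext P u) (linear_ext Q v) = bilinear_ext (\<lambda>a b. bilinear_ext M (P a) (Q b)) u v"
proof -
  have "bilinear_ext M (linear_ext P u) (linear_ext Q v) =
      linear_ext (\<lambda>c. linear_ext (M c) (linear_ext Q v)) (linear_ext P u)"
    by (rule bilinear_ext_linear_ext)
  also have "\<dots> = linear_ext (\<lambda>a. bilinear_ext M (P a) (linear_ext Q v)) u"
    unfolding bilinear_ext_linear_ext[of M] by (rule linear_ext_linear_ext[OF assms(1)])
  also have "\<dots> = linear_ext (\<lambda>a. linear_ext (\<lambda>b. bilinear_ext M (P a) (Q b)) v) u"
    unfolding bilinear_ext_flip[of M] by (intro linear_ext_cong linear_ext_linear_ext assms(2))
  finally show ?thesis by (simp add: bilinear_ext_linear_ext)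
qed

lemma linear_ext_in_span:
  assumes "S \<subseteq> finitary" "formal.subspace V" "\<And>b. b \<in> S \<Longrightarrow> linear_ext F b \<in> V" "x \<in> formal.span S"
  shows "linear_ext F x \<in> V"
proof -
  have "formal.subspace {x \<in> finitary. linear_ext F x \<in> V}"
    by (rule formal.subspaceI)
      (auto simp: linear_ext_add linear_ext_scale finitary_add finitary_scale
        intro: formal.subspace_0[OF assms(2)] formal.subspace_add[OF assms(2)] formal.subspace_scale[OF assms(2)])
  then have "formal.span S \<subseteq> {x \<in> finitary. linear_ext F x \<in> V}"
    using assms(1,3) by (intro formal.span_minimal) auto
  then show ?thesis using assms(4) by blast
qed

lemma glue_term_finitary [simp]: "glue_term k f g \<in> finitary"
  by (simp add: glue_term_def single_if_inv_def)

lemma single_if_inv_finitary [simp]: "single_if_inv f k \<in> finitary"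
  by (simp add: single_if_inv_def)

lemma strand_diff_single:
  "strand_diff (single f) = (\<Sum>p | p \<in> inversions f \<and> inv_num f = inv_num (exchange f p) + 1. single (exchange f p))"
  by (simp add: strand_diff_def)

lemma strand_diff_expand:
  "strand_diff x = linear_ext (\<lambda>f. strand_diff (single f)) x"
  by (simp add: strand_diff_single) (simp add: strand_diff_def)

lemma finitary_strand_diff_single [simp]: "strand_diff (single f) \<in> finitary"
  unfolding strand_diff_single by (intro finitary_sum) simp

context glued_intervals
begin

lemma top_basis_finitary: "top_basis Z1 ` top_data Z1 m \<subseteq> finitary"
  by (auto simp: top_basis_def intro!: finitary_sum)

lemma bottom_basis_finitary: "bottom_basis Z2 ` bottom_data Z2 m \<subseteq> finitary"
  by (auto simp: bottom_basis_def intro!: finitary_sum)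

abbreviation top_comp :: "nat \<Rightarrow> ((nat \<rightharpoonup> top_target) \<Rightarrow> 'k::field) set"
  where "top_comp m \<equiv> formal.span (top_basis Z1 ` top_data Z1 m)"

abbreviation bottom_comp :: "nat \<Rightarrow> ((bottom_source \<rightharpoonup> nat) \<Rightarrow> 'k::field) set"
  where "bottom_comp m \<equiv> formal.span (bottom_basis Z2 ` bottom_data Z2 m)"

lemma top_comp_supp:
  assumes x: "x \<in> top_comp m" and f: "f \<in> supp x"
  shows "f \<in> top_strands n m"
proof -
  interpret matched_strands id TPt Z1 "{}" "Top ` {1..m}" by (rule matched_strands_top[OF two1])
  have "f \<in> mstrs" using matchedD(1)[OF x[unfolded span_top_basis[OF two1]]] f by (simp add: supp_def)
  then show ?thesis unfolding mstrs_def top_strs[OF two1] by simp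
qed

lemma bottom_comp_supp:
  assumes y: "y \<in> bottom_comp m" and g: "g \<in> supp y"
  shows "g \<in> bottom_strands n' m"
proof -
  interpret matched_strands BPt id Z2 "Bot ` {1..m}" "{}" by (rule matched_strands_bottom[OF two2])
  have "g \<in> mstrs" using matchedD(1)[OF y[unfolded span_bottom_basis[OF two2]]] g by (simp add: supp_def)
  then show ?thesis unfolding mstrs_def bottom_strs[OF two2] by simp
qed

lemma top_comp_finitary: "x \<in> top_comp m \<Longrightarrow> x \<in> finitary"
  unfolding span_top_basis[OF two1] by (rule matched_strands.matched_finitary[OF matched_strands_top[OF two1]])

lemma bottom_comp_finitary: "y \<in> bottom_comp m \<Longrightarrow> y \<in> finitary"
  unfolding span_bottom_basis[OF two2] by (rule matched_strands.matched_finitary[OF matched_strands_bottom[OF two2]])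

lemma pairing_finitary [simp]: "pairing x y \<in> finitary"
  unfolding pairing_def by (intro bilinear_ext_in_subspace subspace_finitary) simp

lemma top_action_comp:
  assumes x: "x \<in> top_comp m" and a: "a \<in> formal.span (single ` {w. w permutes {1..m}})"
  shows "vact (top_module N) a x \<in> (top_comp m :: (_ \<Rightarrow> 'k::field) set)"
proof -
  have w: "w permutes {1..m}" if "w \<in> supp a" for w using a that by (auto simp: span_single)
  let ?F = "\<lambda>f w. single_if_inv (map_option (relabel_tops w) \<circ> f) (inv_num f + perm_length w) :: _ \<Rightarrow> 'k"
  have "linear_ext (\<lambda>f. ?F f w) b \<in> top_comp m"
    if w: "w permutes {1..m}" and b: "b \<in> top_basis Z1 ` top_data Z1 m" for w b
  proof -
    obtain f h where fh: "b = top_basis Z1 (f, h)" "(f, h) \<in> top_data Z1 m" using b by force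
    have "linear_ext (\<lambda>f. ?F f w) b = vact (top_module N) (single w) b"
      by (simp add: top_module_def)
    then show ?thesis
      unfolding fh(1) top_action_basis(2)[OF two1 fh(2) w]
      using top_action_basis(1)[OF two1 fh(2) w] by (auto intro: formal.span_base formal.span_zero)
  qed
  then have "linear_ext (\<lambda>f. ?F f w) x \<in> top_comp m" if "w permutes {1..m}" for w
    using linear_ext_in_span[OF top_basis_finitary formal.subspace_span _ x] that by blast
  then show ?thesis
    unfolding top_module_def algebra_module.simps bilinear_ext_flip
    using w by - (rule linear_ext_in_subspace[OF formal.subspace_span], blast)
qed

lemma bottom_action_comp:
  assumes y: "y \<in> bottom_comp m" and a: "a \<in> formal.span (single ` {w. w permutes {1..m}})"
  shows "vact (bottom_module N) a y \<in> (bottom_comp m :: (_ \<Rightarrow> 'k::field) set)"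
proof -
  have w: "w permutes {1..m}" if "w \<in> supp a" for w using a that by (auto simp: span_single)
  let ?F = "\<lambda>w g. single_if_inv (g \<circ> relabel_bottoms w) (inv_num g + perm_length w) :: _ \<Rightarrow> 'k"
  have "linear_ext (?F w) b \<in> bottom_comp m"
    if w: "w permutes {1..m}" and b: "b \<in> bottom_basis Z2 ` bottom_data Z2 m" for w b
  proof -
    obtain g h where gh: "b = bottom_basis Z2 (g, h)" "(g, h) \<in> bottom_data Z2 m" using b by force
    have "linear_ext (?F w) b = vact (bottom_module N) (single w) b"
      by (simp add: bottom_module_def)
    then show ?thesis
      unfolding gh(1) bottom_action_basis(2)[OF two2 gh(2) w]
      using bottom_action_basis(1)[OF two2 gh(2) w] by (auto intro: formal.span_base formal.span_zero)
  qed
  then have "linear_ext (?F w) y \<in> bottom_comp m" if "w permutes {1..m}" for w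
    using linear_ext_in_span[OF bottom_basis_finitary formal.subspace_span _ y] that by blast
  then show ?thesis
    unfolding bottom_module_def algebra_module.simps bilinear_ext_linear_ext
    using w by - (rule linear_ext_in_subspace[OF formal.subspace_span], blast)
qed

lemma pairing_balanced:
  assumes x: "x \<in> top_comp m" and y: "y \<in> bottom_comp m"
    and a: "a \<in> formal.span (single ` {w. w permutes {1..m}})"
  shows "pairing (vact (top_module N) a x) y = pairing x (vact (bottom_module N') a y)"
proof -
  let ?F = "\<lambda>f w. single_if_inv (map_option (relabel_tops w) \<circ> f) (inv_num f + perm_length w)"
  let ?G = "\<lambda>w g. single_if_inv (g \<circ> relabel_bottoms w) (inv_num g + perm_length w)"
  let ?H = "\<lambda>f w. linear_ext (\<lambda>g. linear_ext (glue_term n f) (?G w g)) y"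
  have "pairing (vact (top_module N) a x) y =
      linear_ext (\<lambda>f. linear_ext (glue_term n f) y) (bilinear_ext ?F x a)"
    by (simp add: pairing_def top_module_def bilinear_ext_linear_ext)
  also have "\<dots> = bilinear_ext (\<lambda>f w. linear_ext (\<lambda>f'. linear_ext (glue_term n f') y) (?F f w)) x a"
    by (rule linear_ext_bilinear_ext) simp
  also have "\<dots> = bilinear_ext ?H x a"
  proof (rule bilinear_ext_cong)
    fix f w assume fw: "f \<in> supp x" "w \<in> supp a"
    then have w: "w permutes {1..m}" using a by (auto simp: span_single)
    have "linear_ext (\<lambda>f'. linear_ext (glue_term n f') y) (?F f w) =
        linear_ext (\<lambda>g. linear_ext (\<lambda>f'. glue_term n f' g) (?F f w)) y"
      by (rule linear_ext_swap)
    also have "\<dots> = ?H f w"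
      by (rule linear_ext_cong, rule glue_term_balanced[OF top_comp_supp[OF x fw(1)] bottom_comp_supp[OF y] w])
    finally show "linear_ext (\<lambda>f'. linear_ext (glue_term n f') y) (?F f w) = ?H f w" .
  qed
  also have "\<dots> = linear_ext (\<lambda>f. linear_ext (glue_term n f) (bilinear_ext ?G a y)) x"
    unfolding bilinear_ext_linear_ext[of ?H]
  proof (rule linear_ext_cong)
    fix f
    show "linear_ext (?H f) a = linear_ext (glue_term n f) (bilinear_ext ?G a y)"
      by (subst linear_ext_bilinear_ext) (simp_all add: bilinear_ext_linear_ext)
  qed
  also have "\<dots> = pairing x (vact (bottom_module N') a y)"
    by (simp add: pairing_def bottom_module_def bilinear_ext_linear_ext[of "glue_term n"])
  finally show ?thesis .
qed

abbreviation strands_mult :: "((nat \<rightharpoonup> nat) \<Rightarrow> 'k::field) \<Rightarrow> ((nat \<rightharpoonup> nat) \<Rightarrow> 'k) \<Rightarrow> (nat \<rightharpoonup> nat) \<Rightarrow> 'k"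
  where "strands_mult \<equiv> bilinear_ext (\<lambda>f g.
    if ran f = dom g then single_if_inv (g \<circ>\<^sub>m f) (inv_num f + inv_num g) else 0)"

lemma pairing_mult:
  assumes x: "x \<in> top_comp m" and y: "y \<in> bottom_comp m" and x': "x' \<in> top_comp k" and y': "y' \<in> bottom_comp k"
  shows "pairing (hmult (top_module N) m k x x') (hmult (bottom_module N') m k y y') =
    strands_mult (pairing x y) (pairing x' y')"
proof -
  let ?F = "\<lambda>f f'. if {j. TPt j \<in> ran f} = dom f'
    then single_if_inv (top_compose m f f') (inv_num f + inv_num f') else 0"
  let ?G = "\<lambda>g g'. if ran g = {i. BPt i \<in> dom g'}
    then single_if_inv (bottom_compose m g g') (inv_num g + inv_num g') else 0"
  let ?M = "\<lambda>f g. if ran f = dom g then single_if_inv (g \<circ>\<^sub>m f) (inv_num f + inv_num g) else 0"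
  have "pairing (hmult (top_module N) m k x x') (hmult (bottom_module N') m k y y') =
      bilinear_ext (glue_term n) (bilinear_ext ?F x x') (bilinear_ext ?G y y')"
    by (simp add: pairing_def top_module_def bottom_module_def)
  also have "\<dots> = bilinear_ext (\<lambda>f f'. bilinear_ext (\<lambda>g g'.
      bilinear_ext (glue_term n) (?F f f') (?G g g')) y y') x x'"
    by (rule bilinear_ext_bilinear_ext) auto
  also have "\<dots> = bilinear_ext (\<lambda>f f'. bilinear_ext (\<lambda>g g'.
      bilinear_ext ?M (glue_term n f g) (glue_term n f' g')) y y') x x'"
    by (rule bilinear_ext_cong, rule bilinear_ext_cong, rule glue_term_mult[OF top_comp_supp[OF x]
          bottom_comp_supp[OF y] top_comp_supp[OF x'] bottom_comp_supp[OF y']])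
  also have "\<dots> = bilinear_ext (\<lambda>f g. bilinear_ext (\<lambda>f' g'.
      bilinear_ext ?M (glue_term n f g) (glue_term n f' g')) x' y') x y"
    by (rule bilinear_ext_swap_args[symmetric])
  also have "\<dots> = strands_mult (pairing x y) (pairing x' y')"
    unfolding pairing_def by (rule bilinear_ext_bilinear_ext[symmetric]) simp_all
  finally show ?thesis .
qed

lemma exchange_top_strands:
  assumes "f \<in> top_strands n m" "p \<in> inversions f"
  shows "exchange f p \<in> top_strands n m"
  using matched_strands.strs_exchange(1)[OF matched_strands_top[OF two1, of m], unfolded top_strs[OF two1]] assms .

lemma exchange_bottom_strands:
  assumes "g \<in> bottom_strands n' m" "q \<in> inversions g"
  shows "exchange g q \<in> bottom_strands n' m"
  using matched_strands.strs_exchange(1)[OF matched_strands_bottom[OF two2, of m], unfolded bottom_strs[OF two2]] assms .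

text \<open>A summand survives iff its inversion number is smaller by exactly one than the largest possible.\<close>

lemma glue_term_diff:
  assumes char: "CHAR('k::field) = 2" and f: "f \<in> top_strands n m" and g: "g \<in> bottom_strands n' m"
  shows "linear_ext (\<lambda>f. glue_term n f g) (strand_diff (single f)) + linear_ext (glue_term n f) (strand_diff (single g)) =
    (strand_diff (glue_term n f g) :: _ \<Rightarrow> 'k)"
proof -
  let ?N = "inv_num f + inv_num g" and ?F = "glue_strands n f g"
  \<comment> \<open>Keeping just the strands that are one inversion short of \<open>?N\<close>
    replaces the degree conditions in the differentials. The sums then run over all inversions, as
    \<open>sum_inversions_glue\<close> requires.\<close>
  let ?\<phi> = "\<lambda>G. if inv_num G + 1 = ?N then single G else 0 :: _ \<Rightarrow> 'k"
  note fD = top_strandsD[OF f] and gD = bottom_strandsD[OF g]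
  have "linear_ext (\<lambda>f. glue_term n f g) (strand_diff (single f)) =
      (\<Sum>p | p \<in> inversions f \<and> inv_num f = inv_num (exchange f p) + 1. glue_term n (exchange f p) g)"
    unfolding strand_diff_single by (subst linear_ext_sum) simp_all
  also have "\<dots> = (\<Sum>p\<in>inversions f. ?\<phi> (glue_strands n (exchange f p) g))"
  proof (rule sum.mono_neutral_cong_left)
    show "finite (inversions f)" by (rule finite_inversions[OF fD(1)])
    show "\<forall>p\<in>inversions f - {p. p \<in> inversions f \<and> inv_num f = inv_num (exchange f p) + 1}.
        ?\<phi> (glue_strands n (exchange f p) g) = 0"
    proof
      fix p assume p: "p \<in> inversions f - {p. p \<in> inversions f \<and> inv_num f = inv_num (exchange f p) + 1}"
      have "inv_num (exchange f p) < inv_num f"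
        using p inversions_exchange(1)[OF fD(1,2)] by (cases p) auto
      then have "inv_num (exchange f p) + 1 < inv_num f" using p by auto
      moreover have "inv_num (glue_strands n (exchange f p) g) \<le> inv_num (exchange f p) + inv_num g"
        using p by (intro inv_num_glue_le[OF exchange_top_strands[OF f] g]) simp
      ultimately show "?\<phi> (glue_strands n (exchange f p) g) = 0" by simp
    qed
  qed (auto simp: glue_term_def single_if_inv_def)
  finally have 1: "linear_ext (\<lambda>f. glue_term n f g) (strand_diff (single f)) =
      (\<Sum>p\<in>inversions f. ?\<phi> (glue_strands n (exchange f p) g))" .
  have "linear_ext (glue_term n f) (strand_diff (single g)) =
      (\<Sum>p | p \<in> inversions g \<and> inv_num g = inv_num (exchange g p) + 1. glue_term n f (exchange g p))"
    unfolding strand_diff_single by (subst linear_ext_sum) simp_all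
  also have "\<dots> = (\<Sum>p\<in>inversions g. ?\<phi> (glue_strands n f (exchange g p)))"
  proof (rule sum.mono_neutral_cong_left)
    show "finite (inversions g)" by (rule finite_inversions[OF gD(1)])
    show "\<forall>p\<in>inversions g - {p. p \<in> inversions g \<and> inv_num g = inv_num (exchange g p) + 1}.
        ?\<phi> (glue_strands n f (exchange g p)) = 0"
    proof
      fix p assume p: "p \<in> inversions g - {p. p \<in> inversions g \<and> inv_num g = inv_num (exchange g p) + 1}"
      have "inv_num (exchange g p) < inv_num g"
        using p inversions_exchange(1)[OF gD(1,2)] by (cases p) auto
      then have "inv_num (exchange g p) + 1 < inv_num g" using p by auto
      moreover have "inv_num (glue_strands n f (exchange g p)) \<le> inv_num f + inv_num (exchange g p)"
        using p by (intro inv_num_glue_le[OF f exchange_bottom_strands[OF g]]) simp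
      ultimately show "?\<phi> (glue_strands n f (exchange g p)) = 0" by simp
    qed
  qed (auto simp: glue_term_def single_if_inv_def)
  finally have 2: "linear_ext (glue_term n f) (strand_diff (single g)) =
      (\<Sum>p\<in>inversions g. ?\<phi> (glue_strands n f (exchange g p)))" .
  have "(\<Sum>p\<in>inversions ?F. ?\<phi> (exchange ?F p)) = strand_diff (glue_term n f g)"
  proof (cases "inv_num ?F = ?N")
    case True
    have "(\<Sum>p\<in>inversions ?F. ?\<phi> (exchange ?F p)) =
        (\<Sum>p\<in>{p \<in> inversions ?F. inv_num (exchange ?F p) + 1 = ?N}. single (exchange ?F p))"
      by (rule sum.inter_filter[symmetric, OF finite_inversions[OF finite_dom_glue[OF f g]]])
    also have "\<dots> = strand_diff (single ?F)"
      unfolding strand_diff_single True by (intro sum.cong) auto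
    finally show ?thesis using True by (simp add: glue_term_def single_if_inv_def)
  next
    case False
    then have "inv_num ?F < ?N" using inv_num_glue_le[OF f g] by simp
    \<comment> \<open>If two strands cross twice, every exchange in \<open>?F\<close> stays below
      \<open>?N - 1\<close> inversions. The sum is then \<open>0\<close>, in agreement with the
      vanishing of \<open>glue_term n f g\<close>.\<close>
    then have lt: "inv_num (exchange ?F p) + 1 < ?N" if "p \<in> inversions ?F" for p
      using inversions_exchange(1)[OF finite_dom_glue[OF f g] inj_on_glue[OF f g]] that
      by (cases p) fastforce
    have "(\<Sum>p\<in>inversions ?F. ?\<phi> (exchange ?F p)) = 0"
    proof (intro sum.neutral ballI)
      fix p assume "p \<in> inversions ?F"
      from lt[OF this] show "?\<phi> (exchange ?F p) = 0" by simp
    qed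
    then show ?thesis using False by (simp add: glue_term_def single_if_inv_def strand_diff_def)
  qed
  then show ?thesis
    unfolding 1 2 using sum_inversions_glue[OF f g char, of ?\<phi>] by simp
qed

lemma pairing_diff:
  fixes x :: "_ \<Rightarrow> 'k::field"
  assumes char: "CHAR('k) = 2" and x: "x \<in> top_comp m" and y: "y \<in> bottom_comp m"
  shows "pairing (strand_diff x) y + pairing x (strand_diff y) = strand_diff (pairing x y)"
proof -
  let ?d = "\<lambda>f. strand_diff (single f)"
  have "pairing (strand_diff x) y = linear_ext (\<lambda>f. linear_ext (glue_term n f) y) (linear_ext ?d x)"
    unfolding pairing_def bilinear_ext_linear_ext by (subst strand_diff_expand) (rule refl)
  also have "\<dots> = linear_ext (\<lambda>f. linear_ext (\<lambda>f'. linear_ext (glue_term n f') y) (?d f)) x"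
    by (rule linear_ext_linear_ext) simp
  also have "\<dots> = bilinear_ext (\<lambda>f g. linear_ext (\<lambda>f'. glue_term n f' g) (?d f)) x y"
    unfolding bilinear_ext_linear_ext by (rule linear_ext_cong, rule linear_ext_swap)
  finally have 1: "pairing (strand_diff x) y =
    bilinear_ext (\<lambda>f g. linear_ext (\<lambda>f'. glue_term n f' g) (?d f)) x y" .
  have "pairing x (strand_diff y) = linear_ext (\<lambda>f. linear_ext (glue_term n f) (linear_ext ?d y)) x"
    unfolding pairing_def bilinear_ext_linear_ext by (subst strand_diff_expand) (rule refl)
  also have "\<dots> = bilinear_ext (\<lambda>f g. linear_ext (glue_term n f) (?d g)) x y"
    unfolding bilinear_ext_linear_ext by (intro linear_ext_cong linear_ext_linear_ext) simp
  finally have 2: "pairing x (strand_diff y) = bilinear_ext (\<lambda>f g. linear_ext (glue_term n f) (?d g)) x y" .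
  have "strand_diff (pairing x y) = bilinear_ext (\<lambda>f g. strand_diff (glue_term n f g)) x y"
    unfolding pairing_def strand_diff_expand[of "bilinear_ext _ _ _"]
    by (subst linear_ext_bilinear_ext) (simp_all flip: strand_diff_expand)
  also have "\<dots> = pairing (strand_diff x) y + pairing x (strand_diff y)"
    unfolding 1 2 bilinear_ext_plus[symmetric]
    by (rule bilinear_ext_cong,
        rule glue_term_diff[OF char top_comp_supp[OF x] bottom_comp_supp[OF y], symmetric])
  finally show ?thesis by simp
qed

end

section \<open>The tensor product\<close>

context glued_intervals
begin

abbreviation top_mod :: "((nat \<Rightarrow> nat) \<Rightarrow> 'k::field, (nat \<rightharpoonup> top_target) \<Rightarrow> 'k) algebra_module"
  where "top_mod \<equiv> matched_top_module Z1"

abbreviation bottom_mod :: "((nat \<Rightarrow> nat) \<Rightarrow> 'k::field, (bottom_source \<rightharpoonup> nat) \<Rightarrow> 'k) algebra_module"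
  where "bottom_mod \<equiv> matched_bottom_module Z2"

abbreviation tensors :: "nat \<Rightarrow> (((nat \<rightharpoonup> top_target) \<Rightarrow> 'k::field) \<times> ((bottom_source \<rightharpoonup> nat) \<Rightarrow> 'k) \<Rightarrow> 'k) set"
  where "tensors m \<equiv> free_on_pairs (top_comp m) (bottom_comp m)"

abbreviation relations :: "nat \<Rightarrow> (((nat \<rightharpoonup> top_target) \<Rightarrow> 'k::field) \<times> ((bottom_source \<rightharpoonup> nat) \<Rightarrow> 'k) \<Rightarrow> 'k) set"
  where "relations m \<equiv> tensor_relations (top_comp m) (carrier (nilcoxeter m)) (bottom_comp m)
    (vact top_mod) (vact bottom_mod)"

abbreviation "gluing_alg \<equiv> matching_algebra Z"

definition psi :: "(((nat \<rightharpoonup> top_target) \<Rightarrow> 'k::field) \<times> ((bottom_source \<rightharpoonup> nat) \<Rightarrow> 'k) \<Rightarrow> 'k) \<Rightarrow> (nat \<rightharpoonup> nat) \<Rightarrow> 'k"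
  where "psi = linear_ext (\<lambda>(x, y). pairing x y)"

lemma mod_simps:
  "component top_mod m = top_comp m" "component bottom_mod m = bottom_comp m"
  "vact top_mod = vact (top_module n)" "vact bottom_mod = vact (bottom_module n')"
  "hmult top_mod = hmult (top_module n)" "hmult bottom_mod = hmult (bottom_module n')"
  "hdiff top_mod = strand_diff" "hdiff bottom_mod = strand_diff"
  by (simp_all add: matched_top_module_def matched_bottom_module_def top_module_def bottom_module_def)

lemma nilcoxeter_carrier: "carrier (nilcoxeter m) = formal.span (single ` {w. w permutes {1..m}})"
  by (simp add: nilcoxeter_def)

lemma tensors_supp: "u \<in> tensors m \<Longrightarrow> (x, y) \<in> supp u \<Longrightarrow> x \<in> top_comp m \<and> y \<in> bottom_comp m"
  by (auto simp: free_on_pairs_def span_single)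

lemma tensors_finitary: "u \<in> tensors m \<Longrightarrow> u \<in> finitary"
  by (auto simp: free_on_pairs_def span_single finitary_def)

lemma subspace_tensors: "formal.subspace (tensors m)"
  by (simp add: free_on_pairs_def)

lemma single_tensors: "x \<in> top_comp m \<Longrightarrow> y \<in> bottom_comp m \<Longrightarrow> single (x, y) \<in> tensors m"
  by (auto simp: free_on_pairs_def intro: formal.span_base)

lemma psi_single [simp]: "psi (single (x, y)) = pairing x y"
  by (simp add: psi_def)

lemma psi_add: "u \<in> finitary \<Longrightarrow> v \<in> finitary \<Longrightarrow> psi (u + v) = psi u + psi v"
  by (simp add: psi_def linear_ext_add)

lemma psi_diff: "u \<in> finitary \<Longrightarrow> v \<in> finitary \<Longrightarrow> psi (u - v) = psi u - psi v"
  by (simp add: psi_def linear_ext_diff)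

lemma psi_scale: "u \<in> finitary \<Longrightarrow> psi (c *\<^sub>k u) = c *\<^sub>k psi u"
  by (simp add: psi_def linear_ext_scale)

lemma psi_zero [simp]: "psi 0 = 0"
  by (simp add: psi_def)

lemma subspace_psi: "formal.subspace {u \<in> tensors m. psi u = 0}"
  by (rule formal.subspaceI)
    (auto simp: psi_add psi_scale tensors_finitary
      intro: formal.subspace_0[OF subspace_tensors] formal.subspace_add[OF subspace_tensors]
        formal.subspace_scale[OF subspace_tensors])

text \<open>Bilinearity of the pairing kills the first four kinds of generators, and
  \<open>pairing_balanced\<close> kills the last.\<close>

lemma relations_psi: "relations m \<subseteq> {u \<in> tensors m. psi u = (0 :: _ \<Rightarrow> 'k::field)}"
  unfolding tensor_relations_def mod_simps nilcoxeter_carrier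
proof (rule formal.span_minimal[OF _ subspace_psi], intro Un_least subsetI; elim CollectE exE conjE)
  note T = single_tensors
  note sp = formal.subspace_diff[OF subspace_tensors] formal.subspace_scale[OF subspace_tensors]
  fix u :: "((nat \<rightharpoonup> top_target) \<Rightarrow> 'k) \<times> ((bottom_source \<rightharpoonup> nat) \<Rightarrow> 'k) \<Rightarrow> 'k" and x and x' and y
  assume u: "u = single (x + x', y) - single (x, y) - single (x', y)"
    and x: "x \<in> top_comp m" "x' \<in> top_comp m" and y: "y \<in> bottom_comp m"
  have "u \<in> tensors m" unfolding u using x y by (intro sp T formal.span_add)
  then show "u \<in> {u \<in> tensors m. psi u = 0}"
    by (simp add: u psi_diff finitary_diff pairing_def bilinear_ext_add_left top_comp_finitary[OF x(1)] top_comp_finitary[OF x(2)])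
next
  note T = single_tensors
  note sp = formal.subspace_diff[OF subspace_tensors] formal.subspace_scale[OF subspace_tensors]
  fix u :: "((nat \<rightharpoonup> top_target) \<Rightarrow> 'k) \<times> ((bottom_source \<rightharpoonup> nat) \<Rightarrow> 'k) \<Rightarrow> 'k" and x and y and y'
  assume u: "u = single (x, y + y') - single (x, y) - single (x, y')"
    and x: "x \<in> top_comp m" and y: "y \<in> bottom_comp m" "y' \<in> bottom_comp m"
  have "u \<in> tensors m" unfolding u using x y by (intro sp T formal.span_add)
  then show "u \<in> {u \<in> tensors m. psi u = 0}"
    by (simp add: u psi_diff finitary_diff pairing_def bilinear_ext_add_right
        bottom_comp_finitary[OF y(1)] bottom_comp_finitary[OF y(2)])
next
  note T = single_tensors
  note sp = formal.subspace_diff[OF subspace_tensors] formal.subspace_scale[OF subspace_tensors]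
  fix u :: "((nat \<rightharpoonup> top_target) \<Rightarrow> 'k) \<times> ((bottom_source \<rightharpoonup> nat) \<Rightarrow> 'k) \<Rightarrow> 'k" and c and x and y
  assume u: "u = single (c *\<^sub>k x, y) - c *\<^sub>k single (x, y)"
    and x: "x \<in> top_comp m" and y: "y \<in> bottom_comp m"
  have "u \<in> tensors m" unfolding u using x y by (intro sp T formal.span_scale)
  then show "u \<in> {u \<in> tensors m. psi u = 0}"
    by (simp add: u psi_diff psi_scale finitary_scale pairing_def bilinear_ext_scale_left top_comp_finitary[OF x])
next
  note T = single_tensors
  note sp = formal.subspace_diff[OF subspace_tensors] formal.subspace_scale[OF subspace_tensors]
  fix u :: "((nat \<rightharpoonup> top_target) \<Rightarrow> 'k) \<times> ((bottom_source \<rightharpoonup> nat) \<Rightarrow> 'k) \<Rightarrow> 'k" and c and x and y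
  assume u: "u = single (x, c *\<^sub>k y) - c *\<^sub>k single (x, y)"
    and x: "x \<in> top_comp m" and y: "y \<in> bottom_comp m"
  have "u \<in> tensors m" unfolding u using x y by (intro sp T formal.span_scale)
  then show "u \<in> {u \<in> tensors m. psi u = 0}"
    by (simp add: u psi_diff psi_scale finitary_scale pairing_def bilinear_ext_scale_right bottom_comp_finitary[OF y])
next
  note T = single_tensors
  note sp = formal.subspace_diff[OF subspace_tensors]
  fix u :: "((nat \<rightharpoonup> top_target) \<Rightarrow> 'k) \<times> ((bottom_source \<rightharpoonup> nat) \<Rightarrow> 'k) \<Rightarrow> 'k" and a and x and y
  assume u: "u = single (vact (top_module n) a x, y) - single (x, vact (bottom_module n') a y)"
    and a: "a \<in> formal.span (single ` {w. w permutes {1..m}})"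
    and x: "x \<in> top_comp m" and y: "y \<in> bottom_comp m"
  have "u \<in> tensors m" unfolding u using x y a by (intro sp T top_action_comp bottom_action_comp)
  then show "u \<in> {u \<in> tensors m. psi u = 0}"
    by (simp add: u psi_diff pairing_balanced[OF x y a])
qed

lemma relations_add_left:
  "x \<in> top_comp m \<Longrightarrow> x' \<in> top_comp m \<Longrightarrow> y \<in> bottom_comp m \<Longrightarrow>
   single (x + x', y) - single (x, y) - single (x', y) \<in> relations m"
  and relations_add_right:
  "x \<in> top_comp m \<Longrightarrow> y \<in> bottom_comp m \<Longrightarrow> y' \<in> bottom_comp m \<Longrightarrow>
   single (x, y + y') - single (x, y) - single (x, y') \<in> relations m"
  and relations_scale_left:
  "x \<in> top_comp m \<Longrightarrow> y \<in> bottom_comp m \<Longrightarrow> single (c *\<^sub>k x, y) - c *\<^sub>k single (x, y) \<in> relations m"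
  and relations_scale_right:
  "x \<in> top_comp m \<Longrightarrow> y \<in> bottom_comp m \<Longrightarrow> single (x, c *\<^sub>k y) - c *\<^sub>k single (x, y) \<in> relations m"
  and relations_balanced:
  "w permutes {1..m} \<Longrightarrow> x \<in> top_comp m \<Longrightarrow> y \<in> bottom_comp m \<Longrightarrow>
   single (vact (top_module n) (single w) x, y) - single (x, vact (bottom_module n') (single w) y) \<in> relations m"
proof -
  have sub: "G \<subseteq> relations m" if "G \<subseteq> (
      {single (x + x', y) - single (x, y) - single (x', y) | x x' y. x \<in> top_comp m \<and> x' \<in> top_comp m \<and> y \<in> bottom_comp m} \<union>
      {single (x, y + y') - single (x, y) - single (x, y') | x y y'. x \<in> top_comp m \<and> y \<in> bottom_comp m \<and> y' \<in> bottom_comp m} \<union>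
      {single (c *\<^sub>k x, y) - c *\<^sub>k single (x, y) | c x y. x \<in> top_comp m \<and> y \<in> bottom_comp m} \<union>
      {single (x, c *\<^sub>k y) - c *\<^sub>k single (x, y) | c x y. x \<in> top_comp m \<and> y \<in> bottom_comp m} \<union>
      {single (vact (top_module n) a x, y) - single (x, vact (bottom_module n') a y) | a x y.
        a \<in> carrier (nilcoxeter m) \<and> x \<in> top_comp m \<and> y \<in> bottom_comp m})" for G
    unfolding tensor_relations_def mod_simps using that formal.span_superset by (rule order_trans)
  show "x \<in> top_comp m \<Longrightarrow> x' \<in> top_comp m \<Longrightarrow> y \<in> bottom_comp m \<Longrightarrow>
      single (x + x', y) - single (x, y) - single (x', y) \<in> relations m"
    using sub[of "{single (x + x', y) - single (x, y) - single (x', y)}"] by blast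
  show "x \<in> top_comp m \<Longrightarrow> y \<in> bottom_comp m \<Longrightarrow> y' \<in> bottom_comp m \<Longrightarrow>
      single (x, y + y') - single (x, y) - single (x, y') \<in> relations m"
    using sub[of "{single (x, y + y') - single (x, y) - single (x, y')}"] by blast
  show "x \<in> top_comp m \<Longrightarrow> y \<in> bottom_comp m \<Longrightarrow> single (c *\<^sub>k x, y) - c *\<^sub>k single (x, y) \<in> relations m"
    using sub[of "{single (c *\<^sub>k x, y) - c *\<^sub>k single (x, y)}"] by blast
  show "x \<in> top_comp m \<Longrightarrow> y \<in> bottom_comp m \<Longrightarrow> single (x, c *\<^sub>k y) - c *\<^sub>k single (x, y) \<in> relations m"
    using sub[of "{single (x, c *\<^sub>k y) - c *\<^sub>k single (x, y)}"] by blast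
  have "w permutes {1..m} \<Longrightarrow> single w \<in> carrier (nilcoxeter m)"
    unfolding nilcoxeter_carrier by (intro formal.span_base) blast
  then show "w permutes {1..m} \<Longrightarrow> x \<in> top_comp m \<Longrightarrow> y \<in> bottom_comp m \<Longrightarrow>
      single (vact (top_module n) (single w) x, y) - single (x, vact (bottom_module n') (single w) y) \<in> relations m"
    using sub[of "{single (vact (top_module n) (single w) x, y) - single (x, vact (bottom_module n') (single w) y)}"]
    by blast
qed

lemma subspace_relations: "formal.subspace (relations m)"
  by (simp add: tensor_relations_def)

section \<open>Reduction to standard tensors and the kernel\<close>

definition standard_tensor ::
    "((nat \<rightharpoonup> top_target) \<times> nat set) \<times> ((bottom_source \<rightharpoonup> nat) \<times> nat set) \<Rightarrow>
     ((nat \<rightharpoonup> top_target) \<Rightarrow> 'k::field) \<times> ((bottom_source \<rightharpoonup> nat) \<Rightarrow> 'k) \<Rightarrow> 'k"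
  where "standard_tensor = (\<lambda>(d, d'). single (top_basis Z1 d, bottom_basis Z2 d'))"

text \<open>\<open>Q\<close> consists of the tensors congruent to combinations of standard ones. For
  basis elements, the left factor is a sorted one acted on by a permutation, which is moved to the
  right factor and yields a basis element or \<open>0\<close> there. Linearity in the left and then
  in the right argument does the rest.\<close>

lemma tensors_reduce:
  assumes u: "u \<in> tensors m"
  obtains v where "v \<in> formal.span (standard_tensor ` standard_pairs m)" "u - v \<in> (relations m :: (_ \<Rightarrow> 'k::field) set)"
proof -
  let ?S = "formal.span (standard_tensor ` standard_pairs m) :: (_ \<Rightarrow> 'k) set"
  define Q where "Q = {u. \<exists>v\<in>?S. u - v \<in> (relations m :: (_ \<Rightarrow> 'k) set)}"
  have sub: "formal.subspace Q"
  proof (rule formal.subspaceI)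
    show "0 \<in> Q" unfolding Q_def
      using formal.span_zero formal.subspace_0[OF subspace_relations] by (auto intro!: bexI[of _ 0])
    fix u v and c :: 'k assume "u \<in> Q"
    then obtain u' where u': "u' \<in> ?S" "u - u' \<in> relations m" by (auto simp: Q_def)
    have "c *\<^sub>k u - c *\<^sub>k u' \<in> relations m"
      using formal.subspace_scale[OF subspace_relations u'(2), of c]
      by (simp add: formal.scale_right_diff_distrib)
    then show "c *\<^sub>k u \<in> Q" using formal.span_scale[OF u'(1)] by (auto simp: Q_def)
    assume "v \<in> Q"
    then obtain v' where v': "v' \<in> ?S" "v - v' \<in> relations m" by (auto simp: Q_def)
    have "(u + v) - (u' + v') \<in> relations m"
      using formal.subspace_add[OF subspace_relations u'(2) v'(2)] by (simp add: algebra_simps)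
    then show "u + v \<in> Q" using formal.span_add[OF u'(1) v'(1)] by (auto simp: Q_def)
  qed
  have rel: "relations m \<subseteq> Q"
    unfolding Q_def using formal.span_zero by (auto intro!: bexI[of _ 0])
  have mod: "u \<in> Q" if "u - v \<in> relations m" "v \<in> Q" for u v
    using formal.subspace_add[OF sub that(2), of "u - v"] that(1) rel by auto
  have std: "single (top_basis Z1 d, bottom_basis Z2 d') \<in> Q" if "(d, d') \<in> standard_pairs m" for d d'
  proof -
    have "single (top_basis Z1 d, bottom_basis Z2 d') \<in> ?S"
      using that by (intro formal.span_base image_eqI[of _ _ "(d, d')"]) (simp_all add: standard_tensor_def)
    then show ?thesis
      unfolding Q_def using formal.subspace_0[OF subspace_relations]
      by (auto intro!: bexI[of _ "single (top_basis Z1 d, bottom_basis Z2 d')"])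
  qed
  have base: "single (top_basis Z1 d, bottom_basis Z2 d') \<in> Q"
    if d: "d \<in> top_data Z1 m" and d': "d' \<in> bottom_data Z2 m" for d d'
  proof -
    obtain f h where fh: "d = (f, h)" by (cases d)
    obtain g h' where gh: "d' = (g, h')" by (cases d')
    obtain f' w where f': "(f', h) \<in> top_data Z1 m" "sorted_tops f'" and w: "w permutes {1..m}"
      and eq: "top_basis Z1 (f, h) = (vact (top_module n) (single w) (top_basis Z1 (f', h)) :: _ \<Rightarrow> 'k)"
      by (rule sort_top_basis[OF two1 d[unfolded fh]])
    have x: "top_basis Z1 (f', h) \<in> (top_comp m :: (_ \<Rightarrow> 'k) set)"
      and y: "bottom_basis Z2 d' \<in> (bottom_comp m :: (_ \<Rightarrow> 'k) set)"
      using f'(1) d' by (auto intro: formal.span_base)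
    have "single (top_basis Z1 (f', h), vact (bottom_module n') (single w) (bottom_basis Z2 d')) \<in> Q"
    proof (cases "vact (bottom_module n') (single w) (bottom_basis Z2 d') = (0 :: _ \<Rightarrow> 'k)")
      case True
      \<comment> \<open>A formal pair with second entry \<open>0\<close> is not zero in the free
        vector space. The scaling relation for the scalar \<open>0\<close> makes it zero modulo the
        relations.\<close>
      have "single (top_basis Z1 (f', h), 0 :: _ \<Rightarrow> 'k) - 0 \<in> relations m"
        using relations_scale_right[OF x y, of 0] by simp
      then show ?thesis unfolding True by (rule mod) (rule formal.subspace_0[OF sub])
    next
      case False
      then have "vact (bottom_module n') (single w) (bottom_basis Z2 d') =
          (bottom_basis Z2 (g \<circ> relabel_bottoms w, h') :: _ \<Rightarrow> 'k)"
        unfolding gh bottom_action_basis(2)[OF two2 d'[unfolded gh] w] by (auto split: if_splits)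
      moreover have "((f', h), (g \<circ> relabel_bottoms w, h')) \<in> standard_pairs m"
        using f' bottom_action_basis(1)[OF two2 d'[unfolded gh] w] by (simp add: standard_pairs_def)
      ultimately show ?thesis using std by simp
    qed
    then show ?thesis
      unfolding fh eq by (rule mod[OF relations_balanced[OF w x y]])
  qed
  have left: "single (x, bottom_basis Z2 d') \<in> Q" if x: "x \<in> top_comp m" and d': "d' \<in> bottom_data Z2 m" for x d'
  proof -
    let ?y = "bottom_basis Z2 d' :: _ \<Rightarrow> 'k"
    have y: "?y \<in> bottom_comp m" using d' by (auto intro: formal.span_base)
    have "formal.subspace {x \<in> top_comp m. single (x, ?y) \<in> Q}"
    proof (rule formal.subspaceI)
      have "single (0, ?y) - 0 \<in> relations m" using relations_scale_left[OF x y, of 0] by simp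
      then have "single (0, ?y) \<in> Q" by (rule mod) (rule formal.subspace_0[OF sub])
      then show "0 \<in> {x \<in> top_comp m. single (x, ?y) \<in> Q}" by (simp add: formal.span_zero)
      fix x x' and c :: 'k assume x: "x \<in> {x \<in> top_comp m. single (x, ?y) \<in> Q}"
      then have "single (c *\<^sub>k x, ?y) \<in> Q"
        using relations_scale_left[of x m ?y c] y formal.subspace_scale[OF sub]
        by - (rule mod[of _ "c *\<^sub>k single (x, ?y)"], auto)
      then show "c *\<^sub>k x \<in> {x \<in> top_comp m. single (x, ?y) \<in> Q}" using x by (simp add: formal.span_scale)
      assume x': "x' \<in> {x \<in> top_comp m. single (x, ?y) \<in> Q}"
      have "single (x + x', ?y) \<in> Q"
        using relations_add_left[of x m x' ?y] x x' y formal.subspace_add[OF sub]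
        by - (rule mod[of _ "single (x, ?y) + single (x', ?y)"], auto simp: diff_diff_eq)
      then show "x + x' \<in> {x \<in> top_comp m. single (x, ?y) \<in> Q}" using x x' by (simp add: formal.span_add)
    qed
    then have "top_comp m \<subseteq> {x \<in> top_comp m. single (x, ?y) \<in> Q}"
      using base[OF _ d'] by (intro formal.span_minimal) (auto intro: formal.span_base)
    then show ?thesis using x by blast
  qed
  have all: "single (x, y) \<in> Q" if x: "x \<in> top_comp m" and y: "y \<in> bottom_comp m" for x y
  proof -
    have "formal.subspace {y \<in> bottom_comp m. single (x, y) \<in> Q}"
    proof (rule formal.subspaceI)
      have "single (x, 0) - 0 \<in> relations m" using relations_scale_right[OF x y, of 0] by simp
      then have "single (x, 0) \<in> Q" by (rule mod) (rule formal.subspace_0[OF sub])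
      then show "0 \<in> {y \<in> bottom_comp m. single (x, y) \<in> Q}" by (simp add: formal.span_zero)
      fix y y' and c :: 'k assume y: "y \<in> {y \<in> bottom_comp m. single (x, y) \<in> Q}"
      then have "single (x, c *\<^sub>k y) \<in> Q"
        using relations_scale_right[of x m y c] x formal.subspace_scale[OF sub]
        by - (rule mod[of _ "c *\<^sub>k single (x, y)"], auto)
      then show "c *\<^sub>k y \<in> {y \<in> bottom_comp m. single (x, y) \<in> Q}" using y by (simp add: formal.span_scale)
      assume y': "y' \<in> {y \<in> bottom_comp m. single (x, y) \<in> Q}"
      have "single (x, y + y') \<in> Q"
        using relations_add_right[of x m y y'] x y y' formal.subspace_add[OF sub]
        by - (rule mod[of _ "single (x, y) + single (x, y')"], auto simp: diff_diff_eq)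
      then show "y + y' \<in> {y \<in> bottom_comp m. single (x, y) \<in> Q}" using y y' by (simp add: formal.span_add)
    qed
    then have "bottom_comp m \<subseteq> {y \<in> bottom_comp m. single (x, y) \<in> Q}"
      using left[OF x] by (intro formal.span_minimal) (auto intro: formal.span_base)
    then show ?thesis using y by blast
  qed
  have "tensors m \<subseteq> Q"
    unfolding free_on_pairs_def using all by (intro formal.span_minimal sub) auto
  then show thesis using u that by (auto simp: Q_def)
qed

lemma standard_pairs_matching:
  assumes "((f, h1), (g, h2)) \<in> standard_pairs m"
  shows "join_data ((f, h1), (g, h2)) \<in> matching_data Z"
    "psi (standard_tensor ((f, h1), (g, h2))) = matching_basis Z (join_data ((f, h1), (g, h2)))"
    "crossing_number (fst (join_data ((f, h1), (g, h2)))) = m"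
    "standard_tensor ((f, h1), (g, h2)) \<in> tensors m"
proof -
  note S = standard_pairs_strands[OF assms]
  have d: "(f, h1) \<in> top_data Z1 m" "(g, h2) \<in> bottom_data Z2 m" using assms by (auto simp: standard_pairs_def)
  show "join_data ((f, h1), (g, h2)) \<in> matching_data Z" using join_data_iff[OF S(1-4)] d by simp
  show "psi (standard_tensor ((f, h1), (g, h2))) = matching_basis Z (join_data ((f, h1), (g, h2)))"
    using pairing_basis[OF d] not_doubly_crossed[OF S(5)] by (simp add: standard_tensor_def)
  show "crossing_number (fst (join_data ((f, h1), (g, h2)))) = m"
    using crossing_number_glue[OF S(1,2)] by (simp add: join_data_def)
  show "standard_tensor ((f, h1), (g, h2)) \<in> tensors m"
    unfolding standard_tensor_def using d by (auto intro!: single_tensors formal.span_base)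
qed

lemma finite_standard_pairs: "finite (standard_pairs m)"
proof -
  have "finite (top_data Z1 m)" "finite (bottom_data Z2 m)"
    using matched_strands.finite_data[OF matched_strands_top[OF two1, of m]]
      matched_strands.finite_data[OF matched_strands_bottom[OF two2, of m]]
    unfolding data_top[OF two1] data_bottom[OF two2] .
  then show ?thesis by (simp add: standard_pairs_def)
qed

text \<open>The map \<theta> reads off coefficients at representatives of the classes. It is a left
  inverse of \<open>psi\<close> on standard tensors, since these go to distinct basis elements of
  the matching algebra.\<close>

lemma psi_injective_standard:
  assumes v: "v \<in> formal.span (standard_tensor ` standard_pairs m)" and 0: "psi v = 0"
  shows "v = (0 :: _ \<Rightarrow> 'k::field)"
proof -
  interpret P: matched_strands id id Z "{}" "{}" by (rule matched_strands_plain[OF two])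
  define \<theta> where "\<theta> = (\<lambda>x :: (nat \<rightharpoonup> nat) \<Rightarrow> 'k.
    \<Sum>q\<in>standard_pairs m. x (P.rep (join_data q)) *\<^sub>k standard_tensor q)"
  have rep: "matching_basis Z d (P.rep d') = (if d = d' then 1 else (0::'k))"
    if "d \<in> matching_data Z" "d' \<in> matching_data Z" for d d'
    using P.basis_rep[of d d'] that unfolding data_plain[OF two] basis_plain[OF two] by blast
  have mem: "join_data q \<in> matching_data Z" if "q \<in> standard_pairs m" for q
    using standard_pairs_matching(1) that by (metis surj_pair)
  have psi: "psi (standard_tensor q) = matching_basis Z (join_data q)" if "q \<in> standard_pairs m" for q
    using standard_pairs_matching(2) that by (metis surj_pair)
  have fin: "standard_tensor q \<in> finitary" for q :: "((nat \<rightharpoonup> top_target) \<times> nat set) \<times> ((bottom_source \<rightharpoonup> nat) \<times> nat set)"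
    by (simp add: standard_tensor_def case_prod_unfold)
  have "formal.subspace {v \<in> finitary. \<theta> (psi v) = v}"
  proof (rule formal.subspaceI)
    show "0 \<in> {v \<in> finitary. \<theta> (psi v) = v}" by (simp add: \<theta>_def)
    have add: "\<theta> (x + y) = \<theta> x + \<theta> y" for x y
      by (simp add: \<theta>_def sum.distrib formal.scale_left_distrib)
    have scale: "\<theta> (c *\<^sub>k x) = c *\<^sub>k \<theta> x" for c x
      by (simp add: \<theta>_def formal.scale_sum_right)
    show "u + v \<in> {v \<in> finitary. \<theta> (psi v) = v}"
      if "u \<in> {v \<in> finitary. \<theta> (psi v) = v}" "v \<in> {v \<in> finitary. \<theta> (psi v) = v}" for u v
      using that by (simp add: psi_add add finitary_add)
    show "c *\<^sub>k u \<in> {v \<in> finitary. \<theta> (psi v) = v}"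
      if "u \<in> {v \<in> finitary. \<theta> (psi v) = v}" for c u
      using that by (simp add: psi_scale scale finitary_scale)
  qed
  moreover have "\<theta> (psi (standard_tensor q)) = standard_tensor q" if q: "q \<in> standard_pairs m" for q
  proof -
    have "\<theta> (psi (standard_tensor q)) =
        (\<Sum>q'\<in>standard_pairs m. if q = q' then standard_tensor q' else 0)"
      unfolding \<theta>_def psi[OF q]
    proof (rule sum.cong[OF refl])
      fix q' assume q': "q' \<in> standard_pairs m"
      show "matching_basis Z (join_data q) (P.rep (join_data q')) *\<^sub>k standard_tensor q' =
          (if q = q' then standard_tensor q' else 0 :: _ \<Rightarrow> 'k)"
        using rep[OF mem[OF q] mem[OF q']] inj_onD[OF inj_on_join_data _ q q'] by auto
    qed
    also have "\<dots> = standard_tensor q" using finite_standard_pairs q by simp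
    finally show ?thesis .
  qed
  ultimately have "formal.span (standard_tensor ` standard_pairs m) \<subseteq> {v \<in> finitary. \<theta> (psi v) = v}"
    using fin by (intro formal.span_minimal) auto
  then have "\<theta> (psi v) = v" using v by blast
  then show ?thesis using 0 by (simp add: \<theta>_def)
qed

text \<open>A tensor in the kernel is congruent to a combination of standard tensors. This
  combination then lies in the kernel too, and so is zero.\<close>

lemma relations_eq: "relations m = {u \<in> tensors m. psi u = (0 :: _ \<Rightarrow> 'k::field)}"
proof
  show "{u \<in> tensors m. psi u = 0} \<subseteq> (relations m :: (_ \<Rightarrow> 'k) set)"
  proof clarify
    fix u :: "((nat \<rightharpoonup> top_target) \<Rightarrow> 'k) \<times> ((bottom_source \<rightharpoonup> nat) \<Rightarrow> 'k) \<Rightarrow> 'k"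
    assume u: "u \<in> tensors m" "psi u = 0"
    obtain v where v: "v \<in> formal.span (standard_tensor ` standard_pairs m)" "u - v \<in> relations m"
      by (rule tensors_reduce[OF u(1)])
    have uv: "u - v \<in> tensors m" "psi (u - v) = 0" using v(2) relations_psi by blast+
    have "v = u - (u - v)" by simp
    then have "psi v = psi u - psi (u - v)"
      using psi_diff[OF tensors_finitary[OF u(1)] tensors_finitary[OF uv(1)]] by metis
    then have "v = 0" using u(2) uv(2) by (intro psi_injective_standard[OF v(1)]) simp
    then show "u \<in> relations m" using v(2) by simp
  qed
qed (rule relations_psi)

end

section \<open>The grading by the number of strands through the cut\<close>

context glued_intervals
begin

definition part :: "nat \<Rightarrow> ((nat \<rightharpoonup> nat) \<Rightarrow> 'k::field) \<Rightarrow> (nat \<rightharpoonup> nat) \<Rightarrow> 'k"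
  where "part m x = (\<lambda>F. if crossing_number F = m then x F else 0)"

abbreviation graded_data :: "nat \<Rightarrow> ((nat \<rightharpoonup> nat) \<times> nat set) set"
  where "graded_data m \<equiv> {d \<in> matching_data Z. crossing_number (fst d) = m}"

definition graded :: "nat \<Rightarrow> ((nat \<rightharpoonup> nat) \<Rightarrow> 'k::field) set"
  where "graded m = formal.span (matching_basis Z ` graded_data m)"

lemma subspace_graded: "formal.subspace (graded m)"
  by (simp add: graded_def)

lemma pairing_graded:
  assumes x: "x \<in> top_comp m" and y: "y \<in> bottom_comp m"
  shows "pairing x y \<in> (graded m :: (_ \<Rightarrow> 'k::field) set)"
proof -
  have basis: "pairing (top_basis Z1 d) (bottom_basis Z2 d') \<in> (graded m :: (_ \<Rightarrow> 'k) set)"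
    if d: "d \<in> top_data Z1 m" and d': "d' \<in> bottom_data Z2 m" for d d'
  proof -
    obtain f h g h' where e: "d = (f, h)" "d' = (g, h')" by (metis surj_pair)
    have s: "f \<in> top_strands n m" "g \<in> bottom_strands n' m" "h \<subseteq> pairs Z1" "h' \<subseteq> pairs Z2"
      using d d' by (simp_all add: e top_data_iff bottom_data_iff)
    have "join_data ((f, h), (g, h')) \<in> graded_data m"
      using join_data_iff[OF s] d d' crossing_number_glue[OF s(1,2)] by (simp add: e join_data_def)
    then have "matching_basis Z (join_data ((f, h), (g, h'))) \<in> (graded m :: (_ \<Rightarrow> 'k) set)"
      unfolding graded_def by (intro formal.span_base imageI)
    then show ?thesis
      unfolding e pairing_basis[OF d[unfolded e] d'[unfolded e]]
      using formal.subspace_0[OF subspace_graded] by auto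
  qed
  have left: "pairing (top_basis Z1 d) y \<in> (graded m :: (_ \<Rightarrow> 'k) set)" if d: "d \<in> top_data Z1 m" for d
    unfolding pairing_def bilinear_ext_flip
  proof (rule linear_ext_in_span[OF bottom_basis_finitary subspace_graded _ y])
    fix b :: "_ \<Rightarrow> 'k" assume "b \<in> bottom_basis Z2 ` bottom_data Z2 m"
    then obtain d' where "b = bottom_basis Z2 d'" "d' \<in> bottom_data Z2 m" by blast
    then show "linear_ext (\<lambda>b. linear_ext (\<lambda>a. glue_term n a b) (top_basis Z1 d)) b \<in> graded m"
      using basis[OF d, of d'] unfolding pairing_def bilinear_ext_flip by simp
  qed
  show ?thesis
    unfolding pairing_def bilinear_ext_linear_ext
  proof (rule linear_ext_in_span[OF top_basis_finitary subspace_graded _ x])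
    fix b :: "_ \<Rightarrow> 'k" assume "b \<in> top_basis Z1 ` top_data Z1 m"
    then obtain d where "b = top_basis Z1 d" "d \<in> top_data Z1 m" by blast
    then show "linear_ext (\<lambda>a. linear_ext (glue_term n a) y) b \<in> graded m"
      using left[of d] unfolding pairing_def bilinear_ext_linear_ext by simp
  qed
qed

lemma psi_graded: "u \<in> tensors m \<Longrightarrow> psi u \<in> graded m"
  unfolding psi_def using tensors_supp pairing_graded
  by - (rule linear_ext_in_subspace[OF subspace_graded], force)

text \<open>By \<open>join_data_surj\<close> every basis element of degree \<open>m\<close> is
  already the image of a standard tensor.\<close>

lemma psi_surj:
  assumes a: "a \<in> graded m"
  obtains u where "u \<in> tensors m" "psi u = (a :: _ \<Rightarrow> 'k::field)"
proof -
  have "formal.subspace (psi ` tensors m :: (_ \<Rightarrow> 'k) set)"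
  proof (rule formal.subspaceI)
    show "0 \<in> (psi ` tensors m :: (_ \<Rightarrow> 'k) set)"
      using formal.subspace_0[OF subspace_tensors] by (intro image_eqI[of _ _ 0]) simp_all
    fix a b :: "_ \<Rightarrow> 'k" and c assume "a \<in> psi ` tensors m"
    then obtain u where u: "u \<in> tensors m" "a = psi u" by blast
    show "c *\<^sub>k a \<in> psi ` tensors m"
      using u formal.subspace_scale[OF subspace_tensors u(1)]
      by (intro image_eqI[of _ _ "c *\<^sub>k u"]) (simp_all add: psi_scale tensors_finitary)
    assume "b \<in> psi ` tensors m"
    then obtain v where v: "v \<in> tensors m" "b = psi v" by blast
    show "a + b \<in> psi ` tensors m"
      using u v formal.subspace_add[OF subspace_tensors u(1) v(1)]
      by (intro image_eqI[of _ _ "u + v"]) (simp_all add: psi_add tensors_finitary)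
  qed
  moreover have "matching_basis Z d \<in> (psi ` tensors m :: (_ \<Rightarrow> 'k) set)" if d: "d \<in> graded_data m" for d
  proof -
    obtain F h where Fh: "d = (F, h)" by (cases d)
    have "(F, h) \<in> matching_data Z" "crossing_number F = m" using d by (simp_all add: Fh)
    then obtain q where q: "q \<in> standard_pairs m" "join_data q = (F, h)" by (rule join_data_surj)
    obtain f h1 g h2 where q': "q = ((f, h1), (g, h2))" by (metis surj_pair)
    note s = standard_pairs_matching[OF q(1)[unfolded q']]
    show ?thesis
      using q(2) by (intro image_eqI[of _ _ "standard_tensor q :: _ \<Rightarrow> 'k"]) (simp_all add: q' Fh s(2,4))
  qed
  ultimately have "graded m \<subseteq> (psi ` tensors m :: (_ \<Rightarrow> 'k) set)"
    unfolding graded_def by (intro formal.span_minimal) auto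
  then show thesis using a that by blast
qed

text \<open>Fixed strands never pass the cut, so every summand of a basis element has the crossing
  number of its moving strands.\<close>

lemma crossing_number_graded:
  assumes a: "a \<in> graded m" and F: "a F \<noteq> (0::'k::field)"
  shows "crossing_number F = m"
proof -
  let ?V = "{a :: _ \<Rightarrow> 'k. \<forall>F. a F \<noteq> 0 \<longrightarrow> crossing_number F = m}"
  have "formal.subspace ?V"
    by (rule formal.subspaceI) (auto, metis add.right_neutral)
  moreover have "matching_basis Z d \<in> ?V" if d: "d \<in> graded_data m" for d
  proof clarify
    fix F assume nz: "matching_basis Z d F \<noteq> (0::'k)"
    obtain F0 h where Fh: "d = (F0, h)" by (cases d)
    have "\<exists>S\<in>sections Z h. F = Some |` S ++ F0"
    proof (rule ccontr)
      assume "\<not> ?thesis"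
      then have "matching_basis Z d F = (0::'k)"
        by (auto simp: Fh matching_basis_def sum_fun_apply single_apply intro!: sum.neutral)
      then show False using nz by simp
    qed
    then obtain S where S: "F = Some |` S ++ F0" by blast
    have disj: "F0 s \<noteq> None \<Longrightarrow> F s = F0 s" for s by (auto simp: S map_add_def)
    have "{s. s \<le> n \<and> (\<exists>j > n. F s = Some j)} = {s. s \<le> n \<and> (\<exists>j > n. F0 s = Some j)}"
      by (auto simp: S map_add_def restrict_map_def split: option.splits if_splits)
    then show "crossing_number F = m" using d by (simp add: crossing_number_def Fh)
  qed
  ultimately have "graded m \<subseteq> ?V" unfolding graded_def by (intro formal.span_minimal) auto
  then show ?thesis using a F by blast
qed

lemma gluing_carrier: "carrier gluing_alg = formal.span (matching_basis Z ` matching_data Z)"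
  by (simp add: matching_algebra_def)

lemma graded_carrier: "graded m \<subseteq> carrier gluing_alg"
  unfolding graded_def gluing_carrier by (intro formal.span_mono) auto

lemma part_linear:
  "part m (x + y) = part m x + part m y" "part m (c *\<^sub>k x) = c *\<^sub>k part m x" "part m 0 = 0"
  by (auto simp: part_def fun_eq_iff)

lemma part_sum: "part m (\<Sum>i\<in>I. x i) = (\<Sum>i\<in>I. part m (x i))"
  by (induction I rule: infinite_finite_induct)
    (simp_all only: sum.infinite sum.empty sum.insert part_linear not_False_eq_True)

lemma part_graded_eq:
  assumes "a \<in> graded m"
  shows "part k a = (if k = m then a else 0)"
  using crossing_number_graded[OF assms] by (auto simp: part_def fun_eq_iff)

lemma part_graded:
  assumes x: "x \<in> carrier gluing_alg"
  shows "part m x \<in> (graded m :: (_ \<Rightarrow> 'k::field) set)"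
proof -
  have "formal.subspace {x. part m x \<in> (graded m :: (_ \<Rightarrow> 'k) set)}"
    by (rule formal.subspaceI)
      (auto simp: part_linear intro: formal.subspace_0[OF subspace_graded]
        formal.subspace_add[OF subspace_graded] formal.subspace_scale[OF subspace_graded])
  moreover have "part m (matching_basis Z d) \<in> (graded m :: (_ \<Rightarrow> 'k) set)" if "d \<in> matching_data Z" for d
  proof -
    have d: "matching_basis Z d \<in> (graded (crossing_number (fst d)) :: (_ \<Rightarrow> 'k) set)"
      unfolding graded_def using that by (intro formal.span_base) auto
    then show ?thesis
      using part_graded_eq[OF d, of m] formal.subspace_0[OF subspace_graded] by (auto split: if_splits)
  qed
  ultimately have "formal.span (matching_basis Z ` matching_data Z) \<subseteq> {x. part m x \<in> (graded m :: (_ \<Rightarrow> 'k) set)}"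
    by (intro formal.span_minimal) auto
  then show ?thesis using x by (auto simp: gluing_carrier)
qed

lemma sum_parts:
  assumes "n + 1 \<le> L"
  shows "x = (\<Sum>m\<le>L. part m x)"
proof
  fix F
  have "crossing_number F \<le> L" using crossing_number_le[of F] assms by simp
  then show "x F = (\<Sum>m\<le>L. part m x) F" by (simp add: sum_fun_apply part_def)
qed

lemma part_vanish:
  assumes "n + 1 < m"
  shows "part m x = 0"
proof
  fix F
  show "part m x F = 0 F" using crossing_number_le[of F] assms by (auto simp: part_def)
qed

lemma graded_finitary: "a \<in> graded m \<Longrightarrow> a \<in> finitary"
proof -
  have "matching_basis Z ` graded_data m \<subseteq> finitary"
    by (auto simp: matching_basis_def intro!: finitary_sum)
  then have "graded m \<subseteq> finitary"
    unfolding graded_def by (rule formal.span_minimal[OF _ subspace_finitary])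
  then show "a \<in> graded m \<Longrightarrow> a \<in> finitary" by blast
qed

section \<open>Products and differentials of tensors\<close>

abbreviation tensor_mult where "tensor_mult m k \<equiv> bilinear_ext
  (\<lambda>(x, y) (x', y'). single (hmult top_mod m k x x', hmult bottom_mod m k y y'))"

abbreviation tensor_diff where "tensor_diff \<equiv> linear_ext
  (\<lambda>(x, y). single (hdiff top_mod x, y) + single (x, hdiff bottom_mod y))"

lemma tensor_mult_psi:
  assumes u: "u \<in> tensors m" and v: "v \<in> tensors k"
  shows "tensor_mult m k u v \<in> tensors (m + k)"
    "psi (tensor_mult m k u v) = (strands_mult (psi u) (psi v) :: _ \<Rightarrow> 'k::field)"
proof -
  show "tensor_mult m k u v \<in> tensors (m + k)"
  proof (rule bilinear_ext_in_subspace[OF subspace_tensors])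
    fix a b assume ab: "a \<in> supp u" "b \<in> supp v"
    obtain x y x' y' where e: "a = (x, y)" "b = (x', y')" by (metis surj_pair)
    have "x \<in> top_comp m" "y \<in> bottom_comp m" "x' \<in> top_comp k" "y' \<in> bottom_comp k"
      using tensors_supp[OF u] tensors_supp[OF v] ab by (simp_all add: e)
    then show "(case a of (x, y) \<Rightarrow> \<lambda>(x', y'). single (hmult top_mod m k x x', hmult bottom_mod m k y y')) b
        \<in> tensors (m + k)"
      unfolding e prod.case mod_simps
      by (intro single_tensors top_product_matched[OF two1] bottom_product_matched[OF two2])
  qed
  let ?M = "\<lambda>f g. if ran f = dom g then single_if_inv (g \<circ>\<^sub>m f) (inv_num f + inv_num g) else 0"
  have "psi (tensor_mult m k u v) =
      bilinear_ext (\<lambda>a b. linear_ext (\<lambda>(x, y). pairing x y)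
        ((case a of (x, y) \<Rightarrow> \<lambda>(x', y'). single (hmult top_mod m k x x', hmult bottom_mod m k y y')) b)) u v"
    unfolding psi_def by (rule linear_ext_bilinear_ext) (simp add: case_prod_unfold)
  also have "\<dots> = bilinear_ext (\<lambda>a b. strands_mult (case a of (x, y) \<Rightarrow> pairing x y) (case b of (x, y) \<Rightarrow> pairing x y)) u v"
  proof (rule bilinear_ext_cong)
    fix a b assume ab: "a \<in> supp u" "b \<in> supp v"
    obtain x y x' y' where e: "a = (x, y)" "b = (x', y')" by (metis surj_pair)
    have "x \<in> top_comp m" "y \<in> bottom_comp m" "x' \<in> top_comp k" "y' \<in> bottom_comp k"
      using tensors_supp[OF u] tensors_supp[OF v] ab by (simp_all add: e)
    then show "linear_ext (\<lambda>(x, y). pairing x y)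
        ((case a of (x, y) \<Rightarrow> \<lambda>(x', y'). single (hmult top_mod m k x x', hmult bottom_mod m k y y')) b) =
        strands_mult (case a of (x, y) \<Rightarrow> pairing x y) (case b of (x, y) \<Rightarrow> pairing x y)"
      unfolding e prod.case mod_simps linear_ext_single by (intro pairing_mult)
  qed
  also have "\<dots> = strands_mult (psi u) (psi v)"
    unfolding psi_def by (rule bilinear_ext_linear_ext_args[symmetric]) (simp_all add: case_prod_unfold)
  finally show "psi (tensor_mult m k u v) = strands_mult (psi u) (psi v)" .
qed

lemma tensor_diff_psi:
  assumes u: "u \<in> tensors m" and char: "CHAR('k) = 2"
  shows "tensor_diff u \<in> tensors m" "psi (tensor_diff u) = (strand_diff (psi u) :: _ \<Rightarrow> 'k::field)"
proof -
  show "tensor_diff u \<in> tensors m"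
  proof (rule linear_ext_in_subspace[OF subspace_tensors])
    fix a assume a: "a \<in> supp u"
    obtain x y where e: "a = (x, y)" by (metis surj_pair)
    have "x \<in> top_comp m" "y \<in> bottom_comp m"
      using tensors_supp[OF u] a by (simp_all add: e)
    then show "(case a of (x, y) \<Rightarrow> single (hdiff top_mod x, y) + single (x, hdiff bottom_mod y)) \<in> tensors m"
      unfolding e prod.case mod_simps
      by (intro formal.subspace_add[OF subspace_tensors] single_tensors top_diff_matched[OF two1]
          bottom_diff_matched[OF two2])
  qed
  have "psi (tensor_diff u) = linear_ext (\<lambda>a. linear_ext (\<lambda>(x, y). pairing x y)
      (case a of (x, y) \<Rightarrow> single (hdiff top_mod x, y) + single (x, hdiff bottom_mod y))) u"
    unfolding psi_def by (rule linear_ext_linear_ext) (auto intro!: finitary_add)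
  also have "\<dots> = linear_ext (\<lambda>a. strand_diff (case a of (x, y) \<Rightarrow> pairing x y)) u"
  proof (rule linear_ext_cong)
    fix a assume a: "a \<in> supp u"
    obtain x y where e: "a = (x, y)" by (metis surj_pair)
    have "x \<in> top_comp m" "y \<in> bottom_comp m"
      using tensors_supp[OF u] a by (simp_all add: e)
    then show "linear_ext (\<lambda>(x, y). pairing x y)
        (case a of (x, y) \<Rightarrow> single (hdiff top_mod x, y) + single (x, hdiff bottom_mod y)) =
        strand_diff (case a of (x, y) \<Rightarrow> pairing x y)"
      unfolding e prod.case mod_simps by (simp add: linear_ext_add pairing_diff[OF char])
  qed
  also have "\<dots> = strand_diff (psi u)"
    unfolding psi_def strand_diff_expand[of "linear_ext _ _"] strand_diff_expand[of "case _ of (x, y) \<Rightarrow> pairing x y"]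
    by (rule linear_ext_linear_ext[symmetric]) auto
  finally show "psi (tensor_diff u) = strand_diff (psi u)" .
qed

text \<open>By \<open>relations_eq\<close> the cosets of the relations are fibres of
  \<open>psi\<close>. The operations of the tensor product can then be computed on values in the
  matching algebra.\<close>

definition level :: "nat \<Rightarrow> ((nat \<rightharpoonup> nat) \<Rightarrow> 'k::field) \<Rightarrow>
    (((nat \<rightharpoonup> top_target) \<Rightarrow> 'k) \<times> ((bottom_source \<rightharpoonup> nat) \<Rightarrow> 'k) \<Rightarrow> 'k) set"
  where "level m a = {u \<in> tensors m. psi u = a}"

lemma level_zero: "relations m = level m 0"
  by (simp add: relations_eq level_def)

lemma coset_eq_level:
  assumes u: "u \<in> tensors m"
  shows "u +o relations m = level m (psi u)"
  unfolding level_zero elt_set_plus_def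
proof (intro Set.set_eqI iffI)
  fix v assume "v \<in> {c. \<exists>b\<in>level m 0. c = u + b}"
  then show "v \<in> level m (psi u)"
    using u by (auto simp: level_def psi_add tensors_finitary intro: formal.subspace_add[OF subspace_tensors])
next
  fix v assume v: "v \<in> level m (psi u)"
  then have "v - u \<in> level m 0"
    using u by (auto simp: level_def psi_diff tensors_finitary intro: formal.subspace_diff[OF subspace_tensors])
  then show "v \<in> {c. \<exists>b\<in>level m 0. c = u + b}" by (auto intro!: bexI[of _ "v - u"])
qed

lemma level_nonempty: "a \<in> graded m \<Longrightarrow> \<exists>u. u \<in> level m a"
  by (auto simp: level_def elim!: psi_surj)

lemma level_inject: "a \<in> graded m \<Longrightarrow> level m a = level m b \<Longrightarrow> a = b"
  using level_nonempty[of a m] by (auto simp: level_def)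

lemma level_add:
  assumes "a \<in> graded m" "b \<in> graded m"
  shows "level m a + level m b = level m (a + b)"
proof (intro Set.set_eqI iffI)
  fix u assume "u \<in> level m a + level m b"
  then show "u \<in> level m (a + b)"
    by (auto simp: set_plus_def level_def psi_add tensors_finitary intro: formal.subspace_add[OF subspace_tensors])
next
  fix u assume u: "u \<in> level m (a + b)"
  obtain v where v: "v \<in> level m a" using level_nonempty[OF assms(1)] by blast
  then have "u - v \<in> level m b"
    using u by (auto simp: level_def psi_diff tensors_finitary intro: formal.subspace_diff[OF subspace_tensors])
  then show "u \<in> level m a + level m b" using v set_plus_intro[OF v] by fastforce
qed

text \<open>The operations of \<open>tensor_product\<close> add the relations to the image of a
  coset. Such an image may be a proper part of a fibre, and a single representative is enough for
  the sum to fill it.\<close>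

lemma saturate:
  assumes "S \<subseteq> level m a" "S \<noteq> {}"
  shows "S + relations m = level m a"
proof (intro Set.set_eqI iffI)
  fix u assume "u \<in> S + relations m"
  then show "u \<in> level m a"
    using assms(1) unfolding level_zero
    by (fastforce simp: set_plus_def level_def psi_add tensors_finitary intro: formal.subspace_add[OF subspace_tensors])
next
  fix u assume u: "u \<in> level m a"
  obtain v where v: "v \<in> S" "v \<in> level m a" using assms by blast
  then have "u - v \<in> relations m"
    using u unfolding level_zero
    by (auto simp: level_def psi_diff tensors_finitary intro: formal.subspace_diff[OF subspace_tensors])
  then show "u \<in> S + relations m" using set_plus_intro[OF v(1)] by fastforce
qed

text \<open>The index set \<open>{..k}\<close> is never empty. This matters, because the empty sum
  of sets is \<open>{0}\<close> and not \<open>level l 0\<close>.\<close>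

lemma sum_levels:
  assumes "\<And>m. c m \<in> graded l"
  shows "(\<Sum>m\<le>k::nat. level l (c m)) = level l (\<Sum>m\<le>k. c m)"
proof (induction k)
  case (Suc k)
  have "(\<Sum>m\<le>k. c m) \<in> graded l" using assms by (intro formal.subspace_sum[OF subspace_graded])
  then show ?case unfolding sum.atMost_Suc Suc by (rule level_add[OF _ assms])
qed simp

text \<open>Closure is inherited from the tensors: lift both factors along \<open>psi\<close>,
  multiply there and map back.\<close>

lemma graded_mult:
  assumes "a \<in> graded m" "b \<in> graded k"
  shows "strands_mult a b \<in> graded (m + k)"
proof -
  from assms(1) obtain u where u: "u \<in> tensors m" "psi u = a" by (rule psi_surj)
  from assms(2) obtain v where v: "v \<in> tensors k" "psi v = b" by (rule psi_surj)
  show ?thesis using psi_graded[OF tensor_mult_psi(1)[OF u(1) v(1)]] unfolding tensor_mult_psi(2)[OF u(1) v(1)] u v .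
qed

lemma graded_diff:
  assumes "a \<in> graded m" "CHAR('k) = 2"
  shows "strand_diff a \<in> (graded m :: (_ \<Rightarrow> 'k::field) set)"
proof -
  from assms(1) obtain u where u: "u \<in> tensors m" "psi u = a" by (rule psi_surj)
  show ?thesis
    using psi_graded[OF tensor_diff_psi(1)[OF u(1) assms(2)]] unfolding tensor_diff_psi(2)[OF u(1) assms(2)] u .
qed

text \<open>Degrees add under multiplication, so part \<open>l\<close> of a product receives
  contributions only from parts \<open>m\<close> and \<open>l - m\<close> of the factors.\<close>

lemma part_mult:
  assumes x: "x \<in> carrier gluing_alg" and y: "y \<in> carrier gluing_alg"
  shows "part l (strands_mult x y) = (\<Sum>m\<le>l. strands_mult (part m x) (part (l - m) y))"
proof -
  \<comment> \<open>Large enough for \<open>sum_parts\<close> and for the range to contain all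
    indices up to \<open>l\<close>.\<close>
  let ?L = "l + n + 1"
  let ?M = "\<lambda>m k. strands_mult (part m x) (part k y)"
  note px = part_graded[OF x] and py = part_graded[OF y]
  have "strands_mult x y = strands_mult (\<Sum>m\<le>?L. part m x) (\<Sum>k\<le>?L. part k y)"
    using sum_parts[of ?L x] sum_parts[of ?L y] by simp
  also have "\<dots> = (\<Sum>m\<le>?L. \<Sum>k\<le>?L. ?M m k)"
    by (subst bilinear_ext_sum_left, rule graded_finitary[OF px], subst bilinear_ext_sum_right,
        rule graded_finitary[OF py]) (rule refl)
  finally have "part l (strands_mult x y) = (\<Sum>m\<le>?L. \<Sum>k\<le>?L. part l (?M m k))"
    by (simp only: part_sum)
  also have "\<dots> = (\<Sum>m\<le>?L. \<Sum>k\<le>?L. if l = m + k then ?M m k else 0)"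
    by (intro sum.cong refl part_graded_eq graded_mult px py)
  also have "\<dots> = (\<Sum>m\<le>?L. if m \<le> l then ?M m (l - m) else 0)"
  proof (rule sum.cong[OF refl])
    fix m assume "m \<in> {..?L}"
    show "(\<Sum>k\<le>?L. if l = m + k then ?M m k else 0) = (if m \<le> l then ?M m (l - m) else 0)"
    proof (cases "m \<le> l")
      case True
      then have "(\<Sum>k\<le>?L. if l = m + k then ?M m k else 0) = (\<Sum>k\<le>?L. if k = l - m then ?M m k else 0)"
        by (intro sum.cong refl) auto
      then show ?thesis using True by simp
    qed (auto intro!: sum.neutral)
  qed
  also have "\<dots> = (\<Sum>m\<le>l. ?M m (l - m))"
    by (rule sum.mono_neutral_cong_right) auto
  finally show ?thesis .
qed

lemma part_diff:
  assumes x: "x \<in> carrier gluing_alg" and char: "CHAR('k) = 2"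
  shows "part m (strand_diff x) = (strand_diff (part m x) :: _ \<Rightarrow> 'k::field)"
proof -
  \<comment> \<open>The term \<open>n + 1\<close> serves \<open>sum_parts\<close>, and the term
    \<open>m\<close> keeps the index \<open>m\<close> in range.\<close>
  let ?L = "m + n + 1"
  have "strand_diff x = strand_diff (\<Sum>k\<le>?L. part k x)" using sum_parts[of ?L x] by simp
  also have "\<dots> = (\<Sum>k\<le>?L. strand_diff (part k x))"
    unfolding strand_diff_def by (rule linear_ext_sum, rule graded_finitary[OF part_graded[OF x]])
  finally have "part m (strand_diff x) = (\<Sum>k\<le>?L. part m (strand_diff (part k x)))"
    by (simp only: part_sum)
  also have "\<dots> = (\<Sum>k\<le>?L. if m = k then strand_diff (part k x) else 0)"
    by (intro sum.cong refl part_graded_eq graded_diff part_graded x char)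
  finally show ?thesis by simp
qed

text \<open>Both units are sums over sets of pairs without moving strands. A set of pairs of the
  glued matching splits into one for each interval, and empty strands glue without a double
  crossing.\<close>

lemma unit_psi:
  "single (hone top_mod, hone bottom_mod) \<in> tensors 0"
  "psi (single (hone top_mod, hone bottom_mod)) = (\<one>\<^bsub>gluing_alg\<^esub> :: _ \<Rightarrow> 'k::field)"
proof -
  have d: "(Map.empty, h) \<in> top_data Z1 0" if "h \<in> Pow (pairs Z1)" for h
    using that by (simp add: top_data_def)
  have d': "(Map.empty, h) \<in> bottom_data Z2 0" if "h \<in> Pow (pairs Z2)" for h
    using that by (simp add: bottom_data_def)
  have one: "hone top_mod = (\<Sum>h\<in>Pow (pairs Z1). top_basis Z1 (Map.empty, h))"
    "hone bottom_mod = (\<Sum>h\<in>Pow (pairs Z2). bottom_basis Z2 (Map.empty, h))"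
    by (simp_all add: matched_top_module_def matched_bottom_module_def)
  show "single (hone top_mod, hone bottom_mod) \<in> tensors 0"
    unfolding one using d d' by (intro single_tensors formal.span_sum formal.span_base imageI)
  have "psi (single (hone top_mod, hone bottom_mod)) =
      (\<Sum>h\<in>Pow (pairs Z1). \<Sum>h'\<in>Pow (pairs Z2).
        pairing (top_basis Z1 (Map.empty, h)) (bottom_basis Z2 (Map.empty, h')) :: _ \<Rightarrow> 'k)"
    unfolding psi_single one pairing_def
    by (subst bilinear_ext_sum_left, use top_basis_finitary[of 0] d in blast,
        subst bilinear_ext_sum_right, use bottom_basis_finitary[of 0] d' in blast) (rule refl)
  also have "\<dots> = (\<Sum>h\<in>Pow (pairs Z1). \<Sum>h'\<in>Pow (pairs Z2).
      matching_basis Z (Map.empty, join_sets (2 * genus Z1) h h'))"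
  proof (intro sum.cong refl)
    fix h h' assume h: "h \<in> Pow (pairs Z1)" "h' \<in> Pow (pairs Z2)"
    have "\<not> doubly_crossed Map.empty Map.empty" by (simp add: doubly_crossed_def)
    moreover have "glue_strands n Map.empty Map.empty = Map.empty" by (auto simp: glue_strands_def)
    ultimately show "pairing (top_basis Z1 (Map.empty, h)) (bottom_basis Z2 (Map.empty, h')) =
        (matching_basis Z (Map.empty, join_sets (2 * genus Z1) h h') :: _ \<Rightarrow> 'k)"
      using pairing_basis[OF d[OF h(1)] d'[OF h(2)]] by (simp add: join_data_def)
  qed
  also have "\<dots> = (\<Sum>(h, h')\<in>Pow (pairs Z1) \<times> Pow (pairs Z2).
      matching_basis Z (Map.empty, join_sets (2 * genus Z1) h h'))"
    by (rule sum.cartesian_product)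
  also have "\<dots> = (\<Sum>h\<in>Pow (pairs Z). matching_basis Z (Map.empty, h))"
  proof -
    have "bij_betw (\<lambda>(h, h'). join_sets (2 * genus Z1) h h') (Pow (pairs Z1) \<times> Pow (pairs Z2)) (Pow (pairs Z))"
      unfolding bij_betw_def
    proof
      show "inj_on (\<lambda>(h, h'). join_sets (2 * genus Z1) h h') (Pow (pairs Z1) \<times> Pow (pairs Z2))"
        by (rule inj_onI) (auto dest!: join_sets_inject[rotated 4])
      show "(\<lambda>(h, h'). join_sets (2 * genus Z1) h h') ` (Pow (pairs Z1) \<times> Pow (pairs Z2)) = Pow (pairs Z)"
      proof
        show "(\<lambda>(h, h'). join_sets (2 * genus Z1) h h') ` (Pow (pairs Z1) \<times> Pow (pairs Z2)) \<subseteq> Pow (pairs Z)"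
          unfolding pairs_Z join_sets_def by blast
        show "Pow (pairs Z) \<subseteq> (\<lambda>(h, h'). join_sets (2 * genus Z1) h h') ` (Pow (pairs Z1) \<times> Pow (pairs Z2))"
        proof
          fix h assume "h \<in> Pow (pairs Z)"
          then have "h \<subseteq> pairs Z1 \<union> (+) (2 * genus Z1) ` pairs Z2" unfolding pairs_Z[symmetric] by blast
          then obtain h1 h2 where "h = join_sets (2 * genus Z1) h1 h2" "h1 \<subseteq> pairs Z1" "h2 \<subseteq> pairs Z2"
            by (rule split_join_sets)
          then show "h \<in> (\<lambda>(h, h'). join_sets (2 * genus Z1) h h') ` (Pow (pairs Z1) \<times> Pow (pairs Z2))"
            by (intro image_eqI[of _ _ "(h1, h2)"]) auto
        qed
      qed
    qed
    from sum.reindex_bij_betw[OF this, of "\<lambda>h. matching_basis Z (Map.empty, h)"]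
    show ?thesis by (simp add: case_prod_unfold)
  qed
  also have "\<dots> = \<one>\<^bsub>gluing_alg\<^esub>" by (simp add: matching_algebra_def)
  finally show "psi (single (hone top_mod, hone bottom_mod)) = (\<one>\<^bsub>gluing_alg\<^esub> :: _ \<Rightarrow> 'k)" .
qed

section \<open>The isomorphism with the tensor product\<close>

abbreviation "tensor_alg \<equiv> tensor_product nilcoxeter top_mod bottom_mod"

lemma tensor_alg_simps:
  "carrier tensor_alg = {\<Phi>. \<forall>m. \<exists>u\<in>tensors m. \<Phi> m = u +o relations m}"
  "monoid.mult tensor_alg \<Phi> \<Psi> = (\<lambda>l. \<Sum>m\<le>l.
    {tensor_mult m (l - m) u v | u v. u \<in> \<Phi> m \<and> v \<in> \<Psi> (l - m)} + relations l)"
  "\<one>\<^bsub>tensor_alg\<^esub> = (\<lambda>m. if m = 0 then single (hone top_mod, hone bottom_mod) +o relations m else relations m)"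
  "ring.add tensor_alg \<Phi> \<Psi> = (\<lambda>m. \<Phi> m + \<Psi> m)"
  "module.smult tensor_alg c \<Phi> = (\<lambda>m. (*\<^sub>k) c ` \<Phi> m + relations m)"
  "differential tensor_alg \<Phi> = (\<lambda>m. tensor_diff ` \<Phi> m + relations m)"
  unfolding tensor_product_def Let_def mod_simps(1,2) by simp_all

lemma gluing_alg_simps:
  "monoid.mult gluing_alg = strands_mult" "ring.add gluing_alg = (+)"
  "module.smult gluing_alg = (*\<^sub>k)" "differential gluing_alg = strand_diff"
  by (simp_all add: matching_algebra_def strands_algebra_def)

text \<open>The isomorphism sends \<open>x\<close> to the sequence of the fibres of
  \<open>psi\<close> over its parts. Since \<open>psi\<close> respects all operations,
  \<open>saturate\<close> identifies each operation on fibres with the fibre over the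
  result.\<close>

theorem gluing_isomorphic:
  assumes char: "CHAR('k::field) = 2"
  shows "dg_isomorphic (gluing_alg :: ('k, _) dg_algebra) tensor_alg"
proof -
  define \<phi> where "\<phi> = (\<lambda>x m. level m (part m x) ::
    (((nat \<rightharpoonup> top_target) \<Rightarrow> 'k) \<times> ((bottom_source \<rightharpoonup> nat) \<Rightarrow> 'k) \<Rightarrow> 'k) set)"
  let ?A = "gluing_alg :: ('k, (nat \<rightharpoonup> nat) \<Rightarrow> 'k) dg_algebra"
  have coset: "\<exists>u\<in>tensors m. level m a = u +o relations m" if "a \<in> graded m" for m and a :: "_ \<Rightarrow> 'k"
    using level_nonempty[OF that] coset_eq_level by (force simp: level_def)
  have closed: "\<phi> x \<in> carrier tensor_alg" if "x \<in> carrier ?A" for x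
    unfolding tensor_alg_simps \<phi>_def using coset[OF part_graded[OF that]] by simp
  have mult: "\<phi> (x \<otimes>\<^bsub>?A\<^esub> y) = \<phi> x \<otimes>\<^bsub>tensor_alg\<^esub> \<phi> y" if x: "x \<in> carrier ?A" and y: "y \<in> carrier ?A" for x y
  proof
    fix l
    \<comment> \<open>Extended by \<open>0\<close> beyond \<open>l\<close>, since
      \<open>sum_levels\<close> asks for a family indexed by all natural numbers.\<close>
    let ?c = "\<lambda>m. if m \<le> l then strands_mult (part m x) (part (l - m) y) else 0"
    have c: "?c m \<in> graded l" for m
      using graded_mult[OF part_graded[OF x, of m] part_graded[OF y, of "l - m"]]
        formal.subspace_0[OF subspace_graded, of l] by (cases "m \<le> l") simp_all
    have "{tensor_mult m (l - m) u v | u v. u \<in> \<phi> x m \<and> v \<in> \<phi> y (l - m)} + relations l = level l (?c m)"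
      if m: "m \<in> {..l}" for m
    proof (rule saturate)
      show "{tensor_mult m (l - m) u v | u v. u \<in> \<phi> x m \<and> v \<in> \<phi> y (l - m)} \<subseteq> level l (?c m)"
      proof clarify
        fix u v assume "u \<in> \<phi> x m" "v \<in> \<phi> y (l - m)"
        then have uv: "u \<in> tensors m" "psi u = part m x" "v \<in> tensors (l - m)" "psi v = part (l - m) y"
          by (simp_all add: \<phi>_def level_def)
        show "tensor_mult m (l - m) u v \<in> level l (?c m)"
          using m tensor_mult_psi[OF uv(1,3)] by (simp add: level_def uv)
      qed
      obtain u v where "u \<in> \<phi> x m" "v \<in> \<phi> y (l - m)"
        unfolding \<phi>_def using level_nonempty[OF part_graded[OF x]] level_nonempty[OF part_graded[OF y]] by blast
      then show "{tensor_mult m (l - m) u v | u v. u \<in> \<phi> x m \<and> v \<in> \<phi> y (l - m)} \<noteq> {}" by blast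
    qed
    then have "(\<phi> x \<otimes>\<^bsub>tensor_alg\<^esub> \<phi> y) l = (\<Sum>m\<le>l. level l (?c m))"
      unfolding tensor_alg_simps by (intro sum.cong refl) simp
    also have "\<dots> = level l (\<Sum>m\<le>l. ?c m)" by (rule sum_levels[OF c])
    also have "(\<Sum>m\<le>l. ?c m) = part l (x \<otimes>\<^bsub>?A\<^esub> y)"
      unfolding gluing_alg_simps part_mult[OF x y] by (intro sum.cong) auto
    finally show "\<phi> (x \<otimes>\<^bsub>?A\<^esub> y) l = (\<phi> x \<otimes>\<^bsub>tensor_alg\<^esub> \<phi> y) l" by (simp add: \<phi>_def)
  qed
  have add: "\<phi> (x \<oplus>\<^bsub>?A\<^esub> y) = \<phi> x \<oplus>\<^bsub>tensor_alg\<^esub> \<phi> y" if x: "x \<in> carrier ?A" and y: "y \<in> carrier ?A" for x y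
    by (simp add: tensor_alg_simps gluing_alg_simps \<phi>_def part_linear
        level_add[OF part_graded[OF x] part_graded[OF y]])
  have one: "\<phi> \<one>\<^bsub>?A\<^esub> = \<one>\<^bsub>tensor_alg\<^esub>"
  proof
    fix m
    have "\<one>\<^bsub>?A\<^esub> \<in> graded 0" using psi_graded[OF unit_psi(1)] unfolding unit_psi(2) .
    from part_graded_eq[OF this] show "\<phi> \<one>\<^bsub>?A\<^esub> m = \<one>\<^bsub>tensor_alg\<^esub> m"
      unfolding tensor_alg_simps \<phi>_def
      using coset_eq_level[OF unit_psi(1)] unfolding unit_psi(2) by (auto simp: level_zero)
  qed
  have smult: "\<phi> (c \<odot>\<^bsub>?A\<^esub> x) = c \<odot>\<^bsub>tensor_alg\<^esub> \<phi> x" if x: "x \<in> carrier ?A" for c x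
  proof
    fix m
    have "(*\<^sub>k) c ` level m (part m x) + relations m = level m (c *\<^sub>k part m x)"
    proof (rule saturate)
      show "(*\<^sub>k) c ` level m (part m x) \<subseteq> level m (c *\<^sub>k part m x)"
        by (auto simp: level_def psi_scale tensors_finitary intro: formal.subspace_scale[OF subspace_tensors])
      show "(*\<^sub>k) c ` level m (part m x) \<noteq> {}" using level_nonempty[OF part_graded[OF x]] by blast
    qed
    then show "\<phi> (c \<odot>\<^bsub>?A\<^esub> x) m = (c \<odot>\<^bsub>tensor_alg\<^esub> \<phi> x) m"
      by (simp add: tensor_alg_simps gluing_alg_simps \<phi>_def part_linear)
  qed
  have diff: "\<phi> (differential ?A x) = differential tensor_alg (\<phi> x)" if x: "x \<in> carrier ?A" for x
  proof
    fix m
    have "tensor_diff ` level m (part m x) + relations m = level m (strand_diff (part m x))"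
    proof (rule saturate)
      show "tensor_diff ` level m (part m x) \<subseteq> level m (strand_diff (part m x))"
        using tensor_diff_psi[OF _ char] by (auto simp: level_def)
      show "tensor_diff ` level m (part m x) \<noteq> {}" using level_nonempty[OF part_graded[OF x]] by blast
    qed
    then show "\<phi> (differential ?A x) m = differential tensor_alg (\<phi> x) m"
      by (simp add: tensor_alg_simps gluing_alg_simps \<phi>_def part_diff[OF x char])
  qed
  have inj: "inj_on \<phi> (carrier ?A)"
  proof (rule inj_onI)
    fix x y assume xy: "x \<in> carrier ?A" "y \<in> carrier ?A" "\<phi> x = \<phi> y"
    have "part m x = part m y" for m
      using fun_cong[OF xy(3), of m] level_inject[OF part_graded[OF xy(1)]] by (simp add: \<phi>_def)
    then show "x = y" using sum_parts[of "n + 1" x] sum_parts[of "n + 1" y] by simp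
  qed
  have surj: "\<exists>x\<in>carrier ?A. \<Phi> = \<phi> x" if \<Phi>: "\<Phi> \<in> carrier tensor_alg" for \<Phi>
  proof -
    obtain u where u: "\<And>m. u m \<in> tensors m" "\<And>m. \<Phi> m = u m +o relations m"
      using \<Phi> unfolding tensor_alg_simps by simp metis
    \<comment> \<open>A finite sum is enough for a preimage: by \<open>part_vanish\<close> the
      images \<open>psi (u m)\<close> are \<open>0\<close> for all \<open>m\<close> beyond
      \<open>n + 1\<close>.\<close>
    let ?x = "\<Sum>m\<le>n + 1. psi (u m)"
    have g: "psi (u m) \<in> graded m" for m by (rule psi_graded[OF u(1)])
    then have "?x \<in> carrier ?A"
      using graded_carrier unfolding gluing_carrier by (intro formal.span_sum) blast
    moreover have px: "part m ?x = psi (u m)" for m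
    proof -
      have "part m ?x = (\<Sum>k\<le>n + 1. if m = k then psi (u k) else 0)"
        unfolding part_sum by (intro sum.cong refl part_graded_eq g)
      also have "\<dots> = (if m \<le> n + 1 then psi (u m) else 0)" by simp
      also have "\<dots> = psi (u m)"
        using part_graded_eq[OF g, of m m] part_vanish[of m "psi (u m)"] by auto
      finally show ?thesis .
    qed
    have "\<Phi> = \<phi> ?x" unfolding \<phi>_def px by (rule ext) (simp only: u(2) coset_eq_level[OF u(1)])
    ultimately show ?thesis by blast
  qed
  have "\<phi> \<in> ring_iso ?A tensor_alg"
    unfolding ring_iso_def ring_hom_def bij_betw_def
    using closed mult add one inj surj by (auto simp: image_iff)
  then show ?thesis
    unfolding dg_isomorphic_def using smult diff by blast
qed

end

theorem theorem1p1:
  fixes Z1 Z2 :: matching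
  assumes "CHAR('k::field) = 2"
    and "matched_interval Z1"
    and "matched_interval Z2"
  shows "dg_isomorphic
    (matching_algebra (glue Z1 Z2) :: ('k, (nat \<rightharpoonup> nat) \<Rightarrow> 'k) dg_algebra)
    (tensor_product nilcoxeter (matched_top_module Z1) (matched_bottom_module Z2))"
proof -
  interpret glued_intervals Z1 Z2
    using assms(2,3) by unfold_locales (simp_all add: matched_interval_def)
  show ?thesis by (rule gluing_isomorphic[OF assms(1)])
qed

end
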